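(* Let $m\ge 2$ and $1<p_i<\infty$ for $i=1,\dots,m$, with $\frac1p=\sum_{i=1}^m\frac1{p_i}$. Let $\frac{\alpha_i}{n}=\frac1{p_i}-\frac1{q_i}\in(0,1)$, $\alpha=\sum_{i=1}^m\alpha_i$, $\frac1q=\sum_{i=1}^m\frac1{q_i}$. Let $\vec\omega=(\omega_1,\dots,\omega_m)\in A_{\vec P,q}$ with $\omega_i^{q_i}\in A_\infty$, and let $(\vec\varphi_1,\varphi_2)=(\varphi_{11},\dots,\varphi_{1m},\varphi_2)$ be non-negative measurable functions on $\mathbb R^n\times(0,\infty)$ satisfying $$[\vec\varphi_1,\varphi_2]_B'':=\sup_{x\in\mathbb R^n,r>0}\varphi_2(x,r)^{-1}\int_r^\infty\Big(1+\log\frac tr\Big)\frac{\operatorname{essinf}_{t<\eta<\infty}\prod_{i=1}^m\varphi_{1i}(x,\eta)\|\omega_i\|_{L^{p_i}(B(x,\eta))}}{\prod_{i=1}^m\|\omega_i\|_{L^{q_i}(B(x,t))}}\frac{dt}{t}<\infty.$$ If $\vec b=(b_1,\dots,b_m)\in({\rm BMO})^m$, then for each $j\in\{1,\dots,m\}$, $\mathcal I^j_{\alpha,m,\sum\vec b}$ is bounded from $M^{p_1,\varphi_{11}}(\omega_1^{p_1})\times\cdots\times M^{p_m,\varphi_{1m}}(\omega_m^{p_m})$ to $M^{q,\varphi_2}(u_{\vec\omega}^q)$ with operator norm $\lesssim\|b_j\|_{\rm BMO}$, and $\mathcal I_{\alpha,m,\sum\vec b}$ is bounded between the same spaces with operator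 norm $\lesssim\max_{1\le i\le m}\|b_i\|_{\rm BMO}$.
   Context: A weight is a nonnegative locally integrable function on $\mathbb R^n$, positive a.e.; $w(E)=\int_E w$. $B(x,r)$ is the open ball. For $1\le s<\infty$ and a ball $B$: $\|w\|_{L^s(B)}=(\int_B w^s)^{1/s}$, $\|f\|_{L^s(B,w)}=(\int_B|f|^s w)^{1/s}$. $A_\infty=\bigcup_{1\le p<\infty}A_p$. ${\rm BMO}$ norm: $\|b\|_{\rm BMO}=\sup_B\frac1{|B|}\int_B|b-b_B|$. Generalized weighted Morrey space: $M^{s,\varphi}(w)$ is the set of $f$ with $\|f\|_{M^{s,\varphi}(w)}:=\sup_{x,r>0}\varphi(x,r)^{-1}w(B(x,r))^{-1/s}\|f\|_{L^s(B(x,r),w)}<\infty$. $u_{\vec\omega}=\prod_i\omega_i$; $\vec\omega\in A_{\vec P,q}$ means $\sup_B\big(\frac1{|B|}\int_B u_{\vec\omega}^q\big)^{1/q}\prod_{i=1}^m\big(\frac1{|B|}\int_B\omega_i^{-p_i'}\big)^{1/p_i'}<\infty$. Commutators of the multilinear fractional integral: $\mathcal I^j_{\alpha,m,\sum\vec b}(\vec f)(x)=\int_{(\mathbb R^n)^m}\frac{(b_j(x)-b_j(y_j))\prod_{i=1}^mf_i(y_i)}{(|x-y_1|+\cdots+|x-y_m|)^{mn-\alpha}}\,dy_1\cdots dy_m$ and $\mathcal I_{\alpha,m,\sum\vec b}=\sum_{j=1}^m\mathcal I^j_{\alpha,m,\sum\vec b}$. Operator norm is the least $C$ with $\|T(\vec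 f)\|_Y\le C\prod\|f_i\|_{X_i}$. *)

theory Defs
  imports "HOL-Analysis.Analysis"
begin

definition weight :: "('a::euclidean_space \<Rightarrow> real) \<Rightarrow> bool" where
  "weight w \<longleftrightarrow> (\<forall>x. 0 \<le> w x) \<and> w \<in> borel_measurable borel
     \<and> (\<forall>K. compact K \<longrightarrow> set_integrable lborel K w)
     \<and> (AE x in lborel. 0 < w x)"

definition avg :: "'a::euclidean_space set \<Rightarrow> ('a \<Rightarrow> real) \<Rightarrow> real" where
  "avg B g = (LINT y:B|lborel. g y) / measure lborel B"

definition A_p :: "real \<Rightarrow> ('a::euclidean_space \<Rightarrow> real) \<Rightarrow> bool" where
  "A_p p w \<longleftrightarrow> 1 \<le> p \<and> weight w \<and>
     (if p = 1 then
        (\<exists>C. \<forall>x r. 0 < r \<longrightarrow>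
            (AE y in lborel. y \<in> ball x r \<longrightarrow> avg (ball x r) w \<le> C * w y))
      else
        (\<forall>x r. 0 < r \<longrightarrow> set_integrable lborel (ball x r) (\<lambda>y. w y powr (-1 / (p - 1)))) \<and>
        (\<exists>C. \<forall>x r. 0 < r \<longrightarrow>
            avg (ball x r) w * avg (ball x r) (\<lambda>y. w y powr (-1 / (p - 1))) powr (p - 1) \<le> C))"

definition A_infty :: "('a::euclidean_space \<Rightarrow> real) \<Rightarrow> bool" where
  "A_infty w \<longleftrightarrow> (\<exists>p. 1 \<le> p \<and> A_p p w)"

definition A_vec_Pq :: "nat \<Rightarrow> (nat \<Rightarrow> real) \<Rightarrow> real \<Rightarrow> (nat \<Rightarrow> 'a::euclidean_space \<Rightarrow> real) \<Rightarrow> bool" where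
  "A_vec_Pq m p q \<omega> \<longleftrightarrow>
     (\<forall>x r. 0 < r \<longrightarrow> set_integrable lborel (ball x r) (\<lambda>y. (\<Prod>i<m. \<omega> i y) powr q)) \<and>
     (\<forall>i<m. \<forall>x r. 0 < r \<longrightarrow>
        set_integrable lborel (ball x r) (\<lambda>y. \<omega> i y powr (- (p i / (p i - 1))))) \<and>
     (\<exists>C. \<forall>x r. 0 < r \<longrightarrow>
        avg (ball x r) (\<lambda>y. (\<Prod>i<m. \<omega> i y) powr q) powr (1 / q) *
        (\<Prod>i<m. avg (ball x r) (\<lambda>y. \<omega> i y powr (- (p i / (p i - 1)))) powr ((p i - 1) / p i)) \<le> C)"

definition wmeas :: "('a::euclidean_space \<Rightarrow> real) \<Rightarrow> 'a set \<Rightarrow> real" where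
  "wmeas w B = enn2real (set_nn_integral lborel B (\<lambda>y. ennreal (w y)))"

definition wLnorm :: "real \<Rightarrow> ('a::euclidean_space \<Rightarrow> real) \<Rightarrow> 'a set \<Rightarrow> ('a \<Rightarrow> real) \<Rightarrow> real" where
  "wLnorm s w B f = (enn2real (set_nn_integral lborel B (\<lambda>y. ennreal (\<bar>f y\<bar> powr s * w y)))) powr (1 / s)"

definition Lnorm_ball :: "real \<Rightarrow> ('a::euclidean_space \<Rightarrow> real) \<Rightarrow> 'a set \<Rightarrow> real" where
  "Lnorm_ball s w B = (enn2real (set_nn_integral lborel B (\<lambda>y. ennreal (w y powr s)))) powr (1 / s)"

text \<open>Generalized weighted Morrey space M^{s,phi}(w): the quantity
  phi(x,r)^{-1} w(B(x,r))^{-1/s} \<parallel>f\<parallel>_{L^s(B(x,r),w)} is bounded by C, written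
  multiplicatively so that phi(x,r) = 0 is handled as phi^{-1} = infinity.\<close>
definition morrey_bound :: "real \<Rightarrow> ('a::euclidean_space \<Rightarrow> real \<Rightarrow> real) \<Rightarrow> ('a \<Rightarrow> real) \<Rightarrow> ('a \<Rightarrow> real) \<Rightarrow> real \<Rightarrow> bool" where
  "morrey_bound s \<phi> w f C \<longleftrightarrow> (\<forall>x r. 0 < r \<longrightarrow>
      wmeas w (ball x r) powr (-1 / s) * wLnorm s w (ball x r) f \<le> C * \<phi> x r)"

definition in_morrey :: "real \<Rightarrow> ('a::euclidean_space \<Rightarrow> real \<Rightarrow> real) \<Rightarrow> ('a \<Rightarrow> real) \<Rightarrow> ('a \<Rightarrow> real) \<Rightarrow> bool" where
  "in_morrey s \<phi> w f \<longleftrightarrow> f \<in> borel_measurable borel \<and>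
     (\<forall>x r. 0 < r \<longrightarrow> set_nn_integral lborel (ball x r) (\<lambda>y. ennreal (\<bar>f y\<bar> powr s * w y)) < \<infinity>) \<and>
     (\<exists>C. morrey_bound s \<phi> w f C)"

definition morrey_norm :: "real \<Rightarrow> ('a::euclidean_space \<Rightarrow> real \<Rightarrow> real) \<Rightarrow> ('a \<Rightarrow> real) \<Rightarrow> ('a \<Rightarrow> real) \<Rightarrow> real" where
  "morrey_norm s \<phi> w f = Inf {C. 0 \<le> C \<and> morrey_bound s \<phi> w f C}"

definition bmo :: "('a::euclidean_space \<Rightarrow> real) \<Rightarrow> bool" where
  "bmo b \<longleftrightarrow> b \<in> borel_measurable borel \<and>
     (\<forall>x r. 0 < r \<longrightarrow> set_integrable lborel (ball x r) b) \<and>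
     bdd_above {avg (ball x r) (\<lambda>y. \<bar>b y - avg (ball x r) b\<bar>) | x r. 0 < r}"

definition bmo_norm :: "('a::euclidean_space \<Rightarrow> real) \<Rightarrow> real" where
  "bmo_norm b = Sup {avg (ball x r) (\<lambda>y. \<bar>b y - avg (ball x r) b\<bar>) | x r. 0 < r}"

definition essinf_on :: "real set \<Rightarrow> (real \<Rightarrow> real) \<Rightarrow> real" where
  "essinf_on S g = Sup {c. AE t in lborel. t \<in> S \<longrightarrow> c \<le> g t}"

text \<open>Kernel of the j-th commutator of the multilinear fractional integral; indices 0..m-1,
  y :: nat => 'a is the point (y_0,...,y_{m-1}) of (R^n)^m.\<close>
definition comm_kernel :: "nat \<Rightarrow> real \<Rightarrow> nat \<Rightarrow> (nat \<Rightarrow> 'a::euclidean_space \<Rightarrow> real) \<Rightarrow> (nat \<Rightarrow> 'a \<Rightarrow> real) \<Rightarrow> 'a \<Rightarrow> (nat \<Rightarrow> 'a) \<Rightarrow> real" where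
  "comm_kernel m \<alpha> j b f x y =
     (b j x - b j (y j)) * (\<Prod>i<m. f i (y i)) /
     (\<Sum>i<m. dist x (y i)) powr (real m * real DIM('a) - \<alpha>)"

definition frac_comm_j :: "nat \<Rightarrow> real \<Rightarrow> nat \<Rightarrow> (nat \<Rightarrow> 'a::euclidean_space \<Rightarrow> real) \<Rightarrow> (nat \<Rightarrow> 'a \<Rightarrow> real) \<Rightarrow> 'a \<Rightarrow> real" where
  "frac_comm_j m \<alpha> j b f x = (LINT y|PiM {..<m} (\<lambda>_. lborel). comm_kernel m \<alpha> j b f x y)"

definition frac_comm :: "nat \<Rightarrow> real \<Rightarrow> (nat \<Rightarrow> 'a::euclidean_space \<Rightarrow> real) \<Rightarrow> (nat \<Rightarrow> 'a \<Rightarrow> real) \<Rightarrow> 'a \<Rightarrow> real" where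
  "frac_comm m \<alpha> b f x = (\<Sum>j<m. frac_comm_j m \<alpha> j b f x)"

end

theory Submission
  imports Defs
begin

text \<open>The product of the averages of the \<open>A\<^sub>\<infinity>\<close> weights \<open>\<omega>\<^sub>i\<^bsup>q\<^sub>i\<^esup>\<close> is controlled by the average of the product, so the vector
  condition splits into one condition \<open>A\<^bsub>p\<^sub>i,q\<^sub>i\<^esub>\<close> for each \<open>\<omega>\<^sub>i\<close>. As
  \<open>|x - y\<^sub>1| + \<dots> + |x - y\<^sub>m|\<close> dominates each \<open>|x - y\<^sub>i|\<close>, the kernel is at most the product of the scalar kernels
  \<open>|x - y\<^sub>i|\<^bsup>\<alpha>\<^sub>i - n\<^esup>\<close>, and the part of \<open>f\<close> near a ball \<open>B\<close> is handled by Hoelder's inequality and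
  scalar weighted bounds. The bound for the scalar fractional integral follows from a Hedberg inequality
  with respect to the measure \<open>\<omega>\<^sup>q\<close>. For the scalar commutator use
  \<open>\<epsilon> |t| \<le> exp (\<epsilon> t) + exp (-\<epsilon> t)\<close> with \<open>t = b(x) - b(y)\<close>: this leaves fractional integrals for the weights
  \<open>\<omega> exp (\<plusminus>\<epsilon> b)\<close>, which by a weighted John-Nirenberg inequality satisfy the same condition when \<open>\<epsilon>\<close> is a
  small multiple of \<open>1 / \<parallel>b\<parallel>\<close>. On the dyadic shells \<open>2\<^sup>k B\<close> the averages of \<open>b\<close> drift from \<open>b\<^sub>B\<close> by at most \<open>k \<parallel>b\<parallel>\<close> up to a constant,
  which is the origin of the logarithm; the resulting sum over \<open>k\<close> is dominated by the integral
  condition on \<open>\<phi>\<close>.\<close>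

section \<open>Powers of extended nonnegative reals and the inequality of Hoelder\<close>

text \<open>Convergence of the integrals is not known in advance, so all estimates concern the
  nonnegative integral of the absolute kernel; absolute convergence almost everywhere is read off at
  the end. The target exponent \<open>qq\<close> may lie below one, where no triangle inequality is
  available; hence the constants for powers of sums. Hedberg's argument at the exponent p alone
  would call for the maximal theorem at its endpoint. The room comes from a slightly smaller p, for
  which the weight condition still holds by a reverse Hoelder inequality for
  \<open>\<sigma>\<close>; this in turn is the weighted John-Nirenberg inequality for
  \<open>ln \<sigma>\<close>, which has bounded mean oscillation because of the pair condition. As
  weights are perturbed, constants may depend on the exponents and on the characteristic
  \<open>A\<close> only, and are quantified before weights and functions. Bounds are proved for
  every \<beta> greater than the BMO norm, since the norm may be 0 while the parameter of the
  exponential trick is a multiple of 1 / \<beta>. That choice is also the source of the linear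
  dependence on \<beta>; letting \<beta> tend to the norm ends the proof.\<close>

text \<open>Pitfall: \<open>epow 0 s = 0\<close> also for \<open>s \<le> 0\<close>, and \<open>epow top s = top\<close> also for \<open>s \<le> 0\<close>.\<close>

definition epow :: "ennreal \<Rightarrow> real \<Rightarrow> ennreal" where
  "epow x s = (if x = top then top else ennreal (enn2real x powr s))"

lemma epow_ennreal [simp]: "0 \<le> a \<Longrightarrow> epow (ennreal a) s = ennreal (a powr s)"
  by (simp add: epow_def)

lemma epow_top [simp]: "epow top s = top"
  by (simp add: epow_def)

lemma epow_0 [simp]: "epow 0 s = 0"
  by (simp add: epow_def)

lemma epow_eq_0 [simp]: "epow x s = 0 \<longleftrightarrow> x = 0"
  by (cases x) (auto simp: epow_def)

lemma epow_eq_top [simp]: "epow x s = top \<longleftrightarrow> x = top"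
  by (cases x) (auto simp: epow_def)

lemma epow_mono: "0 \<le> s \<Longrightarrow> x \<le> y \<Longrightarrow> epow x s \<le> epow y s"
  by (cases x; cases y) (auto simp: epow_def powr_mono2 top_unique intro!: ennreal_leI)

lemma epow_mult: "epow (x * y) s = epow x s * epow y s"
proof (cases x; cases y)
  fix a b :: real assume "x = ennreal a" "0 \<le> a" "y = ennreal b" "0 \<le> b"
  then show ?thesis by (simp flip: ennreal_mult add: powr_mult)
next
  fix a :: real assume "x = ennreal a" "0 \<le> a" "y = top"
  then show ?thesis by (cases "a = 0") (auto simp: ennreal_mult_top)
next
  fix a :: real assume "y = ennreal a" "0 \<le> a" "x = top"
  then show ?thesis by (cases "a = 0") (auto simp: ennreal_top_mult)
qed auto

lemma epow_epow: "epow (epow x s) t = epow x (s * t)"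
  by (cases x) (auto simp: powr_powr)

lemma epow_prod: "epow (\<Prod>i\<in>I. g i) s = (\<Prod>i\<in>I. epow (g i) s)" if "finite I"
  using that
proof (induction I rule: finite_induct)
  case empty
  have "epow 1 s = 1" using epow_ennreal[of 1 s] by simp
  then show ?case by simp
qed (simp add: epow_mult)

lemma epow_measurable [measurable]: "(\<lambda>x. epow x s) \<in> borel_measurable borel"
  unfolding epow_def[abs_def] by measurable

lemma borel_measurable_epow [measurable]:
  "f \<in> borel_measurable M \<Longrightarrow> (\<lambda>x. epow (f x) s) \<in> borel_measurable M"
  by (rule measurable_compose[OF _ epow_measurable])

text \<open>A bound valid for every s \<ge> 0 is wanted, as the exponent may be below or above one;
  x + y \<le> 2 max x y gives it at the price of 2^s.\<close>

lemma epow_add_le: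
  assumes "0 \<le> s"
  shows "epow (x + y) s \<le> ennreal (2 powr s) * (epow x s + epow y s)"
proof -
  have "epow (x + y) s \<le> epow (2 * max x y) s"
    using assms by (intro epow_mono) (auto simp: mult_2 intro!: add_mono)
  also have "\<dots> = ennreal (2 powr s) * epow (max x y) s"
    using epow_ennreal[of 2 s] by (simp add: epow_mult)
  also have "epow (max x y) s \<le> epow x s + epow y s"
    by (auto simp: max_def)
  finally show ?thesis by (simp add: mult_left_mono)
qed

lemma epow_sum_le:
  assumes "0 \<le> s" "finite I" "I \<noteq> {}"
  shows "epow (\<Sum>i\<in>I. g i) s \<le> ennreal (real (card I) powr s) * (\<Sum>i\<in>I. epow (g i) s)"
proof -
  define M where "M = Max (g ` I)"
  have "M \<in> g ` I" unfolding M_def using assms by (intro Max_in) auto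
  then obtain i0 where i0: "i0 \<in> I" "M = g i0" by auto
  have "(\<Sum>i\<in>I. g i) \<le> (\<Sum>i\<in>I. M)"
    using assms by (intro sum_mono) (auto simp: M_def)
  also have "\<dots> = ennreal (real (card I)) * M" by (simp add: ennreal_of_nat_eq_real_of_nat)
  finally have "epow (\<Sum>i\<in>I. g i) s \<le> epow (ennreal (real (card I)) * M) s"
    using assms by (intro epow_mono)
  also have "\<dots> = ennreal (real (card I) powr s) * epow (g i0) s"
    by (simp add: epow_mult i0)
  also have "epow (g i0) s \<le> (\<Sum>i\<in>I. epow (g i) s)"
    using i0 assms by (intro member_le_sum) auto
  finally show ?thesis by (simp add: mult_left_mono)
qed

text \<open>Convexity of exp at the points \<open>ln (x i)\<close>. A vanishing \<open>x i\<close>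
  is split off; it makes the product zero because 0 powr t = 0.\<close>

lemma weighted_arith_geom_mean:
  fixes x \<theta> :: "'i \<Rightarrow> real"
  assumes "finite I" "I \<noteq> {}" "\<And>i. i \<in> I \<Longrightarrow> 0 < \<theta> i" "(\<Sum>i\<in>I. \<theta> i) = 1"
    and "\<And>i. i \<in> I \<Longrightarrow> 0 \<le> x i"
  shows "(\<Prod>i\<in>I. x i powr \<theta> i) \<le> (\<Sum>i\<in>I. \<theta> i * x i)"
proof (cases "\<exists>i\<in>I. x i = 0")
  case True
  then have "(\<Prod>i\<in>I. x i powr \<theta> i) = 0" using assms(1) by (intro prod_zero) auto
  also have "\<dots> \<le> (\<Sum>i\<in>I. \<theta> i * x i)" using assms by (intro sum_nonneg) (simp add: less_imp_le)
  finally show ?thesis .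
next
  case False
  then have pos: "0 < x i" if "i \<in> I" for i using assms(5) that by (force simp: less_le)
  have "(\<Prod>i\<in>I. x i powr \<theta> i) = (\<Prod>i\<in>I. exp (\<theta> i * ln (x i)))"
    using False by (intro prod.cong) (auto simp: powr_def)
  also have "\<dots> = exp (\<Sum>i\<in>I. \<theta> i *\<^sub>R ln (x i))"
    using assms(1) by (simp add: exp_sum)
  also have "\<dots> \<le> (\<Sum>i\<in>I. \<theta> i * exp (ln (x i)))"
    using assms by (intro convex_on_sum[OF _ _ exp_convex]) (auto simp: less_imp_le)
  also have "\<dots> = (\<Sum>i\<in>I. \<theta> i * x i)" using pos by (intro sum.cong) auto
  finally show ?thesis .
qed

text \<open>Each factor is normalised by its integral and the arithmetic-geometric mean inequality
  is applied pointwise: the normalised sum integrates to \<Sum> \<theta> = 1. A zero integral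
  annihilates the integrand almost everywhere; otherwise an infinite one makes the right-hand side
  infinite.\<close>

lemma nn_integral_Hoelder_prod:
  fixes g :: "'i \<Rightarrow> 'b \<Rightarrow> ennreal"
  assumes I: "finite I" "I \<noteq> {}" "\<And>i. i \<in> I \<Longrightarrow> 0 < \<theta> i" "(\<Sum>i\<in>I. \<theta> i) = 1"
    and meas: "\<And>i. i \<in> I \<Longrightarrow> g i \<in> borel_measurable M"
  shows "(\<integral>\<^sup>+x. (\<Prod>i\<in>I. epow (g i x) (\<theta> i)) \<partial>M) \<le> (\<Prod>i\<in>I. epow (\<integral>\<^sup>+x. g i x \<partial>M) (\<theta> i))"
proof -
  define A where "A i = (\<integral>\<^sup>+x. g i x \<partial>M)" for i
  consider (zero) i where "i \<in> I" "A i = 0" | (inf) i where "\<And>j. j \<in> I \<Longrightarrow> A j \<noteq> 0" "i \<in> I" "A i = top"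
    | (fin) "\<And>j. j \<in> I \<Longrightarrow> A j \<noteq> 0 \<and> A j \<noteq> top" by auto
  then show ?thesis
  proof cases
    case zero
    then have "AE x in M. g i x = 0"
      using meas[of i] by (simp add: A_def nn_integral_0_iff_AE)
    then have "AE x in M. (\<Prod>i\<in>I. epow (g i x) (\<theta> i)) = 0"
      by eventually_elim (use I(1) zero(1) in \<open>auto intro!: prod_zero\<close>)
    then have "(\<integral>\<^sup>+x. (\<Prod>i\<in>I. epow (g i x) (\<theta> i)) \<partial>M) = (\<integral>\<^sup>+x. 0 \<partial>M)"
      by (rule nn_integral_cong_AE)
    then show ?thesis by simp
  next
    case inf
    have "(\<Prod>i\<in>I. epow (A i) (\<theta> i)) = top"
      using inf I(1) by (auto simp: ennreal_prod_eq_top)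
    then show ?thesis by (simp add: A_def)
  next
    case fin
    define a where "a i = enn2real (A i)" for i
    have a: "A i = ennreal (a i)" "0 < a i" "a i \<noteq> 0" "0 \<le> a i" if "i \<in> I" for i
    proof -
      show *: "A i = ennreal (a i)" "0 < a i"
        using fin[OF that] by (auto simp: a_def enn2real_positive_iff less_top zero_less_iff_neq_zero)
      show "a i \<noteq> 0" "0 \<le> a i" using *(2) by auto
    qed
    have "AE x in M. \<forall>i\<in>I. g i x \<noteq> top"
      using I(1) meas fin nn_integral_PInf_AE by (subst AE_finite_all) (auto simp: A_def infinity_ennreal_def)
    then have "AE x in M. (\<Prod>i\<in>I. epow (g i x) (\<theta> i))
        \<le> (\<Prod>i\<in>I. ennreal (a i powr \<theta> i)) * (\<Sum>i\<in>I. ennreal (\<theta> i / a i) * g i x)"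
    proof eventually_elim
      case (elim x)
      define h where "h i = enn2real (g i x)" for i
      have h: "g i x = ennreal (h i)" "0 \<le> h i" if "i \<in> I" for i
        using elim that by (auto simp: h_def less_top)
      have "(\<Prod>i\<in>I. epow (g i x) (\<theta> i)) = (\<Prod>i\<in>I. ennreal (a i powr \<theta> i) * ennreal ((h i / a i) powr \<theta> i))"
        using a h by (intro prod.cong) (auto simp: powr_divide simp flip: ennreal_mult)
      also have "\<dots> = (\<Prod>i\<in>I. ennreal (a i powr \<theta> i)) * ennreal (\<Prod>i\<in>I. (h i / a i) powr \<theta> i)"
        by (simp add: prod.distrib prod_ennreal)
      also have "ennreal (\<Prod>i\<in>I. (h i / a i) powr \<theta> i) \<le> ennreal (\<Sum>i\<in>I. \<theta> i * (h i / a i))"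
        using I a h by (intro ennreal_leI weighted_arith_geom_mean) (auto simp: less_imp_le)
      also have "\<dots> = (\<Sum>i\<in>I. ennreal (\<theta> i * (h i / a i)))"
        using I a h by (intro sum_ennreal[symmetric]) (auto simp: less_imp_le)
      also have "\<dots> = (\<Sum>i\<in>I. ennreal (\<theta> i / a i) * g i x)"
        using I a h by (intro sum.cong) (auto simp: less_imp_le simp flip: ennreal_mult)
      finally show ?case by (simp add: mult_left_mono)
    qed
    then have "(\<integral>\<^sup>+x. (\<Prod>i\<in>I. epow (g i x) (\<theta> i)) \<partial>M)
      \<le> (\<integral>\<^sup>+x. (\<Prod>i\<in>I. ennreal (a i powr \<theta> i)) * (\<Sum>i\<in>I. ennreal (\<theta> i / a i) * g i x) \<partial>M)"
      by (rule nn_integral_mono_AE)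
    also have "\<dots> = (\<Prod>i\<in>I. ennreal (a i powr \<theta> i)) * (\<Sum>i\<in>I. ennreal (\<theta> i / a i) * A i)"
      using meas I(1) by (subst nn_integral_cmult) (auto simp: nn_integral_sum nn_integral_cmult A_def)
    also have "(\<Sum>i\<in>I. ennreal (\<theta> i / a i) * A i) = (\<Sum>i\<in>I. ennreal (\<theta> i))"
      using I a by (intro sum.cong) (auto simp: less_imp_le simp flip: ennreal_mult)
    also have "\<dots> = 1" using I by (subst sum_ennreal) (auto simp: less_imp_le)
    also have "(\<Prod>i\<in>I. ennreal (a i powr \<theta> i)) = (\<Prod>i\<in>I. epow (A i) (\<theta> i))"
      using a by (intro prod.cong) (auto simp: less_imp_le)
    finally show ?thesis by (simp add: A_def)
  qed
qed

lemma nn_integral_Hoelder: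
  fixes g h :: "'b \<Rightarrow> ennreal"
  assumes "0 < \<theta>" "\<theta> < 1" "g \<in> borel_measurable M" "h \<in> borel_measurable M"
  shows "(\<integral>\<^sup>+x. epow (g x) \<theta> * epow (h x) (1 - \<theta>) \<partial>M)
    \<le> epow (\<integral>\<^sup>+x. g x \<partial>M) \<theta> * epow (\<integral>\<^sup>+x. h x \<partial>M) (1 - \<theta>)"
  using nn_integral_Hoelder_prod[of "UNIV :: bool set" "\<lambda>i. if i then \<theta> else 1 - \<theta>"
      "\<lambda>i. if i then g else h" M] assms
  by (simp add: UNIV_bool mult.commute split: if_splits)

section \<open>Weights\<close>

text \<open>Local integrability is stated as finiteness of extended integrals on balls, so that
  \<open>enn2real\<close> in \<open>wmeas\<close> loses no information on subsets of balls.\<close>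

definition wt :: "('a::euclidean_space \<Rightarrow> real) \<Rightarrow> bool" where
  "wt w \<longleftrightarrow> (\<forall>x. 0 \<le> w x) \<and> w \<in> borel_measurable borel \<and> (AE x in lborel. 0 < w x) \<and>
     (\<forall>x r. (\<integral>\<^sup>+y\<in>ball x r. ennreal (w y) \<partial>lborel) < \<infinity>)"

lemma wtD:
  assumes "wt w"
  shows "0 \<le> w x" and "w \<in> borel_measurable borel" and "AE x in lborel. 0 < w x"
    and "(\<integral>\<^sup>+y\<in>ball x r. ennreal (w y) \<partial>lborel) < \<infinity>"
  using assms by (auto simp: wt_def)

lemma wmeas_nonneg [simp]: "0 \<le> wmeas w E"
  by (simp add: wmeas_def)

lemma set_nn_integral_mono_set:
  "A \<subseteq> B \<Longrightarrow> (\<integral>\<^sup>+y\<in>A. f y \<partial>M) \<le> (\<integral>\<^sup>+y\<in>B. f y \<partial>M)"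
  by (intro nn_integral_mono) (auto simp: indicator_def)

lemma ennreal_wmeas:
  assumes "wt w" "E \<subseteq> ball x r"
  shows "ennreal (wmeas w E) = (\<integral>\<^sup>+y\<in>E. ennreal (w y) \<partial>lborel)"
proof -
  have "(\<integral>\<^sup>+y\<in>E. ennreal (w y) \<partial>lborel) < \<infinity>"
    using set_nn_integral_mono_set[OF assms(2), of lborel "\<lambda>y. ennreal (w y)"] wtD(4)[OF assms(1), of x r]
    by (rule le_less_trans)
  then show ?thesis by (simp add: wmeas_def)
qed

lemma wmeas_mono:
  assumes "wt w" "E \<subseteq> F" "F \<subseteq> ball x r"
  shows "wmeas w E \<le> wmeas w F"
proof -
  have "ennreal (wmeas w E) \<le> ennreal (wmeas w F)"
    using set_nn_integral_mono_set[OF assms(2), of lborel "\<lambda>y. ennreal (w y)"]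
    by (subst (1 2) ennreal_wmeas[OF assms(1), of _ x r]) (use assms in auto)
  then show ?thesis by simp
qed

lemma wmeas_Diff:
  assumes "wt w" "E \<subseteq> F" "F \<subseteq> ball x r" "E \<in> sets borel" "F \<in> sets borel"
  shows "wmeas w F = wmeas w E + wmeas w (F - E)"
proof -
  note [measurable] = wtD(2)[OF assms(1)] assms(4,5)
  have "(\<integral>\<^sup>+y\<in>F. ennreal (w y) \<partial>lborel)
      = (\<integral>\<^sup>+y. ennreal (w y) * indicator E y + ennreal (w y) * indicator (F - E) y \<partial>lborel)"
    using assms(2) by (intro nn_integral_cong) (auto simp: indicator_def)
  also have "\<dots> = (\<integral>\<^sup>+y\<in>E. ennreal (w y) \<partial>lborel) + (\<integral>\<^sup>+y\<in>F - E. ennreal (w y) \<partial>lborel)"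
    by (intro nn_integral_add) auto
  finally have "ennreal (wmeas w F) = ennreal (wmeas w E) + ennreal (wmeas w (F - E))"
    by (subst (1 2 3) ennreal_wmeas[OF assms(1), of _ x r]) (use assms in auto)
  then show ?thesis by (simp flip: ennreal_plus)
qed

lemma wmeas_pos:
  assumes "wt w" "E \<subseteq> ball x r" "E \<in> sets borel" "0 < measure lborel E"
  shows "0 < wmeas w E"
proof (rule ccontr)
  note [measurable] = wtD(2)[OF assms(1)] assms(3)
  assume "\<not> 0 < wmeas w E"
  then have "ennreal (wmeas w E) = 0" by (simp add: ennreal_eq_0_iff)
  then have "(\<integral>\<^sup>+y\<in>E. ennreal (w y) \<partial>lborel) = 0" using ennreal_wmeas[OF assms(1,2)] by simp
  then have "AE y in lborel. ennreal (w y) * indicator E y = 0"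
    by (subst (asm) nn_integral_0_iff_AE) auto
  then have "AE y in lborel. y \<notin> E"
    using wtD(3)[OF assms(1)] by eventually_elim (auto simp: indicator_def ennreal_eq_0_iff split: if_splits)
  then have "emeasure lborel E = 0" using assms(3) by (simp add: AE_iff_measurable[of E lborel])
  then show False using assms(4) by (simp add: measure_def)
qed

lemma measure_ball:
  "0 \<le> r \<Longrightarrow> measure lborel (ball (x::'a::euclidean_space) r) = r ^ DIM('a) * measure lborel (ball (0::'a) 1)"
  by (rule content_ball_conv_unit_ball)

lemma unit_ball_pos: "0 < measure lborel (ball (0::'a::euclidean_space) 1)"
  by (rule content_ball_pos) simp

lemma measure_ball_pos: "0 < r \<Longrightarrow> 0 < measure lborel (ball (x::'a::euclidean_space) r)"
  by (rule content_ball_pos)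

lemma wmeas_ball_pos: "wt w \<Longrightarrow> 0 < r \<Longrightarrow> 0 < wmeas w (ball x r)"
  by (rule wmeas_pos[of w _ x r]) (auto simp: measure_ball_pos)

text \<open>The scalar condition \<open>A\<^bsub>p,q\<^esub>\<close> of \<open>\<omega>\<close>, with \<open>1/p - 1/q = \<kappa>\<close>, is \<open>mpair \<theta> A v \<sigma>\<close> for
  \<open>v = \<omega>\<^sup>q\<close>, \<open>\<sigma> = \<omega>\<^bsup>-p'\<^esup>\<close> and \<open>\<theta> = (1/q) / (1 - \<kappa>)\<close>, so that \<open>1 - \<theta> = (1/p') / (1 - \<kappa>)\<close>: in this
  normalization duality exchanges the two weights. The half of it that concerns \<open>v\<close> alone is \<open>ainf\<close>.\<close>

definition ainf :: "real \<Rightarrow> real \<Rightarrow> ('a::euclidean_space \<Rightarrow> real) \<Rightarrow> bool" where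
  "ainf \<theta> A w \<longleftrightarrow> wt w \<and> (\<forall>x r E. 0 < r \<longrightarrow> E \<in> sets borel \<longrightarrow> E \<subseteq> ball x r \<longrightarrow>
     measure lborel E * wmeas w (ball x r) powr \<theta>
       \<le> A * measure lborel (ball x r) * wmeas w E powr \<theta>)"

definition mpair :: "real \<Rightarrow> real \<Rightarrow> ('a::euclidean_space \<Rightarrow> real) \<Rightarrow> ('a \<Rightarrow> real) \<Rightarrow> bool" where
  "mpair \<theta> A v \<sigma> \<longleftrightarrow> wt v \<and> wt \<sigma> \<and> (AE x in lborel. v x powr \<theta> * \<sigma> x powr (1 - \<theta>) = 1) \<and>
     (\<forall>x r. 0 < r \<longrightarrow> wmeas v (ball x r) powr \<theta> * wmeas \<sigma> (ball x r) powr (1 - \<theta>)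
        \<le> A * measure lborel (ball x r))"

lemma mpair_sym: "mpair \<theta> A v \<sigma> \<Longrightarrow> mpair (1 - \<theta>) A \<sigma> v"
  by (simp add: mpair_def mult.commute)

text \<open>Hoelder's inequality for the function 1 = v^\<theta> \<sigma>^(1 - \<theta>). It is
  converse to the inequality in \<open>mpair\<close> and holds on every bounded Borel set with
  constant one.\<close>

lemma measure_le_wmeas_product:
  assumes v: "wt v" and s: "wt \<sigma>" and eq: "AE x in lborel. v x powr \<theta> * \<sigma> x powr (1 - \<theta>) = 1"
    and "0 < \<theta>" "\<theta> < 1" "E \<in> sets borel" "E \<subseteq> ball x r"
  shows "measure lborel E \<le> wmeas v E powr \<theta> * wmeas \<sigma> E powr (1 - \<theta>)"
proof -
  note [measurable] = wtD(2)[OF v] wtD(2)[OF s] assms(6)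
  have fin: "emeasure lborel E \<noteq> \<infinity>"
    using emeasure_mono[OF assms(7), of lborel] emeasure_lborel_ball_finite[of x r] by (auto simp: top_unique)
  have "ennreal (measure lborel E) = (\<integral>\<^sup>+y. indicator E y \<partial>lborel)"
    using fin by (simp add: emeasure_eq_ennreal_measure)
  also have "\<dots> = (\<integral>\<^sup>+y. epow (ennreal (v y) * indicator E y) \<theta> * epow (ennreal (\<sigma> y) * indicator E y) (1 - \<theta>) \<partial>lborel)"
  proof (rule nn_integral_cong_AE)
    show "AE y in lborel. (indicator E y :: ennreal) = epow (ennreal (v y) * indicator E y) \<theta> * epow (ennreal (\<sigma> y) * indicator E y) (1 - \<theta>)"
      using eq by eventually_elim (auto simp: indicator_def wtD[OF v] wtD[OF s] simp flip: ennreal_mult)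
  qed
  also have "\<dots> \<le> epow (\<integral>\<^sup>+y\<in>E. ennreal (v y) \<partial>lborel) \<theta> * epow (\<integral>\<^sup>+y\<in>E. ennreal (\<sigma> y) \<partial>lborel) (1 - \<theta>)"
    using assms by (intro nn_integral_Hoelder) auto
  also have "\<dots> = ennreal (wmeas v E powr \<theta> * wmeas \<sigma> E powr (1 - \<theta>))"
    by (simp add: ennreal_mult flip: ennreal_wmeas[OF v assms(7)] ennreal_wmeas[OF s assms(7)])
  finally show ?thesis by simp
qed

text \<open>In the Hoelder bound for the measure of \<open>E\<close> the mass of
  \<open>\<sigma>\<close> on \<open>E\<close> is enlarged to its mass on the ball, which the pair
  condition trades for the mass of \<open>v\<close> on the ball.\<close>

lemma mpair_ainf:
  assumes "mpair \<theta> A v \<sigma>" "0 < \<theta>" "\<theta> < 1"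
  shows "ainf \<theta> A v"
  unfolding ainf_def
proof (intro conjI allI impI)
  show v: "wt v" using assms by (simp add: mpair_def)
  have s: "wt \<sigma>" and eq: "AE x in lborel. v x powr \<theta> * \<sigma> x powr (1 - \<theta>) = 1" using assms by (auto simp: mpair_def)
  fix x r and E :: "'a set" assume *: "0 < r" "E \<in> sets borel" "E \<subseteq> ball x r"
  have "measure lborel E * wmeas v (ball x r) powr \<theta>
      \<le> (wmeas v E powr \<theta> * wmeas \<sigma> (ball x r) powr (1 - \<theta>)) * wmeas v (ball x r) powr \<theta>"
    using assms * wmeas_mono[OF s *(3), of x r]
    by (intro mult_right_mono order_trans[OF measure_le_wmeas_product[OF v s eq assms(2,3) *(2,3)]] mult_left_mono powr_mono2) auto
  also have "\<dots> = wmeas v E powr \<theta> * (wmeas v (ball x r) powr \<theta> * wmeas \<sigma> (ball x r) powr (1 - \<theta>))"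
    by simp
  also have "\<dots> \<le> wmeas v E powr \<theta> * (A * measure lborel (ball x r))"
    using assms * by (intro mult_left_mono) (auto simp: mpair_def)
  finally show "measure lborel E * wmeas v (ball x r) powr \<theta> \<le> A * measure lborel (ball x r) * wmeas v E powr \<theta>"
    by (simp add: mult_ac)
qed

lemma ainf_wt: "ainf \<theta> A w \<Longrightarrow> wt w"
  by (simp add: ainf_def)

text \<open>Test with \<open>E\<close> equal to the unit ball. Hence no weight satisfies the
  condition with A < 1, which disposes of small constants in the uniform theorems.\<close>

lemma ainf_ge_1:
  assumes "ainf \<theta> A (w::'a::euclidean_space \<Rightarrow> real)"
  shows "1 \<le> A"
proof -
  define m where "m = measure lborel (ball (0::'a) 1)"
  have "m > 0" by (simp add: m_def unit_ball_pos)
  moreover have "wmeas w (ball 0 1) powr \<theta> > 0"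
    using wmeas_ball_pos[OF ainf_wt[OF assms], of 1 0] by simp
  moreover have "m * wmeas w (ball 0 1) powr \<theta> \<le> A * m * wmeas w (ball 0 1) powr \<theta>"
    using assms unfolding ainf_def m_def by (auto dest!: spec[of _ "0::'a"] spec[of _ "1::real"] spec[of _ "ball 0 1"])
  ultimately show ?thesis by (simp add: mult_le_cancel_right)
qed

text \<open>The condition solved for the mass of the ball: a subset with the fraction \<eta> of the
  volume carries a fixed fraction of the mass. This is the form in which the condition is
  used.\<close>

lemma ainf_le:
  assumes "ainf \<theta> A w" "0 < \<theta>" "0 < r" "E \<in> sets borel" "E \<subseteq> ball x r" "0 < \<eta>"
    "\<eta> * measure lborel (ball x r) \<le> measure lborel E"
  shows "wmeas w (ball x r) \<le> (A / \<eta>) powr (1 / \<theta>) * wmeas w E"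
proof -
  define W where "W = wmeas w (ball x r)"
  define m where "m = measure lborel (ball x r)"
  have m: "0 < m" using assms by (simp add: m_def measure_ball_pos)
  have "(\<eta> * m) * W powr \<theta> \<le> measure lborel E * W powr \<theta>"
    using assms by (intro mult_right_mono) (auto simp: m_def)
  also have "\<dots> \<le> A * m * wmeas w E powr \<theta>"
    using assms by (auto simp: ainf_def W_def m_def)
  finally have "m * (\<eta> * W powr \<theta>) \<le> m * (A * wmeas w E powr \<theta>)" by (simp add: mult_ac)
  then have "W powr \<theta> \<le> (A / \<eta>) * wmeas w E powr \<theta>"
    using m assms(6) by (simp add: mult_le_cancel_left field_simps)
  then have "(W powr \<theta>) powr (1 / \<theta>) \<le> ((A / \<eta>) * wmeas w E powr \<theta>) powr (1 / \<theta>)"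
    using assms by (intro powr_mono2) auto
  also have "\<dots> = (A / \<eta>) powr (1 / \<theta>) * wmeas w E"
    by (subst powr_mult) (use assms ainf_ge_1[OF assms(1)] in \<open>auto simp: powr_powr\<close>)
  finally show ?thesis using assms by (simp add: powr_powr W_def)
qed

lemma ainf_doubling:
  assumes "ainf \<theta> A (w::'a::euclidean_space \<Rightarrow> real)" "0 < \<theta>" "0 < r" "0 < c" "ball y r \<subseteq> ball x (c * r)"
  shows "wmeas w (ball x (c * r)) \<le> (A * c ^ DIM('a)) powr (1 / \<theta>) * wmeas w (ball y r)"
  using ainf_le[OF assms(1,2), of "c * r" "ball y r" x "1 / c ^ DIM('a)"] assms
  by (simp add: measure_ball[of "c * r"] measure_ball[of r] power_mult_distrib)

text \<open>The annulus has at least half the volume of the larger ball, as 2^n \<ge> 2, so it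
  carries a fixed share of the mass. The resulting geometric growth of the mass over dyadic balls is
  what makes Hedberg's sums converge.\<close>

lemma ainf_reverse_doubling:
  assumes "ainf \<theta> A (w::'a::euclidean_space \<Rightarrow> real)" "0 < \<theta>" "0 < r"
  shows "wmeas w (ball x r) \<le> (1 - 1 / (2 * A) powr (1 / \<theta>)) * wmeas w (ball x (2 * r))"
proof -
  have A: "1 \<le> A" by (rule ainf_ge_1[OF assms(1)])
  define E where "E = ball x (2 * r) - ball x r"
  have sub: "ball x r \<subseteq> ball x (2 * r)" using assms by (intro subset_ball) auto
  have "measure lborel E = measure lborel (ball x (2 * r)) - measure lborel (ball x r)"
    unfolding E_def using sub emeasure_lborel_ball_finite[of x "2 * r"]
    by (intro measure_Diff) auto
  moreover have "2 * measure lborel (ball x r) \<le> measure lborel (ball x (2 * r))"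
  proof -
    have "(2::real) ^ 1 \<le> 2 ^ DIM('a)" by (intro power_increasing) (auto simp: Suc_le_eq)
    then show ?thesis using assms unit_ball_pos[where 'a='a]
      by (simp add: measure_ball[of "2 * r"] measure_ball[of r] power_mult_distrib mult_right_mono)
  qed
  ultimately have "1 / 2 * measure lborel (ball x (2 * r)) \<le> measure lborel E" by simp
  then have "wmeas w (ball x (2 * r)) \<le> (A / (1 / 2)) powr (1 / \<theta>) * wmeas w E"
    using assms by (intro ainf_le) (auto simp: E_def)
  moreover have "wmeas w (ball x (2 * r)) = wmeas w (ball x r) + wmeas w E"
    unfolding E_def using sub assms by (intro wmeas_Diff[where x=x and r="2*r"]) (auto simp: ainf_wt)
  ultimately show ?thesis using A by (simp add: field_simps)
qed

section \<open>Dyadic cells and stopping families\<close>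

text \<open>Half-open cube of side \<open>L\<close> of the grid with corner \<open>a\<close>,
  described by floors: membership is then an equivalence relation, and two cells of one grid are
  equal or disjoint by \<open>cell_eq\<close>.\<close>

definition cell :: "'a::euclidean_space \<Rightarrow> real \<Rightarrow> 'a \<Rightarrow> 'a set" where
  "cell a L x = {y. \<forall>i\<in>Basis. \<lfloor>((y - a) \<bullet> i) / L\<rfloor> = \<lfloor>((x - a) \<bullet> i) / L\<rfloor>}"

lemma cell_self [simp]: "x \<in> cell a L x"
  by (simp add: cell_def)

lemma cell_eq: "y \<in> cell a L x \<Longrightarrow> cell a L y = cell a L x"
  by (auto simp: cell_def)

lemma cell_borel [measurable]: "cell a L x \<in> sets borel"
proof -
  have "cell a L x = (\<Inter>i\<in>Basis. {y \<in> space borel. \<lfloor>((y - a) \<bullet> i) / L\<rfloor> = \<lfloor>((x - a) \<bullet> i) / L\<rfloor>})"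
    by (auto simp: cell_def)
  also have "\<dots> \<in> sets borel"
  proof (intro sets.finite_INT)
    fix i :: 'a
    show "{y \<in> space borel. \<lfloor>((y - a) \<bullet> i) / L\<rfloor> = \<lfloor>((x - a) \<bullet> i) / L\<rfloor>} \<in> sets borel"
      by measurable
  qed auto
  finally show ?thesis .
qed

text \<open>Coarse floors are the integer halves of fine floors, so the grids of side L / 2^k are
  nested.\<close>

lemma cell_half: 
  assumes "0 < L"
  shows "cell a (L / 2) x \<subseteq> cell a L x"
proof -
  have *: "\<lfloor>t / L\<rfloor> = \<lfloor>t / (L / 2)\<rfloor> div 2" for t
    using floor_divide_real_eq_div[of 2 "t / (L / 2)"] by simp
  show ?thesis unfolding cell_def using *[of "(_ - a) \<bullet> _"] by fastforce
qed

lemma cell_antimono: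
  assumes "0 < L" "j \<le> k"
  shows "cell a (L / 2 ^ k) x \<subseteq> cell a (L / 2 ^ j) x"
  using assms(2)
proof (induction k rule: dec_induct)
  case (step k)
  have "cell a (L / 2 ^ Suc k) x \<subseteq> cell a (L / 2 ^ k) x"
    using cell_half[of "L / 2 ^ k" a x] assms(1) by (simp add: field_simps)
  with step show ?case by blast
qed simp

lemma emeasure_cell:
  assumes "0 < L"
  shows "emeasure lborel (cell a L (x::'a::euclidean_space)) = ennreal (L ^ DIM('a))"
proof -
  define l where "l = (\<Sum>i\<in>Basis. (a \<bullet> i + L * \<lfloor>((x - a) \<bullet> i) / L\<rfloor>) *\<^sub>R i)"
  define u where "u = l + L *\<^sub>R One"
  have l: "l \<bullet> i = a \<bullet> i + L * \<lfloor>((x - a) \<bullet> i) / L\<rfloor>" if "i \<in> Basis" for i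
    using that by (simp add: l_def inner_sum_left_Basis)
  have u: "u \<bullet> i = l \<bullet> i + L" if "i \<in> Basis" for i
    using that by (simp add: u_def inner_simps)
  have iff: "\<lfloor>((y - a) \<bullet> i) / L\<rfloor> = \<lfloor>((x - a) \<bullet> i) / L\<rfloor> \<longleftrightarrow> l \<bullet> i \<le> y \<bullet> i \<and> y \<bullet> i < u \<bullet> i" if "i \<in> Basis" for i y
  proof -
    define K where "K = \<lfloor>((x - a) \<bullet> i) / L\<rfloor>"
    have "\<lfloor>((y - a) \<bullet> i) / L\<rfloor> = K \<longleftrightarrow> real_of_int K \<le> ((y - a) \<bullet> i) / L \<and> ((y - a) \<bullet> i) / L < real_of_int K + 1"
      by (rule floor_eq_iff)
    also have "\<dots> \<longleftrightarrow> L * real_of_int K \<le> (y - a) \<bullet> i \<and> (y - a) \<bullet> i < L * real_of_int K + L"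
      using assms by (simp add: pos_le_divide_eq pos_divide_less_eq algebra_simps)
    finally show ?thesis unfolding l[OF that] u[OF that] inner_diff_left K_def by (smt (verit))
  qed
  have 1: "box l u \<subseteq> cell a L x" "cell a L x \<subseteq> cbox l u"
    by (auto simp: cell_def mem_box iff less_imp_le)
  have 2: "emeasure lborel (box l u) = ennreal (L ^ DIM('a))" "emeasure lborel (cbox l u) = ennreal (L ^ DIM('a))"
    using assms by (auto simp: emeasure_lborel_box_eq emeasure_lborel_cbox_eq u inner_simps)
  show ?thesis
  proof (rule antisym)
    show "emeasure lborel (cell a L x) \<le> ennreal (L ^ DIM('a))"
      using emeasure_mono[OF 1(2), of lborel] 2 by simp
    show "ennreal (L ^ DIM('a)) \<le> emeasure lborel (cell a L x)"
      using emeasure_mono[OF 1(1), of lborel] 2 by simp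
  qed
qed

lemma measure_cell: "0 < L \<Longrightarrow> measure lborel (cell a L (x::'a::euclidean_space)) = L ^ DIM('a)"
  by (simp add: measure_def emeasure_cell)

lemma cell_subset_ball:
  assumes "0 < L"
  shows "cell a L (x::'a::euclidean_space) \<subseteq> ball x (real DIM('a) * L)"
proof
  fix y assume y: "y \<in> cell a L x"
  have "\<bar>(x - y) \<bullet> i\<bar> < L" if "i \<in> Basis" for i
  proof -
    have "\<lfloor>((y - a) \<bullet> i) / L\<rfloor> = \<lfloor>((x - a) \<bullet> i) / L\<rfloor>" using y that by (simp add: cell_def)
    then have "\<bar>((y - a) \<bullet> i) / L - ((x - a) \<bullet> i) / L\<bar> < 1" by linarith
    then have "\<bar>((y - a) \<bullet> i - (x - a) \<bullet> i) / L\<bar> < 1" by (simp add: diff_divide_distrib)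
    then show ?thesis using assms by (simp add: inner_simps abs_minus_commute)
  qed
  then have "(\<Sum>i\<in>Basis. \<bar>(x - y) \<bullet> i\<bar>) < (\<Sum>i\<in>(Basis::'a set). L)"
    by (intro sum_strict_mono) auto
  then show "y \<in> ball x (real DIM('a) * L)"
    using norm_le_l1[of "x - y"] by (simp add: dist_norm)
qed

text \<open>The grid origin is moved to the lower corner of the cube circumscribed about the ball;
  then all floors are 0. In a grid fixed in advance a ball may straddle cells of every size.\<close>

lemma ball_subset_cell: "0 < r \<Longrightarrow> ball x r \<subseteq> cell (x - r *\<^sub>R One) (2 * r) (x::'a::euclidean_space)"
proof
  fix y assume r: "0 < r" and "y \<in> ball x r"
  then have "\<bar>(y - x) \<bullet> i\<bar> < r" if "i \<in> Basis" for i
    using Basis_le_norm[OF that, of "y - x"] by (simp add: dist_norm norm_minus_commute)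
  then have *: "\<lfloor>((y - (x - r *\<^sub>R One)) \<bullet> i) / (2 * r)\<rfloor> = 0" "\<lfloor>((x - (x - r *\<^sub>R One)) \<bullet> i) / (2 * r)\<rfloor> = 0"
    if "i \<in> Basis" for i
  proof -
    assume "\<And>i. i \<in> Basis \<Longrightarrow> \<bar>(y - x) \<bullet> i\<bar> < r"
    from this[OF that] have "- r < (y - x) \<bullet> i" "(y - x) \<bullet> i < r" by linarith+
    moreover have "(y - (x - r *\<^sub>R One)) \<bullet> i = (y - x) \<bullet> i + r" "(x - (x - r *\<^sub>R One)) \<bullet> i = r"
      using that by (simp_all add: inner_simps)
    ultimately show "\<lfloor>((y - (x - r *\<^sub>R One)) \<bullet> i) / (2 * r)\<rfloor> = 0" "\<lfloor>((x - (x - r *\<^sub>R One)) \<bullet> i) / (2 * r)\<rfloor> = 0"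
      using r by (simp_all add: floor_eq_iff)
  qed
  show "y \<in> cell (x - r *\<^sub>R One) (2 * r) x"
    unfolding cell_def using * by simp
qed

lemma countable_cells: "countable (range (cell a L :: 'a::euclidean_space \<Rightarrow> _))"
proof -
  define g where "g f = {y::'a. \<forall>i\<in>Basis. \<lfloor>((y - a) \<bullet> i) / L\<rfloor> = f i}" for f :: "'a \<Rightarrow> int"
  have "cell a L x \<in> g ` (Basis \<rightarrow>\<^sub>E UNIV)" for x
    by (intro image_eqI[of _ _ "restrict (\<lambda>i. \<lfloor>((x - a) \<bullet> i) / L\<rfloor>) Basis"]) (auto simp: g_def cell_def)
  then have "range (cell a L) \<subseteq> g ` (Basis \<rightarrow>\<^sub>E UNIV)" by auto
  moreover have "countable (g ` (Basis \<rightarrow>\<^sub>E UNIV))"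
    by (intro countable_image countable_PiE) auto
  ultimately show ?thesis by (rule countable_subset)
qed

text \<open>The maximal cells of the grid with property \<open>P\<close>, as in a Calderon-Zygmund
  decomposition: the first cell with \<open>P\<close> in the decreasing chain of cells through
  \<open>x\<close>.\<close>

definition stops :: "'a::euclidean_space \<Rightarrow> real \<Rightarrow> ('a set \<Rightarrow> bool) \<Rightarrow> 'a \<Rightarrow> 'a set set" where
  "stops a L P x0 = {cell a (L / 2 ^ k) x | k x. x \<in> cell a L x0 \<and> P (cell a (L / 2 ^ k) x) \<and>
      (\<forall>j<k. \<not> P (cell a (L / 2 ^ j) x))}"

lemma stopsE:
  assumes "Q \<in> stops a L P x0"
  obtains k x where "Q = cell a (L / 2 ^ k) x" "x \<in> cell a L x0" "P Q" "\<And>j. j < k \<Longrightarrow> \<not> P (cell a (L / 2 ^ j) x)"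
  using assms by (auto simp: stops_def)

lemma stops_borel: "Q \<in> stops a L P x0 \<Longrightarrow> Q \<in> sets borel"
  by (auto elim: stopsE)

lemma stops_subset:
  assumes "0 < L" "Q \<in> stops a L P x0"
  shows "Q \<subseteq> cell a L x0"
  using assms(2)
proof (rule stopsE)
  fix k x assume "Q = cell a (L / 2 ^ k) x" "x \<in> cell a L x0"
  then show ?thesis using cell_antimono[OF assms(1), of 0 k a x] cell_eq[of x a L x0] by simp
qed

lemma countable_stops: "countable (stops a L P x0)"
proof (rule countable_subset)
  show "stops a L P x0 \<subseteq> (\<Union>k. range (cell a (L / 2 ^ k)))" by (auto simp: stops_def)
  show "countable (\<Union>k. range (cell a (L / 2 ^ k)))" by (intro countable_UN countable_cells) auto
qed

text \<open>A common point z of two stopping cells recovers both: the chains through z and through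
  the defining point coincide down to the stopping cell, so its generation is the least one with
  \<open>P\<close> along the chain of z.\<close>

lemma disjoint_stops:
  assumes L: "0 < L"
  shows "disjoint (stops a L P x0)"
proof (rule disjointI)
  fix Q Q' assume "Q \<in> stops a L P x0" "Q' \<in> stops a L P x0" "Q \<noteq> Q'"
  show "Q \<inter> Q' = {}"
  proof (rule ccontr)
    assume "Q \<inter> Q' \<noteq> {}"
    then obtain z where z: "z \<in> Q" "z \<in> Q'" by auto
    have key: "\<exists>k. Q = cell a (L / 2 ^ k) z \<and> k = (LEAST k. P (cell a (L / 2 ^ k) z))"
      if "Q \<in> stops a L P x0" "z \<in> Q" for Q
      using that(1)
    proof (rule stopsE)
      fix k x assume *: "Q = cell a (L / 2 ^ k) x" "P Q" "\<And>j. j < k \<Longrightarrow> \<not> P (cell a (L / 2 ^ j) x)"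
      have eq: "cell a (L / 2 ^ j) z = cell a (L / 2 ^ j) x" if "j \<le> k" for j
        using cell_antimono[OF L that, of a x] \<open>z \<in> Q\<close> *(1) by (intro cell_eq) auto
      have "(LEAST k. P (cell a (L / 2 ^ k) z)) = k"
        using * eq by (intro Least_equality) (auto simp: not_less[symmetric])
      then show ?thesis using * eq[of k] by auto
    qed
    show False using key[OF \<open>Q \<in> _\<close> z(1)] key[OF \<open>Q' \<in> _\<close> z(2)] \<open>Q \<noteq> Q'\<close> by auto
  qed
qed

lemma mem_Union_stops:
  assumes "x \<in> cell a L x0" "P (cell a (L / 2 ^ k) x)"
  shows "x \<in> \<Union>(stops a L P x0)"
proof -
  define k0 where "k0 = (LEAST k. P (cell a (L / 2 ^ k) x))"
  have "P (cell a (L / 2 ^ k0) x)" unfolding k0_def using assms(2) by (rule LeastI)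
  moreover have "\<not> P (cell a (L / 2 ^ j) x)" if "j < k0" for j using not_less_Least that k0_def by metis
  ultimately have "cell a (L / 2 ^ k0) x \<in> stops a L P x0" using assms by (auto simp: stops_def)
  then show ?thesis using cell_self by blast
qed

lemma nn_integral_Union_eq:
  assumes "countable S" "disjoint S" "S \<subseteq> sets borel" "F \<in> borel_measurable borel"
  shows "(\<integral>\<^sup>+y\<in>\<Union>S. F y \<partial>lborel) = (\<integral>\<^sup>+Q. (\<integral>\<^sup>+y\<in>Q. F y \<partial>lborel) \<partial>count_space S)"
proof -
  have "\<Union>S \<in> sets borel" using assms by (intro sets.countable_Union) auto
  then have "(\<integral>\<^sup>+y\<in>\<Union>S. F y \<partial>lborel) = emeasure (density lborel F) (\<Union>S)"
    using assms by (subst emeasure_density) auto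
  also have "\<dots> = (\<integral>\<^sup>+Q. emeasure (density lborel F) Q \<partial>count_space S)"
    using emeasure_UN_countable[of S "\<lambda>Q. Q" "density lborel F"] assms(1-3)
    by (simp add: disjoint_family_on_def disjoint_def subset_iff)
  also have "\<dots> = (\<integral>\<^sup>+Q. (\<integral>\<^sup>+y\<in>Q. F y \<partial>lborel) \<partial>count_space S)"
    using assms by (intro nn_integral_cong) (auto simp: emeasure_density)
  finally show ?thesis .
qed

lemma nn_integral_Union_le:
  assumes "countable S" "disjoint S" "S \<subseteq> sets borel" "F \<in> borel_measurable borel" "G \<in> borel_measurable borel"
    and "\<And>Q. Q \<in> S \<Longrightarrow> (\<integral>\<^sup>+y\<in>Q. F y \<partial>lborel) \<le> c * (\<integral>\<^sup>+y\<in>Q. G y \<partial>lborel)"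
  shows "(\<integral>\<^sup>+y\<in>\<Union>S. F y \<partial>lborel) \<le> c * (\<integral>\<^sup>+y\<in>\<Union>S. G y \<partial>lborel)"
proof -
  have "(\<integral>\<^sup>+Q. (\<integral>\<^sup>+y\<in>Q. F y \<partial>lborel) \<partial>count_space S) \<le> (\<integral>\<^sup>+Q. c * (\<integral>\<^sup>+y\<in>Q. G y \<partial>lborel) \<partial>count_space S)"
    using assms(6) by (intro nn_integral_mono) auto
  also have "\<dots> = c * (\<integral>\<^sup>+Q. (\<integral>\<^sup>+y\<in>Q. G y \<partial>lborel) \<partial>count_space S)"
    by (intro nn_integral_cmult) auto
  finally show ?thesis using assms by (simp add: nn_integral_Union_eq)
qed

text \<open>A substitute for Lebesgue's differentiation theorem along dyadic cells: outer regularity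
  allows a set to be covered, up to small measure, by disjoint cells that meet it.\<close>

lemma AE_le_of_cells:
  fixes g :: "'a::euclidean_space \<Rightarrow> real"
  assumes L: "0 < L" and g [measurable]: "g \<in> borel_measurable borel"
    and int: "(\<integral>\<^sup>+y\<in>cell a L x0. ennreal \<bar>g y\<bar> \<partial>lborel) < \<infinity>"
    and T [measurable]: "T \<in> sets borel" "T \<subseteq> cell a L x0"
    and le: "\<And>x k. x \<in> T \<Longrightarrow> (\<integral>\<^sup>+y\<in>cell a (L / 2 ^ k) x. ennreal (g y) \<partial>lborel)
                 \<le> (\<integral>\<^sup>+y\<in>cell a (L / 2 ^ k) x. ennreal (- g y) \<partial>lborel)"
  shows "AE x in lborel. x \<in> T \<longrightarrow> g x \<le> 0"
proof -
  define Q0 where "Q0 = cell a L x0"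
  define T' where "T' = {x \<in> T. 0 < g x}"
  have T'_meas [measurable]: "T' \<in> sets borel" unfolding T'_def by measurable
  have Q0_meas [measurable]: "Q0 \<in> sets borel" unfolding Q0_def by measurable
  \<comment> \<open>A finite Borel measure with density |g| on the large cell. Outer regularity is
    applied to it, so the excess of the cover over T' is small in exactly the quantity that is
    compared below.\<close>
  define \<nu> where "\<nu> = density lborel (\<lambda>y. ennreal \<bar>g y\<bar> * indicator Q0 y)"
  have \<nu>: "emeasure \<nu> X = (\<integral>\<^sup>+y\<in>X. ennreal \<bar>g y\<bar> * indicator Q0 y \<partial>lborel)" if "X \<in> sets borel" for X
    unfolding \<nu>_def using that by (subst emeasure_density) auto
  have sets_\<nu>: "sets \<nu> = sets borel" by (simp add: \<nu>_def)
  have fin: "emeasure \<nu> (space \<nu>) \<noteq> \<infinity>" using int \<nu>[of UNIV] by (simp add: \<nu>_def Q0_def)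
  have "emeasure \<nu> T' = 0"
  proof (rule ccontr)
    assume ne: "emeasure \<nu> T' \<noteq> 0"
    have fin': "emeasure \<nu> X \<noteq> \<infinity>" for X
      using emeasure_space[of \<nu> X] fin by (auto simp: top_unique)
    obtain t where t: "emeasure \<nu> T' = ennreal t" "0 < t"
      using ne fin'[of T'] by (cases "emeasure \<nu> T'") (auto simp: ennreal_eq_0_iff)
    have "emeasure \<nu> T' < ennreal (2 * t)" using t by (simp add: ennreal_lessI)
    then have "(INF U\<in>{U. T' \<subseteq> U \<and> open U}. emeasure \<nu> U) < ennreal (2 * t)"
      using outer_regular[OF sets_\<nu> fin, of T'] by simp
    then obtain U where U: "T' \<subseteq> U" "open U" "emeasure \<nu> U < ennreal (2 * t)"
      by (auto simp: INF_less_iff)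
    \<comment> \<open>Stopping rule: a cell inside the open set that meets T'. Small cells around
      points of T' qualify, so the stopping cells cover T' without leaving U, and each contains a
      point at which the hypothesis on cells applies.\<close>
    define P where "P Q \<longleftrightarrow> Q \<subseteq> U \<and> Q \<inter> T' \<noteq> {}" for Q
    define S where "S = stops a L P x0"
    have S: "countable S" "disjoint S" "S \<subseteq> sets borel"
      unfolding S_def using countable_stops disjoint_stops[OF L] stops_borel by auto
    define V where "V = \<Union>S"
    have V_meas [measurable]: "V \<in> sets borel" unfolding V_def using S by (intro sets.countable_Union) auto
    have "x \<in> V" if x: "x \<in> T'" for x
    proof -
      obtain e where e: "0 < e" "ball x e \<subseteq> U" using U x by (meson openE subsetD)
      obtain k where "L * real DIM('a) / e < 2 ^ k" using real_arch_pow[of 2] by auto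
      then have "real DIM('a) * (L / 2 ^ k) < e" using e L by (simp add: field_simps)
      then have "cell a (L / 2 ^ k) x \<subseteq> ball x e"
        using cell_subset_ball[of "L / 2 ^ k" a x] L subset_ball[of "real DIM('a) * (L / 2 ^ k)" e x] by auto
      then have "P (cell a (L / 2 ^ k) x)" using e x cell_self[of x a "L / 2 ^ k"] unfolding P_def by blast
      then show ?thesis
        unfolding V_def S_def using x T by (intro mem_Union_stops[where k=k]) (auto simp: T'_def)
    qed
    then have TV: "T' \<subseteq> V" by auto
    have "P Q" if "Q \<in> S" for Q using that unfolding S_def by (rule stopsE)
    then have VU: "V \<subseteq> U" unfolding V_def P_def by blast
    have VQ: "V \<subseteq> Q0" unfolding V_def S_def Q0_def using stops_subset[OF L] by blast
    have "(\<integral>\<^sup>+y\<in>V. ennreal (g y) \<partial>lborel) \<le> 1 * (\<integral>\<^sup>+y\<in>V. ennreal (- g y) \<partial>lborel)"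
      unfolding V_def
    proof (rule nn_integral_Union_le[OF S])
      fix Q assume "Q \<in> S"
      then obtain k x where kx: "Q = cell a (L / 2 ^ k) x" "P Q" unfolding S_def by (rule stopsE)
      then obtain z where z: "z \<in> Q" "z \<in> T" by (auto simp: P_def T'_def)
      have "Q = cell a (L / 2 ^ k) z" using cell_eq[of z a "L / 2 ^ k" x] z kx by auto
      then show "(\<integral>\<^sup>+y\<in>Q. ennreal (g y) \<partial>lborel) \<le> 1 * (\<integral>\<^sup>+y\<in>Q. ennreal (- g y) \<partial>lborel)"
        using le[OF z(2), of k] by simp
    qed auto
    moreover have "emeasure \<nu> T' \<le> (\<integral>\<^sup>+y\<in>V. ennreal (g y) \<partial>lborel)"
      unfolding \<nu>[OF T'_meas] using TV by (intro nn_integral_mono) (auto simp: T'_def indicator_def)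
    moreover have "(\<integral>\<^sup>+y\<in>V. ennreal (- g y) \<partial>lborel) \<le> emeasure \<nu> (U - T')"
    proof (subst \<nu>)
      show "U - T' \<in> sets borel" using U by auto
      have "ennreal (- g y) * indicator V y \<le> ennreal \<bar>g y\<bar> * indicator Q0 y * indicator (U - T') y" for y
        using VU VQ by (auto simp: indicator_def T'_def ennreal_neg intro: ennreal_leI)
      then show "(\<integral>\<^sup>+y\<in>V. ennreal (- g y) \<partial>lborel) \<le> (\<integral>\<^sup>+y\<in>U - T'. ennreal \<bar>g y\<bar> * indicator Q0 y \<partial>lborel)"
        by (intro nn_integral_mono) auto
    qed
    \<comment> \<open>On T' the function is positive, so its negative part over V lives in U - T'.
      Hence T' has mass t and U - T' has mass at least t, against the choice of U with mass below 2
      t.\<close>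
    ultimately have "ennreal t \<le> emeasure \<nu> (U - T')" using t by simp
    moreover have "emeasure \<nu> U = emeasure \<nu> T' + emeasure \<nu> (U - T')"
      using U by (subst plus_emeasure) (auto simp: sets_\<nu> Un_absorb1)
    ultimately have "ennreal t + ennreal t \<le> emeasure \<nu> U" using t by (auto intro: add_mono)
    then show False using U(3) t by (simp flip: ennreal_plus)
  qed
  then have "(\<integral>\<^sup>+y\<in>T'. ennreal \<bar>g y\<bar> * indicator Q0 y \<partial>lborel) = 0" by (simp add: \<nu>)
  then have "AE y in lborel. ennreal \<bar>g y\<bar> * indicator Q0 y * indicator T' y = 0"
    by (subst (asm) nn_integral_0_iff_AE) auto
  then show ?thesis
  proof eventually_elim
    case (elim x)
    show ?case
    proof (intro impI, rule ccontr)
      assume x: "x \<in> T" "\<not> g x \<le> 0"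
      then have "x \<in> T'" "x \<in> Q0" using T(2) unfolding T'_def Q0_def by auto
      then show False using elim x by simp
    qed
  qed
qed

section \<open>Mean oscillation and the weighted John-Nirenberg inequality\<close>

lemma set_integrable_bounded_const:
  assumes "Q \<in> sets borel" "0 < measure lborel Q"
  shows "set_integrable lborel Q (\<lambda>_. c::real)"
proof -
  have "emeasure lborel Q < \<infinity>" using assms by (auto simp: measure_def enn2real_positive_iff)
  then have "integrable lborel (\<lambda>x. indicator Q x *\<^sub>R c)"
    using assms(1) by (intro integrable_scaleR_left) simp
  then show ?thesis by (simp add: set_integrable_def)
qed

lemma avg_minus_const:
  fixes b :: "'a::euclidean_space \<Rightarrow> real"
  assumes "Q \<in> sets borel" "0 < measure lborel Q" "set_integrable lborel Q b"
  shows "avg Q (\<lambda>y. b y - c) = avg Q b - c"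
proof -
  have "(LINT y:Q|lborel. b y - c) = (LINT y:Q|lborel. b y) - (LINT y:Q|lborel. c)"
    using assms by (intro set_integral_diff set_integrable_bounded_const)
  also have "(LINT y:Q|lborel. c) = c * measure lborel Q"
    using assms by (simp add: set_lebesgue_integral_def)
  finally show ?thesis using assms by (simp add: avg_def field_simps)
qed

lemma set_integrable_minus_const:
  fixes b :: "'a::euclidean_space \<Rightarrow> real"
  assumes "Q \<in> sets borel" "0 < measure lborel Q" "set_integrable lborel Q b"
  shows "set_integrable lborel Q (\<lambda>y. b y - c)"
  using assms by (intro set_integral_diff(1) set_integrable_bounded_const)

lemma set_integrable_abs_minus_const:
  fixes b :: "'a::euclidean_space \<Rightarrow> real"
  assumes "Q \<in> sets borel" "0 < measure lborel Q" "set_integrable lborel Q b"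
  shows "set_integrable lborel Q (\<lambda>y. \<bar>b y - c\<bar>)"
  using set_integrable_abs[OF set_integrable_minus_const[OF assms, of c]] by simp

lemma avg_dist_le:
  fixes b :: "'a::euclidean_space \<Rightarrow> real"
  assumes "Q \<in> sets borel" "0 < measure lborel Q" "set_integrable lborel Q b"
  shows "\<bar>avg Q b - c\<bar> \<le> avg Q (\<lambda>y. \<bar>b y - c\<bar>)"
proof -
  have "\<bar>LINT y:Q|lborel. b y - c\<bar> \<le> (LINT y:Q|lborel. \<bar>b y - c\<bar>)"
    using set_integral_norm_bound[OF set_integrable_minus_const[OF assms, of c]] by simp
  then have "\<bar>avg Q (\<lambda>y. b y - c)\<bar> \<le> avg Q (\<lambda>y. \<bar>b y - c\<bar>)"
    using assms(2) by (simp add: avg_def abs_divide divide_right_mono)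
  then show ?thesis by (simp add: avg_minus_const[OF assms])
qed

lemma set_nn_integral_eq:
  fixes g :: "'a::euclidean_space \<Rightarrow> real"
  assumes "set_integrable lborel Q g" "\<And>y. 0 \<le> g y"
  shows "(\<integral>\<^sup>+y\<in>Q. ennreal (g y) \<partial>lborel) = ennreal (LINT y:Q|lborel. g y)"
proof -
  have "(\<integral>\<^sup>+y\<in>Q. ennreal (g y) \<partial>lborel) = (\<integral>\<^sup>+y. ennreal (indicator Q y *\<^sub>R g y) \<partial>lborel)"
    by (intro nn_integral_cong) (auto simp: indicator_def)
  also have "\<dots> = ennreal (LINT y:Q|lborel. g y)"
    using assms unfolding set_lebesgue_integral_def set_integrable_def
    by (intro nn_integral_eq_integral) auto
  finally show ?thesis .
qed

lemma set_nn_integral_avg: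
  fixes g :: "'a::euclidean_space \<Rightarrow> real"
  assumes "set_integrable lborel Q g" "\<And>y. 0 \<le> g y" "0 < measure lborel Q"
  shows "(\<integral>\<^sup>+y\<in>Q. ennreal (g y) \<partial>lborel) = ennreal (avg Q g * measure lborel Q)"
  using assms by (simp add: set_nn_integral_eq avg_def)

lemma avg_subset_le:
  fixes g :: "'a::euclidean_space \<Rightarrow> real"
  assumes "set_integrable lborel B g" "\<And>y. 0 \<le> g y" "Q \<subseteq> B" "Q \<in> sets borel" "0 < measure lborel Q"
    "0 < measure lborel B" "measure lborel B \<le> C * measure lborel Q"
  shows "avg Q g \<le> C * avg B g"
proof -
  have Q: "set_integrable lborel Q g" using assms by (intro set_integrable_subset[of lborel B g Q]) auto
  have "ennreal (avg Q g * measure lborel Q) \<le> ennreal (avg B g * measure lborel B)"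
    using set_nn_integral_mono_set[OF assms(3), of lborel "\<lambda>y. ennreal (g y)"]
    by (simp add: set_nn_integral_avg assms Q)
  moreover have avg: "0 \<le> avg B g"
    using assms(2,6) by (auto simp: avg_def set_lebesgue_integral_def intro!: divide_nonneg_pos integral_nonneg_AE)
  ultimately have "avg Q g * measure lborel Q \<le> avg B g * measure lborel B" using assms by simp
  also have "\<dots> \<le> avg B g * (C * measure lborel Q)"
    using avg assms by (intro mult_left_mono) auto
  finally show ?thesis using assms by (simp add: mult_ac)
qed

text \<open>Any upper bound for the mean oscillations, not the norm itself: \<open>\<beta>\<close>
  can then be taken positive even for constant functions.\<close>

definition bmob :: "real \<Rightarrow> ('a::euclidean_space \<Rightarrow> real) \<Rightarrow> bool" where
  "bmob \<beta> b \<longleftrightarrow> b \<in> borel_measurable borel \<and>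
     (\<forall>x r. 0 < r \<longrightarrow> set_integrable lborel (ball x r) b) \<and>
     (\<forall>x r. 0 < r \<longrightarrow> avg (ball x r) (\<lambda>y. \<bar>b y - avg (ball x r) b\<bar>) \<le> \<beta>)"

lemma bmob_integrable:
  assumes "bmob \<beta> b" "Q \<subseteq> ball x r" "Q \<in> sets borel" "0 < r"
  shows "set_integrable lborel Q b"
  using assms by (intro set_integrable_subset[of lborel "ball x r" b Q]) (auto simp: bmob_def)

text \<open>The average of a nonnegative function over a part filling at least the fraction 1 / C of
  the ball is at most C times the average over the ball. Recentring at the average over
  \<open>Q\<close> costs the same once more, whence the factor 2.\<close>

lemma bmob_osc:
  fixes b :: "'a::euclidean_space \<Rightarrow> real"
  assumes "bmob \<beta> b" "Q \<subseteq> ball x r" "Q \<in> sets borel" "0 < r" "0 < measure lborel Q"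
    and C: "measure lborel (ball x r) \<le> C * measure lborel Q"
  shows "avg Q (\<lambda>y. \<bar>b y - avg (ball x r) b\<bar>) \<le> C * \<beta>"
    and "\<bar>avg Q b - avg (ball x r) b\<bar> \<le> C * \<beta>"
    and "avg Q (\<lambda>y. \<bar>b y - avg Q b\<bar>) \<le> 2 * C * \<beta>"
proof -
  let ?B = "ball x r"
  have B: "0 < measure lborel ?B" using assms by (intro measure_ball_pos)
  have C0: "0 < C" using C B assms(5) by (metis less_le_trans zero_less_mult_pos2)
  have intB: "set_integrable lborel ?B b" using assms by (intro bmob_integrable) auto
  have intQ: "set_integrable lborel Q b" using assms by (intro bmob_integrable)
  show 1: "avg Q (\<lambda>y. \<bar>b y - avg ?B b\<bar>) \<le> C * \<beta>"
  proof -
    have "avg Q (\<lambda>y. \<bar>b y - avg ?B b\<bar>) \<le> C * avg ?B (\<lambda>y. \<bar>b y - avg ?B b\<bar>)"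
      using assms B intB by (intro avg_subset_le set_integrable_abs_minus_const) auto
    also have "\<dots> \<le> C * \<beta>" using assms C0 by (intro mult_left_mono) (auto simp: bmob_def)
    finally show ?thesis .
  qed
  show 2: "\<bar>avg Q b - avg ?B b\<bar> \<le> C * \<beta>"
    using avg_dist_le[OF assms(3,5) intQ, of "avg ?B b"] 1 by simp
  have "avg Q (\<lambda>y. \<bar>b y - s\<bar>) \<le> avg Q (\<lambda>y. \<bar>b y - t\<bar> + C * \<beta>)" if "\<bar>s - t\<bar> \<le> C * \<beta>" for s t
    unfolding avg_def using that assms(3,5) intQ
    by (intro divide_right_mono set_integral_mono set_integral_add(1) set_integrable_abs_minus_const
        set_integrable_bounded_const) auto
  from this[OF 2] have "avg Q (\<lambda>y. \<bar>b y - avg Q b\<bar>) \<le> avg Q (\<lambda>y. \<bar>b y - avg ?B b\<bar> + C * \<beta>)" .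
  also have "\<dots> = avg Q (\<lambda>y. \<bar>b y - avg ?B b\<bar>) + C * \<beta>"
    using avg_minus_const[OF assms(3,5) set_integrable_abs_minus_const[OF assms(3,5) intQ, of "avg ?B b"], of "- (C * \<beta>)"]
    by simp
  finally show "avg Q (\<lambda>y. \<bar>b y - avg Q b\<bar>) \<le> 2 * C * \<beta>" using 1 by simp
qed

text \<open>Brings a signed integral into the subtraction-free form in which
  \<open>AE_le_of_cells\<close> takes its hypothesis.\<close>

lemma set_nn_integral_pos_neg_le:
  fixes g :: "'a::euclidean_space \<Rightarrow> real"
  assumes "set_integrable lborel Q g" "(LINT y:Q|lborel. g y) \<le> 0"
  shows "(\<integral>\<^sup>+y\<in>Q. ennreal (g y) \<partial>lborel) \<le> (\<integral>\<^sup>+y\<in>Q. ennreal (- g y) \<partial>lborel)"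
proof -
  let ?h = "\<lambda>y. indicator Q y *\<^sub>R g y"
  have int: "integrable lborel ?h" using assms(1) by (simp add: set_integrable_def)
  have eq: "(\<integral>\<^sup>+y\<in>Q. ennreal (g y) \<partial>lborel) = (\<integral>\<^sup>+y. ennreal (?h y) \<partial>lborel)"
    "(\<integral>\<^sup>+y\<in>Q. ennreal (- g y) \<partial>lborel) = (\<integral>\<^sup>+y. ennreal (- ?h y) \<partial>lborel)"
    by (auto intro!: nn_integral_cong simp: indicator_def)
  have fin: "(\<integral>\<^sup>+y. ennreal (?h y) \<partial>lborel) \<noteq> \<infinity>" "(\<integral>\<^sup>+y. ennreal (- ?h y) \<partial>lborel) \<noteq> \<infinity>"
    using int by (auto simp: real_integrable_def)
  have "enn2real (\<integral>\<^sup>+y. ennreal (?h y) \<partial>lborel) - enn2real (\<integral>\<^sup>+y. ennreal (- ?h y) \<partial>lborel) \<le> 0"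
    using assms(2) real_lebesgue_integral_def[OF int] by (simp add: set_lebesgue_integral_def)
  then show ?thesis unfolding eq using fin
    by (cases "\<integral>\<^sup>+y. ennreal (?h y) \<partial>lborel"; cases "\<integral>\<^sup>+y. ennreal (- ?h y) \<partial>lborel") auto
qed

text \<open>Volume of a ball of radius n L divided by that of a cell of side L, n being the
  dimension; such a ball centred in the cell contains it.\<close>

definition cellC :: "'a::euclidean_space itself \<Rightarrow> real" where
  "cellC _ = real DIM('a) ^ DIM('a) * measure lborel (ball (0::'a) 1)"

lemma measure_ball_cell:
  "0 < L \<Longrightarrow> measure lborel (ball (x::'a::euclidean_space) (real DIM('a) * L)) = cellC TYPE('a) * measure lborel (cell a L (z::'a))"
  by (simp add: measure_ball[of "real DIM('a) * L"] measure_cell cellC_def power_mult_distrib)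

lemma cellC_ge_1: "1 \<le> cellC TYPE('a::euclidean_space)"
proof -
  have "measure lborel (cell 0 1 (0::'a)) \<le> measure lborel (ball (0::'a) (real DIM('a) * 1))"
    using cell_subset_ball[of 1 0 "0::'a"] emeasure_lborel_ball_finite[of "0::'a" "real DIM('a)"]
    by (intro measure_mono_fmeasurable) (auto simp: fmeasurable_def)
  then show ?thesis using measure_ball_cell[of 1 "0::'a" 0 0] by (simp add: measure_cell)
qed

lemma measure_cell_pos: "0 < L \<Longrightarrow> 0 < measure lborel (cell a L (x::'a::euclidean_space))"
  by (simp add: measure_cell)

section \<open>Exponential integrability on dyadic cells\<close>

context
  fixes w b :: "'a::euclidean_space \<Rightarrow> real" and \<theta> A :: real
  assumes w: "ainf \<theta> A w" and \<theta>: "0 < \<theta>" and b: "bmob 1 b"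
begin

lemma cell_osc:
  assumes "0 < L"
  shows "avg (cell a L x) (\<lambda>y. \<bar>b y - avg (cell a L x) b\<bar>) \<le> 2 * cellC TYPE('a)"
  using bmob_osc(3)[OF b, of "cell a L x" x "real DIM('a) * L" "cellC TYPE('a)"] assms measure_ball_cell[of L x a x]
  by (simp add: cell_subset_ball measure_cell_pos)

lemma cell_bmo_integrable: "0 < L \<Longrightarrow> set_integrable lborel (cell a L x) b"
  using bmob_integrable[OF b cell_subset_ball[of L a x]] by simp

lemma cell_wmeas: "0 < L \<Longrightarrow> E \<subseteq> cell a L x \<Longrightarrow> ennreal (wmeas w E) = (\<integral>\<^sup>+y\<in>E. ennreal (w y) \<partial>lborel)"
  using ennreal_wmeas[OF ainf_wt[OF w], of E x "real DIM('a) * L"] cell_subset_ball[of L a x] by blast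

text \<open>The top cell does not stop, since its average is \<open>c\<close>. The parent of a
  stopping cell is therefore in the chain and has average within \<open>K\<close> of
  \<open>c\<close>; passing to the child costs at most 2^n times the mean oscillation on the
  parent.\<close>

lemma stopping_cell_jump:
  fixes a x0 L
  defines "c \<equiv> avg (cell a L x0) b"
  assumes L: "0 < L" and K: "0 \<le> K" and Q: "Q \<in> stops a L (\<lambda>Q. K < \<bar>avg Q b - c\<bar>) x0"
  shows "\<bar>avg Q b - c\<bar> \<le> K + 2 ^ DIM('a) * (2 * cellC TYPE('a))"
  using Q
proof (rule stopsE)
  fix k z assume kz: "Q = cell a (L / 2 ^ k) z" "z \<in> cell a L x0" "K < \<bar>avg Q b - c\<bar>"
    "\<And>j. j < k \<Longrightarrow> \<not> K < \<bar>avg (cell a (L / 2 ^ j) z) b - c\<bar>"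
  have "k \<noteq> 0"
  proof
    assume "k = 0"
    then have "Q = cell a L x0" using kz(1) cell_eq[OF kz(2)] by simp
    then show False using kz(3) K by (simp add: c_def)
  qed
  then obtain j where j: "k = Suc j" by (cases k) auto
  define R where "R = cell a (L / 2 ^ j) z"
  have L': "0 < L / 2 ^ j" "0 < L / 2 ^ k" using L by auto
  have R: "\<bar>avg R b - c\<bar> \<le> K" using kz(4)[of j] j by (simp add: R_def)
  have sub: "Q \<subseteq> R" using cell_antimono[OF L, of j k a z] j kz(1) by (simp add: R_def)
  have meas: "measure lborel R = 2 ^ DIM('a) * measure lborel Q"
    using L by (simp add: R_def kz(1) j measure_cell power_divide power_mult_distrib)
  have Qpos: "0 < measure lborel Q" "0 < measure lborel R"
    unfolding kz(1) R_def using L' by (auto intro: measure_cell_pos)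
  have intQ: "set_integrable lborel Q b" "set_integrable lborel R b"
    unfolding kz(1) R_def using L' by (auto intro: cell_bmo_integrable)
  have meas_Q: "Q \<in> sets borel" "R \<in> sets borel" by (auto simp: kz(1) R_def)
  have "\<bar>avg Q b - avg R b\<bar> \<le> avg Q (\<lambda>y. \<bar>b y - avg R b\<bar>)"
    using meas_Q Qpos intQ by (intro avg_dist_le)
  also have "\<dots> \<le> 2 ^ DIM('a) * avg R (\<lambda>y. \<bar>b y - avg R b\<bar>)"
    using meas_Q Qpos intQ sub meas by (intro avg_subset_le set_integrable_abs_minus_const) auto
  also have "\<dots> \<le> 2 ^ DIM('a) * (2 * cellC TYPE('a))"
    using cell_osc[OF L'(1), of a z] by (intro mult_left_mono) (auto simp: R_def)
  finally show ?thesis using R by linarith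
qed

text \<open>Calderon-Zygmund iteration as an induction on the truncation level \<open>N\<close>,
  which also keeps all integrals finite. On a stopping cell the average of \<open>b\<close> has
  moved by at most \<open>D\<close>, at the cost of one truncation level and a factor exp
  (\<epsilon> D) = 1 + c0 / 2, while the stopping cells carry at most the fraction 1 - c0 of the
  mass. The constant 4 / c0 reproduces itself because 2 + (1 + c0 / 2) (4 / c0) (1 - c0) = 4 / c0 -
  2 c0.\<close>

lemma cell_JN_trunc:
  fixes c0 D \<epsilon> :: real
  defines "c0 \<equiv> 1 / (2 * A * cellC TYPE('a)) powr (1 / \<theta>)"
    and "D \<equiv> 4 * cellC TYPE('a) + 2 ^ DIM('a) * (2 * cellC TYPE('a))"
  defines "\<epsilon> \<equiv> ln (1 + c0 / 2) / D"
  assumes "0 < L"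
  shows "(\<integral>\<^sup>+y\<in>cell a L x. ennreal (exp (min (\<epsilon> * \<bar>b y - avg (cell a L x) b\<bar>) (real N * (\<epsilon> * D))) * w y) \<partial>lborel)
    \<le> ennreal (4 / c0 * wmeas w (cell a L x))"
  using \<open>0 < L\<close>
proof (induction N arbitrary: L x)
  note [measurable] = wtD(2)[OF ainf_wt[OF w]]
  have b_meas [measurable]: "b \<in> borel_measurable borel" using b by (simp add: bmob_def)
  have wnn: "0 \<le> w y" for y using wtD(1)[OF ainf_wt[OF w]] by simp
  define C1 where "C1 = cellC TYPE('a)"
  have C1: "1 \<le> C1" by (simp add: C1_def cellC_ge_1)
  have A: "1 \<le> A" using ainf_ge_1[OF w] .
  have AC: "1 \<le> 2 * A * C1" using mult_mono[of 1 A 1 C1] A C1 by simp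
  have c0: "0 < c0" "c0 \<le> 1"
    unfolding c0_def C1_def[symmetric] using AC \<theta> ge_one_powr_ge_zero[of "2 * A * C1" "1 / \<theta>"]
    by (auto simp: divide_le_eq)
  have D: "4 * C1 \<le> D" "0 < D" using C1 by (auto simp: D_def C1_def add_pos_pos)
  have eD: "exp (\<epsilon> * D) = 1 + c0 / 2" using D c0 by (simp add: \<epsilon>_def)
  have \<epsilon>: "0 < \<epsilon>" using c0 D by (simp add: \<epsilon>_def)
  {
    case 0
    have "ennreal (wmeas w (cell a L x)) \<le> ennreal (4 / c0 * wmeas w (cell a L x))"
      using c0 mult_right_mono[of c0 4 "wmeas w (cell a L x)"] by (intro ennreal_leI) (auto simp: field_simps)
    moreover have "min (\<epsilon> * \<bar>t\<bar>) 0 = 0" for t using \<epsilon> by (intro min_absorb2) auto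
    ultimately show ?case using cell_wmeas[OF 0 subset_refl, of a x] by simp
  next
    case (Suc N)
    note L = Suc.prems
    define Q0 where "Q0 = cell a L x"
    define c where "c = avg Q0 b"
    define P where "P Q \<longleftrightarrow> 4 * C1 < \<bar>avg Q b - c\<bar>" for Q
    define S where "S = stops a L P x"
    define V where "V = \<Union>S"
    define F where "F y = exp (min (\<epsilon> * \<bar>b y - c\<bar>) (real (Suc N) * (\<epsilon> * D)))" for y
    have F_meas [measurable]: "F \<in> borel_measurable borel" unfolding F_def by measurable
    have Q0_meas [measurable]: "Q0 \<in> sets borel" by (simp add: Q0_def)
    have Q0_sub: "Q0 \<subseteq> ball x (real DIM('a) * L)" unfolding Q0_def using L by (rule cell_subset_ball)
    have Q0_pos: "0 < measure lborel Q0" unfolding Q0_def using L by (rule measure_cell_pos)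
    have Q0_int: "set_integrable lborel Q0 b" unfolding Q0_def using L by (rule cell_bmo_integrable)
    have S: "countable S" "disjoint S" "S \<subseteq> sets borel"
      unfolding S_def using countable_stops disjoint_stops[OF L] stops_borel by auto
    have V_meas [measurable]: "V \<in> sets borel" unfolding V_def using S by (intro sets.countable_Union) auto
    have S_sub: "Q \<subseteq> Q0" if "Q \<in> S" for Q
      using stops_subset[OF L that[unfolded S_def]] by (simp add: Q0_def)
    have VQ: "V \<subseteq> Q0" unfolding V_def using S_sub by blast
    have SP: "P Q" if "Q \<in> S" for Q using that unfolding S_def by (rule stopsE)
    have S_cell: "\<exists>k z. Q = cell a (L / 2 ^ k) z" if "Q \<in> S" for Q
      using that unfolding S_def by (rule stopsE) auto
    have S_pos: "0 < measure lborel Q" and S_int: "set_integrable lborel Q b" if "Q \<in> S" for Q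
      using S_cell[OF that] L by (auto intro!: measure_cell_pos cell_bmo_integrable)
    have w_eq: "(\<integral>\<^sup>+y\<in>E. ennreal (w y) \<partial>lborel) = ennreal (wmeas w E)" if "E \<subseteq> Q0" for E
      using cell_wmeas[OF L, of E a x] that by (simp add: Q0_def)
    have finite_Q0: "emeasure lborel X \<noteq> \<infinity>" if "X \<subseteq> Q0" for X
      using emeasure_mono[OF subset_trans[OF that Q0_sub], of lborel] emeasure_lborel_ball_finite[of x "real DIM('a) * L"]
      by (auto simp: top_unique)

    \<comment> \<open>The threshold 4 C1 is twice the bound 2 C1 for the mean oscillation on a cell,
      so the stopping cells fill at most half of \<open>Q0\<close>.\<close>
    have "measure lborel V \<le> measure lborel Q0 / 2"
    proof -
      have "(\<integral>\<^sup>+y\<in>V. ennreal (4 * C1) \<partial>lborel) \<le> 1 * (\<integral>\<^sup>+y\<in>V. ennreal \<bar>b y - c\<bar> \<partial>lborel)"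
        unfolding V_def
      proof (rule nn_integral_Union_le[OF S])
        fix Q assume Q: "Q \<in> S"
        have "4 * C1 \<le> \<bar>avg Q b - c\<bar>" using SP[OF Q] by (simp add: P_def)
        also have "\<dots> \<le> avg Q (\<lambda>y. \<bar>b y - c\<bar>)" using Q S S_pos S_int by (intro avg_dist_le) auto
        finally have *: "4 * C1 \<le> avg Q (\<lambda>y. \<bar>b y - c\<bar>)" .
        have "(\<integral>\<^sup>+y\<in>Q. ennreal (4 * C1) \<partial>lborel) = ennreal (4 * C1) * emeasure lborel Q"
          using S Q by (subst nn_integral_cmult) auto
        also have "\<dots> = ennreal (4 * C1 * measure lborel Q)"
          using finite_Q0[OF S_sub[OF Q]] C1 by (simp add: emeasure_eq_ennreal_measure ennreal_mult)
        also have "\<dots> \<le> ennreal (avg Q (\<lambda>y. \<bar>b y - c\<bar>) * measure lborel Q)"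
          using * by (intro ennreal_leI mult_right_mono) auto
        also have "\<dots> = (\<integral>\<^sup>+y\<in>Q. ennreal \<bar>b y - c\<bar> \<partial>lborel)"
          using Q S S_pos S_int by (subst set_nn_integral_avg) (auto intro!: set_integrable_abs_minus_const)
        finally show "(\<integral>\<^sup>+y\<in>Q. ennreal (4 * C1) \<partial>lborel) \<le> 1 * (\<integral>\<^sup>+y\<in>Q. ennreal \<bar>b y - c\<bar> \<partial>lborel)" by simp
      qed auto
      also have "\<dots> \<le> (\<integral>\<^sup>+y\<in>Q0. ennreal \<bar>b y - c\<bar> \<partial>lborel)"
        using set_nn_integral_mono_set[OF VQ, of lborel "\<lambda>y. ennreal \<bar>b y - c\<bar>"] by simp
      also have "\<dots> = ennreal (avg Q0 (\<lambda>y. \<bar>b y - c\<bar>) * measure lborel Q0)"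
        using Q0_int Q0_pos by (subst set_nn_integral_avg) (auto intro!: set_integrable_abs_minus_const)
      also have "\<dots> \<le> ennreal (2 * C1 * measure lborel Q0)"
        using cell_osc[OF L, of a x] by (intro ennreal_leI mult_right_mono) (auto simp: Q0_def c_def C1_def)
      finally have "ennreal (4 * C1) * emeasure lborel V \<le> ennreal (2 * C1 * measure lborel Q0)"
        by (subst (asm) nn_integral_cmult) auto
      then have "ennreal (4 * C1 * measure lborel V) \<le> ennreal (2 * C1 * measure lborel Q0)"
        using finite_Q0[OF VQ] C1 by (simp add: emeasure_eq_ennreal_measure ennreal_mult)
      then show ?thesis using C1 Q0_pos by (simp add: ennreal_le_iff)
    qed
    moreover have "measure lborel (Q0 - V) = measure lborel Q0 - measure lborel V"
      using VQ finite_Q0[of Q0] by (intro measure_Diff) auto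
    \<comment> \<open>The unstopped part has at least half of the cell, hence the fraction 1 / (2
      C1) of the circumscribed ball; this is the origin of \<open>c0\<close>.\<close>
    ultimately have "1 / (2 * C1) * measure lborel (ball x (real DIM('a) * L)) \<le> measure lborel (Q0 - V)"
      using C1 L by (simp add: measure_ball_cell[of L x a x] C1_def[symmetric] Q0_def[symmetric])
    then have "wmeas w (ball x (real DIM('a) * L)) \<le> (A / (1 / (2 * C1))) powr (1 / \<theta>) * wmeas w (Q0 - V)"
      using C1 L Q0_sub by (intro ainf_le[OF w \<theta>]) auto
    moreover have "wmeas w Q0 \<le> wmeas w (ball x (real DIM('a) * L))"
      using wmeas_mono[OF ainf_wt[OF w] Q0_sub subset_refl] .
    ultimately have "wmeas w Q0 \<le> wmeas w (Q0 - V) / c0"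
      by (simp add: c0_def C1_def[symmetric] mult_ac)
    then have "c0 * wmeas w Q0 \<le> wmeas w (Q0 - V)" using c0 by (simp add: field_simps)
    moreover have "wmeas w Q0 = wmeas w V + wmeas w (Q0 - V)"
      using Q0_sub VQ by (intro wmeas_Diff[OF ainf_wt[OF w]]) auto
    ultimately have wV: "wmeas w V \<le> (1 - c0) * wmeas w Q0" by (simp add: algebra_simps)

    \<comment> \<open>At an unstopped point all cell averages stay within 4 C1 of \<open>c\<close>;
      the differentiation substitute, applied to b - c - 4 C1 and to c - b - 4 C1, carries this over
      to \<open>b\<close> almost everywhere.\<close>
    have good: "AE y in lborel. y \<in> Q0 - V \<longrightarrow> \<bar>b y - c\<bar> \<le> 4 * C1"
    proof -
      have unstopped: "\<bar>avg (cell a (L / 2 ^ k) z) b - c\<bar> \<le> 4 * C1" if "z \<in> Q0 - V" for k z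
        by (rule ccontr) (use mem_Union_stops[of z a L x P k] that in \<open>auto simp: V_def S_def Q0_def P_def not_le\<close>)
      have L': "0 < L / 2 ^ k" for k :: nat using L by simp
      have 1: "AE y in lborel. y \<in> Q0 - V \<longrightarrow> s * (b y - c) - 4 * C1 \<le> 0" if s: "s = 1 \<or> s = -1" for s
      proof (rule AE_le_of_cells[OF L])
        have int: "set_integrable lborel Q (\<lambda>y. s * (b y - c) - 4 * C1)"
          if "set_integrable lborel Q b" "Q \<in> sets borel" "0 < measure lborel Q" for Q
          using that by (intro set_integrable_minus_const set_integrable_mult_right) auto
        show "(\<lambda>y. s * (b y - c) - 4 * C1) \<in> borel_measurable borel" by measurable
        show "Q0 - V \<in> sets borel" by measurable
        show "Q0 - V \<subseteq> cell a L x" by (auto simp: Q0_def)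
        have "(\<integral>\<^sup>+y\<in>Q0. ennreal \<bar>s * (b y - c) - 4 * C1\<bar> \<partial>lborel)
            = ennreal (LINT y:Q0|lborel. \<bar>s * (b y - c) - 4 * C1\<bar>)"
          using set_integrable_abs[OF int[OF Q0_int Q0_meas Q0_pos]] by (intro set_nn_integral_eq) auto
        then show "(\<integral>\<^sup>+y\<in>cell a L x. ennreal \<bar>s * (b y - c) - 4 * C1\<bar> \<partial>lborel) < \<infinity>"
          by (simp add: Q0_def)
        fix z k assume z: "z \<in> Q0 - V"
        let ?Q = "cell a (L / 2 ^ k) z"
        have *: "set_integrable lborel ?Q b" "?Q \<in> sets borel" "0 < measure lborel ?Q"
          using L' by (auto intro: cell_bmo_integrable measure_cell_pos)
        show "(\<integral>\<^sup>+y\<in>?Q. ennreal (s * (b y - c) - 4 * C1) \<partial>lborel) \<le> (\<integral>\<^sup>+y\<in>?Q. ennreal (- (s * (b y - c) - 4 * C1)) \<partial>lborel)"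
        proof (rule set_nn_integral_pos_neg_le[OF int[OF *]])
          have "avg ?Q (\<lambda>y. s * (b y - c) - 4 * C1) = avg ?Q (\<lambda>y. s * (b y - c)) - 4 * C1"
            using * by (intro avg_minus_const set_integrable_mult_right set_integrable_minus_const) auto
          also have "avg ?Q (\<lambda>y. s * (b y - c)) = s * avg ?Q (\<lambda>y. b y - c)" by (simp add: avg_def)
          also have "avg ?Q (\<lambda>y. b y - c) = avg ?Q b - c" using * by (intro avg_minus_const)
          finally have "avg ?Q (\<lambda>y. s * (b y - c) - 4 * C1) \<le> 0"
            using unstopped[OF z, of k] s by auto
          then show "(LINT y:?Q|lborel. s * (b y - c) - 4 * C1) \<le> 0"
            using *(3) by (simp add: avg_def divide_le_0_iff)
        qed
      qed
      show ?thesis using 1[OF disjI1[OF refl]] 1[OF disjI2[OF refl]] by eventually_elim auto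
    qed

    \<comment> \<open>The induction hypothesis is applied on each stopping cell with the average
      over that cell as the new centre.\<close>
    have bad: "(\<integral>\<^sup>+y\<in>V. ennreal (F y * w y) \<partial>lborel) \<le> ennreal ((1 + c0 / 2) * (4 / c0)) * (\<integral>\<^sup>+y\<in>V. ennreal (w y) \<partial>lborel)"
      unfolding V_def
    proof (rule nn_integral_Union_le[OF S])
      fix Q assume Q: "Q \<in> S"
      then obtain k z where Qeq: "Q = cell a (L / 2 ^ k) z" using S_cell by blast
      have jump: "\<bar>avg Q b - c\<bar> \<le> D"
        using stopping_cell_jump[OF L, of "4 * C1" Q a x] Q C1
        by (simp add: S_def P_def[abs_def] c_def Q0_def D_def C1_def)
      have "F y \<le> (1 + c0 / 2) * exp (min (\<epsilon> * \<bar>b y - avg Q b\<bar>) (real N * (\<epsilon> * D)))" for y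
      proof -
        have "\<epsilon> * \<bar>b y - c\<bar> \<le> \<epsilon> * (D + \<bar>b y - avg Q b\<bar>)" using jump \<epsilon> by (intro mult_left_mono) auto
        then have "min (\<epsilon> * \<bar>b y - c\<bar>) (real (Suc N) * (\<epsilon> * D)) \<le> \<epsilon> * D + min (\<epsilon> * \<bar>b y - avg Q b\<bar>) (real N * (\<epsilon> * D))"
          by (auto simp: min_def algebra_simps)
        then have "F y \<le> exp (\<epsilon> * D + min (\<epsilon> * \<bar>b y - avg Q b\<bar>) (real N * (\<epsilon> * D)))" by (simp add: F_def)
        then show ?thesis by (simp add: exp_add eD)
      qed
      then have "F y * w y \<le> (1 + c0 / 2) * (exp (min (\<epsilon> * \<bar>b y - avg Q b\<bar>) (real N * (\<epsilon> * D))) * w y)" for y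
        unfolding mult.assoc[symmetric] using wnn by (rule mult_right_mono)
      from ennreal_leI[OF this]
      have "ennreal (F y * w y) \<le> ennreal (1 + c0 / 2) * ennreal (exp (min (\<epsilon> * \<bar>b y - avg Q b\<bar>) (real N * (\<epsilon> * D))) * w y)" for y
        using wnn c0 by (subst ennreal_mult[symmetric]) auto
      then have "(\<integral>\<^sup>+y\<in>Q. ennreal (F y * w y) \<partial>lborel)
          \<le> (\<integral>\<^sup>+y. ennreal (1 + c0 / 2) * (ennreal (exp (min (\<epsilon> * \<bar>b y - avg Q b\<bar>) (real N * (\<epsilon> * D))) * w y) * indicator Q y) \<partial>lborel)"
        by (intro nn_integral_mono) (auto simp: indicator_def)
      also have "\<dots> = ennreal (1 + c0 / 2) * (\<integral>\<^sup>+y\<in>Q. ennreal (exp (min (\<epsilon> * \<bar>b y - avg Q b\<bar>) (real N * (\<epsilon> * D))) * w y) \<partial>lborel)"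
        using S Q by (intro nn_integral_cmult) auto
      also have "\<dots> \<le> ennreal (1 + c0 / 2) * ennreal (4 / c0 * wmeas w Q)"
        using Suc.IH[of "L / 2 ^ k" z] L by (intro mult_left_mono) (auto simp: Qeq)
      also have "\<dots> = ennreal ((1 + c0 / 2) * (4 / c0)) * ennreal (wmeas w Q)"
        using c0 by (subst (1 2) ennreal_mult[symmetric]) (auto simp: mult.assoc)
      also have "ennreal (wmeas w Q) = (\<integral>\<^sup>+y\<in>Q. ennreal (w y) \<partial>lborel)"
        using w_eq[OF S_sub[OF Q]] by simp
      finally show "(\<integral>\<^sup>+y\<in>Q. ennreal (F y * w y) \<partial>lborel) \<le> ennreal ((1 + c0 / 2) * (4 / c0)) * (\<integral>\<^sup>+y\<in>Q. ennreal (w y) \<partial>lborel)" .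
    qed auto

    have "(\<integral>\<^sup>+y\<in>Q0. ennreal (F y * w y) \<partial>lborel)
        = (\<integral>\<^sup>+y. ennreal (F y * w y) * indicator (Q0 - V) y + ennreal (F y * w y) * indicator V y \<partial>lborel)"
      using VQ by (intro nn_integral_cong) (auto simp: indicator_def)
    also have "\<dots> = (\<integral>\<^sup>+y\<in>Q0 - V. ennreal (F y * w y) \<partial>lborel) + (\<integral>\<^sup>+y\<in>V. ennreal (F y * w y) \<partial>lborel)"
      by (intro nn_integral_add) auto
    also have "(\<integral>\<^sup>+y\<in>Q0 - V. ennreal (F y * w y) \<partial>lborel) \<le> (\<integral>\<^sup>+y\<in>Q0. ennreal (2 * w y) \<partial>lborel)"
    proof (rule nn_integral_mono_AE)
      show "AE y in lborel. ennreal (F y * w y) * indicator (Q0 - V) y \<le> ennreal (2 * w y) * indicator Q0 y"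
        using good
      proof eventually_elim
        case (elim y)
        have "F y \<le> 2" if "y \<in> Q0 - V"
        proof -
          have "min (\<epsilon> * \<bar>b y - c\<bar>) (real (Suc N) * (\<epsilon> * D)) \<le> \<epsilon> * D"
            using elim that D \<epsilon> by (intro min.coboundedI1 mult_left_mono) auto
          then have "F y \<le> exp (\<epsilon> * D)" by (simp add: F_def)
          then show ?thesis using eD c0 by simp
        qed
        then show ?case using wnn[of y] by (auto simp: indicator_def intro!: ennreal_leI mult_right_mono)
      qed
    qed
    also have "\<dots> = 2 * ennreal (wmeas w Q0)"
      using w_eq[OF subset_refl] by (simp add: ennreal_mult wnn mult.assoc nn_integral_cmult)
    also have "\<dots> + (\<integral>\<^sup>+y\<in>V. ennreal (F y * w y) \<partial>lborel)
        \<le> 2 * ennreal (wmeas w Q0) + ennreal ((1 + c0 / 2) * (4 / c0)) * ennreal ((1 - c0) * wmeas w Q0)"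
      using bad w_eq[OF VQ] wV by (intro add_left_mono order_trans[OF bad] mult_left_mono) (auto intro!: ennreal_leI)
    also have "\<dots> = ennreal (2 * wmeas w Q0 + (1 + c0 / 2) * (4 / c0) * ((1 - c0) * wmeas w Q0))"
    proof -
      have "2 * ennreal (wmeas w Q0) = ennreal (2 * wmeas w Q0)" by (simp add: ennreal_mult)
      moreover have "ennreal ((1 + c0 / 2) * (4 / c0)) * ennreal ((1 - c0) * wmeas w Q0)
          = ennreal ((1 + c0 / 2) * (4 / c0) * ((1 - c0) * wmeas w Q0))"
        using c0 by (intro ennreal_mult[symmetric]) auto
      ultimately show ?thesis using c0 by (subst ennreal_plus) auto
    qed
    also have "\<dots> \<le> ennreal (4 / c0 * wmeas w Q0)"
    proof (rule ennreal_leI)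
      have "2 + (1 + c0 / 2) * (4 / c0) * (1 - c0) = 4 / c0 - 2 * c0"
        using c0 by (simp add: field_simps)
      then have le: "2 + (1 + c0 / 2) * (4 / c0) * (1 - c0) \<le> 4 / c0" using c0 by simp
      have arith: "(2 + K * Z) * W = 2 * W + K * (Z * W)" for K Z W :: real by (simp add: algebra_simps)
      from mult_right_mono[OF le, of "wmeas w Q0"]
      show "2 * wmeas w Q0 + (1 + c0 / 2) * (4 / c0) * ((1 - c0) * wmeas w Q0) \<le> 4 / c0 * wmeas w Q0"
        unfolding arith by simp
    qed
    finally show ?case by (simp add: add_right_mono Q0_def F_def c_def)
  }
qed

end

text \<open>Monotone convergence removes the truncation, the bound being uniform in N.\<close>

lemma nn_integral_exp_min_limit:
  fixes t w :: "'a::euclidean_space \<Rightarrow> real"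
  assumes [measurable]: "t \<in> borel_measurable borel" "w \<in> borel_measurable borel" "Q \<in> sets borel"
    and "\<And>y. 0 \<le> w y" "0 < d"
    and "\<And>N. (\<integral>\<^sup>+y\<in>Q. ennreal (exp (min (t y) (real N * d)) * w y) \<partial>lborel) \<le> K"
  shows "(\<integral>\<^sup>+y\<in>Q. ennreal (exp (t y) * w y) \<partial>lborel) \<le> K"
proof -
  define f where "f N y = ennreal (exp (min (t y) (real N * d)) * w y) * indicator Q y" for N y
  have "(\<integral>\<^sup>+y\<in>Q. ennreal (exp (t y) * w y) \<partial>lborel) \<le> (\<integral>\<^sup>+y. (SUP N. f N y) \<partial>lborel)"
  proof (intro nn_integral_mono)
    fix y
    obtain N where "t y / d < real N" using reals_Archimedean2 by blast
    then have "min (t y) (real N * d) = t y" using assms(5) by (simp add: min_def field_simps)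
    then have "ennreal (exp (t y) * w y) * indicator Q y = f N y" by (simp add: f_def)
    also have "\<dots> \<le> (SUP N. f N y)" by (rule SUP_upper) simp
    finally show "ennreal (exp (t y) * w y) * indicator Q y \<le> (SUP N. f N y)" .
  qed
  also have "\<dots> = (SUP N. \<integral>\<^sup>+y. f N y \<partial>lborel)"
  proof (rule nn_integral_monotone_convergence_SUP)
    have "min (t y) (real M * d) \<le> min (t y) (real N * d)" if "M \<le> N" for M N y
      using that assms(5) by (intro min.mono mult_right_mono) auto
    then show "incseq f" unfolding f_def incseq_def le_fun_def
      using assms(4) by (auto intro!: mult_right_mono ennreal_leI)
  qed (unfold f_def, measurable)
  also have "\<dots> \<le> K" using assms(6) by (intro SUP_least) (simp add: f_def)
  finally show ?thesis .
qed

text \<open>A ball of radius r lies in a cell of side 2 r, and this in a ball of radius 2 n r.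
  \<open>E\<close> bounds the distance between the averages over the ball and the cell,
  \<open>K\<close> the loss in passing from the mass of the cell back to that of the ball.\<close>

lemma weighted_John_Nirenberg_unit:
  fixes \<theta> A :: real
  assumes \<theta>: "0 < \<theta>"
  shows "\<exists>c C. 0 < c \<and> 0 < C \<and> (\<forall>(w::'a::euclidean_space \<Rightarrow> real) b x r. ainf \<theta> A w \<longrightarrow> bmob 1 b \<longrightarrow> 0 < r \<longrightarrow>
    (\<integral>\<^sup>+y\<in>ball x r. ennreal (exp (c * \<bar>b y - avg (ball x r) b\<bar>) * w y) \<partial>lborel) \<le> ennreal (C * wmeas w (ball x r)))"
proof (cases "1 \<le> A")
  case False
  then show ?thesis using ainf_ge_1 by (intro exI[of _ 1]) (auto simp: not_le dest!: ainf_ge_1)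
next
  case A: True
  define C1 where "C1 = cellC TYPE('a)"
  define n where "n = real DIM('a)"
  define c0 where "c0 = 1 / (2 * A * C1) powr (1 / \<theta>)"
  define D where "D = 4 * C1 + 2 ^ DIM('a) * (2 * C1)"
  define \<epsilon> where "\<epsilon> = ln (1 + c0 / 2) / D"
  define E where "E = (2 * n) ^ DIM('a) + C1"
  define K where "K = (A * (2 * n) ^ DIM('a)) powr (1 / \<theta>)"
  have C1: "1 \<le> C1" by (simp add: C1_def cellC_ge_1)
  have n: "1 \<le> n" unfolding n_def using DIM_positive[where 'a='a] by linarith
  have c0: "0 < c0" using A C1 by (simp add: c0_def)
  have D: "0 < D" using C1 by (simp add: D_def add_pos_pos)
  have \<epsilon>: "0 < \<epsilon>" using c0 D by (simp add: \<epsilon>_def)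
  have K: "0 < K" using A n by (simp add: K_def)
  show ?thesis
  proof (rule exI[of _ \<epsilon>], rule exI[of _ "exp (\<epsilon> * E) * (4 / c0) * K"], intro conjI allI impI)
    fix w b :: "'a \<Rightarrow> real" and x :: 'a and r :: real
    assume w: "ainf \<theta> A w" and b: "bmob 1 b" and r: "0 < r"
    note [measurable] = wtD(2)[OF ainf_wt[OF w]]
    have [measurable]: "b \<in> borel_measurable borel" using b by (simp add: bmob_def)
    have wnn: "0 \<le> w y" for y using wtD(1)[OF ainf_wt[OF w]] by simp
    define a where "a = x - r *\<^sub>R One"
    define Q where "Q = cell a (2 * r) x"
    define B where "B = ball x r"
    define B' where "B' = ball x (n * (2 * r))"
    have BQ: "B \<subseteq> Q" unfolding B_def Q_def a_def using r by (rule ball_subset_cell)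
    have QB': "Q \<subseteq> B'" unfolding B'_def Q_def n_def using r by (intro cell_subset_ball) auto
    have nr: "0 < n * (2 * r)" using n r by simp
    have "\<bar>avg B b - avg B' b\<bar> \<le> (2 * n) ^ DIM('a) * 1"
      unfolding B'_def
    proof (rule bmob_osc(2)[OF b])
      show "B \<subseteq> ball x (n * (2 * r))" using BQ QB' by (simp add: B'_def)
      show "measure lborel (ball x (n * (2 * r))) \<le> (2 * n) ^ DIM('a) * measure lborel B"
        unfolding B_def using r nr by (simp add: measure_ball[of "n * (2 * r)"] measure_ball[of r] power_mult_distrib)
    qed (use r nr in \<open>auto simp: B_def measure_ball_pos\<close>)
    moreover have "\<bar>avg Q b - avg B' b\<bar> \<le> C1 * 1"
      unfolding B'_def
    proof (rule bmob_osc(2)[OF b])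
      show "Q \<subseteq> ball x (n * (2 * r))" using QB' by (simp add: B'_def)
      show "measure lborel (ball x (n * (2 * r))) \<le> C1 * measure lborel Q"
        unfolding Q_def C1_def n_def using r by (subst measure_ball_cell) auto
    qed (use r nr in \<open>auto simp: Q_def measure_cell_pos\<close>)
    ultimately have avgs: "\<bar>avg B b - avg Q b\<bar> \<le> E" by (simp add: E_def)
    have JN: "(\<integral>\<^sup>+y\<in>Q. ennreal (exp (\<epsilon> * \<bar>b y - avg Q b\<bar>) * w y) \<partial>lborel) \<le> ennreal (4 / c0 * wmeas w Q)"
    proof (rule nn_integral_exp_min_limit[where d="\<epsilon> * D"])
      show "(\<integral>\<^sup>+y\<in>Q. ennreal (exp (min (\<epsilon> * \<bar>b y - avg Q b\<bar>) (real N * (\<epsilon> * D))) * w y) \<partial>lborel)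
          \<le> ennreal (4 / c0 * wmeas w Q)" for N
        using cell_JN_trunc[OF w \<theta> b, of "2 * r" a x N] r
        by (simp add: Q_def c0_def D_def \<epsilon>_def C1_def)
    qed (use \<epsilon> D wnn in \<open>auto simp: Q_def\<close>)
    have "ennreal (exp (\<epsilon> * \<bar>b y - avg B b\<bar>) * w y) \<le> ennreal (exp (\<epsilon> * E)) * ennreal (exp (\<epsilon> * \<bar>b y - avg Q b\<bar>) * w y)" for y
    proof -
      have "\<epsilon> * \<bar>b y - avg B b\<bar> \<le> \<epsilon> * (E + \<bar>b y - avg Q b\<bar>)"
        using avgs \<epsilon> by (intro mult_left_mono) auto
      then have "exp (\<epsilon> * \<bar>b y - avg B b\<bar>) \<le> exp (\<epsilon> * E) * exp (\<epsilon> * \<bar>b y - avg Q b\<bar>)"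
        by (simp add: exp_add[symmetric] distrib_left)
      from mult_right_mono[OF this wnn[of y]] show ?thesis
        using wnn[of y] by (subst ennreal_mult[symmetric]) (auto intro!: ennreal_leI simp: mult.assoc)
    qed
    then have "(\<integral>\<^sup>+y\<in>B. ennreal (exp (\<epsilon> * \<bar>b y - avg B b\<bar>) * w y) \<partial>lborel)
        \<le> (\<integral>\<^sup>+y. ennreal (exp (\<epsilon> * E)) * (ennreal (exp (\<epsilon> * \<bar>b y - avg Q b\<bar>) * w y) * indicator Q y) \<partial>lborel)"
      using BQ by (intro nn_integral_mono) (auto simp: indicator_def)
    also have "\<dots> = ennreal (exp (\<epsilon> * E)) * (\<integral>\<^sup>+y\<in>Q. ennreal (exp (\<epsilon> * \<bar>b y - avg Q b\<bar>) * w y) \<partial>lborel)"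
      unfolding Q_def by (intro nn_integral_cmult) auto
    also have "\<dots> \<le> ennreal (exp (\<epsilon> * E)) * ennreal (4 / c0 * wmeas w Q)"
      using JN by (intro mult_left_mono) auto
    also have "\<dots> = ennreal (exp (\<epsilon> * E) * (4 / c0) * wmeas w Q)"
      using c0 by (subst ennreal_mult[symmetric]) (auto simp: mult.assoc)
    also have "\<dots> \<le> ennreal (exp (\<epsilon> * E) * (4 / c0) * K * wmeas w B)"
    proof (rule ennreal_leI)
      have "wmeas w Q \<le> wmeas w (ball x (n * 2 * r))"
        using wmeas_mono[OF ainf_wt[OF w] QB', of x "n * (2 * r)"] by (simp add: B'_def mult.assoc)
      also have "\<dots> \<le> (A * (n * 2) ^ DIM('a)) powr (1 / \<theta>) * wmeas w (ball x r)"
        using n r BQ QB' by (intro ainf_doubling[OF w \<theta>]) (auto simp: B_def B'_def mult.assoc)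
      finally have "wmeas w Q \<le> K * wmeas w B" by (simp add: K_def B_def mult_ac)
      then show "exp (\<epsilon> * E) * (4 / c0) * wmeas w Q \<le> exp (\<epsilon> * E) * (4 / c0) * K * wmeas w B"
        using c0 unfolding mult.assoc by (intro mult_left_mono) auto
    qed
    finally show "(\<integral>\<^sup>+y\<in>ball x r. ennreal (exp (\<epsilon> * \<bar>b y - avg (ball x r) b\<bar>) * w y) \<partial>lborel)
        \<le> ennreal (exp (\<epsilon> * E) * (4 / c0) * K * wmeas w (ball x r))" by (simp add: B_def)
  qed (use \<epsilon> c0 K in auto)
qed

lemma bmob_scale:
  assumes "bmob \<beta> b" "0 < \<beta>"
  shows "bmob 1 (\<lambda>x. b x / \<beta>)"
proof -
  have avg_scale: "avg B (\<lambda>x. g x / \<beta>) = avg B g / \<beta>" for B and g :: "'a \<Rightarrow> real"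
    by (simp add: avg_def)
  have "avg (ball x r) (\<lambda>y. \<bar>b y / \<beta> - avg (ball x r) b / \<beta>\<bar>) \<le> 1" if "0 < r" for x r
  proof -
    have eq: "\<bar>b y / \<beta> - c / \<beta>\<bar> = \<bar>b y - c\<bar> / \<beta>" for y c
      using assms(2) by (simp add: diff_divide_distrib[symmetric])
    show ?thesis unfolding eq avg_scale using assms that by (auto simp: bmob_def divide_le_eq)
  qed
  then show ?thesis using assms by (auto simp: bmob_def avg_scale)
qed

text \<open>Scaling of \<open>b\<close> by 1 / \<beta>. Only an upper bound on s matters, since the
  exponential increases with s; s = 0 is used below for factors without \<open>b\<close>. The
  constants depend on \<open>\<theta>\<close> and \<open>A\<close> only.\<close>

theorem weighted_John_Nirenberg:
  fixes \<theta> A :: real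
  assumes \<theta>: "0 < \<theta>"
  shows "\<exists>c C. 0 < c \<and> 0 < C \<and> (\<forall>(w::'a::euclidean_space \<Rightarrow> real) b \<beta> s x r. ainf \<theta> A w \<longrightarrow> bmob \<beta> b \<longrightarrow> 0 < \<beta> \<longrightarrow>
    s * \<beta> \<le> c \<longrightarrow> 0 < r \<longrightarrow>
    (\<integral>\<^sup>+y\<in>ball x r. ennreal (exp (s * \<bar>b y - avg (ball x r) b\<bar>) * w y) \<partial>lborel) \<le> ennreal (C * wmeas w (ball x r)))"
proof -
  obtain c C where c: "0 < c" "0 < C" and *: "\<And>(w::'a \<Rightarrow> real) b x r. ainf \<theta> A w \<Longrightarrow> bmob 1 b \<Longrightarrow> 0 < r \<Longrightarrow>
    (\<integral>\<^sup>+y\<in>ball x r. ennreal (exp (c * \<bar>b y - avg (ball x r) b\<bar>) * w y) \<partial>lborel) \<le> ennreal (C * wmeas w (ball x r))"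
    using weighted_John_Nirenberg_unit[OF \<theta>, of A, where 'a='a] by blast
  have "(\<integral>\<^sup>+y\<in>ball x r. ennreal (exp (s * \<bar>b y - avg (ball x r) b\<bar>) * w y) \<partial>lborel) \<le> ennreal (C * wmeas w (ball x r))"
    if w: "ainf \<theta> A w" "bmob \<beta> b" "0 < \<beta>" "s * \<beta> \<le> c" "0 < r" for w b :: "'a \<Rightarrow> real" and \<beta> s x r
  proof -
    have "avg (ball x r) (\<lambda>x. b x / \<beta>) = avg (ball x r) b / \<beta>" by (simp add: avg_def)
    then have eq: "c * \<bar>b y / \<beta> - avg (ball x r) (\<lambda>x. b x / \<beta>)\<bar> = c / \<beta> * \<bar>b y - avg (ball x r) b\<bar>" for y
      using w(3) by (simp add: diff_divide_distrib[symmetric])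
    have "s \<le> c / \<beta>" using w by (simp add: field_simps)
    then have "exp (s * \<bar>b y - avg (ball x r) b\<bar>) * w y \<le> exp (c / \<beta> * \<bar>b y - avg (ball x r) b\<bar>) * w y" for y
      using wtD(1)[OF ainf_wt[OF w(1)], of y] mult_right_mono[OF \<open>s \<le> c / \<beta>\<close> abs_ge_zero, of "b y - avg (ball x r) b"]
      by (intro mult_right_mono) auto
    then have "(\<integral>\<^sup>+y\<in>ball x r. ennreal (exp (s * \<bar>b y - avg (ball x r) b\<bar>) * w y) \<partial>lborel)
      \<le> (\<integral>\<^sup>+y\<in>ball x r. ennreal (exp (c / \<beta> * \<bar>b y - avg (ball x r) b\<bar>) * w y) \<partial>lborel)"
      by (intro nn_integral_mono) (auto simp: indicator_def intro!: ennreal_leI)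
    also have "\<dots> \<le> ennreal (C * wmeas w (ball x r))"
      using *[OF w(1) bmob_scale[OF w(2,3)] w(5), of x] unfolding eq .
    finally show ?thesis .
  qed
  then show ?thesis using c by blast
qed

section \<open>Logarithms of paired weights and the reverse Hoelder inequality\<close>

lemma mpair_le:
  assumes "mpair \<theta> A v \<sigma>" "0 < \<theta>" "\<theta> < 1" "0 < r"
  shows "wmeas v (ball x r) \<le> (A * measure lborel (ball x r)) powr (1 / \<theta>) * wmeas \<sigma> (ball x r) powr (- (1 - \<theta>) / \<theta>)"
proof -
  let ?B = "ball x r"
  have s: "0 < wmeas \<sigma> ?B" using assms by (intro wmeas_ball_pos) (auto simp: mpair_def)
  have "wmeas v ?B powr \<theta> * wmeas \<sigma> ?B powr (1 - \<theta>) \<le> A * measure lborel ?B"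
    using assms by (auto simp: mpair_def)
  then have "(wmeas v ?B powr \<theta> * wmeas \<sigma> ?B powr (1 - \<theta>)) powr (1 / \<theta>) \<le> (A * measure lborel ?B) powr (1 / \<theta>)"
    using assms by (intro powr_mono2) auto
  then have "wmeas v ?B * wmeas \<sigma> ?B powr ((1 - \<theta>) / \<theta>) \<le> (A * measure lborel ?B) powr (1 / \<theta>)"
    using assms by (subst (asm) powr_mult) (auto simp: powr_powr)
  then have "wmeas v ?B \<le> (A * measure lborel ?B) powr (1 / \<theta>) / wmeas \<sigma> ?B powr ((1 - \<theta>) / \<theta>)"
    using s by (simp add: pos_le_divide_eq)
  moreover have "- (1 - \<theta>) / \<theta> = - ((1 - \<theta>) / \<theta>)" by (rule minus_divide_left[symmetric])
  ultimately show ?thesis by (simp only: powr_minus_divide times_divide_eq_right mult_1_right)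
qed

text \<open>Let u = ln \<sigma> - c, where c is the logarithm of the mean of
  \<open>\<sigma>\<close>, and t = (1 - \<theta>) / \<theta>. Then u \<le> exp u and - u \<le> exp
  (- t u) / t, where exp u is a multiple of \<open>\<sigma>\<close> and exp (- t u) one of
  \<open>v\<close>, as ln v = - t ln \<sigma>. Their averages are 1 and at most A^(1 / \<theta>),
  which gives \<open>M\<close>. Replacing c by the average of ln \<sigma> costs a second
  \<open>M\<close> in the oscillation bound.\<close>

lemma log_bmo:
  fixes v \<sigma> :: "'a::euclidean_space \<Rightarrow> real"
  assumes m: "mpair \<theta> A v \<sigma>" and \<theta>: "0 < \<theta>" "\<theta> < 1"
  defines "M \<equiv> 1 + A powr (1 / \<theta>) * (\<theta> / (1 - \<theta>))"
  shows "bmob (2 * M) (\<lambda>x. ln (\<sigma> x))"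
    and "0 < r \<Longrightarrow> avg (ball x r) (\<lambda>x. ln (\<sigma> x)) \<le> ln (wmeas \<sigma> (ball x r) / measure lborel (ball x r)) + M"
proof -
  have v: "wt v" and s: "wt \<sigma>" using m by (auto simp: mpair_def)
  note [measurable] = wtD(2)[OF v] wtD(2)[OF s]
  define t where "t = (1 - \<theta>) / \<theta>"
  have t: "0 < t" using \<theta> by (simp add: t_def)
  have A: "1 \<le> A" using ainf_ge_1[OF mpair_ainf[OF m \<theta>]] .
  have M: "M = 1 + A powr (1 / \<theta>) / t" by (simp add: M_def t_def)
  have main: "set_integrable lborel (ball x r) (\<lambda>x. ln (\<sigma> x)) \<and>
      avg (ball x r) (\<lambda>y. \<bar>ln (\<sigma> y) - ln (wmeas \<sigma> (ball x r) / measure lborel (ball x r))\<bar>) \<le> M"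
    if r: "0 < r" for x r
  proof -
    define B where "B = ball x r"
    define m where "m = measure lborel B"
    define S where "S = wmeas \<sigma> B"
    define c where "c = ln (S / m)"
    have [measurable]: "B \<in> sets borel" by (simp add: B_def)
    have mpos: "0 < m" unfolding m_def B_def using r by (rule measure_ball_pos)
    have Spos: "0 < S" unfolding S_def B_def using s r by (rule wmeas_ball_pos)
    have ec: "exp c = S / m" using mpos Spos by (simp add: c_def)
    have "AE y in lborel. \<bar>ln (\<sigma> y) - c\<bar> \<le> (m / S) * \<sigma> y + ((S / m) powr t / t) * v y"
      using wtD(3)[OF s] wtD(3)[OF v] m[unfolded mpair_def, THEN conjunct2, THEN conjunct2, THEN conjunct1]
    proof eventually_elim
      case (elim y)
      define u where "u = ln (\<sigma> y) - c"
      have 1: "exp u = (m / S) * \<sigma> y" using elim mpos Spos by (simp add: u_def exp_diff ec)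
      have "\<theta> * ln (v y) + (1 - \<theta>) * ln (\<sigma> y) = ln (v y powr \<theta> * \<sigma> y powr (1 - \<theta>))"
        using elim(1,2) by (simp add: ln_mult ln_powr)
      then have "ln (v y) = - t * ln (\<sigma> y)" using elim(3) \<theta> by (simp add: t_def field_simps)
      then have "- (t * u) = t * c + ln (v y)" by (simp add: u_def algebra_simps)
      then have "exp (- (t * u)) = exp (t * c) * exp (ln (v y))" by (simp only: exp_add)
      then have 2: "exp (- (t * u)) = (S / m) powr t * v y"
        using elim mpos Spos by (simp add: powr_def c_def)
      have "u \<le> exp u" using exp_ge_add_one_self[of u] by linarith
      moreover have "- (t * u) \<le> exp (- (t * u))" using exp_ge_add_one_self[of "- (t * u)"] by linarith
      then have "- u \<le> exp (- (t * u)) / t" using t by (simp add: field_simps)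
      moreover have "0 \<le> exp u" "0 \<le> exp (- (t * u)) / t" using t by auto
      ultimately have "\<bar>u\<bar> \<le> exp u + exp (- (t * u)) / t" by linarith
      then show ?case unfolding 1 2 by (simp add: u_def)
    qed
    then have "(\<integral>\<^sup>+y\<in>B. ennreal \<bar>ln (\<sigma> y) - c\<bar> \<partial>lborel)
       \<le> (\<integral>\<^sup>+y. ennreal (m / S) * (ennreal (\<sigma> y) * indicator B y) + ennreal ((S / m) powr t / t) * (ennreal (v y) * indicator B y) \<partial>lborel)"
    proof (intro nn_integral_mono_AE, eventually_elim)
      case (elim y)
      have "ennreal \<bar>ln (\<sigma> y) - c\<bar> \<le> ennreal (m / S * \<sigma> y + (S / m) powr t / t * v y)"
        using elim by (intro ennreal_leI)
      also have "\<dots> = ennreal (m / S * \<sigma> y) + ennreal ((S / m) powr t / t * v y)"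
        using mpos Spos t wtD(1)[OF s, of y] wtD(1)[OF v, of y] by (intro ennreal_plus) auto
      also have "\<dots> = ennreal (m / S) * ennreal (\<sigma> y) + ennreal ((S / m) powr t / t) * ennreal (v y)"
        using mpos Spos t wtD(1)[OF s, of y] wtD(1)[OF v, of y] by (subst (1 2) ennreal_mult) auto
      finally have "ennreal \<bar>ln (\<sigma> y) - c\<bar> \<le> ennreal (m / S) * ennreal (\<sigma> y) + ennreal ((S / m) powr t / t) * ennreal (v y)" .
      then show ?case by (auto simp: indicator_def)
    qed
    also have "\<dots> = ennreal (m / S) * ennreal S + ennreal ((S / m) powr t / t) * ennreal (wmeas v B)"
    proof -
      have "(\<integral>\<^sup>+y\<in>B. ennreal (\<sigma> y) \<partial>lborel) = ennreal S" "(\<integral>\<^sup>+y\<in>B. ennreal (v y) \<partial>lborel) = ennreal (wmeas v B)"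
        using ennreal_wmeas[OF s, of B x r] ennreal_wmeas[OF v, of B x r] by (auto simp: S_def B_def)
      then show ?thesis by (subst nn_integral_add) (simp_all add: nn_integral_cmult)
    qed
    also have "\<dots> = ennreal (m / S * S + (S / m) powr t / t * wmeas v B)"
      using mpos Spos t by (subst ennreal_plus, simp, simp, subst (1 2) ennreal_mult) auto
    also have "\<dots> \<le> ennreal (M * m)"
    proof (rule ennreal_leI)
      have "(S / m) powr t * wmeas v B \<le> (S / m) powr t * ((A * m) powr (1 / \<theta>) * S powr (- t))"
        using mpair_le[OF m \<theta> r, of x] unfolding S_def m_def B_def t_def minus_divide_left by (rule mult_left_mono) simp
      also have "\<dots> = A powr (1 / \<theta>) * (m powr (1 / \<theta>) * m powr (- t)) * (S powr t * S powr (- t))"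
      proof -
        have "(S / m) powr t = S powr t * m powr (- t)"
          using mpos Spos by (simp add: powr_divide powr_minus_divide)
        moreover have "(A * m) powr (1 / \<theta>) = A powr (1 / \<theta>) * m powr (1 / \<theta>)"
          using mpos A by (simp add: powr_mult)
        ultimately show ?thesis by (simp only: mult_ac)
      qed
      also have "\<dots> = A powr (1 / \<theta>) * m powr (1 / \<theta> - t)"
        using Spos mpos by (simp add: powr_add[symmetric])
      also have "1 / \<theta> - t = 1" using \<theta> by (simp add: t_def field_simps)
      finally have "(S / m) powr t * wmeas v B \<le> A powr (1 / \<theta>) * m" using mpos by simp
      then have "(S / m) powr t * wmeas v B / t \<le> A powr (1 / \<theta>) * m / t" using t by (intro divide_right_mono) auto
      then show "m / S * S + (S / m) powr t / t * wmeas v B \<le> M * m"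
        using Spos by (simp add: M distrib_right)
    qed
    finally have bound: "(\<integral>\<^sup>+y\<in>B. ennreal \<bar>ln (\<sigma> y) - c\<bar> \<partial>lborel) \<le> ennreal (M * m)" .
    have int: "set_integrable lborel B (\<lambda>y. ln (\<sigma> y) - c)"
      unfolding set_integrable_def
    proof (rule integrableI_bounded)
      have "(\<integral>\<^sup>+y. ennreal (norm (indicator B y *\<^sub>R (ln (\<sigma> y) - c))) \<partial>lborel) = (\<integral>\<^sup>+y\<in>B. ennreal \<bar>ln (\<sigma> y) - c\<bar> \<partial>lborel)"
        by (intro nn_integral_cong) (auto simp: indicator_def)
      then show "(\<integral>\<^sup>+y. ennreal (norm (indicator B y *\<^sub>R (ln (\<sigma> y) - c))) \<partial>lborel) < \<infinity>"
        using le_less_trans[OF bound, of \<infinity>] by simp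
    qed measurable
    have "set_integrable lborel B (\<lambda>y. (ln (\<sigma> y) - c) - (- c))"
      by (rule set_integrable_minus_const) (use int mpos in \<open>auto simp: m_def\<close>)
    then have int': "set_integrable lborel B (\<lambda>y. ln (\<sigma> y))" by simp
    have "ennreal (avg B (\<lambda>y. \<bar>ln (\<sigma> y) - c\<bar>) * m) \<le> ennreal (M * m)"
      using bound set_nn_integral_avg[OF set_integrable_abs[OF int]] mpos by (simp add: m_def)
    moreover have "0 \<le> M" using t by (simp add: M add_nonneg_nonneg)
    ultimately have "avg B (\<lambda>y. \<bar>ln (\<sigma> y) - c\<bar>) \<le> M" using mpos by (simp add: ennreal_le_iff)
    then show ?thesis using int' by (simp add: B_def c_def S_def m_def)
  qed
  have key: "\<bar>avg (ball x r) (\<lambda>x. ln (\<sigma> x)) - ln (wmeas \<sigma> (ball x r) / measure lborel (ball x r))\<bar> \<le> M" if "0 < r" for x r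
    using avg_dist_le[of "ball x r" "\<lambda>x. ln (\<sigma> x)" "ln (wmeas \<sigma> (ball x r) / measure lborel (ball x r))"]
      main[OF that, of x] measure_ball_pos[OF that, of x] by auto
  show "0 < r \<Longrightarrow> avg (ball x r) (\<lambda>x. ln (\<sigma> x)) \<le> ln (wmeas \<sigma> (ball x r) / measure lborel (ball x r)) + M"
    using key[of r x] by linarith
  show "bmob (2 * M) (\<lambda>x. ln (\<sigma> x))"
    unfolding bmob_def
  proof (intro conjI allI impI)
    fix x :: 'a and r :: real assume r: "0 < r"
    let ?B = "ball x r" let ?l = "\<lambda>x. ln (\<sigma> x)"
    define c where "c = ln (wmeas \<sigma> ?B / measure lborel ?B)"
    have B: "0 < measure lborel ?B" using r by (rule measure_ball_pos)
    show int: "set_integrable lborel ?B ?l" using main[OF r] by blast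
    have "avg ?B (\<lambda>y. \<bar>?l y - s\<bar>) \<le> avg ?B (\<lambda>y. \<bar>?l y - c\<bar> - (- M))" if "\<bar>s - c\<bar> \<le> M" for s
      unfolding avg_def using that int B
      by (intro divide_right_mono set_integral_mono set_integrable_minus_const set_integrable_abs_minus_const) auto
    from this[OF key[OF r, of x, folded c_def]]
    have "avg ?B (\<lambda>y. \<bar>?l y - avg ?B ?l\<bar>) \<le> avg ?B (\<lambda>y. \<bar>?l y - c\<bar> - (- M))" .
    also have "avg ?B (\<lambda>y. \<bar>?l y - c\<bar> - (- M)) = avg ?B (\<lambda>y. \<bar>?l y - c\<bar>) - (- M)"
      using int B by (intro avg_minus_const set_integrable_abs_minus_const) auto
    finally show "avg ?B (\<lambda>y. \<bar>?l y - avg ?B ?l\<bar>) \<le> 2 * M"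
      using main[OF r, of x] by (simp add: c_def)
  qed measurable
qed

text \<open>Write \<sigma>^(1 + \<delta>) = exp (\<delta> ln \<sigma>) \<sigma> and apply the
  weighted John-Nirenberg inequality to ln \<sigma> with respect to the measure \<sigma> dx itself.
  Its smallness condition, with the oscillation bound 2 M, fixes \<open>\<delta>\<close>; the
  average of ln \<sigma> is at most the logarithm of the mean plus \<open>M\<close>.\<close>

theorem reverse_Hoelder:
  fixes \<theta> A :: real
  assumes \<theta>: "0 < \<theta>" "\<theta> < 1"
  shows "\<exists>\<delta> C. 0 < \<delta> \<and> 0 < C \<and> (\<forall>(v::'a::euclidean_space \<Rightarrow> real) \<sigma> x r. mpair \<theta> A v \<sigma> \<longrightarrow> 0 < r \<longrightarrow>
    (\<integral>\<^sup>+y\<in>ball x r. ennreal (\<sigma> y powr (1 + \<delta>)) \<partial>lborel)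
      \<le> ennreal (C * (wmeas \<sigma> (ball x r) / measure lborel (ball x r)) powr (1 + \<delta>) * measure lborel (ball x r)))"
proof -
  have \<theta>': "0 < 1 - \<theta>" using \<theta> by simp
  define M where "M = 1 + A powr (1 / \<theta>) * (\<theta> / (1 - \<theta>))"
  have M: "0 < M" using \<theta> by (simp add: M_def add_pos_nonneg)
  obtain c C where c: "0 < c" "0 < C" and *: "\<And>(w::'a \<Rightarrow> real) b \<beta> s x r. ainf (1 - \<theta>) A w \<Longrightarrow> bmob \<beta> b \<Longrightarrow> 0 < \<beta> \<Longrightarrow>
    s * \<beta> \<le> c \<Longrightarrow> 0 < r \<Longrightarrow>
    (\<integral>\<^sup>+y\<in>ball x r. ennreal (exp (s * \<bar>b y - avg (ball x r) b\<bar>) * w y) \<partial>lborel) \<le> ennreal (C * wmeas w (ball x r))"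
    using weighted_John_Nirenberg[OF \<theta>', of A, where 'a='a] by blast
  define \<delta> where "\<delta> = c / (2 * M)"
  have \<delta>: "0 < \<delta>" using c M by (simp add: \<delta>_def)
  have "(\<integral>\<^sup>+y\<in>ball x r. ennreal (\<sigma> y powr (1 + \<delta>)) \<partial>lborel)
      \<le> ennreal ((exp (\<delta> * M) * C) * (wmeas \<sigma> (ball x r) / measure lborel (ball x r)) powr (1 + \<delta>) * measure lborel (ball x r))"
    if m: "mpair \<theta> A v \<sigma>" and r: "0 < r" for v \<sigma> :: "'a \<Rightarrow> real" and x r
  proof -
    have s: "wt \<sigma>" using m by (auto simp: mpair_def)
    note [measurable] = wtD(2)[OF s]
    have ai: "ainf (1 - \<theta>) A \<sigma>" using mpair_ainf[OF mpair_sym[OF m]] \<theta> by simp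
    let ?l = "\<lambda>y. ln (\<sigma> y)"
    define B where "B = ball x r"
    have [measurable]: "B \<in> sets borel" by (simp add: B_def)
    define a where "a = wmeas \<sigma> B / measure lborel B"
    have a: "0 < a" unfolding a_def B_def using s r by (simp add: wmeas_ball_pos measure_ball_pos)
    have avg_le: "avg B ?l \<le> ln a + M" unfolding a_def B_def M_def using log_bmo(2)[OF m \<theta> r] .
    have "\<sigma> y powr (1 + \<delta>) \<le> (a powr \<delta> * exp (\<delta> * M)) * (exp (\<delta> * \<bar>?l y - avg B ?l\<bar>) * \<sigma> y)" for y
    proof (cases "\<sigma> y = 0")
      case False
      then have pos: "0 < \<sigma> y" using wtD(1)[OF s, of y] by simp
      have "\<delta> * ?l y \<le> \<delta> * (ln a + M + \<bar>?l y - avg B ?l\<bar>)" using avg_le \<delta> by (intro mult_left_mono) auto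
      then have "exp (\<delta> * ?l y) \<le> exp (\<delta> * ln a + \<delta> * M + \<delta> * \<bar>?l y - avg B ?l\<bar>)"
        by (simp add: distrib_left)
      then have "\<sigma> y powr \<delta> \<le> a powr \<delta> * exp (\<delta> * M) * exp (\<delta> * \<bar>?l y - avg B ?l\<bar>)"
        using pos a by (simp add: powr_def exp_add)
      from mult_right_mono[OF this, of "\<sigma> y"] show ?thesis
        using pos by (simp add: powr_add mult_ac)
    qed simp
    from ennreal_leI[OF this]
    have "ennreal (\<sigma> y powr (1 + \<delta>)) \<le> ennreal (a powr \<delta> * exp (\<delta> * M)) * ennreal (exp (\<delta> * \<bar>?l y - avg B ?l\<bar>) * \<sigma> y)" for y
      using wtD(1)[OF s, of y] by (subst ennreal_mult[symmetric]) auto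
    then have "(\<integral>\<^sup>+y\<in>B. ennreal (\<sigma> y powr (1 + \<delta>)) \<partial>lborel)
      \<le> (\<integral>\<^sup>+y. ennreal (a powr \<delta> * exp (\<delta> * M)) * (ennreal (exp (\<delta> * \<bar>?l y - avg B ?l\<bar>) * \<sigma> y) * indicator B y) \<partial>lborel)"
      by (intro nn_integral_mono) (auto simp: indicator_def)
    also have "\<dots> = ennreal (a powr \<delta> * exp (\<delta> * M)) * (\<integral>\<^sup>+y\<in>B. ennreal (exp (\<delta> * \<bar>?l y - avg B ?l\<bar>) * \<sigma> y) \<partial>lborel)"
      by (intro nn_integral_cmult) measurable
    also have "\<dots> \<le> ennreal (a powr \<delta> * exp (\<delta> * M)) * ennreal (C * wmeas \<sigma> B)"
    proof -
      have "0 < 2 * M" "\<delta> * (2 * M) \<le> c" using M by (auto simp: \<delta>_def)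
      from *[OF ai log_bmo(1)[OF m \<theta>, folded M_def] this r, of x]
      show ?thesis unfolding B_def by (intro mult_left_mono) auto
    qed
    also have "\<dots> = ennreal (a powr \<delta> * exp (\<delta> * M) * (C * (a * measure lborel B)))"
      using c measure_ball_pos[OF r, of x] by (subst ennreal_mult[symmetric]) (auto simp: a_def B_def)
    also have "\<dots> = ennreal ((exp (\<delta> * M) * C) * a powr (1 + \<delta>) * measure lborel B)"
      using a by (simp add: powr_add mult_ac)
    finally show ?thesis by (simp add: a_def B_def)
  qed
  then show ?thesis using \<delta> c by - (rule exI[of _ \<delta>], rule exI[of _ "exp (\<delta> * M) * C"], auto)
qed

section \<open>The maximal function of a weighted measure\<close>

lemma borel_measurable_ball_nn_integral [measurable]:
  fixes F :: "'a::euclidean_space \<Rightarrow> ennreal"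
  assumes [measurable]: "F \<in> borel_measurable borel"
  shows "(\<lambda>x. \<integral>\<^sup>+y\<in>ball x r. F y \<partial>lborel) \<in> borel_measurable borel"
proof -
  have "(\<lambda>x. \<integral>\<^sup>+y\<in>ball x r. F y \<partial>lborel) = (\<lambda>x. \<integral>\<^sup>+y. (if dist x y < r then F y else 0) \<partial>lborel)"
    by (intro ext nn_integral_cong) (auto simp: indicator_def)
  also have "\<dots> \<in> borel_measurable borel" by measurable
  finally show ?thesis .
qed

text \<open>Centred maximal function for the measure v dx. Only dyadic radii occur: a countable
  supremum is measurable, and these are the radii in the dyadic sums for the fractional
  integral.\<close>

definition Mmax :: "('a::euclidean_space \<Rightarrow> real) \<Rightarrow> ('a \<Rightarrow> real) \<Rightarrow> 'a \<Rightarrow> ennreal" where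
  "Mmax v h x = (SUP k::int. ennreal (1 / wmeas v (ball x (2 powr k))) * (\<integral>\<^sup>+y\<in>ball x (2 powr k). ennreal (h y * v y) \<partial>lborel))"

lemma Mmax_measurable [measurable]:
  assumes [measurable]: "v \<in> borel_measurable borel" "h \<in> borel_measurable borel"
  shows "Mmax v h \<in> borel_measurable borel"
proof -
  have [measurable]: "(\<lambda>x. wmeas v (ball x r)) \<in> borel_measurable borel" for r
    unfolding wmeas_def by measurable
  show ?thesis unfolding Mmax_def[abs_def] by measurable
qed

lemma ennreal_cancel_le:
  assumes "0 < W"
  shows "ennreal (1 / W) * I \<le> ennreal t \<longleftrightarrow> I \<le> ennreal t * ennreal W"
proof
  have *: "ennreal W * ennreal (1 / W) = 1" using assms by (simp flip: ennreal_mult)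
  assume "ennreal (1 / W) * I \<le> ennreal t"
  then have "ennreal W * (ennreal (1 / W) * I) \<le> ennreal W * ennreal t" by (rule mult_left_mono) simp
  then show "I \<le> ennreal t * ennreal W" by (simp only: mult.assoc[symmetric] *) (simp add: mult.commute)
next
  have *: "ennreal (1 / W) * ennreal W = 1" using assms by (simp flip: ennreal_mult)
  assume "I \<le> ennreal t * ennreal W"
  then have "ennreal (1 / W) * I \<le> ennreal (1 / W) * (ennreal t * ennreal W)" by (rule mult_left_mono) simp
  also have "\<dots> = ennreal t * (ennreal (1 / W) * ennreal W)" by (simp only: mult_ac)
  finally show "ennreal (1 / W) * I \<le> ennreal t" by (simp only: * mult_1_right)
qed

lemma Mmax_le_iff:
  assumes "wt v"
  shows "Mmax v h x \<le> ennreal t \<longleftrightarrow>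
    (\<forall>k::int. (\<integral>\<^sup>+y\<in>ball x (2 powr k). ennreal (h y * v y) \<partial>lborel) \<le> ennreal t * ennreal (wmeas v (ball x (2 powr k))))"
  using wmeas_ball_pos[OF assms, of "2 powr _"] by (simp add: Mmax_def SUP_le_iff ennreal_cancel_le)

text \<open>Vitali's covering lemma selects disjoint balls on which the average of \<open>h\<close>
  exceeds t and whose fivefold enlargements cover the level set, at a factor \<open>K\<close> in
  mass. It wants bounded radii, so radii up to 2^N are treated and N is then sent to
  infinity.\<close>

lemma Mmax_weak_type:
  fixes v h :: "'a::euclidean_space \<Rightarrow> real"
  assumes v: "wt v" and K: "0 < K" "\<And>x r. 0 < r \<Longrightarrow> wmeas v (ball x (5 * r)) \<le> K * wmeas v (ball x r)"
    and [measurable]: "h \<in> borel_measurable borel" and t: "0 < t"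
  shows "ennreal t * (\<integral>\<^sup>+x\<in>{x. ennreal t < Mmax v h x}. ennreal (v x) \<partial>lborel) \<le> ennreal K * (\<integral>\<^sup>+x. ennreal (h x * v x) \<partial>lborel)"
proof -
  note [measurable] = wtD(2)[OF v]
  define J where "J x r = (\<integral>\<^sup>+y\<in>ball x r. ennreal (h y * v y) \<partial>lborel)" for x r
  define W where "W x r = wmeas v (ball x r)" for x r
  have W_meas [measurable]: "(\<lambda>x. W x r) \<in> borel_measurable borel" for r unfolding W_def wmeas_def by measurable
  have J_meas [measurable]: "(\<lambda>x. J x r) \<in> borel_measurable borel" for r unfolding J_def by measurable
  define good where "good x k \<longleftrightarrow> ennreal (t * W x (2 powr real_of_int k)) < J x (2 powr real_of_int k)" for x and k :: int
  define E where "E N = {x. \<exists>k\<in>{..int N}. good x k}" for N :: nat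
  have [measurable]: "{x. good x k} \<in> sets borel" for k
    unfolding good_def by measurable
  have E_meas [measurable]: "E N \<in> sets borel" for N
  proof -
    have "E N = (\<Union>k\<in>{..int N}. {x. good x k})" by (auto simp: E_def)
    also have "\<dots> \<in> sets borel" by (intro sets.countable_UN'') auto
    finally show ?thesis .
  qed
  have sub: "{x. ennreal t < Mmax v h x} \<subseteq> (\<Union>N. E N)"
  proof
    fix x assume "x \<in> {x. ennreal t < Mmax v h x}"
    then have "\<not> Mmax v h x \<le> ennreal t" by simp
    then obtain k :: int where "\<not> J x (2 powr real_of_int k) \<le> ennreal t * ennreal (W x (2 powr real_of_int k))"
      unfolding Mmax_le_iff[OF v] J_def W_def by blast
    then have "good x k" using t by (simp add: good_def not_le ennreal_mult')
    then have "x \<in> E (nat (max k 0))" by (auto simp: E_def intro!: bexI[of _ k])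
    then show "x \<in> (\<Union>N. E N)" by blast
  qed
  have bound: "ennreal t * (\<integral>\<^sup>+x\<in>E N. ennreal (v x) \<partial>lborel) \<le> ennreal K * (\<integral>\<^sup>+x. ennreal (h x * v x) \<partial>lborel)" for N
  proof -
    define P where "P = {(x, k). k \<in> {..int N} \<and> good x k}"
    have cover: "E N \<subseteq> (\<Union>i\<in>P. ball (fst i) (2 powr real_of_int (snd i)))"
    proof
      fix x assume "x \<in> E N"
      then obtain k where "k \<in> {..int N}" "good x k" unfolding E_def by blast
      then have "(x, k) \<in> P" by (simp add: P_def)
      then show "x \<in> (\<Union>i\<in>P. ball (fst i) (2 powr real_of_int (snd i)))" by (rule UN_I) simp
    qed
    have radii: "0 < 2 powr real_of_int (snd i) \<and> 2 powr real_of_int (snd i) \<le> 2 powr real N" if "i \<in> P" for i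
      using that by (auto simp: P_def intro!: powr_mono)
    obtain C where C: "countable C" "C \<subseteq> P"
      "pairwise (\<lambda>i j. disjnt (ball (fst i) (2 powr real_of_int (snd i))) (ball (fst j) (2 powr real_of_int (snd j)))) C"
      "E N \<subseteq> (\<Union>i\<in>C. ball (fst i) (5 * 2 powr real_of_int (snd i)))"
      by (rule Vitali_covering_lemma_balls[OF cover radii]) (assumption | rule that)+
    define B where "B i = ball (fst i) (2 powr real_of_int (snd i))" for i :: "'a \<times> int"
    have disj: "disjoint_family_on B C" using C(3) by (auto simp: disjoint_family_on_def pairwise_def disjnt_def B_def)
    have "(\<integral>\<^sup>+x\<in>E N. ennreal (v x) \<partial>lborel)
        \<le> (\<integral>\<^sup>+x. (\<integral>\<^sup>+i. ennreal (v x) * indicator (ball (fst i) (5 * 2 powr real_of_int (snd i))) x \<partial>count_space C) \<partial>lborel)"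
    proof (intro nn_integral_mono)
      fix x
      show "ennreal (v x) * indicator (E N) x \<le> (\<integral>\<^sup>+i. ennreal (v x) * indicator (ball (fst i) (5 * 2 powr real_of_int (snd i))) x \<partial>count_space C)"
      proof (cases "x \<in> E N")
        case True
        then obtain i where i: "i \<in> C" "x \<in> ball (fst i) (5 * 2 powr real_of_int (snd i))" using C(4) by blast
        have "ennreal (v x) * indicator (E N) x = ennreal (v x) * indicator (ball (fst i) (5 * 2 powr real_of_int (snd i))) x"
          using True i by simp
        also have "\<dots> \<le> (\<integral>\<^sup>+i. ennreal (v x) * indicator (ball (fst i) (5 * 2 powr real_of_int (snd i))) x \<partial>count_space C)"
          using i by (intro nn_integral_ge_point)
        finally show ?thesis .
      qed simp
    qed
    also have "\<dots> = (\<integral>\<^sup>+i. (\<integral>\<^sup>+x. ennreal (v x) * indicator (ball (fst i) (5 * 2 powr real_of_int (snd i))) x \<partial>lborel) \<partial>count_space C)"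
      by (rule nn_integral_count_space_nn_integral[OF C(1)])
        (intro borel_measurable_times_ennreal borel_measurable_indicator measurable_compose[OF wtD(2)[OF v] measurable_ennreal], simp_all)
    also have "ennreal t * \<dots> = (\<integral>\<^sup>+i. ennreal t * (\<integral>\<^sup>+x. ennreal (v x) * indicator (ball (fst i) (5 * 2 powr real_of_int (snd i))) x \<partial>lborel) \<partial>count_space C)"
      by (intro nn_integral_cmult[symmetric]) auto
    also have "\<dots> \<le> (\<integral>\<^sup>+i. ennreal K * (\<integral>\<^sup>+y\<in>B i. ennreal (h y * v y) \<partial>lborel) \<partial>count_space C)"
    proof (intro nn_integral_mono)
      fix i assume "i \<in> space (count_space C)"
      then have g: "good (fst i) (snd i)" using C(2) by (auto simp: P_def)
      define r where "r = (2::real) powr real_of_int (snd i)"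
      have r: "0 < r" by (simp add: r_def)
      have "ennreal t * (\<integral>\<^sup>+x. ennreal (v x) * indicator (ball (fst i) (5 * r)) x \<partial>lborel) = ennreal (t * wmeas v (ball (fst i) (5 * r)))"
        using t ennreal_wmeas[OF v subset_refl, of "fst i" "5 * r"] by (simp add: ennreal_mult)
      also have "\<dots> \<le> ennreal (K * (t * W (fst i) r))"
        using K(2)[OF r, of "fst i"] t by (intro ennreal_leI) (simp add: W_def mult.left_commute)
      also have "\<dots> = ennreal K * ennreal (t * W (fst i) r)"
        using K(1) t by (intro ennreal_mult) (auto simp: W_def)
      also have "\<dots> \<le> ennreal K * J (fst i) r"
        using g by (intro mult_left_mono) (auto simp: good_def r_def)
      finally show "ennreal t * (\<integral>\<^sup>+x. ennreal (v x) * indicator (ball (fst i) (5 * 2 powr real_of_int (snd i))) x \<partial>lborel)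
        \<le> ennreal K * (\<integral>\<^sup>+y\<in>B i. ennreal (h y * v y) \<partial>lborel)" by (simp add: r_def J_def B_def)
    qed
    also have "\<dots> = ennreal K * (\<integral>\<^sup>+i. (\<integral>\<^sup>+y\<in>B i. ennreal (h y * v y) \<partial>lborel) \<partial>count_space C)"
      by (intro nn_integral_cmult) auto
    also have "(\<integral>\<^sup>+i. (\<integral>\<^sup>+y\<in>B i. ennreal (h y * v y) \<partial>lborel) \<partial>count_space C)
        = (\<integral>\<^sup>+i. emeasure (density lborel (\<lambda>y. ennreal (h y * v y))) (B i) \<partial>count_space C)"
      by (intro nn_integral_cong) (auto simp: emeasure_density B_def)
    also have "\<dots> = emeasure (density lborel (\<lambda>y. ennreal (h y * v y))) (\<Union>(B ` C))"
    proof (rule emeasure_UN_countable[OF _ C(1) disj, symmetric])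
      show "B i \<in> sets (density lborel (\<lambda>y. ennreal (h y * v y)))" for i by (simp add: B_def)
    qed
    also have "\<dots> \<le> emeasure (density lborel (\<lambda>y. ennreal (h y * v y))) UNIV"
      by (intro emeasure_mono) auto
    also have "\<dots> = (\<integral>\<^sup>+x. ennreal (h x * v x) \<partial>lborel)" by (subst emeasure_density) auto
    finally show ?thesis by (simp add: mult_left_mono)
  qed
  have "(\<integral>\<^sup>+x\<in>{x. ennreal t < Mmax v h x}. ennreal (v x) \<partial>lborel) \<le> (\<integral>\<^sup>+x\<in>(\<Union>N. E N). ennreal (v x) \<partial>lborel)"
    by (rule set_nn_integral_mono_set[OF sub])
  also have "\<dots> = emeasure (density lborel (\<lambda>x. ennreal (v x))) (\<Union>N. E N)"
    by (subst emeasure_density) auto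
  also have "\<dots> = (SUP N. emeasure (density lborel (\<lambda>x. ennreal (v x))) (E N))"
  proof (rule SUP_emeasure_incseq[symmetric])
    show "range E \<subseteq> sets (density lborel (\<lambda>x. ennreal (v x)))" by auto
    show "incseq E" by (auto simp: incseq_def E_def)
  qed
  also have "\<dots> = (SUP N. (\<integral>\<^sup>+x\<in>E N. ennreal (v x) \<partial>lborel))"
    by (subst emeasure_density) auto
  finally have "ennreal t * (\<integral>\<^sup>+x\<in>{x. ennreal t < Mmax v h x}. ennreal (v x) \<partial>lborel) \<le> ennreal t * (SUP N. (\<integral>\<^sup>+x\<in>E N. ennreal (v x) \<partial>lborel))"
    by (rule mult_left_mono) simp
  also have "\<dots> = (SUP N. ennreal t * (\<integral>\<^sup>+x\<in>E N. ennreal (v x) \<partial>lborel))"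
    by (intro SUP_mult_left_ennreal)
  also have "\<dots> \<le> ennreal K * (\<integral>\<^sup>+x. ennreal (h x * v x) \<partial>lborel)"
    using bound by (intro SUP_least)
  finally show ?thesis .
qed

lemma nn_integral_powr_from_0:
  assumes "0 \<le> a" "-1 < s"
  shows "(\<integral>\<^sup>+t. ennreal (t powr s) * indicator {0<..<a} t \<partial>lborel) = ennreal (a powr (s + 1) / (s + 1))"
proof -
  have "(\<integral>\<^sup>+t. ennreal (t powr s) * indicator {0<..<a} t \<partial>lborel) = (\<integral>\<^sup>+t. ennreal (t powr s) * indicator {0..a} t \<partial>lborel)"
    by (intro nn_integral_cong_AE) (use AE_lborel_singleton[of 0] AE_lborel_singleton[of a] in \<open>eventually_elim, auto simp: indicator_def\<close>)
  also have "\<dots> = ennreal (a powr (s + 1) / (s + 1))"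
    using has_integral_powr_from_0[OF assms(2,1)] by (intro nn_integral_has_integral_lebesgue') auto
  finally show ?thesis .
qed

text \<open>Proved for the power of every finite a \<le> y; the case y = top follows as a is
  arbitrary.\<close>

lemma epow_layer_cake:
  assumes "0 < s"
  shows "epow y s \<le> (\<integral>\<^sup>+t. ennreal (s * t powr (s - 1)) * indicator {t. 0 < t \<and> ennreal t < y} t \<partial>lborel)" (is "_ \<le> ?I y")
proof -
  have fin: "ennreal (a powr s) \<le> ?I y" if a: "0 \<le> a" "ennreal a \<le> y" for a
  proof -
    have "ennreal (a powr s) = ennreal s * ennreal (a powr (s - 1 + 1) / (s - 1 + 1))"
      using assms by (subst ennreal_mult[symmetric]) auto
    also have "\<dots> = ennreal s * (\<integral>\<^sup>+t. ennreal (t powr (s - 1)) * indicator {0<..<a} t \<partial>lborel)"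
      using assms a by (subst nn_integral_powr_from_0) auto
    also have "\<dots> = (\<integral>\<^sup>+t. ennreal s * (ennreal (t powr (s - 1)) * indicator {0<..<a} t) \<partial>lborel)"
      by (intro nn_integral_cmult[symmetric]) measurable
    also have "\<dots> \<le> ?I y"
    proof (intro nn_integral_mono)
      fix t :: real
      have "ennreal t < y" if "t \<in> {0<..<a}"
        using that a by (auto intro!: less_le_trans[OF ennreal_lessI a(2)])
      then show "ennreal s * (ennreal (t powr (s - 1)) * indicator {0<..<a} t) \<le> ennreal (s * t powr (s - 1)) * indicator {t. 0 < t \<and> ennreal t < y} t"
        using assms by (auto simp: indicator_def ennreal_mult)
    qed
    finally show ?thesis .
  qed
  show ?thesis
  proof (cases y)
    case (real a)
    then show ?thesis using fin[of a] by simp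
  next
    case top
    have "?I y = top"
    proof (rule ccontr)
      assume "?I y \<noteq> top"
      then obtain r where r: "?I y = ennreal r" "0 \<le> r" by (cases "?I y") auto
      have "ennreal (((r + 1) powr (1 / s)) powr s) \<le> ?I y" using top by (intro fin) auto
      then show False using r assms by (simp add: powr_powr)
    qed
    then show ?thesis using top by simp
  qed
qed

text \<open>Marcinkiewicz interpolation: the part of \<open>h\<close> below t / 2 contributes at
  most t / 2 to any average, so the level set at height t is controlled by the weak type bound for
  the part above t / 2. Integration in t gives 2^(s - 1) / (s - 1), finite for s > 1.\<close>

lemma Mmax_strong_type:
  fixes K s :: real
  assumes K: "0 < K" and s: "1 < s"
  shows "\<exists>C>0. \<forall>(v::'a::euclidean_space \<Rightarrow> real) h. wt v \<longrightarrow> (\<forall>x r. 0 < r \<longrightarrow> wmeas v (ball x (5 * r)) \<le> K * wmeas v (ball x r)) \<longrightarrow>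
     h \<in> borel_measurable borel \<longrightarrow> (\<forall>x. 0 \<le> h x) \<longrightarrow>
     (\<integral>\<^sup>+x. epow (Mmax v h x) s * ennreal (v x) \<partial>lborel) \<le> ennreal C * (\<integral>\<^sup>+x. ennreal (h x powr s * v x) \<partial>lborel)"
proof (intro exI[of _ "2 * K * s * (2 powr (s - 1) / (s - 1))"] conjI allI impI)
  fix v h :: "'a \<Rightarrow> real"
  assume v: "wt v" and dbl: "\<forall>x r. 0 < r \<longrightarrow> wmeas v (ball x (5 * r)) \<le> K * wmeas v (ball x r)"
    and h_meas [measurable]: "h \<in> borel_measurable borel" and h: "\<forall>x. 0 \<le> h x"
  note [measurable] = wtD(2)[OF v]
  have vnn: "0 \<le> v y" for y using wtD(1)[OF v] .
  have weak: "(\<integral>\<^sup>+x\<in>{x. ennreal t < Mmax v h x}. ennreal (v x) \<partial>lborel)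
      \<le> ennreal (2 * K / t) * (\<integral>\<^sup>+x. ennreal (h x * v x) * indicator {x. t / 2 < h x} x \<partial>lborel)" if t: "0 < t" for t
  proof -
    define g where "g x = h x * indicator {x. t / 2 < h x} x" for x
    have [measurable]: "g \<in> borel_measurable borel" unfolding g_def by measurable
    have "{x. ennreal t < Mmax v h x} \<subseteq> {x. ennreal (t / 2) < Mmax v g x}"
    proof (rule ccontr)
      assume "\<not> ?thesis"
      then obtain x where "ennreal t < Mmax v h x" "\<not> ennreal (t / 2) < Mmax v g x" by blast
      then have x: "\<not> Mmax v h x \<le> ennreal t" "Mmax v g x \<le> ennreal (t / 2)" by (auto simp: not_less not_le)
      have "Mmax v h x \<le> ennreal t"
        unfolding Mmax_le_iff[OF v]
      proof
        fix k :: int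
        define B where "B = ball x (2 powr real_of_int k)"
        have [measurable]: "B \<in> sets borel" by (simp add: B_def)
        have "ennreal (h y * v y) \<le> ennreal (g y * v y) + ennreal (t / 2) * ennreal (v y)" for y
        proof -
          have "h y * v y \<le> (g y + t / 2) * v y"
            using vnn[of y] t by (intro mult_right_mono) (auto simp: g_def indicator_def)
          then have "ennreal (h y * v y) \<le> ennreal (g y * v y + t / 2 * v y)"
            by (intro ennreal_leI) (simp add: distrib_right)
          also have "\<dots> = ennreal (g y * v y) + ennreal (t / 2) * ennreal (v y)"
            using vnn[of y] h t by (subst ennreal_plus) (auto simp: g_def ennreal_mult[symmetric])
          finally show ?thesis .
        qed
        then have "(\<integral>\<^sup>+y\<in>B. ennreal (h y * v y) \<partial>lborel)
            \<le> (\<integral>\<^sup>+y. ennreal (g y * v y) * indicator B y + ennreal (t / 2) * (ennreal (v y) * indicator B y) \<partial>lborel)"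
          by (intro nn_integral_mono) (auto simp: indicator_def)
        also have "\<dots> = (\<integral>\<^sup>+y\<in>B. ennreal (g y * v y) \<partial>lborel) + ennreal (t / 2) * (\<integral>\<^sup>+y\<in>B. ennreal (v y) \<partial>lborel)"
          by (subst nn_integral_add) (auto simp: nn_integral_cmult)
        also have "\<dots> \<le> ennreal (t / 2) * ennreal (wmeas v B) + ennreal (t / 2) * ennreal (wmeas v B)"
          using x(2)[unfolded Mmax_le_iff[OF v], rule_format, of k] ennreal_wmeas[OF v, of B x "2 powr real_of_int k"]
          by (intro add_mono) (auto simp: B_def)
        also have "\<dots> = (ennreal (t / 2) + ennreal (t / 2)) * ennreal (wmeas v B)" by (simp only: distrib_right)
        also have "ennreal (t / 2) + ennreal (t / 2) = ennreal t" using t by (subst ennreal_plus[symmetric]) (auto simp del: ennreal_plus)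
        finally show "(\<integral>\<^sup>+y\<in>ball x (2 powr real_of_int k). ennreal (h y * v y) \<partial>lborel) \<le> ennreal t * ennreal (wmeas v (ball x (2 powr real_of_int k)))"
          by (simp add: B_def)
      qed
      then show False using x(1) by simp
    qed
    then have "(\<integral>\<^sup>+x\<in>{x. ennreal t < Mmax v h x}. ennreal (v x) \<partial>lborel) \<le> (\<integral>\<^sup>+x\<in>{x. ennreal (t / 2) < Mmax v g x}. ennreal (v x) \<partial>lborel)"
      by (rule set_nn_integral_mono_set)
    also have "\<dots> = ennreal (2 / t) * (ennreal (t / 2) * (\<integral>\<^sup>+x\<in>{x. ennreal (t / 2) < Mmax v g x}. ennreal (v x) \<partial>lborel))"
      using t by (simp add: mult.assoc[symmetric] ennreal_mult[symmetric])
    also have "\<dots> \<le> ennreal (2 / t) * (ennreal K * (\<integral>\<^sup>+x. ennreal (g x * v x) \<partial>lborel))"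
      using t K dbl by (intro mult_left_mono Mmax_weak_type[OF v]) auto
    also have "\<dots> = ennreal (2 * K / t) * (\<integral>\<^sup>+x. ennreal (g x * v x) \<partial>lborel)"
      using t K by (simp add: mult.assoc[symmetric] ennreal_mult[symmetric])
    also have "(\<integral>\<^sup>+x. ennreal (g x * v x) \<partial>lborel) = (\<integral>\<^sup>+x. ennreal (h x * v x) * indicator {x. t / 2 < h x} x \<partial>lborel)"
      by (intro nn_integral_cong) (auto simp: g_def indicator_def)
    finally show ?thesis .
  qed
  have "(\<integral>\<^sup>+x. epow (Mmax v h x) s * ennreal (v x) \<partial>lborel)
      \<le> (\<integral>\<^sup>+x. (\<integral>\<^sup>+t. ennreal (s * t powr (s - 1)) * indicator {t. 0 < t \<and> ennreal t < Mmax v h x} t \<partial>lborel) * ennreal (v x) \<partial>lborel)"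
    using epow_layer_cake s by (intro nn_integral_mono mult_right_mono) auto
  also have "\<dots> = (\<integral>\<^sup>+x. (\<integral>\<^sup>+t. (if 0 < t \<and> ennreal t < Mmax v h x then ennreal (s * t powr (s - 1)) * ennreal (v x) else 0) \<partial>lborel) \<partial>lborel)"
  proof (intro nn_integral_cong)
    fix x
    have [measurable]: "{t. 0 < t \<and> ennreal t < Mmax v h x} \<in> sets borel" by measurable
    have "(\<integral>\<^sup>+t. ennreal (s * t powr (s - 1)) * indicator {t. 0 < t \<and> ennreal t < Mmax v h x} t \<partial>lborel) * ennreal (v x)
      = (\<integral>\<^sup>+t. ennreal (s * t powr (s - 1)) * indicator {t. 0 < t \<and> ennreal t < Mmax v h x} t * ennreal (v x) \<partial>lborel)"
      by (intro nn_integral_multc[symmetric]) measurable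
    also have "\<dots> = (\<integral>\<^sup>+t. (if 0 < t \<and> ennreal t < Mmax v h x then ennreal (s * t powr (s - 1)) * ennreal (v x) else 0) \<partial>lborel)"
      by (intro nn_integral_cong) (auto simp: indicator_def)
    finally show "(\<integral>\<^sup>+t. ennreal (s * t powr (s - 1)) * indicator {t. 0 < t \<and> ennreal t < Mmax v h x} t \<partial>lborel) * ennreal (v x) = \<dots>" .
  qed
  also have "\<dots> = (\<integral>\<^sup>+t. (\<integral>\<^sup>+x. (if 0 < t \<and> ennreal t < Mmax v h x then ennreal (s * t powr (s - 1)) * ennreal (v x) else 0) \<partial>lborel) \<partial>lborel)"
  proof -
    have [measurable]: "Measurable.pred (borel \<Otimes>\<^sub>M borel) (\<lambda>p::'a \<times> real. 0 < snd p \<and> ennreal (snd p) < Mmax v h (fst p))"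
      by measurable
    show ?thesis
      by (subst lborel_pair.Fubini') (auto simp: case_prod_beta')
  qed
  also have "\<dots> \<le> (\<integral>\<^sup>+t. (\<integral>\<^sup>+x. (if 0 < t \<and> t < 2 * h x then ennreal (2 * K * s * t powr (s - 2)) * ennreal (h x * v x) else 0) \<partial>lborel) \<partial>lborel)"
  proof (rule nn_integral_mono)
    fix t :: real
    show "(\<integral>\<^sup>+x. (if 0 < t \<and> ennreal t < Mmax v h x then ennreal (s * t powr (s - 1)) * ennreal (v x) else 0) \<partial>lborel)
      \<le> (\<integral>\<^sup>+x. (if 0 < t \<and> t < 2 * h x then ennreal (2 * K * s * t powr (s - 2)) * ennreal (h x * v x) else 0) \<partial>lborel)"
    proof (cases "0 < t")
      case True
      have "(\<integral>\<^sup>+x. (if 0 < t \<and> ennreal t < Mmax v h x then ennreal (s * t powr (s - 1)) * ennreal (v x) else 0) \<partial>lborel)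
         = (\<integral>\<^sup>+x. ennreal (s * t powr (s - 1)) * (ennreal (v x) * indicator {x. ennreal t < Mmax v h x} x) \<partial>lborel)"
        using True by (intro nn_integral_cong) (auto simp: indicator_def)
      also have "\<dots> = ennreal (s * t powr (s - 1)) * (\<integral>\<^sup>+x\<in>{x. ennreal t < Mmax v h x}. ennreal (v x) \<partial>lborel)"
        by (intro nn_integral_cmult) measurable
      also have "\<dots> \<le> ennreal (s * t powr (s - 1)) * (ennreal (2 * K / t) * (\<integral>\<^sup>+x. ennreal (h x * v x) * indicator {x. t / 2 < h x} x \<partial>lborel))"
        using weak[OF True] by (intro mult_left_mono) auto
      also have "\<dots> = ennreal (2 * K * s * t powr (s - 2)) * (\<integral>\<^sup>+x. ennreal (h x * v x) * indicator {x. t / 2 < h x} x \<partial>lborel)"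
      proof -
        have "t powr (s - 1) = t * t powr (s - 2)"
          using True powr_add[of t 1 "s - 2"] by simp
        then have "s * t powr (s - 1) * (2 * K / t) = 2 * K * s * t powr (s - 2)" using True by simp
        moreover have "ennreal (s * t powr (s - 1)) * ennreal (2 * K / t) = ennreal (s * t powr (s - 1) * (2 * K / t))"
          using True s K by (intro ennreal_mult[symmetric]) auto
        ultimately show ?thesis by (simp only: mult.assoc[symmetric])
      qed
      also have "\<dots> = (\<integral>\<^sup>+x. ennreal (2 * K * s * t powr (s - 2)) * (ennreal (h x * v x) * indicator {x. t / 2 < h x} x) \<partial>lborel)"
        by (intro nn_integral_cmult[symmetric]) measurable
      also have "\<dots> = (\<integral>\<^sup>+x. (if 0 < t \<and> t < 2 * h x then ennreal (2 * K * s * t powr (s - 2)) * ennreal (h x * v x) else 0) \<partial>lborel)"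
        using True by (intro nn_integral_cong) (auto simp: indicator_def)
      finally show ?thesis .
    qed simp
  qed
  also have "\<dots> = (\<integral>\<^sup>+x. (\<integral>\<^sup>+t. (if 0 < t \<and> t < 2 * h x then ennreal (2 * K * s * t powr (s - 2)) * ennreal (h x * v x) else 0) \<partial>lborel) \<partial>lborel)"
    by (subst lborel_pair.Fubini') (auto simp: case_prod_beta')
  also have "\<dots> = (\<integral>\<^sup>+x. ennreal (2 * K * s * (2 powr (s - 1) / (s - 1))) * ennreal (h x powr s * v x) \<partial>lborel)"
  proof (intro nn_integral_cong)
    fix x
    have "(\<integral>\<^sup>+t. (if 0 < t \<and> t < 2 * h x then ennreal (2 * K * s * t powr (s - 2)) * ennreal (h x * v x) else 0) \<partial>lborel)
       = (\<integral>\<^sup>+t. (ennreal (2 * K * s) * ennreal (h x * v x)) * (ennreal (t powr (s - 2)) * indicator {0<..<2 * h x} t) \<partial>lborel)"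
      using K s by (intro nn_integral_cong) (auto simp: indicator_def ennreal_mult mult_ac)
    also have "\<dots> = (ennreal (2 * K * s) * ennreal (h x * v x)) * ennreal ((2 * h x) powr (s - 2 + 1) / (s - 2 + 1))"
      using h s by (subst nn_integral_cmult) (auto simp: nn_integral_powr_from_0)
    also have "\<dots> = ennreal (2 * K * s * (h x * v x) * ((2 * h x) powr (s - 1) / (s - 1)))"
      using K s h vnn[of x] by (subst (1 2) ennreal_mult) auto
    also have "2 * K * s * (h x * v x) * ((2 * h x) powr (s - 1) / (s - 1)) = 2 * K * s * (2 powr (s - 1) / (s - 1)) * (h x powr s * v x)"
    proof -
      have "h x powr s = h x * h x powr (s - 1)"
        using h powr_add[of "h x" 1 "s - 1"] by (cases "h x = 0") (auto simp: less_le)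
      moreover have "(2 * h x) powr (s - 1) = 2 powr (s - 1) * h x powr (s - 1)" using h by (simp add: powr_mult)
      ultimately show ?thesis by simp
    qed
    also have "ennreal (2 * K * s * (2 powr (s - 1) / (s - 1)) * (h x powr s * v x)) = ennreal (2 * K * s * (2 powr (s - 1) / (s - 1))) * ennreal (h x powr s * v x)"
      using K s vnn[of x] by (intro ennreal_mult) auto
    finally show "(\<integral>\<^sup>+t. (if 0 < t \<and> t < 2 * h x then ennreal (2 * K * s * t powr (s - 2)) * ennreal (h x * v x) else 0) \<partial>lborel)
       = ennreal (2 * K * s * (2 powr (s - 1) / (s - 1))) * ennreal (h x powr s * v x)" .
  qed
  also have "\<dots> = ennreal (2 * K * s * (2 powr (s - 1) / (s - 1))) * (\<integral>\<^sup>+x. ennreal (h x powr s * v x) \<partial>lborel)"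
    by (intro nn_integral_cmult) measurable
  finally show "(\<integral>\<^sup>+x. epow (Mmax v h x) s * ennreal (v x) \<partial>lborel)
     \<le> ennreal (2 * K * s * (2 powr (s - 1) / (s - 1))) * (\<integral>\<^sup>+x. ennreal (h x powr s * v x) \<partial>lborel)" .
qed (use K s in auto)

section \<open>Fractional integrals\<close>

lemma pred_ball [measurable]: "Measurable.pred borel (\<lambda>y::'a::euclidean_space. y \<in> ball x r)"
  unfolding mem_ball by measurable

text \<open>Hoelder's inequality for f = (f v^(s - \<kappa>)) v^(- (s - \<kappa>)). For v =
  \<omega>^q, s = 1/p and \<kappa> = 1/p - 1/q the two powers of v are \<omega> and 1/\<omega>; the
  integral on the right is that of (f \<omega>)^p and the one bounded by \<open>S\<close> is that of
  \<omega>^(-p'). Leaving s free allows p to vary at fixed \<open>\<kappa>\<close>.\<close>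

lemma frac_Hoelder:
  fixes v f :: "'a::euclidean_space \<Rightarrow> real"
  assumes v: "wt v" and s: "0 < s" "s < 1"
    and f [measurable]: "f \<in> borel_measurable borel" and f0: "\<And>y. 0 \<le> f y" and B [measurable]: "B \<in> sets borel"
    and S: "0 \<le> S" "(\<integral>\<^sup>+y\<in>B. ennreal (v y powr (- ((s - \<kappa>) / (1 - s)))) \<partial>lborel) \<le> ennreal S"
  shows "(\<integral>\<^sup>+y\<in>B. ennreal (f y) \<partial>lborel)
    \<le> ennreal (S powr (1 - s)) * epow (\<integral>\<^sup>+y\<in>B. ennreal (f y powr (1 / s) * v y powr (1 - \<kappa> / s)) \<partial>lborel) s"
proof -
  note [measurable] = wtD(2)[OF v]
  define F where "F y = ennreal (f y powr (1 / s) * v y powr (1 - \<kappa> / s)) * indicator B y" for y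
  define V where "V y = ennreal (v y powr (- ((s - \<kappa>) / (1 - s)))) * indicator B y" for y
  have [measurable]: "F \<in> borel_measurable borel" "V \<in> borel_measurable borel" unfolding F_def V_def by measurable
  have "(\<integral>\<^sup>+y\<in>B. ennreal (f y) \<partial>lborel) = (\<integral>\<^sup>+y. epow (F y) s * epow (V y) (1 - s) \<partial>lborel)"
  proof (rule nn_integral_cong_AE)
    show "AE y in lborel. ennreal (f y) * indicator B y = epow (F y) s * epow (V y) (1 - s)"
      using wtD(3)[OF v]
    proof eventually_elim
      case (elim y)
      show ?case
      proof (cases "y \<in> B")
        case True
        have e1: "(1 - \<kappa> / s) * s = s - \<kappa>" using s by (simp add: field_simps)
        have e2: "- ((s - \<kappa>) / (1 - s)) * (1 - s) = - (s - \<kappa>)" using s by simp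
        have "epow (F y) s * epow (V y) (1 - s)
            = ennreal ((f y powr (1 / s) * v y powr (1 - \<kappa> / s)) powr s * (v y powr (- ((s - \<kappa>) / (1 - s)))) powr (1 - s))"
          using True by (simp add: F_def V_def flip: ennreal_mult)
        also have "(f y powr (1 / s) * v y powr (1 - \<kappa> / s)) powr s = f y * v y powr (s - \<kappa>)"
          using s f0[of y] by (simp only: powr_mult powr_powr e1) simp
        also have "(v y powr (- ((s - \<kappa>) / (1 - s)))) powr (1 - s) = v y powr (- (s - \<kappa>))"
          by (simp only: powr_powr e2)
        also have "f y * v y powr (s - \<kappa>) * v y powr (- (s - \<kappa>)) = f y"
          using elim by (simp add: powr_add[symmetric] mult.assoc)
        finally show ?thesis using True by simp
      qed (simp add: F_def V_def)
    qed
  qed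
  also have "\<dots> \<le> epow (\<integral>\<^sup>+y. F y \<partial>lborel) s * epow (\<integral>\<^sup>+y. V y \<partial>lborel) (1 - s)"
    using s by (intro nn_integral_Hoelder) measurable
  also have "\<dots> \<le> epow (\<integral>\<^sup>+y. F y \<partial>lborel) s * epow (ennreal S) (1 - s)"
    using s S by (intro mult_left_mono epow_mono) (auto simp: V_def)
  finally show ?thesis using S(1) by (simp add: F_def mult.commute)
qed

lemma mpair_sigma_eq:
  assumes "mpair \<theta> A v \<sigma>" "0 < \<theta>" "\<theta> < 1"
  shows "AE y in lborel. \<sigma> y = v y powr (- (\<theta> / (1 - \<theta>)))"
proof -
  have v: "wt v" and s: "wt \<sigma>" and e: "AE x in lborel. v x powr \<theta> * \<sigma> x powr (1 - \<theta>) = 1"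
    using assms by (auto simp: mpair_def)
  show ?thesis using wtD(3)[OF v] wtD(3)[OF s] e
  proof eventually_elim
    case (elim y)
    then have "\<sigma> y powr (1 - \<theta>) = v y powr (- \<theta>)" by (simp add: powr_minus field_simps)
    then have "(\<sigma> y powr (1 - \<theta>)) powr (1 / (1 - \<theta>)) = (v y powr (- \<theta>)) powr (1 / (1 - \<theta>))" by simp
    then show ?case using elim assms by (simp add: powr_powr)
  qed
qed

text \<open>Openness of the weight condition: the local Hoelder bound holds at \<tau> = 1/p by the
  pair condition and also at some larger \<tau>0, that is, at a smaller p, by the reverse Hoelder
  inequality for \<open>\<sigma>\<close>. The power of the volume is the same in both cases since
  \<open>\<kappa>\<close> is unchanged.\<close>

lemma frac_local:
  fixes \<kappa> \<tau> A :: real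
  assumes \<kappa>: "0 < \<kappa>" "\<kappa> < \<tau>" "\<tau> < 1"
  defines "\<theta> \<equiv> (\<tau> - \<kappa>) / (1 - \<kappa>)"
  shows "\<exists>\<tau>0 A'. \<tau> < \<tau>0 \<and> \<tau>0 < 1 \<and> 0 < A' \<and> (\<forall>(v::'a::euclidean_space \<Rightarrow> real) \<sigma> f x r s. mpair \<theta> A v \<sigma> \<longrightarrow> f \<in> borel_measurable borel \<longrightarrow>
    (\<forall>y. 0 \<le> f y) \<longrightarrow> 0 < r \<longrightarrow> s = \<tau> \<or> s = \<tau>0 \<longrightarrow>
    (\<integral>\<^sup>+y\<in>ball x r. ennreal (f y) \<partial>lborel)
      \<le> ennreal (A' * measure lborel (ball x r) powr (1 - \<kappa>) * wmeas v (ball x r) powr (\<kappa> - s))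
         * epow (\<integral>\<^sup>+y\<in>ball x r. ennreal (f y powr (1 / s) * v y powr (1 - \<kappa> / s)) \<partial>lborel) s)"
proof -
  have \<theta>: "0 < \<theta>" "\<theta> < 1" using \<kappa> by (auto simp: \<theta>_def)
  have \<theta>1: "1 - \<theta> = (1 - \<tau>) / (1 - \<kappa>)" using \<kappa> by (simp add: \<theta>_def field_simps)
  have \<theta>r: "\<theta> / (1 - \<theta>) = (\<tau> - \<kappa>) / (1 - \<tau>)" using \<kappa> unfolding \<theta>1 by (simp add: \<theta>_def)
  obtain \<delta> C where \<delta>: "0 < \<delta>" "0 < C" and RH: "\<And>(v::'a \<Rightarrow> real) \<sigma> x r. mpair \<theta> A v \<sigma> \<Longrightarrow> 0 < r \<Longrightarrow>
    (\<integral>\<^sup>+y\<in>ball x r. ennreal (\<sigma> y powr (1 + \<delta>)) \<partial>lborel)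
      \<le> ennreal (C * (wmeas \<sigma> (ball x r) / measure lborel (ball x r)) powr (1 + \<delta>) * measure lborel (ball x r))"
    using reverse_Hoelder[OF \<theta>, of A, where 'a='a] by blast
  define e where "e = (1 + \<delta>) * ((\<tau> - \<kappa>) / (1 - \<tau>))"
  have e: "0 < e" using \<delta> \<kappa> by (simp add: e_def)
  \<comment> \<open>Solution of (\<tau>0 - \<kappa>) / (1 - \<tau>0) = e: the dual power of
    \<open>v\<close> at \<tau>0 is exactly \<sigma>^(1 + \<delta>).\<close>
  define \<tau>0 where "\<tau>0 = (e + \<kappa>) / (1 + e)"
  have t1: "\<tau>0 - \<kappa> = e * (1 - \<tau>0)" "1 - \<tau>0 = (1 - \<kappa>) / (1 + e)" using e by (auto simp: \<tau>0_def field_simps)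
  have \<tau>01: "\<tau>0 < 1" using t1(2) \<kappa> e by (metis add_pos_pos diff_gt_0_iff_gt divide_pos_pos less_trans zero_less_one)
  have eexp: "e * (1 - \<tau>) = (1 + \<delta>) * (\<tau> - \<kappa>)" using \<kappa> by (simp add: e_def)
  have "e * (1 - \<tau>) > \<tau> - \<kappa>" unfolding eexp using \<delta> \<kappa> by (simp add: field_simps)
  then have \<tau>0: "\<tau> < \<tau>0" using e by (simp add: \<tau>0_def field_simps)
  \<comment> \<open>Exponent to which the pair condition at \<tau> is raised in order to produce the
    exponents belonging to \<tau>0, as \<open>\<rho>1\<close> and \<open>\<rho>2\<close>
    record.\<close>
  define \<rho> where "\<rho> = (\<tau>0 - \<kappa>) / (\<tau> - \<kappa>)"
  have \<rho>: "0 < \<rho>" using \<kappa> \<tau>0 by (simp add: \<rho>_def)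
  have \<rho>1: "(\<tau> - \<kappa>) * \<rho> = \<tau>0 - \<kappa>" using \<kappa> by (simp add: \<rho>_def)
  have \<rho>2: "(1 - \<tau>) * \<rho> = (1 + \<delta>) * (1 - \<tau>0)"
  proof -
    have "(1 - \<tau>) * \<rho> = (e * (1 - \<tau>)) * (1 - \<tau>0) / (\<tau> - \<kappa>)" by (simp add: \<rho>_def t1(1))
    then show ?thesis unfolding eexp using \<kappa> by simp
  qed
  define A' where "A' = 1 + A powr (1 - \<kappa>) + C powr (1 - \<tau>0) * A powr ((1 - \<kappa>) * \<rho>)"
  have A'_pos: "0 < A'" by (simp add: A'_def add_pos_nonneg)
  have "(\<integral>\<^sup>+y\<in>ball x r. ennreal (f y) \<partial>lborel)
      \<le> ennreal (A' * measure lborel (ball x r) powr (1 - \<kappa>) * wmeas v (ball x r) powr (\<kappa> - s))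
         * epow (\<integral>\<^sup>+y\<in>ball x r. ennreal (f y powr (1 / s) * v y powr (1 - \<kappa> / s)) \<partial>lborel) s"
    if m: "mpair \<theta> A v \<sigma>" and f: "f \<in> borel_measurable borel" "\<forall>y. 0 \<le> f y" and r: "0 < r" and s: "s = \<tau> \<or> s = \<tau>0"
    for v \<sigma> f :: "'a \<Rightarrow> real" and x r s
  proof -
    define B where "B = ball x r"
    have v: "wt v" and sg: "wt \<sigma>" using m by (auto simp: mpair_def)
    define b where "b = measure lborel B"
    define w where "w = wmeas v B"
    define g where "g = wmeas \<sigma> B"
    have b: "0 < b" unfolding b_def B_def using r by (rule measure_ball_pos)
    have w: "0 < w" unfolding w_def B_def using v r by (rule wmeas_ball_pos)
    have g: "0 < g" unfolding g_def B_def using sg r by (rule wmeas_ball_pos)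
    have A1: "1 \<le> A" using ainf_ge_1[OF mpair_ainf[OF m \<theta>]] .
    have s1: "0 < s" "s < 1" using s \<kappa> \<tau>0 \<tau>01 by auto
    have "w powr \<theta> * g powr (1 - \<theta>) \<le> A * b" using m r by (auto simp: mpair_def w_def g_def b_def B_def)
    then have "(w powr \<theta> * g powr (1 - \<theta>)) powr (1 - \<kappa>) \<le> (A * b) powr (1 - \<kappa>)"
      using \<kappa> by (intro powr_mono2) auto
    then have "w powr (\<theta> * (1 - \<kappa>)) * g powr ((1 - \<theta>) * (1 - \<kappa>)) \<le> A powr (1 - \<kappa>) * b powr (1 - \<kappa>)"
      using A1 b by (simp only: powr_mult powr_powr)
    moreover have "\<theta> * (1 - \<kappa>) = \<tau> - \<kappa>" "(1 - \<theta>) * (1 - \<kappa>) = 1 - \<tau>" unfolding \<theta>1 using \<kappa> by (auto simp: \<theta>_def)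
    ultimately have Apq: "w powr (\<tau> - \<kappa>) * g powr (1 - \<tau>) \<le> A powr (1 - \<kappa>) * b powr (1 - \<kappa>)" by simp
    have sig: "AE y in lborel. \<sigma> y = v y powr (- ((\<tau> - \<kappa>) / (1 - \<tau>)))"
      using mpair_sigma_eq[OF m \<theta>] unfolding \<theta>r .
    \<comment> \<open>The dual integral to be bounded is the mass of \<open>\<sigma>\<close> for s =
      \<tau> and the integral of \<sigma>^(1 + \<delta>) for s = \<tau>0.\<close>
    have ex: "\<exists>S\<ge>0. (\<integral>\<^sup>+y\<in>B. ennreal (v y powr (- ((s - \<kappa>) / (1 - s)))) \<partial>lborel) \<le> ennreal S
        \<and> S powr (1 - s) \<le> A' * b powr (1 - \<kappa>) * w powr (\<kappa> - s)"
    proof (cases "s = \<tau>")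
      case True
      have "(\<integral>\<^sup>+y\<in>B. ennreal (v y powr (- ((s - \<kappa>) / (1 - s)))) \<partial>lborel) = (\<integral>\<^sup>+y\<in>B. ennreal (\<sigma> y) \<partial>lborel)"
        by (rule nn_integral_cong_AE) (use sig in \<open>eventually_elim, simp add: True\<close>)
      also have "\<dots> = ennreal g" using ennreal_wmeas[OF sg, of B x r] by (simp add: g_def B_def)
      finally have 1: "(\<integral>\<^sup>+y\<in>B. ennreal (v y powr (- ((s - \<kappa>) / (1 - s)))) \<partial>lborel) \<le> ennreal g" by simp
      have "g powr (1 - \<tau>) \<le> A powr (1 - \<kappa>) * b powr (1 - \<kappa>) / w powr (\<tau> - \<kappa>)"
        using Apq w by (subst pos_le_divide_eq) (auto simp: mult.commute)
      also have "\<dots> = A powr (1 - \<kappa>) * b powr (1 - \<kappa>) * w powr (\<kappa> - \<tau>)"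
        using powr_minus_divide[of w "\<tau> - \<kappa>"] by simp
      also have "\<dots> \<le> A' * b powr (1 - \<kappa>) * w powr (\<kappa> - \<tau>)"
        by (intro mult_right_mono) (auto simp: A'_def)
      finally show ?thesis using 1 g True by (intro exI[of _ g]) auto
    next
      case False
      then have s0: "s = \<tau>0" using s by simp
      define a where "a = g / b"
      have a: "0 < a" using g b by (simp add: a_def)
      have "(\<integral>\<^sup>+y\<in>B. ennreal (v y powr (- ((s - \<kappa>) / (1 - s)))) \<partial>lborel) = (\<integral>\<^sup>+y\<in>B. ennreal (\<sigma> y powr (1 + \<delta>)) \<partial>lborel)"
      proof (rule nn_integral_cong_AE)
        have "(\<tau>0 - \<kappa>) / (1 - \<tau>0) = e" using \<tau>01 by (simp add: t1(1))
        then have ex: "- ((s - \<kappa>) / (1 - s)) = - ((\<tau> - \<kappa>) / (1 - \<tau>)) * (1 + \<delta>)"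
          unfolding s0 by (simp only: e_def) simp
        show "AE y in lborel. ennreal (v y powr (- ((s - \<kappa>) / (1 - s)))) * indicator B y = ennreal (\<sigma> y powr (1 + \<delta>)) * indicator B y"
          using sig by eventually_elim (simp only: ex powr_powr)
      qed
      also have "\<dots> \<le> ennreal (C * a powr (1 + \<delta>) * b)"
        using RH[OF m r, of x] by (simp add: a_def g_def b_def B_def)
      finally have 1: "(\<integral>\<^sup>+y\<in>B. ennreal (v y powr (- ((s - \<kappa>) / (1 - s)))) \<partial>lborel) \<le> ennreal (C * a powr (1 + \<delta>) * b)" .
      have "w powr (\<tau> - \<kappa>) * a powr (1 - \<tau>) \<le> A powr (1 - \<kappa>) * b powr (\<tau> - \<kappa>)"
      proof -
        have "w powr (\<tau> - \<kappa>) * a powr (1 - \<tau>) = w powr (\<tau> - \<kappa>) * g powr (1 - \<tau>) / b powr (1 - \<tau>)"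
          using g b by (simp add: a_def powr_divide)
        also have "\<dots> \<le> A powr (1 - \<kappa>) * b powr (1 - \<kappa>) / b powr (1 - \<tau>)"
          using Apq by (intro divide_right_mono) auto
        also have "\<dots> = A powr (1 - \<kappa>) * b powr ((1 - \<kappa>) - (1 - \<tau>))"
          using powr_diff[of b "1 - \<kappa>" "1 - \<tau>"] by simp
        finally show ?thesis by simp
      qed
      then have "(w powr (\<tau> - \<kappa>) * a powr (1 - \<tau>)) powr \<rho> \<le> (A powr (1 - \<kappa>) * b powr (\<tau> - \<kappa>)) powr \<rho>"
        using \<rho> by (intro powr_mono2) auto
      then have 2: "w powr (\<tau>0 - \<kappa>) * a powr ((1 + \<delta>) * (1 - \<tau>0)) \<le> A powr ((1 - \<kappa>) * \<rho>) * b powr (\<tau>0 - \<kappa>)"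
        by (simp only: powr_mult powr_powr \<rho>1 \<rho>2)
      have "(C * a powr (1 + \<delta>) * b) powr (1 - \<tau>0) = C powr (1 - \<tau>0) * b powr (1 - \<tau>0) * a powr ((1 + \<delta>) * (1 - \<tau>0))"
        using \<delta> a b by (simp add: powr_mult powr_powr)
      also have "a powr ((1 + \<delta>) * (1 - \<tau>0)) \<le> A powr ((1 - \<kappa>) * \<rho>) * b powr (\<tau>0 - \<kappa>) / w powr (\<tau>0 - \<kappa>)"
        using 2 w by (subst pos_le_divide_eq) (auto simp: mult.commute)
      also have "A powr ((1 - \<kappa>) * \<rho>) * b powr (\<tau>0 - \<kappa>) / w powr (\<tau>0 - \<kappa>) = A powr ((1 - \<kappa>) * \<rho>) * b powr (\<tau>0 - \<kappa>) * w powr (\<kappa> - \<tau>0)"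
        using powr_minus_divide[of w "\<tau>0 - \<kappa>"] by simp
      also have "C powr (1 - \<tau>0) * b powr (1 - \<tau>0) * (A powr ((1 - \<kappa>) * \<rho>) * b powr (\<tau>0 - \<kappa>) * w powr (\<kappa> - \<tau>0))
          = C powr (1 - \<tau>0) * A powr ((1 - \<kappa>) * \<rho>) * (b powr (1 - \<tau>0) * b powr (\<tau>0 - \<kappa>)) * w powr (\<kappa> - \<tau>0)"
        by (simp only: mult_ac)
      also have "b powr (1 - \<tau>0) * b powr (\<tau>0 - \<kappa>) = b powr (1 - \<kappa>)" by (simp add: powr_add[symmetric])
      also have "C powr (1 - \<tau>0) * A powr ((1 - \<kappa>) * \<rho>) * b powr (1 - \<kappa>) * w powr (\<kappa> - \<tau>0) \<le> A' * b powr (1 - \<kappa>) * w powr (\<kappa> - \<tau>0)"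
        by (intro mult_right_mono) (auto simp: A'_def)
      finally have "(C * a powr (1 + \<delta>) * b) powr (1 - s) \<le> A' * b powr (1 - \<kappa>) * w powr (\<kappa> - s)"
        by (simp add: s0 mult_left_mono)
      then show ?thesis using 1 \<delta> b by (intro exI[of _ "C * a powr (1 + \<delta>) * b"]) auto
    qed
    then obtain S where S: "0 \<le> S" "(\<integral>\<^sup>+y\<in>B. ennreal (v y powr (- ((s - \<kappa>) / (1 - s)))) \<partial>lborel) \<le> ennreal S"
      "S powr (1 - s) \<le> A' * b powr (1 - \<kappa>) * w powr (\<kappa> - s)" by blast
    have "(\<integral>\<^sup>+y\<in>B. ennreal (f y) \<partial>lborel)
      \<le> ennreal (S powr (1 - s)) * epow (\<integral>\<^sup>+y\<in>B. ennreal (f y powr (1 / s) * v y powr (1 - \<kappa> / s)) \<partial>lborel) s"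
      using f by (intro frac_Hoelder[OF v s1 _ _ _ S(1,2)]) (auto simp: B_def)
    also have "\<dots> \<le> ennreal (A' * b powr (1 - \<kappa>) * w powr (\<kappa> - s)) * epow (\<integral>\<^sup>+y\<in>B. ennreal (f y powr (1 / s) * v y powr (1 - \<kappa> / s)) \<partial>lborel) s"
      using S(3) by (intro mult_right_mono ennreal_leI) auto
    finally show ?thesis by (simp add: B_def b_def w_def)
  qed
  then show ?thesis using \<tau>0 \<tau>01 A'_pos by blast
qed

text \<open>The inverse is taken in \<open>ennreal\<close>, so the kernel is infinite on the diagonal, whereas real
  division makes \<open>comm_kernel\<close> vanish there.\<close>

definition riesz :: "real \<Rightarrow> ('a::euclidean_space \<Rightarrow> real) \<Rightarrow> 'a \<Rightarrow> ennreal" where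
  "riesz \<kappa> f x = (\<integral>\<^sup>+y. ennreal (f y) * inverse (ennreal (dist x y powr (real DIM('a) * (1 - \<kappa>)))) \<partial>lborel)"

section \<open>Dyadic decomposition of the fractional integral and Hedberg's inequality\<close>

lemma inverse_ennreal_powr: "0 < d \<Longrightarrow> inverse (ennreal (d powr e)) = ennreal (d powr (- e))"
  by (simp add: inverse_ennreal powr_minus)

text \<open>Bounds the contribution of the shell 2^(i - 1) \<le> |x - y| < 2^i: the kernel is taken
  at the inner radius, the integral over the whole ball, as the local bounds are stated on
  balls.\<close>

definition dyad :: "real \<Rightarrow> ('a::euclidean_space \<Rightarrow> real) \<Rightarrow> 'a \<Rightarrow> int \<Rightarrow> ennreal" where
  "dyad \<kappa> f x i = ennreal ((2 powr (real_of_int i - 1)) powr (- (real DIM('a) * (1 - \<kappa>)))) * (\<integral>\<^sup>+y\<in>ball x (2 powr real_of_int i). ennreal (f y) \<partial>lborel)"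

lemma suminf_ge_term: "f k \<le> (\<Sum>k. f k :: ennreal)"
  using sum_le_suminf[of f "{k}"] by simp

text \<open>The free index \<open>j\<close> separates small balls from large ones and is chosen in
  Hedberg's argument. The point y = x, where the kernel is infinite, is a null set.\<close>

lemma riesz_dyadic:
  fixes f :: "'a::euclidean_space \<Rightarrow> real"
  assumes [measurable]: "f \<in> borel_measurable borel" and \<kappa>: "\<kappa> < 1"
  shows "riesz \<kappa> f x \<le> (\<Sum>k. dyad \<kappa> f x (j - int k)) + (\<Sum>k. dyad \<kappa> f x (j + 1 + int k))"
proof -
  define e where "e = real DIM('a) * (1 - \<kappa>)"
  have e: "0 \<le> e" using \<kappa> by (simp add: e_def)
  define c where "c i = ennreal ((2 powr (real_of_int i - 1)) powr (- e))" for i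
  define g where "g i y = c i * (ennreal (f y) * indicator (ball x (2 powr real_of_int i)) y)" for i y
  have g_meas [measurable]: "g i \<in> borel_measurable borel" for i
    unfolding g_def by (intro borel_measurable_times_ennreal borel_measurable_const borel_measurable_indicator
      measurable_compose[OF assms(1) measurable_ennreal]) simp_all
  have "riesz \<kappa> f x \<le> (\<integral>\<^sup>+y. (\<Sum>k. g (j - int k) y) + (\<Sum>k. g (j + 1 + int k) y) \<partial>lborel)"
    unfolding riesz_def e_def[symmetric]
  proof (rule nn_integral_mono_AE)
    show "AE y in lborel. ennreal (f y) * inverse (ennreal (dist x y powr e)) \<le> (\<Sum>k. g (j - int k) y) + (\<Sum>k. g (j + 1 + int k) y)"
      using AE_lborel_singleton[of x]
    proof eventually_elim
      case (elim y)
      define d where "d = dist x y"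
      have d: "0 < d" using elim by (simp add: d_def)
      define i where "i = \<lfloor>log 2 d\<rfloor> + 1"
      have "real_of_int i - 1 \<le> log 2 d" "log 2 d < real_of_int i" unfolding i_def by linarith+
      then have i: "2 powr (real_of_int i - 1) \<le> d" "d < 2 powr real_of_int i"
        using d by (simp_all add: le_log_iff log_less_iff)
      have "d powr (- e) \<le> (2 powr (real_of_int i - 1)) powr (- e)"
        using i(1) e by (intro powr_mono2') auto
      then have "ennreal (f y) * inverse (ennreal (d powr e)) \<le> ennreal (f y) * c i"
        unfolding inverse_ennreal_powr[OF d] c_def by (intro mult_left_mono ennreal_leI) auto
      also have "\<dots> = g i y" using i(2) by (simp add: g_def d_def mult.commute)
      also have "\<dots> \<le> (\<Sum>k. g (j - int k) y) + (\<Sum>k. g (j + 1 + int k) y)"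
      proof (cases "i \<le> j")
        case True
        then have "g i y = g (j - int (nat (j - i))) y" by simp
        also have "\<dots> \<le> (\<Sum>k. g (j - int k) y)" by (rule suminf_ge_term)
        finally show ?thesis by (rule order_trans) simp
      next
        case False
        then have "g i y = g (j + 1 + int (nat (i - j - 1))) y" by simp
        also have "\<dots> \<le> (\<Sum>k. g (j + 1 + int k) y)" by (rule suminf_ge_term)
        finally show ?thesis by (rule order_trans) simp
      qed
      finally show ?case by (simp add: d_def)
    qed
  qed
  also have "\<dots> = (\<Sum>k. \<integral>\<^sup>+y. g (j - int k) y \<partial>lborel) + (\<Sum>k. \<integral>\<^sup>+y. g (j + 1 + int k) y \<partial>lborel)"
    by (subst nn_integral_add) (simp_all add: nn_integral_suminf)
  also have "(\<lambda>i. \<integral>\<^sup>+y. g i y \<partial>lborel) = dyad \<kappa> f x"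
    unfolding g_def by (intro ext) (simp add: nn_integral_cmult dyad_def c_def e_def)
  finally show ?thesis by (simp add: fun_eq_iff)
qed

lemma riesz_eq_0:
  fixes f :: "'a::euclidean_space \<Rightarrow> real"
  assumes "f \<in> borel_measurable borel" "\<kappa> < 1"
    and "\<And>k::int. (\<integral>\<^sup>+y\<in>ball x (2 powr real_of_int k). ennreal (f y) \<partial>lborel) = 0"
  shows "riesz \<kappa> f x = 0"
proof -
  have "dyad \<kappa> f x = (\<lambda>_. 0)" by (intro ext) (simp add: dyad_def assms(3))
  then show ?thesis using riesz_dyadic[OF assms(1,2), of x 0] by simp
qed

lemma suminf_geometric_ennreal:
  assumes "0 \<le> c" "0 \<le> q" "q < 1"
  shows "(\<Sum>k. ennreal (c * q ^ k)) = ennreal (c / (1 - q))"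
proof -
  have "(\<Sum>k. ennreal (c * q ^ k)) = ennreal (\<Sum>k. c * q ^ k)"
    using assms by (intro suminf_ennreal2 summable_mult summable_geometric) auto
  also have "(\<Sum>k. c * q ^ k) = c / (1 - q)"
    using assms by (subst suminf_mult) (auto simp: suminf_geometric)
  finally show ?thesis .
qed

text \<open>\<open>W\<close> decreases geometrically to 0 towards minus infinity and is unbounded
  towards infinity, so it crosses every positive level \<open>T\<close>.\<close>

lemma geometric_threshold:
  fixes W :: "int \<Rightarrow> real"
  assumes W: "\<And>i. 0 < W i" and \<rho>: "0 < \<rho>" "\<rho> < 1" and le: "\<And>i. W i \<le> \<rho> * W (i + 1)" and T: "0 < T"
  shows "\<exists>j. W j \<le> T \<and> T < W (j + 1)"
    and "W (i - int k) \<le> \<rho> ^ k * W i"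
proof -
  have down: "W (i - int k) \<le> \<rho> ^ k * W i" for i k
  proof (induction k)
    case (Suc k)
    have "W (i - int (Suc k)) \<le> \<rho> * W (i - int k)" using le[of "i - int (Suc k)"] by simp
    also have "\<dots> \<le> \<rho> * (\<rho> ^ k * W i)" using Suc \<rho> by (intro mult_left_mono) auto
    finally show ?case by simp
  qed simp
  then show "W (i - int k) \<le> \<rho> ^ k * W i" .
  obtain k where "\<rho> ^ k < T / W 0" using real_arch_pow_inv[of "T / W 0" \<rho>] T W[of 0] \<rho> by auto
  then have "\<rho> ^ k * W 0 < T" using W[of 0] by (simp add: field_simps)
  then have i0: "W (- int k) \<le> T" using down[of 0 k] by simp
  define i0 where "i0 = - int k"
  obtain l where "\<rho> ^ l < W i0 / T" using real_arch_pow_inv[of "W i0 / T" \<rho>] T W[of i0] \<rho> by auto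
  then have "\<rho> ^ l * T < W i0" using T by (simp add: field_simps)
  also have "W i0 \<le> \<rho> ^ l * W (i0 + int l)" using down[of "i0 + int l" l] by simp
  finally have "T < W (i0 + int l)" using \<rho> by (simp add: mult_less_cancel_left)
  then have ex: "\<exists>l. T < W (i0 + int l)" by blast
  define l0 where "l0 = (LEAST l. T < W (i0 + int l))"
  have l0: "T < W (i0 + int l0)" unfolding l0_def using ex by (rule LeastI_ex)
  have "l0 \<noteq> 0"
  proof
    assume "l0 = 0"
    then show False using l0 i0 by (simp add: i0_def)
  qed
  then obtain l1 where l1: "l0 = Suc l1" by (cases l0) auto
  have "\<not> T < W (i0 + int l1)" using not_less_Least[of l1 "\<lambda>l. T < W (i0 + int l)"] l1 by (simp add: l0_def)
  then show "\<exists>j. W j \<le> T \<and> T < W (j + 1)"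
    using l0 by (intro exI[of _ "i0 + int l1"]) (simp add: l1 add_ac not_less)
qed

text \<open>Below the threshold the bound with \<open>m\<close> sums geometrically, above it the
  bound with \<open>G\<close> does. \<open>T\<close> is the mass at which both bounds agree,
  T^\<kappa> m = T^(\<kappa> - \<tau>) G, which yields the interpolated powers of \<open>G\<close>
  and \<open>m\<close>.\<close>

lemma Hedberg_sum:
  fixes W :: "int \<Rightarrow> real" and I :: "int \<Rightarrow> ennreal"
  assumes W: "\<And>i. 0 < W i" and \<rho>: "0 < \<rho>" "\<rho> < 1" and le: "\<And>i. W i \<le> \<rho> * W (i + 1)"
    and \<kappa>: "0 < \<kappa>" "\<kappa> < \<tau>" and pos: "0 < a" "0 < m" "0 < G"
    and inner: "\<And>i. I i \<le> ennreal (a * W i powr \<kappa> * m)"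
    and outer: "\<And>i. I i \<le> ennreal (a * W i powr (\<kappa> - \<tau>) * G)"
  shows "\<exists>j. (\<Sum>k. I (j - int k)) + (\<Sum>k. I (j + 1 + int k))
    \<le> ennreal (a * (1 / (1 - \<rho> powr \<kappa>) + 1 / (1 - \<rho> powr (\<tau> - \<kappa>))) * (G powr (\<kappa> / \<tau>) * m powr (1 - \<kappa> / \<tau>)))"
proof -
  define T where "T = (G / m) powr (1 / \<tau>)"
  have T: "0 < T" using pos by (simp add: T_def)
  obtain j where j: "W j \<le> T" "T < W (j + 1)" using geometric_threshold(1)[of W \<rho> T, OF W \<rho> le T] by blast
  define q1 where "q1 = \<rho> powr \<kappa>"
  define q2 where "q2 = \<rho> powr (\<tau> - \<kappa>)"
  have q: "0 < q1" "q1 < 1" "0 < q2" "q2 < 1"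
    using \<rho> \<kappa> powr_less_mono2[of \<kappa> \<rho> 1] powr_less_mono2[of "\<tau> - \<kappa>" \<rho> 1] by (auto simp: q1_def q2_def)
  define Z where "Z = G powr (\<kappa> / \<tau>) * m powr (1 - \<kappa> / \<tau>)"
  have Z1: "m * T powr \<kappa> = Z"
  proof -
    have "T powr \<kappa> = G powr (\<kappa> / \<tau>) / m powr (\<kappa> / \<tau>)"
      using pos by (simp add: T_def powr_powr powr_divide)
    moreover have "m powr (1 - \<kappa> / \<tau>) = m / m powr (\<kappa> / \<tau>)" using pos by (simp add: powr_diff)
    ultimately show ?thesis by (simp add: Z_def)
  qed
  have Z2: "G * T powr (\<kappa> - \<tau>) = Z"
  proof -
    have "T powr (\<kappa> - \<tau>) = T powr \<kappa> / T powr \<tau>" by (simp add: powr_diff)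
    also have "T powr \<tau> = G / m" using pos \<kappa> by (simp add: T_def powr_powr)
    finally show ?thesis using pos by (simp add: Z1[symmetric] field_simps)
  qed
  have "(\<Sum>k. I (j - int k)) \<le> (\<Sum>k. ennreal (a * Z * q1 ^ k))"
  proof (intro suminf_le allI)
    fix k
    have "W (j - int k) powr \<kappa> \<le> (\<rho> ^ k * T) powr \<kappa>"
      using geometric_threshold(2)[of W \<rho> T j k, OF W \<rho> le T] j \<rho> \<kappa> W[of "j - int k"]
      by (intro powr_mono2) (auto intro: order_trans mult_left_mono)
    also have "\<dots> = q1 ^ k * T powr \<kappa>"
      using \<rho> T by (simp add: powr_mult q1_def powr_realpow[symmetric] powr_powr mult.commute)
    finally have "a * W (j - int k) powr \<kappa> * m \<le> a * (q1 ^ k * T powr \<kappa>) * m"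
      using pos by (intro mult_right_mono mult_left_mono) auto
    also have "\<dots> = a * Z * q1 ^ k" by (simp add: Z1[symmetric])
    finally show "I (j - int k) \<le> ennreal (a * Z * q1 ^ k)"
      using inner[of "j - int k"] by (meson ennreal_leI order_trans)
  qed auto
  also have "\<dots> = ennreal (a * Z / (1 - q1))"
    using q pos by (intro suminf_geometric_ennreal) (auto simp: Z_def)
  finally have 1: "(\<Sum>k. I (j - int k)) \<le> ennreal (a * Z / (1 - q1))" .
  have "(\<Sum>k. I (j + 1 + int k)) \<le> (\<Sum>k. ennreal (a * Z * q2 ^ k))"
  proof (intro suminf_le allI)
    fix k
    have "T \<le> \<rho> ^ k * W (j + 1 + int k)"
      using geometric_threshold(2)[of W \<rho> T "j + 1 + int k" k, OF W \<rho> le T] j by simp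
    then have "T / \<rho> ^ k \<le> W (j + 1 + int k)" using \<rho> by (simp add: field_simps)
    then have "W (j + 1 + int k) powr (\<kappa> - \<tau>) \<le> (T / \<rho> ^ k) powr (\<kappa> - \<tau>)"
      using T \<rho> \<kappa> by (intro powr_mono2') auto
    also have "\<dots> = q2 ^ k * T powr (\<kappa> - \<tau>)"
    proof -
      have "(\<rho> ^ k) powr (\<kappa> - \<tau>) * q2 ^ k = 1"
        using \<rho> by (simp add: q2_def powr_realpow[symmetric] powr_powr powr_add[symmetric] algebra_simps)
      then have *: "1 / (\<rho> ^ k) powr (\<kappa> - \<tau>) = q2 ^ k" using \<rho> by (simp add: field_simps)
      have "(T / \<rho> ^ k) powr (\<kappa> - \<tau>) = (1 / (\<rho> ^ k) powr (\<kappa> - \<tau>)) * T powr (\<kappa> - \<tau>)"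
        using T \<rho> by (simp add: powr_divide)
      then show ?thesis by (simp only: *)
    qed
    finally have "a * W (j + 1 + int k) powr (\<kappa> - \<tau>) * G \<le> a * (q2 ^ k * T powr (\<kappa> - \<tau>)) * G"
      using pos by (intro mult_right_mono mult_left_mono) auto
    also have "\<dots> = a * Z * q2 ^ k" by (simp add: Z2[symmetric])
    finally show "I (j + 1 + int k) \<le> ennreal (a * Z * q2 ^ k)"
      using outer[of "j + 1 + int k"] by (meson ennreal_leI order_trans)
  qed auto
  also have "\<dots> = ennreal (a * Z / (1 - q2))"
    using q pos by (intro suminf_geometric_ennreal) (auto simp: Z_def)
  finally have "(\<Sum>k. I (j - int k)) + (\<Sum>k. I (j + 1 + int k)) \<le> ennreal (a * Z / (1 - q1)) + ennreal (a * Z / (1 - q2))"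
    using 1 by (intro add_mono)
  also have "\<dots> = ennreal (a * Z / (1 - q1) + a * Z / (1 - q2))"
    using q pos by (intro ennreal_plus[symmetric]) (auto simp: Z_def)
  also have "a * Z / (1 - q1) + a * Z / (1 - q2) = a * (1 / (1 - q1) + 1 / (1 - q2)) * Z"
    by (simp add: distrib_left distrib_right)
  finally show ?thesis unfolding q1_def q2_def Z_def by blast
qed

text \<open>Hedberg's inequality with the v-mass of balls in place of their radius. On small balls
  the bound at \<tau>0 is used, where the integral is at most \<open>Mmax\<close> times the mass
  since h v is its integrand; on large balls the bound at \<tau> with the global integral
  \<open>g\<close>.\<close>

lemma riesz_pointwise:
  fixes v h f :: "'a::euclidean_space \<Rightarrow> real"
  assumes v: "wt v" and \<kappa>: "0 < \<kappa>" "\<kappa> < \<tau>" "\<tau> < 1" "\<tau> < \<tau>0" and A': "0 < A'"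
    and f: "f \<in> borel_measurable borel" "\<And>y. 0 \<le> f y"
    and \<rho>: "0 < \<rho>" "\<rho> < 1" "\<And>i::int. wmeas v (ball x (2 powr real_of_int i)) \<le> \<rho> * wmeas v (ball x (2 * 2 powr real_of_int i))"
    and loc: "\<And>r s. 0 < r \<Longrightarrow> s = \<tau> \<or> s = \<tau>0 \<Longrightarrow> (\<integral>\<^sup>+y\<in>ball x r. ennreal (f y) \<partial>lborel)
      \<le> ennreal (A' * measure lborel (ball x r) powr (1 - \<kappa>) * wmeas v (ball x r) powr (\<kappa> - s))
         * epow (\<integral>\<^sup>+y\<in>ball x r. ennreal (f y powr (1 / s) * v y powr (1 - \<kappa> / s)) \<partial>lborel) s"
    and h: "\<And>y. h y * v y = f y powr (1 / \<tau>0) * v y powr (1 - \<kappa> / \<tau>0)"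
    and g: "0 \<le> g" "(\<integral>\<^sup>+y. ennreal (f y powr (1 / \<tau>) * v y powr (1 - \<kappa> / \<tau>)) \<partial>lborel) = ennreal g"
  defines "a \<equiv> 2 powr (real DIM('a) * (1 - \<kappa>)) * measure lborel (ball (0::'a) 1) powr (1 - \<kappa>) * A'"
  shows "riesz \<kappa> f x \<le> ennreal (a * (1 / (1 - \<rho> powr \<kappa>) + 1 / (1 - \<rho> powr (\<tau> - \<kappa>))) * g powr \<kappa>)
     * epow (Mmax v h x) (\<tau>0 * (1 - \<kappa> / \<tau>))"
proof -
  define e where "e = real DIM('a) * (1 - \<kappa>)"
  define V where "V = measure lborel (ball (0::'a) 1)"
  have V: "0 < V" unfolding V_def by (rule unit_ball_pos)
  define W where "W i = wmeas v (ball x (2 powr real_of_int i))" for i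
  have W: "0 < W i" for i unfolding W_def using v by (intro wmeas_ball_pos) auto
  have a: "0 < a" using A' V by (simp add: a_def V_def[symmetric])
  have "2 * 2 powr real_of_int i = 2 powr real_of_int (i + 1)" for i by (simp add: powr_add)
  then have le: "W i \<le> \<rho> * W (i + 1)" for i using \<rho>(3)[of i] by (simp add: W_def)
  define F where "F s i = (\<integral>\<^sup>+y\<in>ball x (2 powr real_of_int i). ennreal (f y powr (1 / s) * v y powr (1 - \<kappa> / s)) \<partial>lborel)" for s i
  have dy: "dyad \<kappa> f x i \<le> ennreal (a * W i powr (\<kappa> - s)) * epow (F s i) s" if s: "s = \<tau> \<or> s = \<tau>0" for i s
  proof -
    define B where "B = ball x (2 powr real_of_int i)"
    have mB: "measure lborel B powr (1 - \<kappa>) = (2 powr real_of_int i) powr e * V powr (1 - \<kappa>)"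
    proof -
      have "measure lborel B = (2 powr real_of_int i) powr real DIM('a) * V"
        unfolding B_def by (subst measure_ball) (auto simp: V_def powr_realpow)
      then show ?thesis by (simp only: powr_mult powr_powr e_def mult.assoc)
    qed
    \<comment> \<open>The inner radius in \<open>dyad\<close> is half the radius of the ball, so the
      powers of 2^i cancel and 2^e remains.\<close>
    have pw: "(2 powr (real_of_int i - 1)) powr (- e) * (2 powr real_of_int i) powr e = (2::real) powr e"
      by (simp add: powr_powr powr_add[symmetric] algebra_simps)
    have "dyad \<kappa> f x i \<le> ennreal ((2 powr (real_of_int i - 1)) powr (- e)) * (ennreal (A' * measure lborel B powr (1 - \<kappa>) * W i powr (\<kappa> - s)) * epow (F s i) s)"
      unfolding dyad_def e_def[symmetric] using loc[of "2 powr real_of_int i" s] s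
      by (intro mult_left_mono) (auto simp: B_def W_def F_def)
    also have "\<dots> = ennreal ((2 powr (real_of_int i - 1)) powr (- e) * (A' * measure lborel B powr (1 - \<kappa>) * W i powr (\<kappa> - s))) * epow (F s i) s"
      using A' by (subst ennreal_mult) (auto simp: mult.assoc)
    also have "(2 powr (real_of_int i - 1)) powr (- e) * (A' * measure lborel B powr (1 - \<kappa>) * W i powr (\<kappa> - s))
        = ((2 powr (real_of_int i - 1)) powr (- e) * (2 powr real_of_int i) powr e) * V powr (1 - \<kappa>) * A' * W i powr (\<kappa> - s)"
      unfolding mB by (simp only: mult_ac)
    also have "\<dots> = a * W i powr (\<kappa> - s)" unfolding pw by (simp add: a_def e_def V_def)
    finally show ?thesis .
  qed
  have F\<tau>: "F \<tau> i \<le> ennreal g" for i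
    unfolding F_def g(2)[symmetric] by (intro nn_integral_mono) (auto simp: indicator_def)
  \<comment> \<open>\<open>Hedberg_sum\<close> wants positive data; if one of them vanishes,
    \<open>f\<close> has integral 0 on every dyadic ball and the fractional integral is 0. This also
    covers g = 0 with infinite \<open>Mmax\<close>, where the right-hand side is 0.\<close>
  have zero: "riesz \<kappa> f x = 0" if "s = \<tau> \<or> s = \<tau>0" "\<And>i. F s i = 0" for s
  proof (rule riesz_eq_0)
    fix k :: int
    show "(\<integral>\<^sup>+y\<in>ball x (2 powr real_of_int k). ennreal (f y) \<partial>lborel) = 0"
      using loc[of "2 powr real_of_int k" s] that by (simp add: F_def)
  qed (use f \<kappa> in auto)
  show ?thesis
  proof (cases "Mmax v h x")
    case (real \<mu>)
    have "F \<tau>0 i \<le> ennreal \<mu> * ennreal (W i)" for i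
      using Mmax_le_iff[OF v, of h x \<mu>] real by (simp add: h F_def W_def)
    then have F0: "F \<tau>0 i \<le> ennreal (\<mu> * W i)" for i using real W[of i] by (simp add: ennreal_mult less_imp_le)
    consider "\<mu> = 0" | "g = 0" | "0 < \<mu>" "0 < g" using real g(1) by fastforce
    then show ?thesis
    proof cases
      case 1
      have "F \<tau>0 i = 0" for i using F0[of i] 1 by simp
      then show ?thesis using zero[of \<tau>0] by simp
    next
      case 2
      have "F \<tau> i = 0" for i using F\<tau>[of i] 2 by simp
      then show ?thesis using zero[of \<tau>] by simp
    next
      case 3
      have \<tau>0: "0 < \<tau>0" "0 < \<tau>" using \<kappa> by auto
      have outer: "dyad \<kappa> f x i \<le> ennreal (a * W i powr (\<kappa> - \<tau>) * g powr \<tau>)" for i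
      proof -
        have "dyad \<kappa> f x i \<le> ennreal (a * W i powr (\<kappa> - \<tau>)) * epow (F \<tau> i) \<tau>" by (rule dy) simp
        also have "\<dots> \<le> ennreal (a * W i powr (\<kappa> - \<tau>)) * epow (ennreal g) \<tau>"
          using F\<tau> \<tau>0 by (intro mult_left_mono epow_mono) auto
        also have "\<dots> = ennreal (a * W i powr (\<kappa> - \<tau>) * g powr \<tau>)"
          using g(1) a by (simp add: ennreal_mult)
        finally show ?thesis .
      qed
      have inner: "dyad \<kappa> f x i \<le> ennreal (a * W i powr \<kappa> * \<mu> powr \<tau>0)" for i
      proof -
        have "dyad \<kappa> f x i \<le> ennreal (a * W i powr (\<kappa> - \<tau>0)) * epow (F \<tau>0 i) \<tau>0" by (rule dy) simp
        also have "\<dots> \<le> ennreal (a * W i powr (\<kappa> - \<tau>0)) * epow (ennreal (\<mu> * W i)) \<tau>0"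
          using F0 \<tau>0 by (intro mult_left_mono epow_mono) auto
        also have "\<dots> = ennreal (a * W i powr (\<kappa> - \<tau>0) * (\<mu> * W i) powr \<tau>0)"
          using 3 W[of i] a by (subst epow_ennreal) (auto simp flip: ennreal_mult)
        also have "a * W i powr (\<kappa> - \<tau>0) * (\<mu> * W i) powr \<tau>0 = a * (W i powr (\<kappa> - \<tau>0) * W i powr \<tau>0) * \<mu> powr \<tau>0"
          using 3 W[of i] by (simp add: powr_mult)
        also have "W i powr (\<kappa> - \<tau>0) * W i powr \<tau>0 = W i powr \<kappa>" using powr_add[of "W i" "\<kappa> - \<tau>0" \<tau>0] by simp
        finally show ?thesis .
      qed
      obtain j where j: "(\<Sum>k. dyad \<kappa> f x (j - int k)) + (\<Sum>k. dyad \<kappa> f x (j + 1 + int k))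
        \<le> ennreal (a * (1 / (1 - \<rho> powr \<kappa>) + 1 / (1 - \<rho> powr (\<tau> - \<kappa>))) * ((g powr \<tau>) powr (\<kappa> / \<tau>) * (\<mu> powr \<tau>0) powr (1 - \<kappa> / \<tau>)))"
        using Hedberg_sum[of W \<rho> \<kappa> \<tau> a "\<mu> powr \<tau>0" "g powr \<tau>" "dyad \<kappa> f x", OF W \<rho>(1,2) le \<kappa>(1,2) a _ _ inner outer] 3
        by auto
      have "riesz \<kappa> f x \<le> (\<Sum>k. dyad \<kappa> f x (j - int k)) + (\<Sum>k. dyad \<kappa> f x (j + 1 + int k))"
        using f \<kappa> by (intro riesz_dyadic) auto
      also note j
      also have "(g powr \<tau>) powr (\<kappa> / \<tau>) = g powr \<kappa>" using \<tau>0 by (simp add: powr_powr)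
      also have "(\<mu> powr \<tau>0) powr (1 - \<kappa> / \<tau>) = \<mu> powr (\<tau>0 * (1 - \<kappa> / \<tau>))" by (simp only: powr_powr)
      also have "ennreal (a * (1 / (1 - \<rho> powr \<kappa>) + 1 / (1 - \<rho> powr (\<tau> - \<kappa>))) * (g powr \<kappa> * \<mu> powr (\<tau>0 * (1 - \<kappa> / \<tau>))))
         = ennreal (a * (1 / (1 - \<rho> powr \<kappa>) + 1 / (1 - \<rho> powr (\<tau> - \<kappa>))) * g powr \<kappa>) * ennreal (\<mu> powr (\<tau>0 * (1 - \<kappa> / \<tau>)))"
      proof (subst ennreal_mult[symmetric])
        have "\<rho> powr \<kappa> < 1" "\<rho> powr (\<tau> - \<kappa>) < 1"
          using powr_less_mono2[of \<kappa> \<rho> 1] powr_less_mono2[of "\<tau> - \<kappa>" \<rho> 1] \<rho> \<kappa> by auto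
        then show "0 \<le> a * (1 / (1 - \<rho> powr \<kappa>) + 1 / (1 - \<rho> powr (\<tau> - \<kappa>))) * g powr \<kappa>" using a by simp
      qed (auto simp: mult.assoc)
      also have "ennreal (\<mu> powr (\<tau>0 * (1 - \<kappa> / \<tau>))) = epow (Mmax v h x) (\<tau>0 * (1 - \<kappa> / \<tau>))"
        using 3 by (simp add: real)
      finally show ?thesis .
    qed
  next
    case top
    show ?thesis
    proof (cases "g = 0")
      case True
      have "F \<tau> i = 0" for i using F\<tau>[of i] True by simp
      then show ?thesis using zero[of \<tau>] by simp
    next
      case False
      have "\<rho> powr \<kappa> < 1" "\<rho> powr (\<tau> - \<kappa>) < 1"
        using powr_less_mono2[of \<kappa> \<rho> 1] powr_less_mono2[of "\<tau> - \<kappa>" \<rho> 1] \<rho> \<kappa> by auto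
      then have "0 < a * (1 / (1 - \<rho> powr \<kappa>) + 1 / (1 - \<rho> powr (\<tau> - \<kappa>))) * g powr \<kappa>"
        using a False g(1) by (intro mult_pos_pos add_pos_pos) auto
      then show ?thesis unfolding top epow_top by (subst ennreal_mult_top) auto
    qed
  qed
qed

text \<open>With q = 1 / (\<tau> - \<kappa>), the q-th power of the pointwise inequality contains
  \<open>Mmax\<close> to the power s = \<tau>0 / \<tau> > 1, and h^s v is the integrand on the
  right. The strong type bound in L^s(v dx) thus contributes that integral to the power 1, and
  \<kappa> q + 1 = \<tau> / (\<tau> - \<kappa>).\<close>

theorem riesz_weighted:
  fixes \<kappa> \<tau> A :: real
  assumes \<kappa>: "0 < \<kappa>" "\<kappa> < \<tau>" "\<tau> < 1"
  defines "\<theta> \<equiv> (\<tau> - \<kappa>) / (1 - \<kappa>)"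
  shows "\<exists>C>0. \<forall>(v::'a::euclidean_space \<Rightarrow> real) \<sigma> f. mpair \<theta> A v \<sigma> \<longrightarrow> f \<in> borel_measurable borel \<longrightarrow> (\<forall>y. 0 \<le> f y) \<longrightarrow>
    (\<integral>\<^sup>+x. epow (riesz \<kappa> f x) (1 / (\<tau> - \<kappa>)) * ennreal (v x) \<partial>lborel)
      \<le> ennreal C * epow (\<integral>\<^sup>+y. ennreal (f y powr (1 / \<tau>) * v y powr (1 - \<kappa> / \<tau>)) \<partial>lborel) (\<tau> / (\<tau> - \<kappa>))"
proof (cases "1 \<le> A")
  have \<theta>: "0 < \<theta>" "\<theta> < 1" using \<kappa> by (auto simp: \<theta>_def)
  {
    case False
    then have "\<not> mpair \<theta> A v \<sigma>" for v \<sigma> :: "'a \<Rightarrow> real" using mpair_ainf[OF _ \<theta>] ainf_ge_1 by blast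
    then show ?thesis by (intro exI[of _ 1]) auto
  next
    case A: True
    obtain \<tau>0 A' where \<tau>0: "\<tau> < \<tau>0" "\<tau>0 < 1" "0 < A'" and loc: "\<And>(v::'a \<Rightarrow> real) \<sigma> f x r s. mpair \<theta> A v \<sigma> \<Longrightarrow> f \<in> borel_measurable borel \<Longrightarrow>
      (\<forall>y. 0 \<le> f y) \<Longrightarrow> 0 < r \<Longrightarrow> s = \<tau> \<or> s = \<tau>0 \<Longrightarrow>
      (\<integral>\<^sup>+y\<in>ball x r. ennreal (f y) \<partial>lborel)
        \<le> ennreal (A' * measure lborel (ball x r) powr (1 - \<kappa>) * wmeas v (ball x r) powr (\<kappa> - s))
           * epow (\<integral>\<^sup>+y\<in>ball x r. ennreal (f y powr (1 / s) * v y powr (1 - \<kappa> / s)) \<partial>lborel) s"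
      using frac_local[OF \<kappa>, of A, folded \<theta>_def, where 'a='a] by blast
    define K where "K = (A * 5 ^ DIM('a)) powr (1 / \<theta>)"
    define \<rho> where "\<rho> = 1 - 1 / (2 * A) powr (1 / \<theta>)"
    define s where "s = \<tau>0 / \<tau>"
    have K: "0 < K" using A by (simp add: K_def)
    have s: "1 < s" using \<tau>0 \<kappa> by (simp add: s_def)
    have "1 < (2 * A) powr (1 / \<theta>)" using A \<theta> powr_less_mono2[of "1 / \<theta>" 1 "2 * A"] by simp
    then have \<rho>: "0 < \<rho>" "\<rho> < 1" by (auto simp: \<rho>_def divide_less_eq)
    obtain Cs where Cs: "0 < Cs" and strong: "\<And>(v::'a \<Rightarrow> real) h. wt v \<Longrightarrow> (\<forall>x r. 0 < r \<longrightarrow> wmeas v (ball x (5 * r)) \<le> K * wmeas v (ball x r)) \<Longrightarrow>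
       h \<in> borel_measurable borel \<Longrightarrow> (\<forall>x. 0 \<le> h x) \<Longrightarrow>
       (\<integral>\<^sup>+x. epow (Mmax v h x) s * ennreal (v x) \<partial>lborel) \<le> ennreal Cs * (\<integral>\<^sup>+x. ennreal (h x powr s * v x) \<partial>lborel)"
      using Mmax_strong_type[OF K s, where 'a='a] by blast
    define a where "a = 2 powr (real DIM('a) * (1 - \<kappa>)) * measure lborel (ball (0::'a) 1) powr (1 - \<kappa>) * A'"
    define c1 where "c1 = a * (1 / (1 - \<rho> powr \<kappa>) + 1 / (1 - \<rho> powr (\<tau> - \<kappa>)))"
    have c1: "0 < c1"
    proof -
      have "\<rho> powr \<kappa> < 1" "\<rho> powr (\<tau> - \<kappa>) < 1"
        using powr_less_mono2[of \<kappa> \<rho> 1] powr_less_mono2[of "\<tau> - \<kappa>" \<rho> 1] \<rho> \<kappa> by auto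
      moreover have "0 < a" using \<tau>0 unit_ball_pos[where 'a='a] by (simp add: a_def)
      ultimately show ?thesis unfolding c1_def by (intro mult_pos_pos add_pos_pos) auto
    qed
    define q where "q = 1 / (\<tau> - \<kappa>)"
    have q: "0 < q" using \<kappa> by (simp add: q_def)
    show ?thesis
    proof (rule exI[of _ "c1 powr q * Cs"], intro conjI allI impI)
      show "0 < c1 powr q * Cs" using c1 Cs by simp
      fix v \<sigma> f :: "'a \<Rightarrow> real"
      assume m: "mpair \<theta> A v \<sigma>" and f [measurable]: "f \<in> borel_measurable borel" and f0: "\<forall>y. 0 \<le> f y"
      have v: "wt v" using m by (auto simp: mpair_def)
      have ai: "ainf \<theta> A v" using mpair_ainf[OF m \<theta>] .
      note [measurable] = wtD(2)[OF v]
      define G where "G = (\<integral>\<^sup>+y. ennreal (f y powr (1 / \<tau>) * v y powr (1 - \<kappa> / \<tau>)) \<partial>lborel)"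
      have "(\<integral>\<^sup>+x. epow (riesz \<kappa> f x) q * ennreal (v x) \<partial>lborel) \<le> ennreal (c1 powr q * Cs) * epow G (\<tau> / (\<tau> - \<kappa>))"
      proof (cases G)
        case top
        then show ?thesis using c1 Cs by (simp add: ennreal_mult_top)
      next
        case (real g)
        \<comment> \<open>Chosen so that h v is the integrand at \<tau>0 and h^s v the integrand at
          \<tau>.\<close>
        define h where "h y = f y powr (1 / \<tau>0) * v y powr (- \<kappa> / \<tau>0)" for y
        have [measurable]: "h \<in> borel_measurable borel" unfolding h_def by measurable
        have hv: "h y * v y = f y powr (1 / \<tau>0) * v y powr (1 - \<kappa> / \<tau>0)" for y
        proof (cases "v y = 0")
          case False
          then have "v y powr (1 - \<kappa> / \<tau>0) = v y powr (- \<kappa> / \<tau>0) * v y"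
            using wtD(1)[OF v, of y] powr_add[of "v y" "- \<kappa> / \<tau>0" 1] by simp
          then show ?thesis by (simp add: h_def)
        qed simp
        have hsv: "h y powr s * v y = f y powr (1 / \<tau>) * v y powr (1 - \<kappa> / \<tau>)" for y
        proof (cases "v y = 0")
          case False
          have "1 / \<tau>0 * s = 1 / \<tau>" "- \<kappa> / \<tau>0 * s = - \<kappa> / \<tau>" using \<tau>0 \<kappa> by (auto simp: s_def)
          then have "h y powr s = f y powr (1 / \<tau>) * v y powr (- \<kappa> / \<tau>)"
            by (simp only: h_def powr_mult powr_powr)
          moreover have "v y powr (1 - \<kappa> / \<tau>) = v y powr (- \<kappa> / \<tau>) * v y"
            using False wtD(1)[OF v, of y] powr_add[of "v y" "- \<kappa> / \<tau>" 1] by simp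
          ultimately show ?thesis by simp
        qed simp
        have "riesz \<kappa> f x \<le> ennreal (c1 * g powr \<kappa>) * epow (Mmax v h x) (\<tau>0 * (1 - \<kappa> / \<tau>))" for x
          unfolding c1_def a_def
        proof (rule riesz_pointwise[OF v \<kappa> \<tau>0(1,3)])
          show "wmeas v (ball x (2 powr real_of_int i)) \<le> \<rho> * wmeas v (ball x (2 * 2 powr real_of_int i))" for i :: int
            unfolding \<rho>_def using \<theta> by (intro ainf_reverse_doubling[OF ai]) auto
          show "(\<integral>\<^sup>+y. ennreal (f y powr (1 / \<tau>) * v y powr (1 - \<kappa> / \<tau>)) \<partial>lborel) = ennreal g"
            using real by (simp add: G_def)
        qed (use real f f0 \<rho> hv loc[OF m f f0] in auto)
        then have "epow (riesz \<kappa> f x) q \<le> epow (ennreal (c1 * g powr \<kappa>) * epow (Mmax v h x) (\<tau>0 * (1 - \<kappa> / \<tau>))) q" for x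
          using q by (intro epow_mono) auto
        also have "epow (ennreal (c1 * g powr \<kappa>) * epow (Mmax v h x) (\<tau>0 * (1 - \<kappa> / \<tau>))) q
            = ennreal ((c1 * g powr \<kappa>) powr q) * epow (Mmax v h x) s" for x
        proof -
          have "\<tau>0 * (1 - \<kappa> / \<tau>) * q = s" using \<kappa> by (simp add: s_def q_def field_simps)
          then show ?thesis using c1 by (simp only: epow_mult epow_epow epow_ennreal[of "c1 * g powr \<kappa>"]) simp
        qed
        finally have "epow (riesz \<kappa> f x) q * ennreal (v x) \<le> ennreal ((c1 * g powr \<kappa>) powr q) * (epow (Mmax v h x) s * ennreal (v x))" for x
          by (simp add: mult.assoc[symmetric] mult_right_mono)
        then have "(\<integral>\<^sup>+x. epow (riesz \<kappa> f x) q * ennreal (v x) \<partial>lborel) \<le> (\<integral>\<^sup>+x. ennreal ((c1 * g powr \<kappa>) powr q) * (epow (Mmax v h x) s * ennreal (v x)) \<partial>lborel)"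
          by (intro nn_integral_mono)
        also have "\<dots> = ennreal ((c1 * g powr \<kappa>) powr q) * (\<integral>\<^sup>+x. epow (Mmax v h x) s * ennreal (v x) \<partial>lborel)"
          by (intro nn_integral_cmult) measurable
        also have "(\<integral>\<^sup>+x. epow (Mmax v h x) s * ennreal (v x) \<partial>lborel) \<le> ennreal Cs * (\<integral>\<^sup>+x. ennreal (h x powr s * v x) \<partial>lborel)"
        proof (rule strong[OF v])
          show "\<forall>x r. 0 < r \<longrightarrow> wmeas v (ball x (5 * r)) \<le> K * wmeas v (ball x r)"
          proof (intro allI impI)
            fix x :: 'a and r :: real assume r: "0 < r"
            have "ball x r \<subseteq> ball x (5 * r)" using r by (intro subset_ball) auto
            then show "wmeas v (ball x (5 * r)) \<le> K * wmeas v (ball x r)"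
              unfolding K_def using r \<theta> by (intro ainf_doubling[OF ai]) auto
          qed
        qed (auto simp: h_def)
        also have "(\<integral>\<^sup>+x. ennreal (h x powr s * v x) \<partial>lborel) = ennreal g" using real by (simp add: hsv G_def)
        also have "ennreal ((c1 * g powr \<kappa>) powr q) * (ennreal Cs * ennreal g) = ennreal ((c1 * g powr \<kappa>) powr q * (Cs * g))"
          using Cs real by (simp add: ennreal_mult)
        also have "(c1 * g powr \<kappa>) powr q * (Cs * g) = c1 powr q * Cs * g powr (\<tau> / (\<tau> - \<kappa>))"
        proof (cases "g = 0")
          case False
          have "\<tau> / (\<tau> - \<kappa>) = \<kappa> * q + 1" using \<kappa> by (simp add: q_def field_simps)
          then have "g powr (\<tau> / (\<tau> - \<kappa>)) = g powr (\<kappa> * q) * g" using False real by (simp add: powr_add)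
          moreover have "(c1 * g powr \<kappa>) powr q = c1 powr q * g powr (\<kappa> * q)" using c1 by (simp only: powr_mult powr_powr)
          ultimately show ?thesis by simp
        qed simp
        also have "ennreal (c1 powr q * Cs * g powr (\<tau> / (\<tau> - \<kappa>))) = ennreal (c1 powr q * Cs) * epow G (\<tau> / (\<tau> - \<kappa>))"
          using real Cs by (simp add: ennreal_mult)
        finally show ?thesis by (simp add: mult_left_mono)
      qed
      then show "(\<integral>\<^sup>+x. epow (riesz \<kappa> f x) (1 / (\<tau> - \<kappa>)) * ennreal (v x) \<partial>lborel)
        \<le> ennreal (c1 powr q * Cs) * epow (\<integral>\<^sup>+y. ennreal (f y powr (1 / \<tau>) * v y powr (1 - \<kappa> / \<tau>)) \<partial>lborel) (\<tau> / (\<tau> - \<kappa>))"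
        by (simp add: q_def G_def)
    qed
  }
qed

section \<open>Perturbation of a weight pair by exponentials of BMO functions\<close>

lemma exp_perturbed_mass:
  assumes w: "ainf \<theta> A w" and b: "b \<in> borel_measurable borel"
    and JN: "(\<integral>\<^sup>+y\<in>ball x r. ennreal (exp (\<bar>t\<bar> * \<bar>b y - c\<bar>) * w y) \<partial>lborel) \<le> ennreal (C * wmeas w (ball x r))" and C: "0 < C"
  shows "(\<integral>\<^sup>+y\<in>ball x r. ennreal (w y * exp (t * b y)) \<partial>lborel) \<le> ennreal (exp (t * c) * C * wmeas w (ball x r))"
proof -
  note [measurable] = wtD(2)[OF ainf_wt[OF w]] b
  have "ennreal (w y * exp (t * b y)) \<le> ennreal (exp (t * c)) * ennreal (exp (\<bar>t\<bar> * \<bar>b y - c\<bar>) * w y)" for y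
  proof -
    have "t * (b y - c) \<le> \<bar>t\<bar> * \<bar>b y - c\<bar>" by (metis abs_ge_self abs_mult)
    then have "t * b y \<le> t * c + \<bar>t\<bar> * \<bar>b y - c\<bar>" by (simp add: algebra_simps)
    then have "exp (t * b y) \<le> exp (t * c) * exp (\<bar>t\<bar> * \<bar>b y - c\<bar>)" by (simp flip: exp_add)
    from mult_right_mono[OF this, of "w y"] show ?thesis
      using wtD(1)[OF ainf_wt[OF w], of y]
      by (subst ennreal_mult[symmetric]) (auto intro!: ennreal_leI simp: mult_ac)
  qed
  then have "(\<integral>\<^sup>+y\<in>ball x r. ennreal (w y * exp (t * b y)) \<partial>lborel)
      \<le> (\<integral>\<^sup>+y. ennreal (exp (t * c)) * (ennreal (exp (\<bar>t\<bar> * \<bar>b y - c\<bar>) * w y) * indicator (ball x r) y) \<partial>lborel)"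
    by (intro nn_integral_mono) (auto simp: indicator_def)
  also have "\<dots> = ennreal (exp (t * c)) * (\<integral>\<^sup>+y\<in>ball x r. ennreal (exp (\<bar>t\<bar> * \<bar>b y - c\<bar>) * w y) \<partial>lborel)"
    by (intro nn_integral_cmult) measurable
  also have "\<dots> \<le> ennreal (exp (t * c)) * ennreal (C * wmeas w (ball x r))"
    using JN by (intro mult_left_mono) auto
  also have "\<dots> = ennreal (exp (t * c) * C * wmeas w (ball x r))"
    using C by (subst ennreal_mult[symmetric]) (auto simp: mult.assoc)
  finally show ?thesis .
qed

lemma wt_perturb:
  assumes "wt w" "b \<in> borel_measurable borel"
    and "\<And>x r. 0 < r \<Longrightarrow> (\<integral>\<^sup>+y\<in>ball x r. ennreal (w y * exp (t * b y)) \<partial>lborel) < \<infinity>"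
  shows "wt (\<lambda>y. w y * exp (t * b y))"
  unfolding wt_def
proof (intro conjI allI)
  note [measurable] = wtD(2)[OF assms(1)] assms(2)
  show "(\<lambda>y. w y * exp (t * b y)) \<in> borel_measurable borel" by measurable
  show "AE y in lborel. 0 < w y * exp (t * b y)" using wtD(3)[OF assms(1)] by eventually_elim simp
  show "(\<integral>\<^sup>+y\<in>ball x r. ennreal (w y * exp (t * b y)) \<partial>lborel) < \<infinity>" for x r
  proof (cases "0 < r")
    case False
    then have empty: "ball x r = {}" by simp
    show ?thesis unfolding empty by simp
  qed (use assms(3) in auto)
qed (simp add: wtD(1)[OF assms(1)])

text \<open>The exponents s / \<theta> and - s / (1 - \<theta>) are those for which the exponentials
  cancel in v^\<theta> \<sigma>^(1 - \<theta>). On a ball \<open>b\<close> is its average plus an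
  oscillation: the oscillation is absorbed by John-Nirenberg for v dx and for \<sigma> dx, and the
  factors from the average cancel for the same reason.\<close>

theorem mpair_perturb:
  fixes \<theta> A :: real
  assumes \<theta>: "0 < \<theta>" "\<theta> < 1"
  shows "\<exists>c A'. 0 < c \<and> (\<forall>(v::'a::euclidean_space \<Rightarrow> real) \<sigma> b \<beta> s. mpair \<theta> A v \<sigma> \<longrightarrow> bmob \<beta> b \<longrightarrow> 0 < \<beta> \<longrightarrow> \<bar>s\<bar> * \<beta> \<le> c \<longrightarrow>
    mpair \<theta> A' (\<lambda>x. v x * exp (s / \<theta> * b x)) (\<lambda>x. \<sigma> x * exp (- s / (1 - \<theta>) * b x)))"
proof -
  have \<theta>': "0 < 1 - \<theta>" using \<theta> by simp
  obtain c1 C1 where c1: "0 < c1" "0 < C1" and JN1: "\<And>(w::'a \<Rightarrow> real) b \<beta> s x r. ainf \<theta> A w \<Longrightarrow> bmob \<beta> b \<Longrightarrow> 0 < \<beta> \<Longrightarrow>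
    s * \<beta> \<le> c1 \<Longrightarrow> 0 < r \<Longrightarrow>
    (\<integral>\<^sup>+y\<in>ball x r. ennreal (exp (s * \<bar>b y - avg (ball x r) b\<bar>) * w y) \<partial>lborel) \<le> ennreal (C1 * wmeas w (ball x r))"
    using weighted_John_Nirenberg[OF \<theta>(1), of A, where 'a='a] by blast
  obtain c2 C2 where c2: "0 < c2" "0 < C2" and JN2: "\<And>(w::'a \<Rightarrow> real) b \<beta> s x r. ainf (1 - \<theta>) A w \<Longrightarrow> bmob \<beta> b \<Longrightarrow> 0 < \<beta> \<Longrightarrow>
    s * \<beta> \<le> c2 \<Longrightarrow> 0 < r \<Longrightarrow>
    (\<integral>\<^sup>+y\<in>ball x r. ennreal (exp (s * \<bar>b y - avg (ball x r) b\<bar>) * w y) \<partial>lborel) \<le> ennreal (C2 * wmeas w (ball x r))"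
    using weighted_John_Nirenberg[OF \<theta>', of A, where 'a='a] by blast
  define c where "c = min (c1 * \<theta>) (c2 * (1 - \<theta>))"
  define A' where "A' = C1 powr \<theta> * C2 powr (1 - \<theta>) * A"
  have c: "0 < c" using c1 c2 \<theta> by (simp add: c_def)
  have "mpair \<theta> A' (\<lambda>x. v x * exp (s / \<theta> * b x)) (\<lambda>x. \<sigma> x * exp (- s / (1 - \<theta>) * b x))"
    if m: "mpair \<theta> A v \<sigma>" and b: "bmob \<beta> b" "0 < \<beta>" and s: "\<bar>s\<bar> * \<beta> \<le> c" for v \<sigma> b :: "'a \<Rightarrow> real" and \<beta> s
  proof -
    have v: "wt v" and sg: "wt \<sigma>" and eq: "AE x in lborel. v x powr \<theta> * \<sigma> x powr (1 - \<theta>) = 1"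
      and bd: "\<And>x r. 0 < r \<Longrightarrow> wmeas v (ball x r) powr \<theta> * wmeas \<sigma> (ball x r) powr (1 - \<theta>) \<le> A * measure lborel (ball x r)"
      using m by (auto simp: mpair_def)
    have av: "ainf \<theta> A v" and as: "ainf (1 - \<theta>) A \<sigma>" using mpair_ainf[OF m \<theta>] mpair_ainf[OF mpair_sym[OF m]] \<theta> by auto
    have bm [measurable]: "b \<in> borel_measurable borel" using b by (simp add: bmob_def)
    define t where "t = s / \<theta>"
    define u where "u = - s / (1 - \<theta>)"
    have "\<bar>t\<bar> * \<beta> = \<bar>s\<bar> * \<beta> / \<theta>" "\<bar>u\<bar> * \<beta> = \<bar>s\<bar> * \<beta> / (1 - \<theta>)" using \<theta> by (auto simp: t_def u_def)
    moreover have "\<bar>s\<bar> * \<beta> \<le> c1 * \<theta>" "\<bar>s\<bar> * \<beta> \<le> c2 * (1 - \<theta>)" using s by (auto simp: c_def)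
    ultimately have tu: "\<bar>t\<bar> * \<beta> \<le> c1" "\<bar>u\<bar> * \<beta> \<le> c2" using \<theta> by (auto simp: divide_le_eq)
    have V: "(\<integral>\<^sup>+y\<in>ball x r. ennreal (v y * exp (t * b y)) \<partial>lborel) \<le> ennreal (exp (t * avg (ball x r) b) * C1 * wmeas v (ball x r))"
      if "0 < r" for x r
      by (rule exp_perturbed_mass[OF av bm JN1[OF av b tu(1) that] c1(2)])
    have S: "(\<integral>\<^sup>+y\<in>ball x r. ennreal (\<sigma> y * exp (u * b y)) \<partial>lborel) \<le> ennreal (exp (u * avg (ball x r) b) * C2 * wmeas \<sigma> (ball x r))"
      if "0 < r" for x r
      by (rule exp_perturbed_mass[OF as bm JN2[OF as b tu(2) that] c2(2)])
    have lt: "X < \<infinity>" if "X \<le> ennreal Y" for X Y using le_less_trans[OF that, of \<infinity>] by simp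
    have "mpair \<theta> A' (\<lambda>x. v x * exp (t * b x)) (\<lambda>x. \<sigma> x * exp (u * b x))"
      unfolding mpair_def
    proof (intro conjI allI impI)
      show wv: "wt (\<lambda>x. v x * exp (t * b x))" by (rule wt_perturb[OF v bm lt[OF V]])
      show ws: "wt (\<lambda>x. \<sigma> x * exp (u * b x))" by (rule wt_perturb[OF sg bm lt[OF S]])
      have "t * \<theta> = s" "u * (1 - \<theta>) = - s" using \<theta> by (auto simp: t_def u_def)
      then have ex: "t * b x * \<theta> + u * b x * (1 - \<theta>) = 0" for x
        by (simp add: mult.commute[of t] mult.commute[of u] mult.assoc)
      show "AE x in lborel. (v x * exp (t * b x)) powr \<theta> * (\<sigma> x * exp (u * b x)) powr (1 - \<theta>) = 1"
        using eq wtD(3)[OF v] wtD(3)[OF sg]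
      proof eventually_elim
        case (elim x)
        have "(v x * exp (t * b x)) powr \<theta> * (\<sigma> x * exp (u * b x)) powr (1 - \<theta>)
           = (v x powr \<theta> * \<sigma> x powr (1 - \<theta>)) * (exp (t * b x * \<theta>) * exp (u * b x * (1 - \<theta>)))"
          using elim(2,3) by (simp only: powr_mult exp_powr_real mult_ac)
        then show ?case by (simp only: elim exp_add[symmetric] ex) simp
      qed
      fix x :: 'a and r :: real assume r: "0 < r"
      define B where "B = ball x r"
      define k where "k = avg B b"
      have "ennreal (wmeas (\<lambda>x. v x * exp (t * b x)) B) \<le> ennreal (exp (t * k) * C1 * wmeas v B)"
        using V[OF r, of x] ennreal_wmeas[OF wv, of B x r] by (simp add: B_def k_def)
      then have 1: "wmeas (\<lambda>x. v x * exp (t * b x)) B \<le> exp (t * k) * C1 * wmeas v B" using c1 by (simp add: ennreal_le_iff)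
      have "ennreal (wmeas (\<lambda>x. \<sigma> x * exp (u * b x)) B) \<le> ennreal (exp (u * k) * C2 * wmeas \<sigma> B)"
        using S[OF r, of x] ennreal_wmeas[OF ws, of B x r] by (simp add: B_def k_def)
      then have 2: "wmeas (\<lambda>x. \<sigma> x * exp (u * b x)) B \<le> exp (u * k) * C2 * wmeas \<sigma> B" using c2 by (simp add: ennreal_le_iff)
      have "wmeas (\<lambda>x. v x * exp (t * b x)) B powr \<theta> * wmeas (\<lambda>x. \<sigma> x * exp (u * b x)) B powr (1 - \<theta>)
        \<le> (exp (t * k) * C1 * wmeas v B) powr \<theta> * (exp (u * k) * C2 * wmeas \<sigma> B) powr (1 - \<theta>)"
        using 1 2 \<theta> by (intro mult_mono powr_mono2) auto
      also have "\<dots> = (exp (t * k * \<theta>) * exp (u * k * (1 - \<theta>))) * (C1 powr \<theta> * C2 powr (1 - \<theta>)) * (wmeas v B powr \<theta> * wmeas \<sigma> B powr (1 - \<theta>))"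
        using c1 c2 by (simp add: powr_mult exp_powr_real mult_ac)
      also have "exp (t * k * \<theta>) * exp (u * k * (1 - \<theta>)) = 1"
      proof -
        have "t * k * \<theta> + u * k * (1 - \<theta>) = 0"
          using \<open>t * \<theta> = s\<close> \<open>u * (1 - \<theta>) = - s\<close> by (simp add: mult.commute[of t] mult.commute[of u] mult.assoc)
        then show ?thesis by (simp flip: exp_add)
      qed
      also have "1 * (C1 powr \<theta> * C2 powr (1 - \<theta>)) * (wmeas v B powr \<theta> * wmeas \<sigma> B powr (1 - \<theta>))
          \<le> 1 * (C1 powr \<theta> * C2 powr (1 - \<theta>)) * (A * measure lborel B)"
        using bd[OF r, of x] by (intro mult_left_mono) (auto simp: B_def)
      finally show "wmeas (\<lambda>x. v x * exp (t * b x)) (ball x r) powr \<theta> * wmeas (\<lambda>x. \<sigma> x * exp (u * b x)) (ball x r) powr (1 - \<theta>)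
        \<le> A' * measure lborel (ball x r)" by (simp add: A'_def B_def mult.assoc)
    qed
    then show ?thesis by (simp add: t_def u_def)
  qed
  then show ?thesis using c by blast
qed

section \<open>The commutator of the fractional integral\<close>

definition rieszb :: "real \<Rightarrow> ('a::euclidean_space \<Rightarrow> real) \<Rightarrow> ('a \<Rightarrow> real) \<Rightarrow> 'a \<Rightarrow> ennreal" where
  "rieszb \<kappa> b f x = (\<integral>\<^sup>+y. ennreal (\<bar>b x - b y\<bar> * f y) * inverse (ennreal (dist x y powr (real DIM('a) * (1 - \<kappa>)))) \<partial>lborel)"

lemma riesz_measurable [measurable]:
  fixes f :: "'a::euclidean_space \<Rightarrow> real"
  assumes [measurable]: "f \<in> borel_measurable borel"
  shows "riesz \<kappa> f \<in> borel_measurable borel"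
  unfolding riesz_def[abs_def] by measurable

lemma rieszb_measurable [measurable]:
  fixes f :: "'a::euclidean_space \<Rightarrow> real"
  assumes [measurable]: "f \<in> borel_measurable borel" "b \<in> borel_measurable borel"
  shows "rieszb \<kappa> b f \<in> borel_measurable borel"
  unfolding rieszb_def[abs_def] by measurable

text \<open>Each exponential of b(x) - b(y) factors into a function of x and one of y, so no
  difference remains under the integral.\<close>

lemma rieszb_le:
  fixes f b :: "'a::euclidean_space \<Rightarrow> real"
  assumes [measurable]: "f \<in> borel_measurable borel" "b \<in> borel_measurable borel" and f0: "\<And>y. 0 \<le> f y" and \<epsilon>: "0 < \<epsilon>"
  shows "rieszb \<kappa> b f x \<le> ennreal (1 / \<epsilon>) * (ennreal (exp (\<epsilon> * b x)) * riesz \<kappa> (\<lambda>y. f y * exp (- \<epsilon> * b y)) x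
     + ennreal (exp (- \<epsilon> * b x)) * riesz \<kappa> (\<lambda>y. f y * exp (\<epsilon> * b y)) x)"
proof -
  define k where "k y = inverse (ennreal (dist x y powr (real DIM('a) * (1 - \<kappa>))))" for y
  have [measurable]: "k \<in> borel_measurable borel" unfolding k_def by measurable
  define f1 where "f1 y = f y * exp (- \<epsilon> * b y)" for y
  define f2 where "f2 y = f y * exp (\<epsilon> * b y)" for y
  have [measurable]: "f1 \<in> borel_measurable borel" "f2 \<in> borel_measurable borel" unfolding f1_def f2_def by measurable
  have pw: "ennreal (\<bar>b x - b y\<bar> * f y)
      \<le> ennreal (1 / \<epsilon>) * (ennreal (exp (\<epsilon> * b x)) * ennreal (f1 y) + ennreal (exp (- \<epsilon> * b x)) * ennreal (f2 y))" for y
  proof -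
    define t where "t = \<epsilon> * (b x - b y)"
    have "\<bar>t\<bar> \<le> exp t + exp (- t)"
      using exp_ge_add_one_self[of t] exp_ge_add_one_self[of "- t"] exp_gt_zero[of t] exp_gt_zero[of "- t"] by linarith
    moreover have "\<bar>t\<bar> = \<epsilon> * \<bar>b x - b y\<bar>" using \<epsilon> by (simp add: t_def abs_mult)
    ultimately have "\<bar>b x - b y\<bar> \<le> 1 / \<epsilon> * (exp t + exp (- t))" using \<epsilon> by (simp add: field_simps)
    from mult_right_mono[OF this f0[of y]]
    have "\<bar>b x - b y\<bar> * f y \<le> 1 / \<epsilon> * (exp (\<epsilon> * b x) * f1 y + exp (- \<epsilon> * b x) * f2 y)"
      by (simp add: t_def f1_def f2_def exp_diff exp_minus field_simps)
    then have "ennreal (\<bar>b x - b y\<bar> * f y) \<le> ennreal (1 / \<epsilon> * (exp (\<epsilon> * b x) * f1 y + exp (- \<epsilon> * b x) * f2 y))"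
      by (rule ennreal_leI)
    also have "\<dots> = ennreal (1 / \<epsilon>) * (ennreal (exp (\<epsilon> * b x)) * ennreal (f1 y) + ennreal (exp (- \<epsilon> * b x)) * ennreal (f2 y))"
    proof -
      have "ennreal (k * (a * g + c * h)) = ennreal k * (ennreal a * ennreal g + ennreal c * ennreal h)"
        if "0 \<le> k" "0 \<le> a" "0 \<le> g" "0 \<le> c" "0 \<le> h" for k a g c h :: real
        using that by (simp add: ennreal_mult)
      moreover have "0 \<le> 1 / \<epsilon>" "0 \<le> f1 y" "0 \<le> f2 y" using \<epsilon> f0[of y] by (auto simp: f1_def f2_def)
      ultimately show ?thesis by (simp only: exp_ge_zero)
    qed
    finally show ?thesis .
  qed
  have "rieszb \<kappa> b f x \<le> (\<integral>\<^sup>+y. ennreal (1 / \<epsilon>) * (ennreal (exp (\<epsilon> * b x)) * (ennreal (f1 y) * k y) + ennreal (exp (- \<epsilon> * b x)) * (ennreal (f2 y) * k y)) \<partial>lborel)"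
    unfolding rieszb_def k_def[symmetric]
  proof (rule nn_integral_mono)
    fix y
    have "ennreal (\<bar>b x - b y\<bar> * f y) * k y \<le> (ennreal (1 / \<epsilon>) * (ennreal (exp (\<epsilon> * b x)) * ennreal (f1 y) + ennreal (exp (- \<epsilon> * b x)) * ennreal (f2 y))) * k y"
      using pw[of y] by (rule mult_right_mono) simp
    then show "ennreal (\<bar>b x - b y\<bar> * f y) * k y \<le> ennreal (1 / \<epsilon>) * (ennreal (exp (\<epsilon> * b x)) * (ennreal (f1 y) * k y) + ennreal (exp (- \<epsilon> * b x)) * (ennreal (f2 y) * k y))"
      by (simp only: distrib_right mult.assoc)
  qed
  also have "\<dots> = ennreal (1 / \<epsilon>) * (ennreal (exp (\<epsilon> * b x)) * riesz \<kappa> f1 x + ennreal (exp (- \<epsilon> * b x)) * riesz \<kappa> f2 x)"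
  proof -
    have m1: "(\<lambda>y. ennreal (f1 y) * k y) \<in> borel_measurable lborel" "(\<lambda>y. ennreal (f2 y) * k y) \<in> borel_measurable lborel"
      by measurable
    show ?thesis unfolding riesz_def k_def[symmetric] using m1
      by (subst nn_integral_cmult, simp, subst nn_integral_add, simp, simp, subst (1 2) nn_integral_cmult, auto)
  qed
  finally show ?thesis unfolding f1_def[abs_def] f2_def[abs_def] .
qed

text \<open>Conjugation by exp (t b) is absorbed by the weight: the outer factor changes v into v
  exp (t q b), and the inner one cancels against this change in f^(1 / \<tau>) v^(1 - \<kappa> /
  \<tau>), because q (1 - \<kappa> / \<tau>) = 1 / \<tau>.\<close>

theorem rieszb_weighted:
  fixes \<kappa> \<tau> A :: real
  assumes \<kappa>: "0 < \<kappa>" "\<kappa> < \<tau>" "\<tau> < 1"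
  defines "\<theta> \<equiv> (\<tau> - \<kappa>) / (1 - \<kappa>)"
  shows "\<exists>C>0. \<forall>(v::'a::euclidean_space \<Rightarrow> real) \<sigma> b \<beta> f. mpair \<theta> A v \<sigma> \<longrightarrow> bmob \<beta> b \<longrightarrow> 0 < \<beta> \<longrightarrow> f \<in> borel_measurable borel \<longrightarrow> (\<forall>y. 0 \<le> f y) \<longrightarrow>
    (\<integral>\<^sup>+x. epow (rieszb \<kappa> b f x) (1 / (\<tau> - \<kappa>)) * ennreal (v x) \<partial>lborel)
      \<le> ennreal (C * \<beta> powr (1 / (\<tau> - \<kappa>))) * epow (\<integral>\<^sup>+y. ennreal (f y powr (1 / \<tau>) * v y powr (1 - \<kappa> / \<tau>)) \<partial>lborel) (\<tau> / (\<tau> - \<kappa>))"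
proof -
  have \<theta>: "0 < \<theta>" "\<theta> < 1" using \<kappa> by (auto simp: \<theta>_def)
  obtain c A' where c: "0 < c" and pert: "\<And>(v::'a \<Rightarrow> real) \<sigma> b \<beta> s. mpair \<theta> A v \<sigma> \<Longrightarrow> bmob \<beta> b \<Longrightarrow> 0 < \<beta> \<Longrightarrow> \<bar>s\<bar> * \<beta> \<le> c \<Longrightarrow>
    mpair \<theta> A' (\<lambda>x. v x * exp (s / \<theta> * b x)) (\<lambda>x. \<sigma> x * exp (- s / (1 - \<theta>) * b x))"
    using mpair_perturb[OF \<theta>, of A, where 'a='a] by blast
  obtain C where C: "0 < C" and I: "\<And>(v::'a \<Rightarrow> real) \<sigma> f. mpair \<theta> A' v \<sigma> \<Longrightarrow> f \<in> borel_measurable borel \<Longrightarrow> (\<forall>y. 0 \<le> f y) \<Longrightarrow>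
    (\<integral>\<^sup>+x. epow (riesz \<kappa> f x) (1 / (\<tau> - \<kappa>)) * ennreal (v x) \<partial>lborel)
      \<le> ennreal C * epow (\<integral>\<^sup>+y. ennreal (f y powr (1 / \<tau>) * v y powr (1 - \<kappa> / \<tau>)) \<partial>lborel) (\<tau> / (\<tau> - \<kappa>))"
    using riesz_weighted[OF \<kappa>, of A', folded \<theta>_def, where 'a='a] by blast
  define q where "q = 1 / (\<tau> - \<kappa>)"
  have q: "0 < q" using \<kappa> by (simp add: q_def)
  define C' where "C' = (1 / (c * (1 - \<kappa>))) powr q * (2 powr q * (2 * C))"
  show ?thesis
  proof (rule exI[of _ C'], intro conjI allI impI)
    show "0 < C'" using c C \<kappa> by (simp add: C'_def)
    fix v \<sigma> b f :: "'a \<Rightarrow> real" and \<beta>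
    assume m: "mpair \<theta> A v \<sigma>" and b: "bmob \<beta> b" "0 < \<beta>" and f [measurable]: "f \<in> borel_measurable borel" and f0: "\<forall>y. 0 \<le> f y"
    have v: "wt v" using m by (auto simp: mpair_def)
    have bm [measurable]: "b \<in> borel_measurable borel" using b by (simp add: bmob_def)
    note [measurable] = wtD(2)[OF v]
    \<comment> \<open>The largest parameter that the perturbation theorem admits after the rescaling
      s = t / (1 - \<kappa>), for which s / \<theta> = t q. Being a multiple of 1 / \<beta>, it
      produces the power \<beta>^q.\<close>
    define \<epsilon> where "\<epsilon> = c / \<beta> * (1 - \<kappa>)"
    have \<epsilon>: "0 < \<epsilon>" using c b \<kappa> by (simp add: \<epsilon>_def)
    define G where "G = (\<integral>\<^sup>+y. ennreal (f y powr (1 / \<tau>) * v y powr (1 - \<kappa> / \<tau>)) \<partial>lborel)"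
    have one: "(\<integral>\<^sup>+x. epow (ennreal (exp (t * b x)) * riesz \<kappa> (\<lambda>y. f y * exp (- t * b y)) x) q * ennreal (v x) \<partial>lborel) \<le> ennreal C * epow G (\<tau> / (\<tau> - \<kappa>))"
      if t: "\<bar>t\<bar> = \<epsilon>" for t
    proof -
      define s where "s = t / (1 - \<kappa>)"
      have s: "\<bar>s\<bar> * \<beta> \<le> c" using \<kappa> b t by (simp add: s_def \<epsilon>_def)
      have st: "s / \<theta> = t * q" using \<kappa> by (simp add: s_def q_def \<theta>_def)
      define v' where "v' x = v x * exp (t * q * b x)" for x
      have mp: "mpair \<theta> A' v' (\<lambda>x. \<sigma> x * exp (- s / (1 - \<theta>) * b x))"
        using pert[OF m b s] unfolding st v'_def .
      have "(\<integral>\<^sup>+x. epow (ennreal (exp (t * b x)) * riesz \<kappa> (\<lambda>y. f y * exp (- t * b y)) x) q * ennreal (v x) \<partial>lborel)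
        = (\<integral>\<^sup>+x. epow (riesz \<kappa> (\<lambda>y. f y * exp (- t * b y)) x) q * ennreal (v' x) \<partial>lborel)"
      proof (rule nn_integral_cong)
        fix x
        have *: "ennreal (v' x) = epow (ennreal (exp (t * b x))) q * ennreal (v x)"
          using wtD(1)[OF v, of x] by (simp add: v'_def exp_powr_real mult_ac ennreal_mult)
        show "epow (ennreal (exp (t * b x)) * riesz \<kappa> (\<lambda>y. f y * exp (- t * b y)) x) q * ennreal (v x)
            = epow (riesz \<kappa> (\<lambda>y. f y * exp (- t * b y)) x) q * ennreal (v' x)"
          unfolding epow_mult * by (simp only: mult_ac)
      qed
      also have "\<dots> \<le> ennreal C * epow (\<integral>\<^sup>+y. ennreal ((f y * exp (- t * b y)) powr (1 / \<tau>) * v' y powr (1 - \<kappa> / \<tau>)) \<partial>lborel) (\<tau> / (\<tau> - \<kappa>))"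
        unfolding q_def using f0 by (intro I[OF mp]) auto
      also have "(\<lambda>y. (f y * exp (- t * b y)) powr (1 / \<tau>) * v' y powr (1 - \<kappa> / \<tau>)) = (\<lambda>y. f y powr (1 / \<tau>) * v y powr (1 - \<kappa> / \<tau>))"
      proof
        fix y
        have "q * (1 - \<kappa> / \<tau>) = 1 / \<tau>" using \<kappa> by (simp add: q_def field_simps)
        then have "- t * b y * (1 / \<tau>) + t * q * b y * (1 - \<kappa> / \<tau>) = 0"
          by (metis (no_types, opaque_lifting) add.left_inverse minus_mult_left mult.assoc mult.commute)
        then have "exp (- t * b y * (1 / \<tau>)) * exp (t * q * b y * (1 - \<kappa> / \<tau>)) = 1" by (simp only: exp_add[symmetric] exp_zero)
        then show "(f y * exp (- t * b y)) powr (1 / \<tau>) * v' y powr (1 - \<kappa> / \<tau>) = f y powr (1 / \<tau>) * v y powr (1 - \<kappa> / \<tau>)"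
          unfolding v'_def powr_mult exp_powr_real by (simp add: mult_ac)
      qed
      finally show ?thesis by (simp add: G_def)
    qed
    define X where "X x = ennreal (exp (\<epsilon> * b x)) * riesz \<kappa> (\<lambda>y. f y * exp (- \<epsilon> * b y)) x" for x
    define Y where "Y x = ennreal (exp (- \<epsilon> * b x)) * riesz \<kappa> (\<lambda>y. f y * exp (\<epsilon> * b y)) x" for x
    have [measurable]: "X \<in> borel_measurable borel" "Y \<in> borel_measurable borel" unfolding X_def Y_def by measurable
    have XY: "(\<integral>\<^sup>+x. epow (X x) q * ennreal (v x) \<partial>lborel) \<le> ennreal C * epow G (\<tau> / (\<tau> - \<kappa>))"
      "(\<integral>\<^sup>+x. epow (Y x) q * ennreal (v x) \<partial>lborel) \<le> ennreal C * epow G (\<tau> / (\<tau> - \<kappa>))"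
      using one[of \<epsilon>] one[of "- \<epsilon>"] \<epsilon> by (auto simp: X_def Y_def)
    define E where "E = ennreal ((1 / \<epsilon>) powr q) * ennreal (2 powr q)"
    have "epow (rieszb \<kappa> b f x) q \<le> E * (epow (X x) q + epow (Y x) q)" for x
    proof -
      have "epow (rieszb \<kappa> b f x) q \<le> epow (ennreal (1 / \<epsilon>) * (X x + Y x)) q"
        unfolding X_def Y_def using f0 \<epsilon> q by (intro epow_mono rieszb_le) auto
      also have "\<dots> = ennreal ((1 / \<epsilon>) powr q) * epow (X x + Y x) q" using \<epsilon> by (simp add: epow_mult)
      also have "\<dots> \<le> ennreal ((1 / \<epsilon>) powr q) * (ennreal (2 powr q) * (epow (X x) q + epow (Y x) q))"
        using q by (intro mult_left_mono epow_add_le) auto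
      finally show ?thesis by (simp add: E_def mult.assoc)
    qed
    then have "epow (rieszb \<kappa> b f x) q * ennreal (v x) \<le> E * (epow (X x) q * ennreal (v x) + epow (Y x) q * ennreal (v x))" for x
      unfolding distrib_right[symmetric] mult.assoc[symmetric] by (rule mult_right_mono) simp
    then have "(\<integral>\<^sup>+x. epow (rieszb \<kappa> b f x) q * ennreal (v x) \<partial>lborel)
        \<le> (\<integral>\<^sup>+x. E * (epow (X x) q * ennreal (v x) + epow (Y x) q * ennreal (v x)) \<partial>lborel)"
      by (intro nn_integral_mono)
    also have "\<dots> = E * ((\<integral>\<^sup>+x. epow (X x) q * ennreal (v x) \<partial>lborel) + (\<integral>\<^sup>+x. epow (Y x) q * ennreal (v x) \<partial>lborel))"
      by (subst nn_integral_cmult, measurable, subst nn_integral_add) auto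
    also have "\<dots> \<le> E * (ennreal C * epow G (\<tau> / (\<tau> - \<kappa>)) + ennreal C * epow G (\<tau> / (\<tau> - \<kappa>)))"
      using XY by (intro mult_left_mono add_mono) auto
    also have "\<dots> = E * (ennreal (2 * C) * epow G (\<tau> / (\<tau> - \<kappa>)))"
    proof -
      have "ennreal (2 * C) = ennreal C + ennreal C" unfolding mult_2 using C by (intro ennreal_plus) auto
      then show ?thesis by (simp only: distrib_right)
    qed
    also have "\<dots> = ennreal (C' * \<beta> powr q) * epow G (\<tau> / (\<tau> - \<kappa>))"
    proof -
      have "1 / \<epsilon> = 1 / (c * (1 - \<kappa>)) * \<beta>" by (simp add: \<epsilon>_def)
      then have "(1 / \<epsilon>) powr q = (1 / (c * (1 - \<kappa>))) powr q * \<beta> powr q" by (simp only: powr_mult)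
      then have "(1 / \<epsilon>) powr q * 2 powr q * (2 * C) = C' * \<beta> powr q" by (simp add: C'_def)
      moreover have "E * ennreal (2 * C) = ennreal ((1 / \<epsilon>) powr q * 2 powr q * (2 * C))"
        unfolding E_def using C by (subst ennreal_mult[of "_ * _"], simp, simp, subst ennreal_mult) auto
      ultimately show ?thesis by (simp only: mult.assoc[symmetric])
    qed
    finally show "(\<integral>\<^sup>+x. epow (rieszb \<kappa> b f x) (1 / (\<tau> - \<kappa>)) * ennreal (v x) \<partial>lborel)
      \<le> ennreal (C' * \<beta> powr (1 / (\<tau> - \<kappa>))) * epow (\<integral>\<^sup>+y. ennreal (f y powr (1 / \<tau>) * v y powr (1 - \<kappa> / \<tau>)) \<partial>lborel) (\<tau> / (\<tau> - \<kappa>))"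
      by (simp add: q_def G_def)
  qed
qed

section \<open>From the vector weight condition to scalar conditions\<close>

lemma wmeas_eq_LINT:
  fixes g :: "'a::euclidean_space \<Rightarrow> real"
  assumes "set_integrable lborel B g" "\<And>y. 0 \<le> g y"
  shows "wmeas g B = (LINT y:B|lborel. g y)"
proof -
  have "0 \<le> (LINT y:B|lborel. g y)"
    using assms(2) unfolding set_lebesgue_integral_def by (intro integral_nonneg_AE) auto
  then show ?thesis using assms by (simp add: wmeas_def set_nn_integral_eq)
qed

lemma weight_wt:
  assumes "weight w"
  shows "wt w" and "0 < r \<Longrightarrow> set_integrable lborel (ball x r) w"
proof -
  have int: "set_integrable lborel (ball x r) w" for x r
    using assms by (intro set_integrable_subset[of lborel "cball x r" w "ball x r"]) (auto simp: weight_def)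
  show "0 < r \<Longrightarrow> set_integrable lborel (ball x r) w" by (rule int)
  have "(\<integral>\<^sup>+y\<in>ball x r. ennreal (w y) \<partial>lborel) < \<infinity>" for x r
    using set_nn_integral_eq[OF int, of x r] assms by (simp add: weight_def)
  then show "wt w" using assms by (auto simp: weight_def wt_def)
qed

text \<open>A uniform description of the Muckenhoupt condition: the case of exponent one is absorbed
  into exponent two.\<close>

lemma A_infty_dual:
  fixes w :: "'a::euclidean_space \<Rightarrow> real"
  assumes "A_infty w"
  shows "wt w" and "\<exists>r C. 1 < r \<and> 0 < C \<and> (\<forall>x \<rho>. 0 < \<rho> \<longrightarrow> (\<exists>N\<ge>0. (\<integral>\<^sup>+y\<in>ball x \<rho>. ennreal (w y powr (-1 / (r - 1))) \<partial>lborel) \<le> ennreal N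
      \<and> wmeas w (ball x \<rho>) * N powr (r - 1) \<le> C * measure lborel (ball x \<rho>) powr r))"
proof -
  obtain p where p: "1 \<le> p" "A_p p w" using assms by (auto simp: A_infty_def)
  have wgt: "weight w" using p by (simp add: A_p_def)
  show w: "wt w" using weight_wt(1)[OF wgt] .
  have avgw: "avg (ball x \<rho>) w = wmeas w (ball x \<rho>) / measure lborel (ball x \<rho>)" if "0 < \<rho>" for x \<rho>
    using wmeas_eq_LINT[OF weight_wt(2)[OF wgt that], of x] wtD(1)[OF w] by (simp add: avg_def)
  show "\<exists>r C. 1 < r \<and> 0 < C \<and> (\<forall>x \<rho>. 0 < \<rho> \<longrightarrow> (\<exists>N\<ge>0. (\<integral>\<^sup>+y\<in>ball x \<rho>. ennreal (w y powr (-1 / (r - 1))) \<partial>lborel) \<le> ennreal N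
      \<and> wmeas w (ball x \<rho>) * N powr (r - 1) \<le> C * measure lborel (ball x \<rho>) powr r))"
  proof (cases "p = 1")
    case True
    then obtain C0 where C0: "\<And>x \<rho>. 0 < \<rho> \<Longrightarrow> AE y in lborel. y \<in> ball x \<rho> \<longrightarrow> avg (ball x \<rho>) w \<le> C0 * w y"
      using p by (auto simp: A_p_def)
    define C where "C = \<bar>C0\<bar> + 1"
    show ?thesis
    proof (rule exI[of _ 2], rule exI[of _ C], intro conjI allI impI)
      fix x :: 'a and \<rho> :: real assume \<rho>: "0 < \<rho>"
      define B where "B = ball x \<rho>"
      define b where "b = measure lborel B"
      define W where "W = wmeas w B"
      have b: "0 < b" unfolding b_def B_def using \<rho> by (rule measure_ball_pos)
      have W: "0 < W" unfolding W_def B_def using w \<rho> by (rule wmeas_ball_pos)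
      have [measurable]: "B \<in> sets borel" by (simp add: B_def)
      \<comment> \<open>The condition with exponent one says 1 / w \<le> C b / W almost everywhere
        on the ball, a bound for the power -1 of w, which is the dual power for exponent
        two.\<close>
      have "(\<integral>\<^sup>+y\<in>B. ennreal (w y powr (-1 / (2 - 1))) \<partial>lborel) \<le> (\<integral>\<^sup>+y. ennreal (C * b / W) * indicator B y \<partial>lborel)"
      proof (rule nn_integral_mono_AE)
        show "AE y in lborel. ennreal (w y powr (-1 / (2 - 1))) * indicator B y \<le> ennreal (C * b / W) * indicator B y"
          using C0[OF \<rho>, of x] wtD(3)[OF w]
        proof eventually_elim
          case (elim y)
          show ?case
          proof (cases "y \<in> B")
            case True
            then have "W / b \<le> C0 * w y" using elim(1) avgw[OF \<rho>, of x] by (simp add: B_def W_def b_def)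
            also have "\<dots> \<le> C * w y" using elim(2) by (intro mult_right_mono) (auto simp: C_def)
            finally have "1 / w y \<le> C * b / W" using elim(2) b W by (simp add: field_simps)
            then show ?thesis using elim(2) by (auto simp: powr_minus_divide intro!: mult_right_mono ennreal_leI)
          qed simp
        qed
      qed
      also have "\<dots> = ennreal (C * b / W) * emeasure lborel B" by (subst nn_integral_cmult) auto
      also have "\<dots> = ennreal (C * b / W * b)"
      proof -
        have "emeasure lborel B = ennreal b"
          using emeasure_lborel_ball_finite[of x \<rho>] by (simp add: B_def b_def emeasure_eq_ennreal_measure)
        then show ?thesis using b W by (simp only:) (intro ennreal_mult[symmetric], auto simp: C_def)
      qed
      finally have 1: "(\<integral>\<^sup>+y\<in>ball x \<rho>. ennreal (w y powr (-1 / (2 - 1))) \<partial>lborel) \<le> ennreal (C * b / W * b)" by (simp add: B_def)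
      have "0 \<le> C * b / W * b" using b W by (simp add: C_def)
      moreover have "W * (C * b / W * b) powr (2 - 1) \<le> C * b powr 2"
        using b W by (simp add: C_def power2_eq_square)
      ultimately show "\<exists>N\<ge>0. (\<integral>\<^sup>+y\<in>ball x \<rho>. ennreal (w y powr (-1 / (2 - 1))) \<partial>lborel) \<le> ennreal N
        \<and> wmeas w (ball x \<rho>) * N powr (2 - 1) \<le> C * measure lborel (ball x \<rho>) powr 2"
        using 1 by (intro exI[of _ "C * b / W * b"]) (auto simp: W_def b_def B_def)
    qed (auto simp: C_def)
  next
    case False
    then have p1: "1 < p" using p by simp
    obtain C0 where int: "\<And>x r. 0 < r \<Longrightarrow> set_integrable lborel (ball x r) (\<lambda>y. w y powr (-1 / (p - 1)))"
      and C0: "\<And>x r. 0 < r \<Longrightarrow> avg (ball x r) w * avg (ball x r) (\<lambda>y. w y powr (-1 / (p - 1))) powr (p - 1) \<le> C0"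
      using p False by (auto simp: A_p_def)
    define C where "C = \<bar>C0\<bar> + 1"
    show ?thesis
    proof (rule exI[of _ p], rule exI[of _ C], intro conjI allI impI)
      fix x :: 'a and \<rho> :: real assume \<rho>: "0 < \<rho>"
      define B where "B = ball x \<rho>"
      define b where "b = measure lborel B"
      define W where "W = wmeas w B"
      define N where "N = (LINT y:B|lborel. w y powr (-1 / (p - 1)))"
      have b: "0 < b" unfolding b_def B_def using \<rho> by (rule measure_ball_pos)
      have N: "0 \<le> N" unfolding N_def set_lebesgue_integral_def by (intro integral_nonneg_AE) auto
      have "(\<integral>\<^sup>+y\<in>B. ennreal (w y powr (-1 / (p - 1))) \<partial>lborel) = ennreal N"
        unfolding N_def B_def using int[OF \<rho>] by (intro set_nn_integral_eq) auto
      moreover have "W * N powr (p - 1) \<le> C * b powr p"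
      proof -
        have "W / b * (N / b) powr (p - 1) \<le> C0"
        proof -
          have "avg B w = W / b" "avg B (\<lambda>y. w y powr (-1 / (p - 1))) = N / b"
            using avgw[OF \<rho>, of x] by (auto simp: B_def W_def b_def N_def avg_def)
          then show ?thesis using C0[OF \<rho>, of x, folded B_def] by simp
        qed
        then have "W / b * (N / b) powr (p - 1) \<le> C" by (simp add: C_def)
        then have "W * N powr (p - 1) / (b * b powr (p - 1)) \<le> C" using b N by (simp add: powr_divide)
        moreover have "b * b powr (p - 1) = b powr p" using b powr_add[of b 1 "p - 1"] by simp
        ultimately show ?thesis using b by (simp add: pos_divide_le_eq)
      qed
      ultimately show "\<exists>N\<ge>0. (\<integral>\<^sup>+y\<in>ball x \<rho>. ennreal (w y powr (-1 / (p - 1))) \<partial>lborel) \<le> ennreal N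
        \<and> wmeas w (ball x \<rho>) * N powr (p - 1) \<le> C * measure lborel (ball x \<rho>) powr p"
        using N by (intro exI[of _ N]) (auto simp: W_def b_def B_def)
    qed (use p1 in \<open>auto simp: C_def\<close>)
  qed
qed

lemma wt_of_integrable:
  assumes "\<And>y. 0 \<le> w y" "w \<in> borel_measurable borel" "AE y in lborel. 0 < w y"
    and "\<And>x r. 0 < r \<Longrightarrow> set_integrable lborel (ball x r) w"
  shows "wt w"
  unfolding wt_def
proof (intro conjI allI)
  show "(\<integral>\<^sup>+y\<in>ball x r. ennreal (w y) \<partial>lborel) < \<infinity>" for x r
  proof (cases "0 < r")
    case True
    then show ?thesis using set_nn_integral_eq[OF assms(4)[OF True] assms(1), of x] by simp
  next
    case False
    then have empty: "ball x r = {}" by simp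
    show ?thesis unfolding empty by simp
  qed
qed (use assms in auto)

lemma avg_eq_wmeas:
  assumes "set_integrable lborel B g" "\<And>y. 0 \<le> g y"
  shows "avg B g = wmeas g B / measure lborel B"
  using wmeas_eq_LINT[OF assms] by (simp add: avg_def)

lemma prod_mono_ennreal:
  fixes f g :: "'i \<Rightarrow> ennreal"
  assumes "\<And>i. i \<in> I \<Longrightarrow> f i \<le> g i"
  shows "(\<Prod>i\<in>I. f i) \<le> (\<Prod>i\<in>I. g i)"
  using assms by (induction I rule: infinite_finite_induct) (auto intro!: mult_mono)

lemma prod_powr_distrib_const:
  fixes b :: real
  assumes "0 < b" "finite I"
  shows "(\<Prod>i\<in>I. b powr t i) = b powr (\<Sum>i\<in>I. t i)"
  using assms by (simp add: powr_sum)

lemma prod_powr: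
  fixes f :: "'i \<Rightarrow> real"
  assumes "finite I" "\<And>i. i \<in> I \<Longrightarrow> 0 \<le> f i"
  shows "(\<Prod>i\<in>I. f i) powr s = (\<Prod>i\<in>I. f i powr s)"
  using assms
proof (induction I rule: finite_induct)
  case (insert i I)
  then show ?case by (simp add: powr_mult prod_nonneg)
qed simp

text \<open>Two halves. Hoelder's inequality for the constant 1, written as a product of negative
  powers of the \<omega>_i and a positive power of their product, combined with the Muckenhoupt
  bounds for v_i = \<omega>_i^q_i, compares the product of the v_i(B)^(1/q_i) with u(B)^(1/qq).
  Inserted in the vector condition, this bounds the product of the scalar quantities
  \<open>X j\<close> above; as each of them is bounded below by Hoelder, each single one is bounded
  above.\<close>

lemma vector_weight_reduction:
  fixes \<omega> :: "nat \<Rightarrow> 'a::euclidean_space \<Rightarrow> real"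
  assumes m: "0 < m" and p: "\<And>i. i < m \<Longrightarrow> 1 < p i" and q: "\<And>i. i < m \<Longrightarrow> 0 < q i"
    and \<kappa>: "\<And>i. i < m \<Longrightarrow> 0 < 1 / p i - 1 / q i"
    and qq: "1 / qq = (\<Sum>i<m. 1 / q i)" and \<omega>0: "\<And>i y. i < m \<Longrightarrow> 0 \<le> \<omega> i y"
    and AP: "A_vec_Pq m p qq \<omega>" and Ai: "\<And>i. i < m \<Longrightarrow> A_infty (\<lambda>y. \<omega> i y powr q i)"
  shows "\<exists>A. \<forall>i<m. mpair (1 / q i / (1 - (1 / p i - 1 / q i))) (A i) (\<lambda>y. \<omega> i y powr q i) (\<lambda>y. \<omega> i y powr (- (p i / (p i - 1))))"
    and "\<exists>C>0. \<forall>x r. 0 < r \<longrightarrow> (\<Prod>i<m. wmeas (\<lambda>y. \<omega> i y powr q i) (ball x r) powr (1 / q i))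
        \<le> C * wmeas (\<lambda>y. (\<Prod>i<m. \<omega> i y) powr qq) (ball x r) powr (1 / qq)"
    and "wt (\<lambda>y. (\<Prod>i<m. \<omega> i y) powr qq)"
proof -
  define v where "v i y = \<omega> i y powr q i" for i y
  define \<sigma> where "\<sigma> i y = \<omega> i y powr (- (p i / (p i - 1)))" for i y
  define u where "u y = (\<Prod>i<m. \<omega> i y) powr qq" for y
  have "0 < (\<Sum>i<m. 1 / q i)" using m q by (intro sum_pos) auto
  then have qq0: "0 < qq" unfolding qq[symmetric] by (simp add: zero_less_divide_1_iff)
  have wv: "wt (v i)" if "i < m" for i using A_infty_dual(1)[OF Ai[OF that]] by (simp add: v_def[abs_def])
  have \<omega>m [measurable]: "\<omega> i \<in> borel_measurable borel" if "i < m" for i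
  proof -
    have "\<omega> i = (\<lambda>y. v i y powr (1 / q i))" using q[OF that] \<omega>0[OF that] by (auto simp: v_def powr_powr)
    moreover note [measurable] = wtD(2)[OF wv[OF that]]
    have "(\<lambda>y. v i y powr (1 / q i)) \<in> borel_measurable borel" by measurable
    ultimately show ?thesis by simp
  qed
  have "AE y in lborel. i < m \<longrightarrow> 0 < \<omega> i y" for i
  proof (cases "i < m")
    case True
    show ?thesis using wtD(3)[OF wv[OF True]]
    proof eventually_elim
      case (elim y)
      then have "\<omega> i y \<noteq> 0" by (auto simp: v_def)
      then show ?case using \<omega>0[OF True, of y] by simp
    qed
  qed simp
  then have \<omega>pos: "AE y in lborel. \<forall>i<m. 0 < \<omega> i y" by (simp add: AE_all_countable)
  have u0: "0 \<le> u y" for y by (simp add: u_def)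
  have ints: "0 < r \<Longrightarrow> set_integrable lborel (ball x r) u" "0 < r \<Longrightarrow> i < m \<Longrightarrow> set_integrable lborel (ball x r) (\<sigma> i)" for x r i
    using AP by (auto simp: A_vec_Pq_def u_def[abs_def] \<sigma>_def[abs_def])
  have wu: "wt u"
  proof (rule wt_of_integrable[OF u0])
    show "u \<in> borel_measurable borel" unfolding u_def[abs_def] by measurable
    show "AE y in lborel. 0 < u y" using \<omega>pos by eventually_elim (auto simp: u_def intro!: prod_pos)
  qed (use ints in auto)
  then show "wt (\<lambda>y. (\<Prod>i<m. \<omega> i y) powr qq)" by (simp add: u_def[abs_def])
  have w\<sigma>: "wt (\<sigma> i)" if i: "i < m" for i
  proof (rule wt_of_integrable)
    show "\<sigma> i \<in> borel_measurable borel" unfolding \<sigma>_def[abs_def] using \<omega>m[OF i] by measurable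
    show "AE y in lborel. 0 < \<sigma> i y" using \<omega>pos by eventually_elim (use i in \<open>auto simp: \<sigma>_def\<close>)
  qed (use ints i in \<open>auto simp: \<sigma>_def\<close>)

  define P where "P i r C \<longleftrightarrow> 1 < r \<and> 0 < C \<and> (\<forall>x \<rho>. 0 < \<rho> \<longrightarrow> (\<exists>N\<ge>0. (\<integral>\<^sup>+y\<in>ball x \<rho>. ennreal (v i y powr (-1 / (r - 1))) \<partial>lborel) \<le> ennreal N
      \<and> wmeas (v i) (ball x \<rho>) * N powr (r - 1) \<le> C * measure lborel (ball x \<rho>) powr r))" for i r C
  have "\<exists>z. i < m \<longrightarrow> P i (fst z) (snd z)" for i
  proof (cases "i < m")
    case True
    obtain r C where "P i r C" using A_infty_dual(2)[OF Ai[OF True]] unfolding P_def v_def[abs_def] by blast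
    then show ?thesis by (intro exI[of _ "(r, C)"]) simp
  qed simp
  then have "\<forall>i. \<exists>z. i < m \<longrightarrow> P i (fst z) (snd z)" by blast
  from choice[OF this] obtain z where z: "\<And>i. i < m \<Longrightarrow> P i (fst (z i)) (snd (z i))" by blast
  define rr where "rr i = fst (z i)" for i
  define CC where "CC i = snd (z i)" for i
  have rr: "1 < rr i" "0 < CC i" if "i < m" for i using z[OF that] by (auto simp: P_def rr_def CC_def)
  have dual: "\<exists>N\<ge>0. (\<integral>\<^sup>+y\<in>ball x \<rho>. ennreal (v i y powr (-1 / (rr i - 1))) \<partial>lborel) \<le> ennreal N
      \<and> wmeas (v i) (ball x \<rho>) * N powr (rr i - 1) \<le> CC i * measure lborel (ball x \<rho>) powr rr i" if "i < m" "0 < \<rho>" for i x \<rho>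
    using z[OF that(1)] that(2) unfolding P_def rr_def CC_def by blast
  \<comment> \<open>Normalisation: with s = 1 / D the Hoelder exponents (rr i - 1) s / q i and s /
    qq sum to one. As D is also the sum of the rr i / q i, the powers of the volume from the dual
    bounds multiply to b^D.\<close>
  define D where "D = 1 / qq + (\<Sum>i<m. (rr i - 1) / q i)"
  define s where "s = 1 / D"
  define C1 where "C1 = (\<Prod>i<m. CC i powr (1 / q i))"
  have C1: "0 < C1" unfolding C1_def using rr by (intro prod_pos) (simp add: less_imp_neq[THEN not_sym])
  have "0 \<le> (\<Sum>i<m. (rr i - 1) / q i)" using rr q by (intro sum_nonneg) (simp add: less_imp_le)
  then have D: "0 < D" unfolding D_def using qq0 by (intro add_pos_nonneg) auto
  have s: "0 < s" using D by (simp add: s_def)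
  have D2: "D = (\<Sum>i<m. rr i / q i)" unfolding D_def qq sum.distrib[symmetric]
    by (intro sum.cong) (auto simp: add_divide_distrib[symmetric])
  have rev: "(\<Prod>i<m. wmeas (v i) (ball x r) powr (1 / q i)) \<le> C1 * wmeas u (ball x r) powr (1 / qq)" if r: "0 < r" for x r
  proof -
    define B where "B = ball x r"
    have B_meas [measurable]: "B \<in> sets borel" by (simp add: B_def)
    define b where "b = measure lborel B"
    have b: "0 < b" unfolding b_def B_def using r by (rule measure_ball_pos)
    define W where "W i = wmeas (v i) B" for i
    define U where "U = wmeas u B"
    have U: "0 \<le> U" by (simp add: U_def)
    define Q where "Q i N \<longleftrightarrow> 0 \<le> N \<and> (\<integral>\<^sup>+y\<in>B. ennreal (v i y powr (-1 / (rr i - 1))) \<partial>lborel) \<le> ennreal N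
      \<and> W i * N powr (rr i - 1) \<le> CC i * b powr rr i" for i N
    have "\<forall>i. \<exists>N. i < m \<longrightarrow> Q i N"
      using dual[OF _ r, of _ x] unfolding Q_def B_def[symmetric] W_def b_def by blast
    from choice[OF this] obtain N where "\<And>i. i < m \<Longrightarrow> Q i (N i)" by blast
    then have N: "\<And>i. i < m \<Longrightarrow> 0 \<le> N i" "\<And>i. i < m \<Longrightarrow> (\<integral>\<^sup>+y\<in>B. ennreal (v i y powr (-1 / (rr i - 1))) \<partial>lborel) \<le> ennreal (N i)"
      "\<And>i. i < m \<Longrightarrow> W i * N i powr (rr i - 1) \<le> CC i * b powr rr i"
      unfolding Q_def by blast+
    \<comment> \<open>Index m stands for the extra factor \<open>u\<close>, so the product runs over
      \<open>Suc m\<close> factors.\<close>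
    define t where "t i = (if i < m then (rr i - 1) * s / q i else s / qq)" for i
    define g where "g i y = (if i < m then ennreal (v i y powr (-1 / (rr i - 1))) else ennreal (u y)) * indicator B y" for i y
    have g_meas: "g i \<in> borel_measurable lborel" for i
    proof (cases "i < m")
      case True
      note [measurable] = wtD(2)[OF wv[OF True]]
      show ?thesis unfolding g_def[abs_def] using True by simp
    next
      case False
      note [measurable] = wtD(2)[OF wu]
      show ?thesis unfolding g_def[abs_def] using False by simp
    qed
    have "emeasure lborel B = ennreal b"
      using emeasure_lborel_ball_finite[of x r] by (simp add: B_def b_def emeasure_eq_ennreal_measure)
    then have "ennreal b = (\<integral>\<^sup>+y. indicator B y \<partial>lborel)" by simp
    also have "\<dots> = (\<integral>\<^sup>+y. (\<Prod>i<Suc m. epow (g i y) (t i)) \<partial>lborel)"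
    proof (rule nn_integral_cong_AE)
      show "AE y in lborel. indicator B y = (\<Prod>i<Suc m. epow (g i y) (t i))"
        using \<omega>pos
      proof eventually_elim
        case (elim y)
        show ?case
        proof (cases "y \<in> B")
          case True
          \<comment> \<open>Each dual power of v_i contributes \<omega>_i^(-s), and \<open>u\<close>
            contributes the product of the \<omega>_i to the power s, so that all factors together
            give 1.\<close>
          have "epow (g i y) (t i) = ennreal (\<omega> i y powr (- s))" if "i < m" for i
          proof -
            have "q i * (-1 / (rr i - 1)) * ((rr i - 1) * s / q i) = - s" using rr(1)[OF that] q[OF that] by simp
            then have "(v i y powr (-1 / (rr i - 1))) powr t i = \<omega> i y powr (- s)"
              using that unfolding v_def t_def by (simp only: powr_powr if_True)
            then show ?thesis using that True by (simp add: g_def)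
          qed
          then have "(\<Prod>i<m. epow (g i y) (t i)) = (\<Prod>i<m. ennreal (\<omega> i y powr (- s)))" by (intro prod.cong) auto
          also have "\<dots> = ennreal (\<Prod>i<m. \<omega> i y powr (- s))" by (intro prod_ennreal) auto
          also have "(\<Prod>i<m. \<omega> i y powr (- s)) = (\<Prod>i<m. \<omega> i y) powr (- s)" using \<omega>0 by (intro prod_powr[symmetric]) auto
          finally have 1: "(\<Prod>i<m. epow (g i y) (t i)) = ennreal ((\<Prod>i<m. \<omega> i y) powr (- s))" .
          have 2: "epow (g m y) (t m) = ennreal ((\<Prod>i<m. \<omega> i y) powr s)"
            using True qq0 by (simp add: g_def t_def u_def powr_powr)
          have P: "0 < (\<Prod>i<m. \<omega> i y)" using elim by (intro prod_pos) auto
          have "z powr (- s) * z powr s = 1" if "0 < z" for z :: real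
            using that by (simp add: powr_add[symmetric])
          from this[OF P] have "(\<Prod>i<m. \<omega> i y) powr (- s) * (\<Prod>i<m. \<omega> i y) powr s = 1" .
          then show ?thesis using True by (simp add: 1 2 ennreal_mult[symmetric])
        qed (simp add: g_def)
      qed
    qed
    also have "\<dots> \<le> (\<Prod>i<Suc m. epow (\<integral>\<^sup>+y. g i y \<partial>lborel) (t i))"
    proof (rule nn_integral_Hoelder_prod)
      show "0 < t i" for i
        using rr q s qq0 by (simp add: t_def)
      have "(\<Sum>i<m. t i) = (\<Sum>i<m. (rr i - 1) / q i) * s"
        unfolding sum_distrib_right by (intro sum.cong) (auto simp: t_def)
      then have "(\<Sum>i<Suc m. t i) = D * s" by (simp add: t_def D_def distrib_right)
      then show "(\<Sum>i<Suc m. t i) = 1" using D by (simp add: s_def)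
    qed (use g_meas in auto)
    also have "\<dots> = (\<Prod>i<m. epow (\<integral>\<^sup>+y. g i y \<partial>lborel) (t i)) * epow (\<integral>\<^sup>+y. g m y \<partial>lborel) (t m)" by simp
    also have "\<dots> \<le> (\<Prod>i<m. ennreal (N i powr t i)) * ennreal (U powr t m)"
    proof (rule mult_mono)
      show "(\<Prod>i<m. epow (\<integral>\<^sup>+y. g i y \<partial>lborel) (t i)) \<le> (\<Prod>i<m. ennreal (N i powr t i))"
      proof (rule prod_mono_ennreal)
        fix i assume "i \<in> {..<m}"
        then have i: "i < m" by simp
        have "epow (\<integral>\<^sup>+y. g i y \<partial>lborel) (t i) \<le> epow (ennreal (N i)) (t i)"
          using N(2)[OF i] i rr(1)[OF i] q[OF i] s by (intro epow_mono) (auto simp: g_def t_def)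
        then show "epow (\<integral>\<^sup>+y. g i y \<partial>lborel) (t i) \<le> ennreal (N i powr t i)" using N(1)[OF i] by simp
      qed
      have "(\<integral>\<^sup>+y. g m y \<partial>lborel) = ennreal U"
        using ennreal_wmeas[OF wu, of B x r] by (simp add: g_def U_def B_def)
      then show "epow (\<integral>\<^sup>+y. g m y \<partial>lborel) (t m) \<le> ennreal (U powr t m)" using U by simp
    qed auto
    also have "\<dots> = ennreal ((\<Prod>i<m. N i powr t i) * U powr t m)"
      by (simp add: prod_ennreal ennreal_mult prod_nonneg)
    finally have "b \<le> (\<Prod>i<m. N i powr t i) * U powr t m" by (simp add: prod_nonneg ennreal_le_iff)
    then have "b powr D \<le> ((\<Prod>i<m. N i powr t i) * U powr t m) powr D" using b D by (intro powr_mono2) auto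
    also have "\<dots> = (\<Prod>i<m. (N i powr (rr i - 1)) powr (1 / q i)) * U powr (1 / qq)"
    proof -
      have e: "t m * D = 1 / qq" "\<And>i. i < m \<Longrightarrow> t i * D = (rr i - 1) * (1 / q i)"
        using D by (auto simp: t_def s_def)
      have "((\<Prod>i<m. N i powr t i) * U powr t m) powr D = (\<Prod>i<m. N i powr t i) powr D * U powr (t m * D)"
        by (simp only: powr_mult powr_powr)
      also have "(\<Prod>i<m. N i powr t i) powr D = (\<Prod>i<m. (N i powr t i) powr D)" by (intro prod_powr) auto
      also have "\<dots> = (\<Prod>i<m. (N i powr (rr i - 1)) powr (1 / q i))"
        using e(2) by (intro prod.cong) (auto simp: powr_powr)
      finally show ?thesis by (simp only: e(1))
    qed
    finally have 1: "b powr D \<le> (\<Prod>i<m. (N i powr (rr i - 1)) powr (1 / q i)) * U powr (1 / qq)" .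
    have "b powr D * (\<Prod>i<m. W i powr (1 / q i))
        \<le> ((\<Prod>i<m. (N i powr (rr i - 1)) powr (1 / q i)) * U powr (1 / qq)) * (\<Prod>i<m. W i powr (1 / q i))"
      using 1 by (intro mult_right_mono prod_nonneg) auto
    also have "\<dots> = (\<Prod>i<m. (W i * N i powr (rr i - 1)) powr (1 / q i)) * U powr (1 / qq)"
      by (simp add: powr_mult prod.distrib mult_ac)
    also have "\<dots> \<le> (\<Prod>i<m. (CC i * b powr rr i) powr (1 / q i)) * U powr (1 / qq)"
      using N(3) q by (intro mult_right_mono prod_mono conjI powr_mono2) (auto simp: W_def less_imp_le)
    also have "(\<Prod>i<m. (CC i * b powr rr i) powr (1 / q i)) = C1 * (\<Prod>i<m. b powr (rr i / q i))"
      by (simp add: powr_mult prod.distrib C1_def powr_powr)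
    also have "(\<Prod>i<m. b powr (rr i / q i)) = b powr D" unfolding D2 using b by (intro prod_powr_distrib_const) auto
    finally have "b powr D * (\<Prod>i<m. W i powr (1 / q i)) \<le> b powr D * (C1 * U powr (1 / qq))" by (simp add: mult_ac)
    then show ?thesis using b by (simp add: W_def U_def B_def)
  qed
  then show "\<exists>C>0. \<forall>x r. 0 < r \<longrightarrow> (\<Prod>i<m. wmeas (\<lambda>y. \<omega> i y powr q i) (ball x r) powr (1 / q i))
        \<le> C * wmeas (\<lambda>y. (\<Prod>i<m. \<omega> i y) powr qq) (ball x r) powr (1 / qq)"
    using C1 by (intro exI[of _ C1]) (auto simp: v_def[abs_def] u_def[abs_def])

  obtain C0 where C0: "\<And>x r. 0 < r \<Longrightarrow> avg (ball x r) u powr (1 / qq) * (\<Prod>i<m. avg (ball x r) (\<sigma> i) powr ((p i - 1) / p i)) \<le> C0"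
    using AP by (auto simp: A_vec_Pq_def u_def[abs_def] \<sigma>_def[abs_def])
  define K where "K = C1 * (\<bar>C0\<bar> + 1)"
  have K: "0 < K" using C1 by (simp add: K_def)
  define \<theta> where "\<theta> i = 1 / q i / (1 - (1 / p i - 1 / q i))" for i
  \<comment> \<open>The exponent 1 - \<kappa>_i, for which \<theta> i t i = 1 / q i and (1 -
    \<theta> i) t i = 1 / p_i': the quantity \<open>X\<close> below is the left-hand side of the
    pair condition raised to this power.\<close>
  define t where "t i = 1 - (1 / p i - 1 / q i)" for i
  have tpos: "0 < t i" and \<theta>: "0 < \<theta> i" "\<theta> i < 1" and t\<theta>: "\<theta> i * t i = 1 / q i" "(1 - \<theta> i) * t i = (p i - 1) / p i"
    if i: "i < m" for i
  proof -
    have 1: "1 / p i < 1" "0 < 1 / q i" using p[OF i] q[OF i] by auto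
    then show t: "0 < t i" unfolding t_def by linarith
    have \<theta>t: "\<theta> i = 1 / q i / t i" by (simp add: \<theta>_def t_def)
    show "0 < \<theta> i" unfolding \<theta>t using t q[OF i] by simp
    show "\<theta> i < 1" unfolding \<theta>t divide_less_eq_1_pos[OF t] using 1(1) unfolding t_def by linarith
    show e: "\<theta> i * t i = 1 / q i" unfolding \<theta>t using t by simp
    have "(1 - \<theta> i) * t i = t i - 1 / q i" using e by (simp add: left_diff_distrib)
    then show "(1 - \<theta> i) * t i = (p i - 1) / p i" using p[OF i] by (simp add: t_def diff_divide_distrib)
  qed
  have eq: "AE y in lborel. v i y powr \<theta> i * \<sigma> i y powr (1 - \<theta> i) = 1" if i: "i < m" for i
    using \<omega>pos
  proof eventually_elim
    case (elim y)
    have "q i * \<theta> i = 1 / t i" using t\<theta>(1)[OF i] q[OF i] tpos[OF i] by (simp add: field_simps)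
    moreover have "- (p i / (p i - 1)) * (1 - \<theta> i) = - (1 / t i)"
    proof -
      have "1 - \<theta> i = (p i - 1) / p i / t i" unfolding t\<theta>(2)[OF i, symmetric] using tpos[OF i] by simp
      then show ?thesis using p[OF i] by simp
    qed
    moreover have "0 < \<omega> i y" using elim i by simp
    ultimately show ?case unfolding v_def \<sigma>_def powr_powr
      by (simp only: powr_add[symmetric]) simp
  qed
  have "mpair (\<theta> i) (K powr (1 / t i)) (v i) (\<sigma> i)" if i: "i < m" for i
    unfolding mpair_def
  proof (intro conjI allI impI wv[OF i] w\<sigma>[OF i] eq[OF i])
    fix x :: 'a and r :: real assume r: "0 < r"
    define B where "B = ball x r"
    define b where "b = measure lborel B"
    have b: "0 < b" unfolding b_def B_def using r by (rule measure_ball_pos)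
    define W where "W i = wmeas (v i) B" for i
    define S where "S i = wmeas (\<sigma> i) B" for i
    define U where "U = wmeas u B"
    define X where "X i = W i powr (1 / q i) * S i powr ((p i - 1) / p i)" for i
    have X_eq: "X j = (W j powr \<theta> j * S j powr (1 - \<theta> j)) powr t j" if "j < m" for j
      unfolding X_def t\<theta>[OF that, symmetric] by (simp only: powr_mult powr_powr)
    have low: "b powr t j \<le> X j" if j: "j < m" for j
    proof -
      have "b \<le> W j powr \<theta> j * S j powr (1 - \<theta> j)"
        unfolding b_def W_def S_def
        by (rule measure_le_wmeas_product[OF wv[OF j] w\<sigma>[OF j] eq[OF j] \<theta>[OF j], where x=x and r=r]) (auto simp: B_def)
      then show ?thesis unfolding X_eq[OF j] using b tpos[OF j] by (intro powr_mono2) auto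
    qed
    have avs: "avg B u = U / b" "\<And>j. j < m \<Longrightarrow> avg B (\<sigma> j) = S j / b"
      using avg_eq_wmeas[OF ints(1)[OF r] u0, of x] avg_eq_wmeas[OF ints(2)[OF r], of _ x]
      by (auto simp: U_def S_def b_def B_def \<sigma>_def)
    have bprod: "(\<Prod>j<m. b powr t j) = b powr (1 / qq) * (\<Prod>j<m. b powr ((p j - 1) / p j))"
    proof -
      have "b powr t j = b powr (1 / q j) * b powr ((p j - 1) / p j)" if "j < m" for j
      proof -
        have "t j = 1 / q j + (p j - 1) / p j" using p[OF that] by (simp add: t_def diff_divide_distrib)
        then show ?thesis by (simp only: powr_add)
      qed
      then have "(\<Prod>j<m. b powr t j) = (\<Prod>j<m. b powr (1 / q j)) * (\<Prod>j<m. b powr ((p j - 1) / p j))"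
        by (simp add: prod.distrib[symmetric])
      then show ?thesis unfolding qq using b by (simp add: prod_powr_distrib_const)
    qed
    have "(\<Prod>j<m. X j) = (\<Prod>j<m. W j powr (1 / q j)) * (\<Prod>j<m. S j powr ((p j - 1) / p j))"
      by (simp add: X_def prod.distrib)
    also have "\<dots> \<le> (C1 * U powr (1 / qq)) * (\<Prod>j<m. S j powr ((p j - 1) / p j))"
      using rev[OF r, of x] by (intro mult_right_mono prod_nonneg) (auto simp: W_def U_def B_def)
    also have "\<dots> = C1 * (avg B u powr (1 / qq) * (\<Prod>j<m. avg B (\<sigma> j) powr ((p j - 1) / p j))) * (\<Prod>j<m. b powr t j)"
    proof -
      have "U powr (1 / qq) = avg B u powr (1 / qq) * b powr (1 / qq)"
        using b by (simp add: avs powr_divide U_def)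
      moreover have "(\<Prod>j<m. S j powr ((p j - 1) / p j)) = (\<Prod>j<m. avg B (\<sigma> j) powr ((p j - 1) / p j)) * (\<Prod>j<m. b powr ((p j - 1) / p j))"
        unfolding prod.distrib[symmetric] using b by (intro prod.cong) (auto simp: avs powr_divide S_def)
      ultimately show ?thesis unfolding bprod by (simp only: mult_ac)
    qed
    also have "\<dots> \<le> C1 * (\<bar>C0\<bar> + 1) * (\<Prod>j<m. b powr t j)"
      using C0[OF r, of x] C1 by (intro mult_right_mono mult_left_mono prod_nonneg) (auto simp: B_def)
    finally have up: "(\<Prod>j<m. X j) \<le> K * (\<Prod>j<m. b powr t j)" by (simp add: K_def)
    have split: "(\<Prod>j<m. f j) = f i * (\<Prod>j\<in>{..<m} - {i}. f j)" for f :: "nat \<Rightarrow> real"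
      using i by (simp add: prod.remove)
    have rest: "0 < (\<Prod>j\<in>{..<m} - {i}. b powr t j)" using b by (intro prod_pos) auto
    \<comment> \<open>All other factors are replaced by their lower bounds and cancelled, which
      isolates the index i.\<close>
    have "X i * (\<Prod>j\<in>{..<m} - {i}. b powr t j) \<le> X i * (\<Prod>j\<in>{..<m} - {i}. X j)"
      using low by (intro mult_left_mono prod_mono) (auto simp: X_def)
    also have "\<dots> \<le> (K * b powr t i) * (\<Prod>j\<in>{..<m} - {i}. b powr t j)"
      using up unfolding split by (simp add: mult_ac)
    finally have "X i \<le> K * b powr t i" using rest by (simp add: mult_le_cancel_right)
    then have "X i powr (1 / t i) \<le> (K * b powr t i) powr (1 / t i)"
      using tpos[OF i] by (intro powr_mono2) (auto simp: X_def)
    moreover have "(K * b powr t i) powr (1 / t i) = K powr (1 / t i) * b"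
      using b tpos[OF i] by (simp add: powr_mult powr_powr)
    moreover have "X i powr (1 / t i) = W i powr \<theta> i * S i powr (1 - \<theta> i)"
      unfolding X_eq[OF i] using tpos[OF i] by (simp add: powr_powr)
    ultimately show "wmeas (v i) (ball x r) powr \<theta> i * wmeas (\<sigma> i) (ball x r) powr (1 - \<theta> i) \<le> K powr (1 / t i) * measure lborel (ball x r)"
      by (simp add: W_def S_def b_def B_def)
  qed
  then show "\<exists>A. \<forall>i<m. mpair (1 / q i / (1 - (1 / p i - 1 / q i))) (A i) (\<lambda>y. \<omega> i y powr q i) (\<lambda>y. \<omega> i y powr (- (p i / (p i - 1))))"
    unfolding \<theta>_def v_def[abs_def] \<sigma>_def[abs_def] by (intro exI[of _ "\<lambda>i. K powr (1 / t i)"]) auto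
qed

section \<open>The multilinear commutator on a ball\<close>

text \<open>Telescoping over doublings, each of which costs 2^n \<beta>: linear in k, that is,
  logarithmic in the ratio of the radii.\<close>

lemma avg_ball_dist:
  fixes b :: "'a::euclidean_space \<Rightarrow> real"
  assumes b: "bmob \<beta> b" and r: "0 < r"
  shows "\<bar>avg (ball x r) b - avg (ball x (2 ^ k * r)) b\<bar> \<le> real k * (2 ^ DIM('a) * \<beta>)"
proof (induction k)
  case (Suc k)
  have r': "0 < 2 ^ k * r" using r by simp
  have sub: "ball x (2 ^ k * r) \<subseteq> ball x (2 ^ Suc k * r)" using r by (intro subset_ball) auto
  have "\<bar>avg (ball x (2 ^ k * r)) b - avg (ball x (2 ^ Suc k * r)) b\<bar> \<le> 2 ^ DIM('a) * \<beta>"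
  proof (rule bmob_osc(2)[OF b sub])
    show "measure lborel (ball x (2 ^ Suc k * r)) \<le> 2 ^ DIM('a) * measure lborel (ball x (2 ^ k * r))"
      by (subst (1 2) measure_ball) (use r in \<open>auto simp: power_mult_distrib\<close>)
  qed (use r r' measure_ball_pos[OF r'] in auto)
  then have "\<bar>avg (ball x r) b - avg (ball x (2 ^ Suc k * r)) b\<bar> \<le> real k * (2 ^ DIM('a) * \<beta>) + 2 ^ DIM('a) * \<beta>"
    using Suc by linarith
  then show ?case by (simp add: distrib_right)
qed simp

text \<open>Collects what the estimates use of each weight, namely its scalar pair condition. The
  comparison of the product of scalar masses with the mass of \<open>u\<close> enters at the Morrey
  estimate.\<close>

locale frac_system =
  fixes m :: nat and p q A :: "nat \<Rightarrow> real" and qq :: real and \<omega> :: "nat \<Rightarrow> 'a::euclidean_space \<Rightarrow> real"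
  assumes m: "0 < m" and p: "\<And>i. i < m \<Longrightarrow> 1 < p i" and q: "\<And>i. i < m \<Longrightarrow> 0 < q i"
    and gap: "\<And>i. i < m \<Longrightarrow> 0 < 1 / p i - 1 / q i"
    and qq: "1 / qq = (\<Sum>i<m. 1 / q i)" and \<omega>0: "\<And>i y. i < m \<Longrightarrow> 0 \<le> \<omega> i y"
    and pair: "\<And>i. i < m \<Longrightarrow> mpair (1 / q i / (1 - (1 / p i - 1 / q i))) (A i) (\<lambda>y. \<omega> i y powr q i) (\<lambda>y. \<omega> i y powr (- (p i / (p i - 1))))"
begin

definition "\<kappa> i = 1 / p i - 1 / q i"
definition "v i y = \<omega> i y powr q i"
definition "\<sigma> i y = \<omega> i y powr (- (p i / (p i - 1)))"
definition "u y = (\<Prod>i<m. \<omega> i y) powr qq"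
definition "W i B = wmeas (v i) B"
definition \<Phi> :: "(nat \<Rightarrow> 'a \<Rightarrow> real) \<Rightarrow> nat \<Rightarrow> 'a set \<Rightarrow> ennreal" where
  "\<Phi> f i B = (\<integral>\<^sup>+y\<in>B. ennreal (\<bar>f i y\<bar> powr p i * \<omega> i y powr p i) \<partial>lborel)"
text \<open>A discrete form of the integral with weight \<open>1 + log (t / r)\<close> in the hypothesis on \<open>\<phi>\<close>: the factor
  \<open>k + 1\<close> is the logarithm of \<open>2\<^bsup>k + 1\<^esup>\<close>, up to a constant.\<close>

definition "Z f x0 r = (\<Sum>k. ennreal (real k + 1) * (\<Prod>i<m. ennreal (W i (ball x0 (2 ^ Suc k * r)) powr (- (1 / q i))) * epow (\<Phi> f i (ball x0 (2 ^ Suc k * r))) (1 / p i)))"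

text \<open>Dictionary to the scalar theorems: \<tau> = 1 / p i and \<tau> - \<kappa> i = 1 / q
  i.\<close>

lemma exps:
  assumes "i < m"
  shows "0 < \<kappa> i" "\<kappa> i < 1 / p i" "1 / p i < 1" "1 / p i - \<kappa> i = 1 / q i" "\<kappa> i < 1"
    and "1 / q i / (1 - \<kappa> i) = (1 / p i - \<kappa> i) / (1 - \<kappa> i)"
    and "1 / (1 / p i - \<kappa> i) = q i" "1 / p i / (1 / p i - \<kappa> i) = q i / p i"
proof -
  have "1 / p i < 1" "0 < 1 / q i" using p[OF assms] q[OF assms] by auto
  then show "\<kappa> i < 1" unfolding \<kappa>_def by linarith
qed (use p[OF assms] q[OF assms] gap[OF assms] in \<open>auto simp: \<kappa>_def\<close>)

lemma qq_pos: "0 < qq"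
proof -
  have "0 < (\<Sum>i<m. 1 / q i)" using m q by (intro sum_pos) auto
  then show ?thesis unfolding qq[symmetric] by (simp add: zero_less_divide_1_iff)
qed

lemma sum_qq: "(\<Sum>i<m. qq / q i) = 1"
proof -
  have "(\<Sum>i<m. qq / q i) = qq * (\<Sum>i<m. 1 / q i)" by (simp add: sum_distrib_left)
  then show ?thesis using qq_pos by (simp add: qq[symmetric])
qed

lemma pair': "i < m \<Longrightarrow> mpair ((1 / p i - \<kappa> i) / (1 - \<kappa> i)) (A i) (v i) (\<sigma> i)"
  using pair[of i] exps(6)[of i] by (simp add: \<kappa>_def v_def[abs_def] \<sigma>_def[abs_def])

lemma theta:
  assumes "i < m"
  shows "0 < (1 / p i - \<kappa> i) / (1 - \<kappa> i)" "(1 / p i - \<kappa> i) / (1 - \<kappa> i) < 1"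
    "1 - (1 / p i - \<kappa> i) / (1 - \<kappa> i) = (1 - 1 / p i) / (1 - \<kappa> i)"
proof -
  have "0 < 1 / p i - \<kappa> i" "1 / p i - \<kappa> i < 1 - \<kappa> i" "0 < 1 - \<kappa> i" using exps[OF assms] by linarith+
  then show "0 < (1 / p i - \<kappa> i) / (1 - \<kappa> i)" "(1 / p i - \<kappa> i) / (1 - \<kappa> i) < 1"
    "1 - (1 / p i - \<kappa> i) / (1 - \<kappa> i) = (1 - 1 / p i) / (1 - \<kappa> i)"
    by (auto simp: field_simps)
qed

lemma wt_v: "i < m \<Longrightarrow> wt (v i)" and wt_\<sigma>: "i < m \<Longrightarrow> wt (\<sigma> i)"
  using pair' by (auto simp: mpair_def)

lemma ainf_v: "i < m \<Longrightarrow> ainf ((1 / p i - \<kappa> i) / (1 - \<kappa> i)) (A i) (v i)"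
  using mpair_ainf[OF pair' theta(1,2)] by blast

lemma \<omega>_meas: "i < m \<Longrightarrow> \<omega> i \<in> borel_measurable borel"
proof -
  assume i: "i < m"
  have "\<omega> i = (\<lambda>y. v i y powr (1 / q i))" using q[OF i] \<omega>0[OF i] by (auto simp: v_def powr_powr)
  moreover note [measurable] = wtD(2)[OF wt_v[OF i]]
  have "(\<lambda>y. v i y powr (1 / q i)) \<in> borel_measurable borel" by measurable
  ultimately show ?thesis by simp
qed

lemma \<omega>_pos: "AE y in lborel. \<forall>i<m. 0 < \<omega> i y"
proof -
  have "AE y in lborel. i < m \<longrightarrow> 0 < \<omega> i y" for i
  proof (cases "i < m")
    case True
    show ?thesis using wtD(3)[OF wt_v[OF True]]
    proof eventually_elim
      case (elim y)
      then have "\<omega> i y \<noteq> 0" by (auto simp: v_def)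
      then show ?case using \<omega>0[OF True, of y] by simp
    qed
  qed simp
  then show ?thesis by (simp add: AE_all_countable)
qed

lemma W_pos: "i < m \<Longrightarrow> 0 < r \<Longrightarrow> 0 < W i (ball x r)"
  unfolding W_def by (intro wmeas_ball_pos wt_v)

lemma integrand_eq:
  assumes "i < m"
  shows "t powr (1 / (1 / p i)) * v i y powr (1 - \<kappa> i / (1 / p i)) = t powr p i * \<omega> i y powr p i"
proof -
  have "q i * (1 - \<kappa> i / (1 / p i)) = p i"
    using p[OF assms] q[OF assms] by (simp add: \<kappa>_def field_simps)
  then show ?thesis using p[OF assms] by (simp add: v_def powr_powr)
qed

lemma riesz_bound:
  assumes i: "i < m"
  shows "\<exists>C>0. \<forall>f. f \<in> borel_measurable borel \<longrightarrow> (\<forall>y. 0 \<le> f y) \<longrightarrow>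
    (\<integral>\<^sup>+x. epow (riesz (\<kappa> i) f x) (q i) * ennreal (v i x) \<partial>lborel)
      \<le> ennreal C * epow (\<integral>\<^sup>+y. ennreal (f y powr p i * \<omega> i y powr p i) \<partial>lborel) (q i / p i)"
proof -
  obtain C where C: "0 < C" and *: "\<And>(v::'a \<Rightarrow> real) \<sigma> f. mpair ((1 / p i - \<kappa> i) / (1 - \<kappa> i)) (A i) v \<sigma> \<Longrightarrow> f \<in> borel_measurable borel \<Longrightarrow> \<forall>y. 0 \<le> f y \<Longrightarrow>
    (\<integral>\<^sup>+x. epow (riesz (\<kappa> i) f x) (1 / (1 / p i - \<kappa> i)) * ennreal (v x) \<partial>lborel)
      \<le> ennreal C * epow (\<integral>\<^sup>+y. ennreal (f y powr (1 / (1 / p i)) * v y powr (1 - \<kappa> i / (1 / p i))) \<partial>lborel) (1 / p i / (1 / p i - \<kappa> i))"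
    using riesz_weighted[OF exps(1-3)[OF i], of "A i", where 'a='a] by blast
  show ?thesis using C *[OF pair'[OF i], unfolded exps(7,8)[OF i] integrand_eq[OF i]] by blast
qed

lemma rieszb_bound:
  assumes i: "i < m"
  shows "\<exists>C>0. \<forall>f b \<beta>. bmob \<beta> b \<longrightarrow> 0 < \<beta> \<longrightarrow> f \<in> borel_measurable borel \<longrightarrow> (\<forall>y. 0 \<le> f y) \<longrightarrow>
    (\<integral>\<^sup>+x. epow (rieszb (\<kappa> i) b f x) (q i) * ennreal (v i x) \<partial>lborel)
      \<le> ennreal (C * \<beta> powr q i) * epow (\<integral>\<^sup>+y. ennreal (f y powr p i * \<omega> i y powr p i) \<partial>lborel) (q i / p i)"
proof -
  obtain C where C: "0 < C" and *: "\<And>(v::'a \<Rightarrow> real) \<sigma> b \<beta> f. mpair ((1 / p i - \<kappa> i) / (1 - \<kappa> i)) (A i) v \<sigma> \<Longrightarrow> bmob \<beta> b \<Longrightarrow> 0 < \<beta> \<Longrightarrow> f \<in> borel_measurable borel \<Longrightarrow> \<forall>y. 0 \<le> f y \<Longrightarrow>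
    (\<integral>\<^sup>+x. epow (rieszb (\<kappa> i) b f x) (1 / (1 / p i - \<kappa> i)) * ennreal (v x) \<partial>lborel)
      \<le> ennreal (C * \<beta> powr (1 / (1 / p i - \<kappa> i))) * epow (\<integral>\<^sup>+y. ennreal (f y powr (1 / (1 / p i)) * v y powr (1 - \<kappa> i / (1 / p i))) \<partial>lborel) (1 / p i / (1 / p i - \<kappa> i))"
    using rieszb_weighted[OF exps(1-3)[OF i], of "A i", where 'a='a] by blast
  show ?thesis using C *[OF pair'[OF i], unfolded exps(7,8)[OF i] integrand_eq[OF i]] by blast
qed

text \<open>Hoelder's inequality on a ball with the exponential attached to the dual weight
  \<open>\<sigma> i\<close>, where John-Nirenberg for \<sigma> dx absorbs it; the pair condition
  then exchanges the mass of \<open>\<sigma> i\<close> for that of \<open>v i\<close>. The case s =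
  0 is the plain local bound, used for the factors without \<open>b\<close>.\<close>

lemma local_exp_bound:
  assumes i: "i < m"
  shows "\<exists>c C. 0 < c \<and> 0 < C \<and> (\<forall>f b \<beta> s x r. bmob \<beta> b \<longrightarrow> 0 < \<beta> \<longrightarrow> s * \<beta> \<le> c \<longrightarrow> f \<in> borel_measurable borel \<longrightarrow> (\<forall>y. 0 \<le> f y) \<longrightarrow> 0 < r \<longrightarrow>
    (\<integral>\<^sup>+y\<in>ball x r. ennreal (exp (s * \<bar>b y - avg (ball x r) b\<bar>) * f y) \<partial>lborel)
      \<le> ennreal (C * measure lborel (ball x r) powr (1 - \<kappa> i) * W i (ball x r) powr (- (1 / q i)))
         * epow (\<integral>\<^sup>+y\<in>ball x r. ennreal (f y powr p i * \<omega> i y powr p i) \<partial>lborel) (1 / p i))"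
proof -
  define \<tau> where "\<tau> = 1 / p i"
  define \<theta> where "\<theta> = (1 / p i - \<kappa> i) / (1 - \<kappa> i)"
  note th = theta[OF i, folded \<theta>_def]
  have mp: "mpair \<theta> (A i) (v i) (\<sigma> i)" using pair'[OF i] by (simp add: \<theta>_def)
  have as: "ainf (1 - \<theta>) (A i) (\<sigma> i)" using mpair_ainf[OF mpair_sym[OF mp]] th by auto
  have A1: "1 \<le> A i" using ainf_ge_1[OF as] .
  have \<tau>: "0 < \<tau>" "\<tau> < 1" using exps[OF i] p[OF i] by (auto simp: \<tau>_def)
  have th1: "0 < 1 - \<theta>" using th by simp
  obtain c C where c: "0 < c" "0 < C" and JN: "\<And>(w::'a \<Rightarrow> real) b \<beta> s x r. ainf (1 - \<theta>) (A i) w \<Longrightarrow> bmob \<beta> b \<Longrightarrow> 0 < \<beta> \<Longrightarrow>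
    s * \<beta> \<le> c \<Longrightarrow> 0 < r \<Longrightarrow>
    (\<integral>\<^sup>+y\<in>ball x r. ennreal (exp (s * \<bar>b y - avg (ball x r) b\<bar>) * w y) \<partial>lborel) \<le> ennreal (C * wmeas w (ball x r))"
    using weighted_John_Nirenberg[OF th1, of "A i", where 'a='a] by blast
  define c' where "c' = c * (1 - \<tau>)"
  define C' where "C' = C powr (1 - \<tau>) * A i powr (1 - \<kappa> i)"
  have pos: "0 < c'" "0 < C'" using c \<tau> A1 by (auto simp: c'_def C'_def)
  have "(\<integral>\<^sup>+y\<in>ball x r. ennreal (exp (s * \<bar>b y - avg (ball x r) b\<bar>) * f y) \<partial>lborel)
      \<le> ennreal (C' * measure lborel (ball x r) powr (1 - \<kappa> i) * W i (ball x r) powr (- (1 / q i)))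
         * epow (\<integral>\<^sup>+y\<in>ball x r. ennreal (f y powr p i * \<omega> i y powr p i) \<partial>lborel) (1 / p i)"
    if b: "bmob \<beta> b" "0 < \<beta>" "s * \<beta> \<le> c'" and f [measurable]: "f \<in> borel_measurable borel" and f0: "\<forall>y. 0 \<le> f y" and r: "0 < r"
    for f b \<beta> s x r
  proof -
    define B where "B = ball x r"
    have [measurable]: "B \<in> sets borel" "b \<in> borel_measurable borel" using b by (auto simp: B_def bmob_def)
    note [measurable] = \<omega>_meas[OF i] wtD(2)[OF wt_\<sigma>[OF i]]
    define k where "k = avg B b"
    define F where "F y = ennreal (f y powr p i * \<omega> i y powr p i) * indicator B y" for y
    define G where "G y = ennreal (exp (s / (1 - \<tau>) * \<bar>b y - k\<bar>) * \<sigma> i y) * indicator B y" for y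
    have FG [measurable]: "F \<in> borel_measurable borel" "G \<in> borel_measurable borel" unfolding F_def G_def by measurable
    have "(\<integral>\<^sup>+y\<in>B. ennreal (exp (s * \<bar>b y - k\<bar>) * f y) \<partial>lborel) = (\<integral>\<^sup>+y. epow (F y) \<tau> * epow (G y) (1 - \<tau>) \<partial>lborel)"
    proof (rule nn_integral_cong_AE)
      show "AE y in lborel. ennreal (exp (s * \<bar>b y - k\<bar>) * f y) * indicator B y = epow (F y) \<tau> * epow (G y) (1 - \<tau>)"
        using \<omega>_pos
      proof eventually_elim
        case (elim y)
        have o: "0 < \<omega> i y" using elim i by simp
        show ?case
        proof (cases "y \<in> B")
          case True
          have e1: "p i * \<tau> = 1" using p[OF i] by (simp add: \<tau>_def)
          have e2: "- (p i / (p i - 1)) * (1 - \<tau>) = - 1" using p[OF i] by (simp add: \<tau>_def field_simps)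
          have e3: "s / (1 - \<tau>) * t * (1 - \<tau>) = s * t" for t using \<tau> by simp
          have "(f y powr p i * \<omega> i y powr p i) powr \<tau> = f y * \<omega> i y"
            using f0 o by (simp only: powr_mult powr_powr e1) simp
          moreover have "(exp (s / (1 - \<tau>) * \<bar>b y - k\<bar>) * \<sigma> i y) powr (1 - \<tau>) = exp (s * \<bar>b y - k\<bar>) * \<omega> i y powr (- 1)"
            unfolding \<sigma>_def by (simp only: powr_mult powr_powr exp_powr_real e2 e3)
          moreover have "0 \<le> \<sigma> i y" by (simp add: \<sigma>_def)
          ultimately have "epow (F y) \<tau> * epow (G y) (1 - \<tau>) = ennreal (f y * \<omega> i y) * ennreal (exp (s * \<bar>b y - k\<bar>) * \<omega> i y powr (- 1))"
            using True by (simp add: F_def G_def)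
          also have "\<dots> = ennreal (f y * \<omega> i y * (exp (s * \<bar>b y - k\<bar>) * \<omega> i y powr (- 1)))"
            using f0 o by (intro ennreal_mult[symmetric]) auto
          also have "f y * \<omega> i y * (exp (s * \<bar>b y - k\<bar>) * \<omega> i y powr (- 1)) = exp (s * \<bar>b y - k\<bar>) * f y"
            using o by (simp add: powr_minus_divide)
          finally show ?thesis using True by simp
        qed (simp add: F_def)
      qed
    qed
    also have "\<dots> \<le> epow (\<integral>\<^sup>+y. F y \<partial>lborel) \<tau> * epow (\<integral>\<^sup>+y. G y \<partial>lborel) (1 - \<tau>)"
      using \<tau> by (intro nn_integral_Hoelder) measurable
    also have "\<dots> \<le> epow (\<integral>\<^sup>+y. F y \<partial>lborel) \<tau> * epow (ennreal (C * wmeas (\<sigma> i) B)) (1 - \<tau>)"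
    proof (intro mult_left_mono epow_mono)
      have "s / (1 - \<tau>) * \<beta> \<le> c" using b(3) \<tau> by (simp add: c'_def divide_le_eq)
      from JN[OF as b(1,2) this r, of x] show "(\<integral>\<^sup>+y. G y \<partial>lborel) \<le> ennreal (C * wmeas (\<sigma> i) B)"
        by (simp add: G_def B_def k_def)
    qed (use \<tau> in auto)
    also have "epow (ennreal (C * wmeas (\<sigma> i) B)) (1 - \<tau>) = ennreal ((C * wmeas (\<sigma> i) B) powr (1 - \<tau>))"
      using c by simp
    also have "ennreal ((C * wmeas (\<sigma> i) B) powr (1 - \<tau>)) \<le> ennreal (C' * measure lborel B powr (1 - \<kappa> i) * W i B powr (- (1 / q i)))"
    proof (rule ennreal_leI)
      define w where "w = W i B"
      define g where "g = wmeas (\<sigma> i) B"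
      define l where "l = measure lborel B"
      have w: "0 < w" unfolding w_def B_def using i r by (rule W_pos)
      have l: "0 < l" unfolding l_def B_def using r by (rule measure_ball_pos)
      have "w powr \<theta> * g powr (1 - \<theta>) \<le> A i * l" using mp r by (auto simp: mpair_def w_def g_def l_def B_def W_def)
      then have "(w powr \<theta> * g powr (1 - \<theta>)) powr (1 - \<kappa> i) \<le> (A i * l) powr (1 - \<kappa> i)"
        using exps[OF i] by (intro powr_mono2) auto
      then have "w powr (\<theta> * (1 - \<kappa> i)) * g powr ((1 - \<theta>) * (1 - \<kappa> i)) \<le> A i powr (1 - \<kappa> i) * l powr (1 - \<kappa> i)"
        by (simp only: powr_mult powr_powr)
      moreover have "\<theta> * (1 - \<kappa> i) = 1 / q i" "(1 - \<theta>) * (1 - \<kappa> i) = 1 - \<tau>"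
        unfolding th(3) using exps[OF i] by (auto simp: \<theta>_def \<tau>_def)
      ultimately have "w powr (1 / q i) * g powr (1 - \<tau>) \<le> A i powr (1 - \<kappa> i) * l powr (1 - \<kappa> i)" by simp
      then have "g powr (1 - \<tau>) \<le> A i powr (1 - \<kappa> i) * l powr (1 - \<kappa> i) / w powr (1 / q i)"
        using w by (subst pos_le_divide_eq) (auto simp: mult.commute)
      then have "C powr (1 - \<tau>) * g powr (1 - \<tau>) \<le> C powr (1 - \<tau>) * (A i powr (1 - \<kappa> i) * l powr (1 - \<kappa> i) / w powr (1 / q i))"
        by (rule mult_left_mono) simp
      then show "(C * g) powr (1 - \<tau>) \<le> C' * l powr (1 - \<kappa> i) * w powr (- (1 / q i))"
        by (simp add: powr_mult C'_def powr_minus_divide)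
    qed
    finally have "(\<integral>\<^sup>+y\<in>B. ennreal (exp (s * \<bar>b y - k\<bar>) * f y) \<partial>lborel)
        \<le> epow (\<integral>\<^sup>+y. F y \<partial>lborel) \<tau> * ennreal (C' * measure lborel B powr (1 - \<kappa> i) * W i B powr (- (1 / q i)))"
      by (simp add: mult_left_mono)
    then show ?thesis unfolding F_def B_def k_def \<tau>_def by (simp only: mult.commute[of "epow _ _"])
  qed
  then show ?thesis using pos by blast
qed

end

text \<open>If all y_i lie in the double ball, the sum of distances dominates each distance.
  Otherwise let the distance of the farthest y_i from x0 be between 2^(k+1) r and 2^(k+2) r: then
  all points are in the ball of radius 2^(k+2) r, and the sum of distances from x is at least 2^k r.
  A single far point suffices for this, so mixed configurations of near and far points are
  included.\<close>

lemma kernel_split: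
  fixes x x0 :: "'a::euclidean_space" and y :: "nat \<Rightarrow> 'a" and a e :: "nat \<Rightarrow> real"
  assumes r: "0 < r" and x: "x \<in> ball x0 r" and a: "\<And>i. i < m \<Longrightarrow> 0 \<le> a i" and e: "\<And>i. i < m \<Longrightarrow> 0 \<le> e i"
  shows "ennreal ((\<Prod>i<m. a i) / (\<Sum>i<m. dist x (y i)) powr (\<Sum>i<m. e i))
    \<le> (\<Prod>i<m. ennreal (a i * indicator (ball x0 (2 * r)) (y i)) * inverse (ennreal (dist x (y i) powr e i)))
     + (\<Sum>k. ennreal ((2 ^ k * r) powr (- (\<Sum>i<m. e i))) * (\<Prod>i<m. ennreal (a i * indicator (ball x0 (2 ^ Suc (Suc k) * r)) (y i))))"
    (is "ennreal (?P / ?S powr ?E) \<le> ?N + (\<Sum>k. ?F k)")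
proof (cases "\<forall>i<m. y i \<in> ball x0 (2 * r)")
  case True
  have "ennreal (?P / ?S powr ?E) \<le> ?N"
  proof -
    consider "\<exists>i<m. a i = 0" | i where "i < m" "dist x (y i) = 0" "\<forall>i<m. 0 < a i"
      | "\<forall>i<m. 0 < a i \<and> 0 < dist x (y i)"
      using a by (metis less_le zero_le_dist)
    then show ?thesis
    proof cases
      case 1
      then have P0: "?P = 0" by (intro prod_zero) auto
      show ?thesis unfolding P0 by simp
    next
      \<comment> \<open>Some y_i equals x: the extended kernel is infinite there and no other factor
        vanishes, so the right-hand side is infinite.\<close>
      case 2
      have "?N = top"
        unfolding ennreal_prod_eq_top
      proof (intro conjI ballI bexI[of _ i])
        show "ennreal (a i * indicator (ball x0 (2 * r)) (y i)) * inverse (ennreal (dist x (y i) powr e i)) = top"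
          using 2 True by (simp add: ennreal_mult_top ennreal_eq_0_iff not_le)
        fix k assume "k \<in> {..<m}"
        then show "ennreal (a k * indicator (ball x0 (2 * r)) (y k)) * inverse (ennreal (dist x (y k) powr e k)) \<noteq> 0"
          using 2 True by (simp add: ennreal_eq_0_iff not_le)
      qed (use 2 in auto)
      then show ?thesis by simp
    next
      case 3
      have le: "dist x (y i) \<le> ?S" if "i < m" for i
        using that by (intro member_le_sum) auto
      have S: "0 < ?S" if "0 < m" using le[OF that] 3 that by (meson less_le_trans)
      have "?P / ?S powr ?E \<le> (\<Prod>i<m. a i * dist x (y i) powr (- e i))"
      proof (cases "m = 0")
        case False
        then have S: "0 < ?S" using S by simp
        have "?P / ?S powr ?E = ?P * (\<Prod>i<m. ?S powr (- e i))"
        proof -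
          have "(\<Prod>i<m. ?S powr (- e i)) = ?S powr (- ?E)"
            using prod_powr_distrib_const[OF S, of "{..<m}" "\<lambda>i. - e i"] by (simp add: sum_negf)
          then show ?thesis by (simp only: powr_minus_divide times_divide_eq_right mult_1_right)
        qed
        also have "\<dots> = (\<Prod>i<m. a i * ?S powr (- e i))" by (simp add: prod.distrib)
        also have "\<dots> \<le> (\<Prod>i<m. a i * dist x (y i) powr (- e i))"
          using 3 a e le by (intro prod_mono conjI mult_left_mono powr_mono2') auto
        finally show ?thesis .
      qed simp
      then have "ennreal (?P / ?S powr ?E) \<le> ennreal (\<Prod>i<m. a i * dist x (y i) powr (- e i))" by (rule ennreal_leI)
      also have "\<dots> = (\<Prod>i<m. ennreal (a i * dist x (y i) powr (- e i)))" using a by (intro prod_ennreal[symmetric]) auto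
      also have "\<dots> = ?N"
        using 3 True by (intro prod.cong) (auto simp: inverse_ennreal_powr ennreal_mult' less_imp_le)
      finally show ?thesis .
    qed
  qed
  then show ?thesis by (rule order_trans) simp
next
  case False
  then obtain i0 where i0: "i0 < m" "2 * r \<le> dist x0 (y i0)" by (auto simp: not_less)
  define M where "M = Max ((\<lambda>i. dist x0 (y i)) ` {..<m})"
  have le_M: "dist x0 (y i) \<le> M" if "i < m" for i using that by (auto simp: M_def)
  have "M \<in> (\<lambda>i. dist x0 (y i)) ` {..<m}" unfolding M_def using i0 by (intro Max_in) auto
  then obtain i1 where i1: "i1 < m" "M = dist x0 (y i1)" by auto
  obtain K where "M / r < 2 ^ K" using real_arch_pow[of 2] by auto
  then have ex: "M < 2 ^ K * r" using r by (simp add: field_simps)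
  \<comment> \<open>First radius 2^L r beyond all points; L \<ge> 2 because some point lies outside
    the double ball.\<close>
  define L where "L = (LEAST K. M < 2 ^ K * r)"
  have L: "M < 2 ^ L * r" unfolding L_def using ex by (rule LeastI)
  have nL: "\<not> M < 2 ^ l * r" if "l < L" for l using not_less_Least[of l "\<lambda>K. M < 2 ^ K * r"] that by (simp add: L_def)
  have "2 \<le> L"
  proof (rule ccontr)
    assume "\<not> 2 \<le> L"
    then have "(2::real) ^ L \<le> 2 ^ 1" by (intro power_increasing) auto
    then have "2 ^ L * r \<le> 2 * r" using r by simp
    then show False using L le_M[OF i0(1)] i0(2) by linarith
  qed
  then have "L = Suc (Suc (L - 2))" by simp
  then obtain k where k: "L = Suc (Suc k)" by blast
  have M_ge: "2 ^ Suc k * r \<le> M" using nL[of "Suc k"] k by simp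
  have "dist x0 x < r" using x by simp
  then have "M - r \<le> dist x (y i1)" using dist_triangle[of x0 "y i1" x] i1 by linarith
  moreover have "r \<le> 2 ^ k * r" using r by simp
  ultimately have "2 ^ k * r \<le> dist x (y i1)" using M_ge by simp
  also have "\<dots> \<le> ?S" using i1 by (intro member_le_sum) auto
  finally have S: "2 ^ k * r \<le> ?S" .
  have "?P / ?S powr ?E \<le> (2 ^ k * r) powr (- ?E) * ?P"
  proof -
    have "?S powr (- ?E) \<le> (2 ^ k * r) powr (- ?E)"
      using S r e by (intro powr_mono2') (auto intro: sum_nonneg)
    then have "?S powr (- ?E) * ?P \<le> (2 ^ k * r) powr (- ?E) * ?P"
      using a by (intro mult_right_mono prod_nonneg) auto
    then show ?thesis by (simp add: powr_minus_divide)
  qed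
  then have "ennreal (?P / ?S powr ?E) \<le> ennreal ((2 ^ k * r) powr (- ?E) * ?P)" by (rule ennreal_leI)
  also have "\<dots> = ennreal ((2 ^ k * r) powr (- ?E)) * (\<Prod>i<m. ennreal (a i))"
    using a by (subst prod_ennreal) (auto simp: ennreal_mult')
  also have "(\<Prod>i<m. ennreal (a i)) = (\<Prod>i<m. ennreal (a i * indicator (ball x0 (2 ^ Suc (Suc k) * r)) (y i)))"
    using le_M L unfolding k by (intro prod.cong) (auto simp: indicator_def intro: le_less_trans)
  also have "ennreal ((2 ^ k * r) powr (- ?E)) * \<dots> \<le> (\<Sum>k. ?F k)" by (rule suminf_ge_term[of ?F k])
  finally show ?thesis by (rule order_trans) simp
qed

lemma prod_if_one:
  fixes f :: "nat \<Rightarrow> 'b::comm_monoid_mult"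
  assumes "j < m"
  shows "(\<Prod>i<m. if i = j then f i else 1) = f j"
  using assms by (simp add: prod.delta)

lemma epow_prod_epow: "finite I \<Longrightarrow> (\<Prod>i\<in>I. epow (f i) s) = epow (\<Prod>i\<in>I. f i) s"
  by (simp add: epow_prod)

section \<open>Near and far parts of the multilinear commutator\<close>

context frac_system
begin

text \<open>Exponent of the scalar kernel in the i-th variable; the sum over i is the exponent m n -
  \<alpha> of the multilinear kernel.\<close>

definition "e i = real DIM('a) * (1 - \<kappa> i)"
definition "T f x0 r k = (\<Prod>i<m. ennreal (W i (ball x0 (2 ^ Suc k * r)) powr (- (1 / q i))) * epow (\<Phi> f i (ball x0 (2 ^ Suc k * r))) (1 / p i))"
text \<open>Nonnegative majorant of the commutator, meaningful whether or not the kernel is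
  integrable.\<close>

definition J :: "real \<Rightarrow> nat \<Rightarrow> (nat \<Rightarrow> 'a \<Rightarrow> real) \<Rightarrow> (nat \<Rightarrow> 'a \<Rightarrow> real) \<Rightarrow> 'a \<Rightarrow> ennreal" where
  "J \<alpha> j b f x = (\<integral>\<^sup>+y. ennreal \<bar>comm_kernel m \<alpha> j b f x y\<bar> \<partial>PiM {..<m} (\<lambda>_. lborel))"
definition near :: "nat \<Rightarrow> ('a \<Rightarrow> real) \<Rightarrow> (nat \<Rightarrow> 'a \<Rightarrow> real) \<Rightarrow> 'a \<Rightarrow> real \<Rightarrow> nat \<Rightarrow> 'a \<Rightarrow> ennreal" where
  "near j b f x0 r i x = (if i = j then rieszb (\<kappa> i) b (\<lambda>y. \<bar>f i y\<bar> * indicator (ball x0 (2 * r)) y) x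
  else riesz (\<kappa> i) (\<lambda>y. \<bar>f i y\<bar> * indicator (ball x0 (2 * r)) y) x)"
definition wgt :: "nat \<Rightarrow> ('a \<Rightarrow> real) \<Rightarrow> 'a \<Rightarrow> nat \<Rightarrow> 'a \<Rightarrow> real" where
  "wgt j b x i y = (if i = j then \<bar>b x - b y\<bar> else (1::real))"

lemma Z_eq: "Z f x0 r = (\<Sum>k. ennreal (real k + 1) * T f x0 r k)"
  by (simp add: Z_def T_def)

lemma e_nonneg: "i < m \<Longrightarrow> 0 \<le> e i"
  using exps(5)[of i] by (simp add: e_def)

lemma near_measurable [measurable]:
  assumes [measurable]: "b \<in> borel_measurable borel" "f i \<in> borel_measurable borel"
  shows "near j b f x0 r i \<in> borel_measurable borel"
proof -
  have Fm: "(\<lambda>y. \<bar>f i y\<bar> * indicator (ball x0 (2 * r)) y) \<in> borel_measurable borel" by measurable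
  show ?thesis
    unfolding near_def[abs_def] using riesz_measurable[OF Fm] rieszb_measurable[OF Fm assms(1)] by simp
qed

text \<open>After \<open>kernel_split\<close> both parts are built from products of functions of
  single variables, so the integrals over the product space factorise; \<open>b\<close> affects
  factor j alone.\<close>

lemma J_split:
  assumes \<alpha>: "\<alpha> = (\<Sum>i<m. real DIM('a) * \<kappa> i)" and j: "j < m" and r: "0 < r" and x: "x \<in> ball x0 r"
    and bm [measurable]: "b j \<in> borel_measurable borel" and fm: "\<And>i. i < m \<Longrightarrow> f i \<in> borel_measurable borel"
  shows "J \<alpha> j b f x \<le> (\<Prod>i<m. near j (b j) f x0 r i x)
    + (\<Sum>k. ennreal ((2 ^ k * r) powr (- (\<Sum>i<m. e i))) * (\<Prod>i<m. \<integral>\<^sup>+y\<in>ball x0 (2 ^ Suc (Suc k) * r). ennreal (wgt j (b j) x i y * \<bar>f i y\<bar>) \<partial>lborel))"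
proof -
  interpret product_sigma_finite "\<lambda>_::nat. lborel :: 'a measure" ..
  have E: "real m * real DIM('a) - \<alpha> = (\<Sum>i<m. e i)"
    by (simp add: \<alpha> e_def sum_subtractf sum_distrib_left[symmetric] right_diff_distrib)
  define a where "a i y = wgt j (b j) x i y * \<bar>f i y\<bar>" for i y
  have a0: "0 \<le> a i y" for i y by (simp add: a_def wgt_def)
  have am: "a i \<in> borel_measurable borel" if "i < m" for i
    unfolding a_def[abs_def] wgt_def[abs_def] using fm[OF that] by measurable
  define h where "h i y = ennreal (a i y * indicator (ball x0 (2 * r)) y) * inverse (ennreal (dist x y powr e i))" for i y
  define g where "g k i y = ennreal (a i y * indicator (ball x0 (2 ^ Suc (Suc k) * r)) y)" for k i y
  have hm: "h i \<in> borel_measurable borel" if "i < m" for i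
    unfolding h_def using am[OF that] by measurable
  have gm: "g k i \<in> borel_measurable borel" if "i < m" for i k
    unfolding g_def using am[OF that] by measurable
  have comp: "(\<lambda>y. F (y i)) \<in> borel_measurable (PiM {..<m} (\<lambda>_. lborel))" if "i < m" "F \<in> borel_measurable borel" for i and F :: "'a \<Rightarrow> ennreal"
    using that by (intro measurable_compose[OF measurable_component_singleton[of i]]) auto
  have abs_kernel: "\<bar>comm_kernel m \<alpha> j b f x y\<bar> = (\<Prod>i<m. a i (y i)) / (\<Sum>i<m. dist x (y i)) powr (\<Sum>i<m. e i)" for y
  proof -
    have "(\<Prod>i<m. a i (y i)) = (\<Prod>i<m. if i = j then \<bar>b j x - b j (y i)\<bar> else 1) * (\<Prod>i<m. \<bar>f i (y i)\<bar>)"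
      unfolding prod.distrib[symmetric] by (intro prod.cong) (auto simp: a_def wgt_def)
    also have "(\<Prod>i<m. if i = j then \<bar>b j x - b j (y i)\<bar> else 1) = \<bar>b j x - b j (y j)\<bar>"
      by (rule prod_if_one[OF j])
    finally have prod_a: "(\<Prod>i<m. a i (y i)) = \<bar>b j x - b j (y j)\<bar> * (\<Prod>i<m. \<bar>f i (y i)\<bar>)" .
    show ?thesis unfolding comm_kernel_def E prod_a by (simp add: abs_mult abs_prod)
  qed
  have "J \<alpha> j b f x \<le> (\<integral>\<^sup>+y. (\<Prod>i<m. h i (y i)) + (\<Sum>k. ennreal ((2 ^ k * r) powr (- (\<Sum>i<m. e i))) * (\<Prod>i<m. g k i (y i))) \<partial>PiM {..<m} (\<lambda>_. lborel))"
    unfolding J_def abs_kernel h_def g_def using a0 e_nonneg by (intro nn_integral_mono kernel_split r x) auto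
  also have "\<dots> = (\<integral>\<^sup>+y. (\<Prod>i<m. h i (y i)) \<partial>PiM {..<m} (\<lambda>_. lborel))
      + (\<Sum>k. ennreal ((2 ^ k * r) powr (- (\<Sum>i<m. e i))) * (\<integral>\<^sup>+y. (\<Prod>i<m. g k i (y i)) \<partial>PiM {..<m} (\<lambda>_. lborel)))"
  proof -
    have m1: "(\<lambda>y. \<Prod>i<m. h i (y i)) \<in> borel_measurable (PiM {..<m} (\<lambda>_. lborel))"
      using comp hm by (intro borel_measurable_prod_ennreal) auto
    have m2: "(\<lambda>y. \<Prod>i<m. g k i (y i)) \<in> borel_measurable (PiM {..<m} (\<lambda>_. lborel))" for k
      using comp gm by (intro borel_measurable_prod_ennreal) auto
    show ?thesis using m1 m2
      by (subst nn_integral_add) (auto simp: nn_integral_suminf nn_integral_cmult)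
  qed
  also have "(\<integral>\<^sup>+y. (\<Prod>i<m. h i (y i)) \<partial>PiM {..<m} (\<lambda>_. lborel)) = (\<Prod>i<m. \<integral>\<^sup>+y. h i y \<partial>lborel)"
    using hm by (intro product_nn_integral_prod) auto
  also have "\<dots> = (\<Prod>i<m. near j (b j) f x0 r i x)"
    by (intro prod.cong refl) (auto simp: near_def h_def a_def wgt_def rieszb_def riesz_def e_def mult.assoc)
  also have "(\<lambda>k. \<integral>\<^sup>+y. (\<Prod>i<m. g k i (y i)) \<partial>PiM {..<m} (\<lambda>_. lborel)) = (\<lambda>k. \<Prod>i<m. \<integral>\<^sup>+y\<in>ball x0 (2 ^ Suc (Suc k) * r). ennreal (a i y) \<partial>lborel)"
  proof
    fix k
    have "(\<integral>\<^sup>+y. (\<Prod>i<m. g k i (y i)) \<partial>PiM {..<m} (\<lambda>_. lborel)) = (\<Prod>i<m. \<integral>\<^sup>+y. g k i y \<partial>lborel)"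
      using gm by (intro product_nn_integral_prod) auto
    also have "\<dots> = (\<Prod>i<m. \<integral>\<^sup>+y\<in>ball x0 (2 ^ Suc (Suc k) * r). ennreal (a i y) \<partial>lborel)"
      unfolding g_def by (intro prod.cong refl nn_integral_cong) (auto simp: indicator_def)
    finally show "(\<integral>\<^sup>+y. (\<Prod>i<m. g k i (y i)) \<partial>PiM {..<m} (\<lambda>_. lborel)) = \<dots>" .
  qed
  finally show ?thesis by (simp add: fun_eq_iff a_def)
qed

text \<open>The difference b(x) - b(y) is routed through the averages over the ball and over the
  enlarged ball. With s times the three distances called x1, d, y1 one has x1 + d + y1 \<le> (1 + d)
  exp (x1 + y1). The exponential in y is absorbed by \<open>local_exp_bound\<close>, the one in x
  does not depend on k and leaves the sum, and 1 + d is at most a multiple of k + 2.\<close>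

lemma far_bound:
  assumes j: "j < m"
  shows "\<exists>c C. 0 < c \<and> 0 < C \<and> (\<forall>b \<beta> f x0 r x s. bmob \<beta> b \<longrightarrow> 0 < \<beta> \<longrightarrow> (\<forall>i<m. f i \<in> borel_measurable borel) \<longrightarrow> 0 < r \<longrightarrow> 0 < s \<longrightarrow> s * \<beta> \<le> c \<longrightarrow>
    (\<Sum>k. ennreal ((2 ^ k * r) powr (- (\<Sum>i<m. e i))) * (\<Prod>i<m. \<integral>\<^sup>+y\<in>ball x0 (2 ^ Suc (Suc k) * r). ennreal (wgt j b x i y * \<bar>f i y\<bar>) \<partial>lborel))
      \<le> ennreal (exp (s * \<bar>b x - avg (ball x0 r) b\<bar>)) * (ennreal (C / s) * Z f x0 r))"
proof -
  \<comment> \<open>Both constants of each index are packed into one pair, so that a single choice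
    suffices.\<close>
  have "\<forall>i. \<exists>z. i < m \<longrightarrow> 0 < fst z \<and> 0 < snd z \<and> (\<forall>f b \<beta> s x r. bmob \<beta> b \<longrightarrow> 0 < \<beta> \<longrightarrow> s * \<beta> \<le> fst z \<longrightarrow> f \<in> borel_measurable borel \<longrightarrow> (\<forall>y. 0 \<le> f y) \<longrightarrow> 0 < r \<longrightarrow>
    (\<integral>\<^sup>+y\<in>ball x r. ennreal (exp (s * \<bar>b y - avg (ball x r) b\<bar>) * f y) \<partial>lborel)
      \<le> ennreal (snd z * measure lborel (ball x r) powr (1 - \<kappa> i) * W i (ball x r) powr (- (1 / q i)))
         * epow (\<integral>\<^sup>+y\<in>ball x r. ennreal (f y powr p i * \<omega> i y powr p i) \<partial>lborel) (1 / p i))"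
    using local_exp_bound by fastforce
  from choice[OF this] obtain z where z: "\<And>i. i < m \<Longrightarrow> 0 < fst (z i) \<and> 0 < snd (z i)"
    and loc: "\<And>i f b \<beta> s x r. i < m \<Longrightarrow> bmob \<beta> b \<Longrightarrow> 0 < \<beta> \<Longrightarrow> s * \<beta> \<le> fst (z i) \<Longrightarrow> f \<in> borel_measurable borel \<Longrightarrow> (\<forall>y. 0 \<le> f y) \<Longrightarrow> 0 < r \<Longrightarrow>
    (\<integral>\<^sup>+y\<in>ball x r. ennreal (exp (s * \<bar>b y - avg (ball x r) b\<bar>) * f y) \<partial>lborel)
      \<le> ennreal (snd (z i) * measure lborel (ball x r) powr (1 - \<kappa> i) * W i (ball x r) powr (- (1 / q i)))
         * epow (\<integral>\<^sup>+y\<in>ball x r. ennreal (f y powr p i * \<omega> i y powr p i) \<partial>lborel) (1 / p i)"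
    by blast
  define V where "V = measure lborel (ball (0::'a) 1)"
  have V: "0 < V" unfolding V_def by (rule unit_ball_pos)
  define c where "c = fst (z j)"
  \<comment> \<open>The factor 4 powr e i compares the volume factor at radius 2^(k+2) r with the
    kernel at distance 2^k r; the powers of 2^k r cancel.\<close>
  define C5 where "C5 = (\<Prod>i<m. snd (z i) * 4 powr e i * V powr (1 - \<kappa> i))"
  define n2 where "n2 = (2::real) ^ DIM('a)"
  define C where "C = C5 * (1 + c * n2)"
  have c: "0 < c" using z[OF j] by (simp add: c_def)
  have C5: "0 < C5" unfolding C5_def using z V by (intro prod_pos) auto
  have n2: "0 < n2" by (simp add: n2_def)
  have C: "0 < C" using C5 c n2 by (simp add: C_def add_pos_pos)
  have "(\<Sum>k. ennreal ((2 ^ k * r) powr (- (\<Sum>i<m. e i))) * (\<Prod>i<m. \<integral>\<^sup>+y\<in>ball x0 (2 ^ Suc (Suc k) * r). ennreal (wgt j b x i y * \<bar>f i y\<bar>) \<partial>lborel))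
      \<le> ennreal (exp (s * \<bar>b x - avg (ball x0 r) b\<bar>)) * (ennreal (C / s) * Z f x0 r)"
    if b: "bmob \<beta> b" "0 < \<beta>" and f: "\<forall>i<m. f i \<in> borel_measurable borel" and r: "0 < r" and s: "0 < s" "s * \<beta> \<le> c" for b \<beta> f x0 r x s
  proof -
    have [measurable]: "b \<in> borel_measurable borel" using b by (simp add: bmob_def)
    define X where "X = exp (s * \<bar>b x - avg (ball x0 r) b\<bar>)"
    have X: "0 < X" by (simp add: X_def)
    have term_le: "ennreal ((2 ^ k * r) powr (- (\<Sum>i<m. e i))) * (\<Prod>i<m. \<integral>\<^sup>+y\<in>ball x0 (2 ^ Suc (Suc k) * r). ennreal (wgt j b x i y * \<bar>f i y\<bar>) \<partial>lborel)
        \<le> ennreal (X * (C / s)) * (ennreal (real (Suc k) + 1) * T f x0 r (Suc k))" for k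
    proof -
      define \<rho> where "\<rho> = 2 ^ Suc (Suc k) * r"
      have \<rho>: "0 < \<rho>" using r by (simp add: \<rho>_def)
      define B where "B = ball x0 \<rho>"
      have [measurable]: "B \<in> sets borel" by (simp add: B_def)
      define L where "L = X * ((1 + c * n2) * (real k + 2) / s)"
      have L: "0 \<le> L" using X c n2 s by (simp add: L_def)
      define t where "t i = (if i = j then s else 0)" for i
      have pw: "wgt j b x i y \<le> (if i = j then L else 1) * exp (t i * \<bar>b y - avg B b\<bar>)" for i y
      proof (cases "i = j")
        case True
        define x1 where "x1 = s * \<bar>b x - avg (ball x0 r) b\<bar>"
        define y1 where "y1 = s * \<bar>b y - avg B b\<bar>"
        define d where "d = s * \<bar>avg (ball x0 r) b - avg B b\<bar>"
        have "s * \<bar>b x - b y\<bar> \<le> s * (\<bar>b x - avg (ball x0 r) b\<bar> + \<bar>avg (ball x0 r) b - avg B b\<bar> + \<bar>b y - avg B b\<bar>)"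
          using s by (intro mult_left_mono) auto
        then have 1: "s * \<bar>b x - b y\<bar> \<le> x1 + d + y1" by (simp add: x1_def y1_def d_def distrib_left)
        have nn: "0 \<le> x1" "0 \<le> y1" "0 \<le> d" using s by (auto simp: x1_def y1_def d_def)
        have "d \<le> s * (real (Suc (Suc k)) * (n2 * \<beta>))"
          unfolding d_def B_def \<rho>_def n2_def using s by (intro mult_left_mono avg_ball_dist[OF b(1) r]) auto
        also have "\<dots> = (s * \<beta>) * (n2 * (real k + 2))" by (simp add: algebra_simps)
        also have "\<dots> \<le> c * (n2 * (real k + 2))" using s n2 by (intro mult_right_mono) auto
        finally have 2: "1 + d \<le> (1 + c * n2) * (real k + 2)" using c n2 by (simp add: algebra_simps)
        have 3: "x1 + d + y1 \<le> (1 + d) * exp (x1 + y1)"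
        proof -
          have "1 + (x1 + y1) \<le> exp (x1 + y1)" by (rule exp_ge_add_one_self)
          then have "(1 + d) * (1 + (x1 + y1)) \<le> (1 + d) * exp (x1 + y1)" using nn by (intro mult_left_mono) auto
          moreover have "x1 + d + y1 \<le> (1 + d) * (1 + (x1 + y1))" using nn by (simp add: algebra_simps)
          ultimately show ?thesis by linarith
        qed
        have "s * \<bar>b x - b y\<bar> \<le> (1 + c * n2) * (real k + 2) * exp (x1 + y1)"
          by (rule order_trans[OF 1 order_trans[OF 3 mult_right_mono[OF 2]]]) simp
        then have "\<bar>b x - b y\<bar> \<le> (1 + c * n2) * (real k + 2) * exp (x1 + y1) / s"
          using s by (simp add: pos_le_divide_eq mult.commute)
        also have "\<dots> = L * exp y1" by (simp add: L_def X_def x1_def exp_add)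
        finally show ?thesis using True by (simp add: wgt_def t_def y1_def)
      qed (simp add: wgt_def t_def)
      have int: "(\<integral>\<^sup>+y\<in>B. ennreal (wgt j b x i y * \<bar>f i y\<bar>) \<partial>lborel)
         \<le> ennreal (if i = j then L else 1) * (ennreal (snd (z i) * measure lborel B powr (1 - \<kappa> i)) * (ennreal (W i B powr (- (1 / q i))) * epow (\<Phi> f i B) (1 / p i)))"
        if i: "i < m" for i
      proof -
        have [measurable]: "f i \<in> borel_measurable borel" using f i by simp
        have "ennreal (wgt j b x i y * \<bar>f i y\<bar>) \<le> ennreal (if i = j then L else 1) * ennreal (exp (t i * \<bar>b y - avg B b\<bar>) * \<bar>f i y\<bar>)" for y
          using mult_right_mono[OF pw[of i y] abs_ge_zero[of "f i y"]] L
          by (subst ennreal_mult[symmetric]) (auto simp: mult.assoc intro!: ennreal_leI)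
        then have "(\<integral>\<^sup>+y\<in>B. ennreal (wgt j b x i y * \<bar>f i y\<bar>) \<partial>lborel)
          \<le> (\<integral>\<^sup>+y. ennreal (if i = j then L else 1) * (ennreal (exp (t i * \<bar>b y - avg B b\<bar>) * \<bar>f i y\<bar>) * indicator B y) \<partial>lborel)"
          by (intro nn_integral_mono) (auto simp: indicator_def)
        also have "\<dots> = ennreal (if i = j then L else 1) * (\<integral>\<^sup>+y\<in>B. ennreal (exp (t i * \<bar>b y - avg B b\<bar>) * \<bar>f i y\<bar>) \<partial>lborel)"
          by (intro nn_integral_cmult) measurable
        also have "(\<integral>\<^sup>+y\<in>B. ennreal (exp (t i * \<bar>b y - avg B b\<bar>) * \<bar>f i y\<bar>) \<partial>lborel)
          \<le> ennreal (snd (z i) * measure lborel B powr (1 - \<kappa> i) * W i B powr (- (1 / q i))) * epow (\<Phi> f i B) (1 / p i)"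
        proof -
          have "t i * \<beta> \<le> fst (z i)" using s z[OF i] by (auto simp: t_def c_def)
          then show ?thesis unfolding B_def \<Phi>_def by (intro loc[OF i b] \<rho>) auto
        qed
        also have "\<dots> = ennreal (snd (z i) * measure lborel B powr (1 - \<kappa> i)) * (ennreal (W i B powr (- (1 / q i))) * epow (\<Phi> f i B) (1 / p i))"
          using z[OF i] by (simp add: ennreal_mult mult.assoc)
        finally show ?thesis by (simp add: mult_left_mono)
      qed
      have "(\<Prod>i<m. \<integral>\<^sup>+y\<in>B. ennreal (wgt j b x i y * \<bar>f i y\<bar>) \<partial>lborel)
        \<le> (\<Prod>i<m. ennreal (if i = j then L else 1) * (ennreal (snd (z i) * measure lborel B powr (1 - \<kappa> i)) * (ennreal (W i B powr (- (1 / q i))) * epow (\<Phi> f i B) (1 / p i))))"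
        using int by (intro prod_mono_ennreal) auto
      also have "\<dots> = (\<Prod>i<m. if i = j then ennreal L else 1) * ((\<Prod>i<m. ennreal (snd (z i) * measure lborel B powr (1 - \<kappa> i))) * T f x0 r (Suc k))"
        unfolding prod.distrib T_def B_def \<rho>_def by (simp add: if_distrib cong: if_cong)
      also have "(\<Prod>i<m. if i = j then ennreal L else 1) = ennreal L" by (rule prod_if_one[OF j])
      also have "(\<Prod>i<m. ennreal (snd (z i) * measure lborel B powr (1 - \<kappa> i))) = ennreal (\<Prod>i<m. snd (z i) * measure lborel B powr (1 - \<kappa> i))"
        using z by (intro prod_ennreal) (auto simp: less_imp_le)
      finally have "ennreal ((2 ^ k * r) powr (- (\<Sum>i<m. e i))) * (\<Prod>i<m. \<integral>\<^sup>+y\<in>B. ennreal (wgt j b x i y * \<bar>f i y\<bar>) \<partial>lborel)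
        \<le> ennreal ((2 ^ k * r) powr (- (\<Sum>i<m. e i))) * (ennreal L * (ennreal (\<Prod>i<m. snd (z i) * measure lborel B powr (1 - \<kappa> i)) * T f x0 r (Suc k)))"
        by (rule mult_left_mono) simp
      also have "\<dots> = ennreal ((2 ^ k * r) powr (- (\<Sum>i<m. e i)) * (L * (\<Prod>i<m. snd (z i) * measure lborel B powr (1 - \<kappa> i)))) * T f x0 r (Suc k)"
      proof -
        have "ennreal a * (ennreal l * (ennreal d * t)) = ennreal (a * (l * d)) * t" if "0 \<le> a" "0 \<le> l" "0 \<le> d" for a l d t
          using that by (simp add: ennreal_mult mult.assoc)
        note * = this
        show ?thesis using z by (intro * L prod_nonneg) (auto simp: less_imp_le)
      qed
      also have "(2 ^ k * r) powr (- (\<Sum>i<m. e i)) * (L * (\<Prod>i<m. snd (z i) * measure lborel B powr (1 - \<kappa> i))) = X * (C / s) * (real k + 2)"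
      proof -
        have "(2 ^ k * r) powr (- (\<Sum>i<m. e i)) = (\<Prod>i<m. (2 ^ k * r) powr (- e i))"
          using prod_powr_distrib_const[of "2 ^ k * r" "{..<m}" "\<lambda>i. - e i"] r by (simp add: sum_negf)
        then have "(2 ^ k * r) powr (- (\<Sum>i<m. e i)) * (\<Prod>i<m. snd (z i) * measure lborel B powr (1 - \<kappa> i))
          = (\<Prod>i<m. (2 ^ k * r) powr (- e i) * (snd (z i) * measure lborel B powr (1 - \<kappa> i)))"
          by (simp only: prod.distrib)
        also have "\<dots> = C5"
          unfolding C5_def
        proof (intro prod.cong refl)
          fix i assume "i \<in> {..<m}"
          define h where "h = 2 ^ k * r"
          have h: "0 < h" using r by (simp add: h_def)
          have "measure lborel B = (4 * h) powr real DIM('a) * V"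
            unfolding B_def V_def using \<rho> h by (subst measure_ball) (auto simp: powr_realpow \<rho>_def h_def mult.assoc)
          then have "measure lborel B powr (1 - \<kappa> i) = (4 * h) powr e i * V powr (1 - \<kappa> i)"
            by (simp only: powr_mult powr_powr e_def)
          also have "(4 * h) powr e i = 4 powr e i * h powr e i" by (simp only: powr_mult)
          finally have "measure lborel B powr (1 - \<kappa> i) = 4 powr e i * V powr (1 - \<kappa> i) * h powr e i" by (simp only: mult_ac)
          moreover have "h powr (- e i) * h powr e i = 1" using h by (simp add: powr_add[symmetric])
          ultimately show "(2 ^ k * r) powr (- e i) * (snd (z i) * measure lborel B powr (1 - \<kappa> i)) = snd (z i) * 4 powr e i * V powr (1 - \<kappa> i)"
            by (simp add: h_def[symmetric])
        qed
        finally show ?thesis by (simp add: L_def C_def)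
      qed
      also have "ennreal (X * (C / s) * (real k + 2)) = ennreal (X * (C / s)) * ennreal (real (Suc k) + 1)"
        using X C s by (subst ennreal_mult[symmetric]) (auto simp: add_ac)
      finally show ?thesis unfolding B_def \<rho>_def by (simp only: mult.assoc)
    qed
    have "(\<Sum>k. ennreal ((2 ^ k * r) powr (- (\<Sum>i<m. e i))) * (\<Prod>i<m. \<integral>\<^sup>+y\<in>ball x0 (2 ^ Suc (Suc k) * r). ennreal (wgt j b x i y * \<bar>f i y\<bar>) \<partial>lborel))
        \<le> (\<Sum>k. ennreal (X * (C / s)) * (ennreal (real (Suc k) + 1) * T f x0 r (Suc k)))"
      using term_le by (intro suminf_le) auto
    also have "\<dots> = ennreal (X * (C / s)) * (\<Sum>k. ennreal (real (Suc k) + 1) * T f x0 r (Suc k))" by (rule ennreal_suminf_cmult)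
    also have "\<dots> \<le> ennreal (X * (C / s)) * Z f x0 r"
    proof (rule mult_left_mono)
      \<comment> \<open>Shell k lives on the ball of term k + 1 of \<open>Z\<close>, with
        coefficient k + 2. Term 0, on the double ball, is left for the near part.\<close>
      have "(\<Sum>k. ennreal (real k + 1) * T f x0 r k) = (\<Sum>k. ennreal (real (k + 1) + 1) * T f x0 r (k + 1)) + (\<Sum>k<1. ennreal (real k + 1) * T f x0 r k)"
        by (rule suminf_offset) simp
      then show "(\<Sum>k. ennreal (real (Suc k) + 1) * T f x0 r (Suc k)) \<le> Z f x0 r" unfolding Z_eq by simp
    qed simp
    also have "\<dots> = ennreal X * (ennreal (C / s) * Z f x0 r)" using X C s by (subst ennreal_mult) (auto simp: mult.assoc)
    finally show ?thesis by (simp add: X_def)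
  qed
  then show ?thesis using c C by blast
qed

section \<open>Integration against the target weight\<close>

lemma u_prod: "ennreal (u x) = (\<Prod>i<m. epow (ennreal (v i x)) (qq / q i))"
proof -
  have "u x = (\<Prod>i<m. \<omega> i x powr qq)" unfolding u_def using \<omega>0 by (intro prod_powr) auto
  also have "\<dots> = (\<Prod>i<m. v i x powr (qq / q i))"
  proof (intro prod.cong refl)
    fix i assume "i \<in> {..<m}"
    then show "\<omega> i x powr qq = v i x powr (qq / q i)" using q[of i] by (simp add: v_def powr_powr)
  qed
  finally have "ennreal (u x) = (\<Prod>i<m. ennreal (v i x powr (qq / q i)))" by (simp only:) (intro prod_ennreal[symmetric], auto)
  also have "\<dots> = (\<Prod>i<m. epow (ennreal (v i x)) (qq / q i))" by (intro prod.cong) (auto simp: v_def)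
  finally show ?thesis .
qed

lemma u_meas [measurable]: "u \<in> borel_measurable borel"
  unfolding u_def[abs_def] using \<omega>_meas by measurable

text \<open>Since \<open>u\<close> is the product of the v_i^(qq / q i), the integrand is the
  product of the functions g_i^(q i) v_i to the powers qq / q i, which sum to one even if qq <
  1.\<close>

lemma Hoelder_u:
  assumes g: "\<And>i. i < m \<Longrightarrow> g i \<in> borel_measurable borel"
  shows "(\<integral>\<^sup>+x. epow (\<Prod>i<m. g i x) qq * ennreal (u x) \<partial>lborel) \<le> (\<Prod>i<m. epow (\<integral>\<^sup>+x. epow (g i x) (q i) * ennreal (v i x) \<partial>lborel) (qq / q i))"
proof -
  have "epow (\<Prod>i<m. g i x) qq * ennreal (u x) = (\<Prod>i<m. epow (epow (g i x) (q i) * ennreal (v i x)) (qq / q i))" for x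
  proof -
    have "epow (\<Prod>i<m. g i x) qq = (\<Prod>i<m. epow (epow (g i x) (q i)) (qq / q i))"
      unfolding epow_prod[OF finite_lessThan] epow_epow
    proof (intro prod.cong refl)
      fix i assume "i \<in> {..<m}"
      then show "epow (g i x) qq = epow (g i x) (q i * (qq / q i))" using q[of i] by simp
    qed
    then show ?thesis by (simp add: u_prod prod.distrib epow_mult)
  qed
  then have "(\<integral>\<^sup>+x. epow (\<Prod>i<m. g i x) qq * ennreal (u x) \<partial>lborel)
      = (\<integral>\<^sup>+x. (\<Prod>i<m. epow (epow (g i x) (q i) * ennreal (v i x)) (qq / q i)) \<partial>lborel)" by simp
  also have "\<dots> \<le> (\<Prod>i<m. epow (\<integral>\<^sup>+x. epow (g i x) (q i) * ennreal (v i x) \<partial>lborel) (qq / q i))"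
  proof (rule nn_integral_Hoelder_prod)
    show "(\<lambda>x. epow (g i x) (q i) * ennreal (v i x)) \<in> borel_measurable lborel" if "i \<in> {..<m}" for i
    proof -
      have i: "i < m" using that by simp
      note [measurable] = g[OF i] wtD(2)[OF wt_v[OF i]]
      show ?thesis by measurable
    qed
  qed (use m q qq_pos sum_qq in auto)
  finally show ?thesis .
qed

lemma epow_powr: "0 \<le> a \<Longrightarrow> epow (ennreal a * X) s = ennreal (a powr s) * epow X s"
  by (simp add: epow_mult)

text \<open>The scalar bounds hold on the whole space for the truncated functions, so the integral
  need not be restricted to the ball. Index j takes the commutator bound; its factor \<beta>^(q j)
  becomes \<beta>^qq under the Hoelder exponent qq / q j.\<close>

lemma near_bound:
  assumes j: "j < m"
  shows "\<exists>C>0. \<forall>b \<beta> f x0 r. bmob \<beta> b \<longrightarrow> 0 < \<beta> \<longrightarrow> (\<forall>i<m. f i \<in> borel_measurable borel) \<longrightarrow> 0 < r \<longrightarrow>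
    (\<integral>\<^sup>+x. epow (\<Prod>i<m. near j b f x0 r i x) qq * ennreal (u x) \<partial>lborel)
      \<le> ennreal C * epow (ennreal \<beta> * (\<Prod>i<m. epow (\<Phi> f i (ball x0 (2 * r))) (1 / p i))) qq"
proof -
  define P where "P i C \<longleftrightarrow> 0 < C \<and> (\<forall>f. f \<in> borel_measurable borel \<longrightarrow> (\<forall>y. 0 \<le> f y) \<longrightarrow>
    (\<integral>\<^sup>+x. epow (riesz (\<kappa> i) f x) (q i) * ennreal (v i x) \<partial>lborel)
      \<le> ennreal C * epow (\<integral>\<^sup>+y. ennreal (f y powr p i * \<omega> i y powr p i) \<partial>lborel) (q i / p i))" for i C
  have "\<forall>i. \<exists>C. i < m \<longrightarrow> P i C" unfolding P_def using riesz_bound by blast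
  from choice[OF this] obtain D where D: "\<And>i. i < m \<Longrightarrow> P i (D i)" by blast
  obtain E where E: "0 < E" and Eb: "\<And>f b \<beta>. bmob \<beta> b \<Longrightarrow> 0 < \<beta> \<Longrightarrow> f \<in> borel_measurable borel \<Longrightarrow> (\<forall>y. 0 \<le> f y) \<Longrightarrow>
    (\<integral>\<^sup>+x. epow (rieszb (\<kappa> j) b f x) (q j) * ennreal (v j x) \<partial>lborel)
      \<le> ennreal (E * \<beta> powr q j) * epow (\<integral>\<^sup>+y. ennreal (f y powr p j * \<omega> j y powr p j) \<partial>lborel) (q j / p j)"
    using rieszb_bound[OF j] by blast
  define F where "F i = (if i = j then E else D i)" for i
  have F: "0 < F i" if "i < m" for i using D[OF that] E by (auto simp: F_def P_def)
  define C where "C = (\<Prod>i<m. F i powr (qq / q i))"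
  have C: "0 < C" unfolding C_def using F by (intro prod_pos) (force simp: less_le)
  have "(\<integral>\<^sup>+x. epow (\<Prod>i<m. near j b f x0 r i x) qq * ennreal (u x) \<partial>lborel)
      \<le> ennreal C * epow (ennreal \<beta> * (\<Prod>i<m. epow (\<Phi> f i (ball x0 (2 * r))) (1 / p i))) qq"
    if b: "bmob \<beta> b" "0 < \<beta>" and f: "\<forall>i<m. f i \<in> borel_measurable borel" for b \<beta> f x0 r
  proof -
    have bm: "b \<in> borel_measurable borel" using b by (simp add: bmob_def)
    define B where "B = ball x0 (2 * r)"
    define X where "X i = epow (\<Phi> f i B) (1 / p i)" for i
    have "(\<integral>\<^sup>+x. epow (\<Prod>i<m. near j b f x0 r i x) qq * ennreal (u x) \<partial>lborel)
      \<le> (\<Prod>i<m. epow (\<integral>\<^sup>+x. epow (near j b f x0 r i x) (q i) * ennreal (v i x) \<partial>lborel) (qq / q i))"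
      using bm f by (intro Hoelder_u near_measurable) auto
    also have "\<dots> \<le> (\<Prod>i<m. ennreal (F i powr (qq / q i)) * (if i = j then ennreal (\<beta> powr qq) else 1) * epow (X i) qq)"
    proof (rule prod_mono_ennreal)
      fix i assume "i \<in> {..<m}"
      then have i: "i < m" by simp
      note [measurable] = f[rule_format, OF i]
      define h where "h y = \<bar>f i y\<bar> * indicator B y" for y
      have [measurable]: "B \<in> sets borel" by (simp add: B_def)
      have h: "h \<in> borel_measurable borel" "\<forall>y. 0 \<le> h y"
      proof -
        show "h \<in> borel_measurable borel" unfolding h_def by measurable
      qed (simp add: h_def)
      have "(\<integral>\<^sup>+y. ennreal (h y powr p i * \<omega> i y powr p i) \<partial>lborel) = \<Phi> f i B"
        unfolding \<Phi>_def h_def using p[OF i] by (intro nn_integral_cong) (auto simp: indicator_def)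
      then have \<Phi>h: "epow (\<integral>\<^sup>+y. ennreal (h y powr p i * \<omega> i y powr p i) \<partial>lborel) (q i / p i) = epow (X i) (q i)"
        by (simp add: X_def epow_epow)
      have "(\<integral>\<^sup>+x. epow (near j b f x0 r i x) (q i) * ennreal (v i x) \<partial>lborel)
        \<le> ennreal (F i * (if i = j then \<beta> powr q i else 1)) * epow (X i) (q i)"
      proof (cases "i = j")
        case True
        then show ?thesis
          using Eb[OF b h] \<Phi>h by (simp add: near_def F_def h_def[abs_def] B_def)
      next
        case False
        have "(\<integral>\<^sup>+x. epow (riesz (\<kappa> i) h x) (q i) * ennreal (v i x) \<partial>lborel) \<le> ennreal (D i) * epow (X i) (q i)"
          using D[OF i, unfolded P_def, THEN conjunct2, rule_format, OF h(1)] h(2) unfolding \<Phi>h by simp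
        then show ?thesis using False by (simp add: near_def F_def h_def[abs_def] B_def)
      qed
      then have "epow (\<integral>\<^sup>+x. epow (near j b f x0 r i x) (q i) * ennreal (v i x) \<partial>lborel) (qq / q i)
        \<le> epow (ennreal (F i * (if i = j then \<beta> powr q i else 1)) * epow (X i) (q i)) (qq / q i)"
        using qq_pos q[OF i] by (intro epow_mono) auto
      also have "\<dots> = ennreal (F i powr (qq / q i)) * (if i = j then ennreal (\<beta> powr qq) else 1) * epow (X i) qq"
      proof -
        define G where "G = (if i = j then \<beta> powr q i else 1)"
        have G: "0 \<le> G" "G powr (qq / q i) = (if i = j then \<beta> powr qq else 1)"
          using q[OF i] by (auto simp: G_def powr_powr)
        have "epow (ennreal (F i * G) * epow (X i) (q i)) (qq / q i) = ennreal ((F i * G) powr (qq / q i)) * epow (epow (X i) (q i)) (qq / q i)"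
          using F[OF i] G(1) by (intro epow_powr) auto
        also have "(F i * G) powr (qq / q i) = F i powr (qq / q i) * (if i = j then \<beta> powr qq else 1)"
          by (simp only: powr_mult G(2))
        also have "epow (epow (X i) (q i)) (qq / q i) = epow (X i) qq" using q[OF i] by (simp add: epow_epow)
        finally show ?thesis by (simp add: G_def ennreal_mult)
      qed
      finally show "epow (\<integral>\<^sup>+x. epow (near j b f x0 r i x) (q i) * ennreal (v i x) \<partial>lborel) (qq / q i)
        \<le> ennreal (F i powr (qq / q i)) * (if i = j then ennreal (\<beta> powr qq) else 1) * epow (X i) qq" .
    qed
    also have "\<dots> = (\<Prod>i<m. ennreal (F i powr (qq / q i))) * ennreal (\<beta> powr qq) * epow (\<Prod>i<m. X i) qq"
      by (simp add: prod.distrib prod_if_one[OF j] epow_prod_epow)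
    also have "(\<Prod>i<m. ennreal (F i powr (qq / q i))) = ennreal C" unfolding C_def by (intro prod_ennreal) auto
    also have "ennreal C * ennreal (\<beta> powr qq) * epow (\<Prod>i<m. X i) qq = ennreal C * epow (ennreal \<beta> * (\<Prod>i<m. X i)) qq"
      using b by (simp add: epow_powr mult.assoc)
    finally show ?thesis by (simp add: X_def B_def)
  qed
  then show ?thesis using C by blast
qed

text \<open>Hoelder with the exponential in factor j alone and the indicator of the ball in every
  factor, as the v_i are only locally integrable. John-Nirenberg for v_j is used at the exponent s q
  j, hence the constant c / q j.\<close>

lemma exp_mass:
  assumes j: "j < m"
  shows "\<exists>c C. 0 < c \<and> 0 < C \<and> (\<forall>b \<beta> s x0 r. bmob \<beta> b \<longrightarrow> 0 < \<beta> \<longrightarrow> s * \<beta> \<le> c \<longrightarrow> 0 < r \<longrightarrow>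
    (\<integral>\<^sup>+x\<in>ball x0 r. epow (ennreal (exp (s * \<bar>b x - avg (ball x0 r) b\<bar>))) qq * ennreal (u x) \<partial>lborel)
      \<le> ennreal (C * (\<Prod>i<m. W i (ball x0 r) powr (1 / q i)) powr qq))"
proof -
  obtain c C where c: "0 < c" "0 < C" and JN: "\<And>(w::'a \<Rightarrow> real) b \<beta> s x r. ainf ((1 / p j - \<kappa> j) / (1 - \<kappa> j)) (A j) w \<Longrightarrow> bmob \<beta> b \<Longrightarrow> 0 < \<beta> \<Longrightarrow>
    s * \<beta> \<le> c \<Longrightarrow> 0 < r \<Longrightarrow>
    (\<integral>\<^sup>+y\<in>ball x r. ennreal (exp (s * \<bar>b y - avg (ball x r) b\<bar>) * w y) \<partial>lborel) \<le> ennreal (C * wmeas w (ball x r))"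
    using weighted_John_Nirenberg[OF theta(1)[OF j], of "A j", where 'a='a] by blast
  define c' where "c' = c / q j"
  have c': "0 < c'" using c q[OF j] by (simp add: c'_def)
  define C' where "C' = C powr (qq / q j)"
  have C': "0 < C'" using c by (simp add: C'_def)
  have "(\<integral>\<^sup>+x\<in>ball x0 r. epow (ennreal (exp (s * \<bar>b x - avg (ball x0 r) b\<bar>))) qq * ennreal (u x) \<partial>lborel)
      \<le> ennreal (C' * (\<Prod>i<m. W i (ball x0 r) powr (1 / q i)) powr qq)"
    if b: "bmob \<beta> b" "0 < \<beta>" "s * \<beta> \<le> c'" and r: "0 < r" for b \<beta> s x0 r
  proof -
    have [measurable]: "b \<in> borel_measurable borel" using b by (simp add: bmob_def)
    define B where "B = ball x0 r"
    define k where "k = avg B b"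
    define g where "g i x = (if i = j then ennreal (exp (s * \<bar>b x - k\<bar>)) else 1) * (indicator B x :: ennreal)" for i x
    have gm: "g i \<in> borel_measurable borel" for i
      unfolding g_def B_def by (cases "i = j") simp_all
    have ind: "(\<Prod>i<m. indicator B x) = (indicator B x :: ennreal)" for x
      using m by (cases "x \<in> B") (auto intro!: prod_zero)
    have prod_g: "(\<Prod>i<m. g i x) = ennreal (exp (s * \<bar>b x - k\<bar>)) * indicator B x" for x
      unfolding g_def prod.distrib ind prod_if_one[OF j] ..
    have "(\<integral>\<^sup>+x\<in>B. epow (ennreal (exp (s * \<bar>b x - k\<bar>))) qq * ennreal (u x) \<partial>lborel)
        = (\<integral>\<^sup>+x. epow (\<Prod>i<m. g i x) qq * ennreal (u x) \<partial>lborel)"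
      unfolding prod_g by (intro nn_integral_cong) (auto simp: indicator_def)
    also have "\<dots> \<le> (\<Prod>i<m. epow (\<integral>\<^sup>+x. epow (g i x) (q i) * ennreal (v i x) \<partial>lborel) (qq / q i))"
      using gm by (intro Hoelder_u)
    also have "\<dots> \<le> (\<Prod>i<m. ennreal (((if i = j then C else 1) * W i B) powr (qq / q i)))"
    proof (rule prod_mono_ennreal)
      fix i assume "i \<in> {..<m}"
      then have i: "i < m" by simp
      have v0: "0 \<le> v i x" for x by (simp add: v_def)
      have "(\<integral>\<^sup>+x. epow (g i x) (q i) * ennreal (v i x) \<partial>lborel) \<le> ennreal ((if i = j then C else 1) * W i B)"
      proof (cases "i = j")
        case True
        have "s * q j * \<beta> \<le> c" using b(3) q[OF j] by (simp add: c'_def pos_le_divide_eq mult_ac)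
        note * = JN[OF ainf_v[OF j] b(1,2) this r, of x0]
        have "(\<integral>\<^sup>+x. epow (g i x) (q i) * ennreal (v i x) \<partial>lborel) = (\<integral>\<^sup>+x\<in>B. ennreal (exp (s * q j * \<bar>b x - k\<bar>) * v j x) \<partial>lborel)"
        proof (intro nn_integral_cong)
          fix x
          have "exp (s * \<bar>b x - k\<bar>) powr q j = exp (s * q j * \<bar>b x - k\<bar>)" by (simp add: exp_powr_real mult_ac)
          then show "epow (g i x) (q i) * ennreal (v i x) = ennreal (exp (s * q j * \<bar>b x - k\<bar>) * v j x) * indicator B x"
            using True v0[of x] by (simp add: g_def indicator_def ennreal_mult)
        qed
        then show ?thesis using * True by (simp add: B_def k_def W_def)
      next
        case False
        have "epow 1 (q i) = 1" using epow_ennreal[of 1 "q i"] by simp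
        then have "(\<integral>\<^sup>+x. epow (g i x) (q i) * ennreal (v i x) \<partial>lborel) = (\<integral>\<^sup>+x\<in>B. ennreal (v i x) \<partial>lborel)"
          using False by (intro nn_integral_cong) (auto simp: g_def indicator_def)
        then show ?thesis using False ennreal_wmeas[OF wt_v[OF i], of B x0 r] by (simp add: B_def W_def)
      qed
      then have "epow (\<integral>\<^sup>+x. epow (g i x) (q i) * ennreal (v i x) \<partial>lborel) (qq / q i) \<le> epow (ennreal ((if i = j then C else 1) * W i B)) (qq / q i)"
        using qq_pos q[OF i] by (intro epow_mono) auto
      also have "\<dots> = ennreal (((if i = j then C else 1) * W i B) powr (qq / q i))"
        using c by (intro epow_ennreal) (auto simp: W_def)
      finally show "epow (\<integral>\<^sup>+x. epow (g i x) (q i) * ennreal (v i x) \<partial>lborel) (qq / q i) \<le> ennreal (((if i = j then C else 1) * W i B) powr (qq / q i))" .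
    qed
    also have "\<dots> = ennreal (\<Prod>i<m. ((if i = j then C else 1) * W i B) powr (qq / q i))" by (intro prod_ennreal) auto
    also have "(\<Prod>i<m. ((if i = j then C else 1) * W i B) powr (qq / q i)) = C' * (\<Prod>i<m. W i B powr (1 / q i)) powr qq"
    proof -
      have "(\<Prod>i<m. ((if i = j then C else 1) * W i B) powr (qq / q i))
          = (\<Prod>i<m. (if i = j then C powr (qq / q i) else 1) * (W i B powr (1 / q i)) powr qq)"
        by (intro prod.cong refl) (auto simp: powr_mult powr_powr W_def)
      also have "\<dots> = (\<Prod>i<m. if i = j then C powr (qq / q i) else 1) * (\<Prod>i<m. (W i B powr (1 / q i)) powr qq)"
        by (rule prod.distrib)
      also have "(\<Prod>i<m. if i = j then C powr (qq / q i) else 1) = C'" unfolding C'_def by (rule prod_if_one[OF j])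
      also have "(\<Prod>i<m. (W i B powr (1 / q i)) powr qq) = (\<Prod>i<m. W i B powr (1 / q i)) powr qq"
        by (intro prod_powr[symmetric]) auto
      finally show ?thesis .
    qed
    finally show ?thesis by (simp add: B_def k_def)
  qed
  then show ?thesis using c' C' by blast
qed

text \<open>Term 0 of \<open>Z\<close> is the near quantity divided by the masses of the double
  ball; doubling of the v_i returns to the ball itself.\<close>

lemma near_le_Z:
  "\<exists>D>0. \<forall>f x0 r. 0 < r \<longrightarrow> (\<Prod>i<m. epow (\<Phi> f i (ball x0 (2 * r))) (1 / p i))
     \<le> ennreal (D * (\<Prod>i<m. W i (ball x0 r) powr (1 / q i))) * Z f x0 r"
proof -
  define K where "K i = (A i * 2 ^ DIM('a)) powr (1 / ((1 / p i - \<kappa> i) / (1 - \<kappa> i)))" for i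
  define D where "D = (\<Prod>i<m. K i powr (1 / q i))"
  have K: "0 < K i" if "i < m" for i
    using ainf_ge_1[OF ainf_v[OF that]] by (simp add: K_def)
  have D: "0 < D" unfolding D_def using K by (intro prod_pos) (force simp: less_le)
  have "(\<Prod>i<m. epow (\<Phi> f i (ball x0 (2 * r))) (1 / p i)) \<le> ennreal (D * (\<Prod>i<m. W i (ball x0 r) powr (1 / q i))) * Z f x0 r"
    if r: "0 < r" for f x0 r
  proof -
    define B where "B = ball x0 (2 * r)"
    define P where "P = (\<Prod>i<m. W i B powr (1 / q i))"
    have Wp: "0 < W i B" if "i < m" for i unfolding B_def using that r by (intro W_pos) auto
    have "(\<Prod>i<m. ennreal (W i B powr (1 / q i))) * T f x0 r 0 = (\<Prod>i<m. epow (\<Phi> f i B) (1 / p i))"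
      unfolding T_def prod.distrib[symmetric]
    proof (intro prod.cong refl)
      fix i assume "i \<in> {..<m}"
      then have "W i B powr (1 / q i) * W i B powr (- (1 / q i)) = 1" using Wp[of i] by (simp add: powr_add[symmetric])
      then have "ennreal (W i B powr (1 / q i)) * ennreal (W i B powr (- (1 / q i))) = 1" by (simp flip: ennreal_mult)
      then show "ennreal (W i B powr (1 / q i)) * (ennreal (W i (ball x0 (2 ^ Suc 0 * r)) powr (- (1 / q i))) * epow (\<Phi> f i (ball x0 (2 ^ Suc 0 * r))) (1 / p i)) = epow (\<Phi> f i B) (1 / p i)"
        by (simp add: B_def mult.assoc[symmetric])
    qed
    moreover have "(\<Prod>i<m. ennreal (W i B powr (1 / q i))) = ennreal P" unfolding P_def by (intro prod_ennreal) auto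
    ultimately have "(\<Prod>i<m. epow (\<Phi> f i B) (1 / p i)) = ennreal P * T f x0 r 0" by simp
    also have "\<dots> \<le> ennreal P * Z f x0 r"
      unfolding Z_eq using suminf_ge_term[of "\<lambda>k. ennreal (real k + 1) * T f x0 r k" 0] by (intro mult_left_mono) auto
    also have "\<dots> \<le> ennreal (D * (\<Prod>i<m. W i (ball x0 r) powr (1 / q i))) * Z f x0 r"
    proof (intro mult_right_mono ennreal_leI)
      have "P \<le> (\<Prod>i<m. (K i * W i (ball x0 r)) powr (1 / q i))"
        unfolding P_def
      proof (intro prod_mono conjI)
        fix i assume "i \<in> {..<m}"
        then have i: "i < m" by simp
        have "ball x0 r \<subseteq> ball x0 (2 * r)" using r by (intro subset_ball) auto
        then have "W i B \<le> K i * W i (ball x0 r)"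
          unfolding W_def K_def B_def using r by (intro ainf_doubling[OF ainf_v[OF i] theta(1)[OF i]]) auto
        then show "W i B powr (1 / q i) \<le> (K i * W i (ball x0 r)) powr (1 / q i)"
          using q[OF i] by (intro powr_mono2) (auto simp: W_def)
      qed auto
      also have "\<dots> = D * (\<Prod>i<m. W i (ball x0 r) powr (1 / q i))" by (simp add: powr_mult prod.distrib D_def)
      finally show "P \<le> \<dots>" .
    qed simp
    finally show ?thesis by (simp add: B_def)
  qed
  then show ?thesis using D by blast
qed

text \<open>The far sum is at most exp (s |b - avg|), a function of x alone, times a multiple of
  \<open>Z\<close> that is constant in x; the former is integrated over the ball by
  \<open>exp_mass\<close>.\<close>

theorem master_estimate:
  assumes \<alpha>: "\<alpha> = (\<Sum>i<m. real DIM('a) * \<kappa> i)" and j: "j < m"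
  shows "\<exists>C>0. \<forall>b \<beta> f x0 r. bmob \<beta> (b j) \<longrightarrow> 0 < \<beta> \<longrightarrow> (\<forall>i<m. f i \<in> borel_measurable borel) \<longrightarrow> 0 < r \<longrightarrow>
    (\<integral>\<^sup>+x\<in>ball x0 r. epow (J \<alpha> j b f x) qq * ennreal (u x) \<partial>lborel)
      \<le> epow (ennreal (C * \<beta> * (\<Prod>i<m. W i (ball x0 r) powr (1 / q i))) * Z f x0 r) qq"
proof -
  obtain C1 where C1: "0 < C1" and near: "\<And>b \<beta> f x0 r. bmob \<beta> b \<Longrightarrow> 0 < \<beta> \<Longrightarrow> (\<forall>i<m. f i \<in> borel_measurable borel) \<Longrightarrow> 0 < r \<Longrightarrow>
    (\<integral>\<^sup>+x. epow (\<Prod>i<m. near j b f x0 r i x) qq * ennreal (u x) \<partial>lborel)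
      \<le> ennreal C1 * epow (ennreal \<beta> * (\<Prod>i<m. epow (\<Phi> f i (ball x0 (2 * r))) (1 / p i))) qq"
    using near_bound[OF j] by blast
  obtain D where D: "0 < D" and nZ: "\<And>f x0 r. 0 < r \<Longrightarrow> (\<Prod>i<m. epow (\<Phi> f i (ball x0 (2 * r))) (1 / p i))
     \<le> ennreal (D * (\<Prod>i<m. W i (ball x0 r) powr (1 / q i))) * Z f x0 r" using near_le_Z by blast
  obtain c2 C2 where C2: "0 < c2" "0 < C2" and far: "\<And>b \<beta> f x0 r x s. bmob \<beta> b \<Longrightarrow> 0 < \<beta> \<Longrightarrow> (\<forall>i<m. f i \<in> borel_measurable borel) \<Longrightarrow> 0 < r \<Longrightarrow> 0 < s \<Longrightarrow> s * \<beta> \<le> c2 \<Longrightarrow>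
    (\<Sum>k. ennreal ((2 ^ k * r) powr (- (\<Sum>i<m. e i))) * (\<Prod>i<m. \<integral>\<^sup>+y\<in>ball x0 (2 ^ Suc (Suc k) * r). ennreal (wgt j b x i y * \<bar>f i y\<bar>) \<partial>lborel))
      \<le> ennreal (exp (s * \<bar>b x - avg (ball x0 r) b\<bar>)) * (ennreal (C2 / s) * Z f x0 r)"
    using far_bound[OF j] by blast
  obtain c3 C3 where C3: "0 < c3" "0 < C3" and mass: "\<And>b \<beta> s x0 r. bmob \<beta> b \<Longrightarrow> 0 < \<beta> \<Longrightarrow> s * \<beta> \<le> c3 \<Longrightarrow> 0 < r \<Longrightarrow>
    (\<integral>\<^sup>+x\<in>ball x0 r. epow (ennreal (exp (s * \<bar>b x - avg (ball x0 r) b\<bar>))) qq * ennreal (u x) \<partial>lborel)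
      \<le> ennreal (C3 * (\<Prod>i<m. W i (ball x0 r) powr (1 / q i)) powr qq)"
    using exp_mass[OF j] by blast
  define c where "c = min c2 c3"
  have c: "0 < c" using C2 C3 by (simp add: c_def)
  \<comment> \<open>\<open>C\<close> is the root of order qq of this sum; 2^qq comes from adding the
    near and the far part inside the power.\<close>
  define K where "K = 2 powr qq * (C1 * D powr qq + (C2 / c) powr qq * C3)"
  have K: "0 < K" using C1 D C2 C3 c by (simp add: K_def add_pos_pos)
  define C where "C = K powr (1 / qq)"
  have CK: "C powr qq = K" using K qq_pos by (simp add: C_def powr_powr)
  have "(\<integral>\<^sup>+x\<in>ball x0 r. epow (J \<alpha> j b f x) qq * ennreal (u x) \<partial>lborel)
      \<le> epow (ennreal (C * \<beta> * (\<Prod>i<m. W i (ball x0 r) powr (1 / q i))) * Z f x0 r) qq"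
    if b: "bmob \<beta> (b j)" "0 < \<beta>" and f: "\<forall>i<m. f i \<in> borel_measurable borel" and r: "0 < r" for b \<beta> f x0 r
  proof -
    have bm [measurable]: "b j \<in> borel_measurable borel" using b by (simp add: bmob_def)
    \<comment> \<open>Admissible for both exponential bounds; the factor 1 / s of the far part is
      then \<beta> / c.\<close>
    define s where "s = c / \<beta>"
    have s: "0 < s" "s * \<beta> \<le> c2" "s * \<beta> \<le> c3" using c b by (auto simp: s_def c_def)
    define B where "B = ball x0 r"
    have [measurable]: "B \<in> sets borel" by (simp add: B_def)
    define P where "P = (\<Prod>i<m. W i B powr (1 / q i))"
    have P: "0 < P" unfolding P_def B_def using W_pos r by (intro prod_pos) (force simp: less_le)
    define R where "R = ennreal (C2 / s) * Z f x0 r"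
    define X where "X x = ennreal (exp (s * \<bar>b j x - avg B (b j)\<bar>))" for x
    define N where "N x = (\<Prod>i<m. near j (b j) f x0 r i x)" for x
    have Xm [measurable]: "X \<in> borel_measurable borel" unfolding X_def by measurable
    have Nm [measurable]: "N \<in> borel_measurable borel"
      unfolding N_def[abs_def] using bm f by (intro borel_measurable_prod_ennreal near_measurable) auto
    have pw: "epow (J \<alpha> j b f x) qq \<le> ennreal (2 powr qq) * (epow (N x) qq + epow R qq * epow (X x) qq)" if "x \<in> B" for x
    proof -
      have "J \<alpha> j b f x \<le> N x + (\<Sum>k. ennreal ((2 ^ k * r) powr (- (\<Sum>i<m. e i))) * (\<Prod>i<m. \<integral>\<^sup>+y\<in>ball x0 (2 ^ Suc (Suc k) * r). ennreal (wgt j (b j) x i y * \<bar>f i y\<bar>) \<partial>lborel))"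
        unfolding N_def by (rule J_split[OF \<alpha> j r]) (use that bm f in \<open>auto simp: B_def\<close>)
      also have "\<dots> \<le> N x + X x * R"
        unfolding X_def R_def B_def by (intro add_left_mono far[OF b f r s(1,2)])
      finally have "J \<alpha> j b f x \<le> N x + X x * R" .
      then have "epow (J \<alpha> j b f x) qq \<le> epow (N x + X x * R) qq" using qq_pos by (intro epow_mono) auto
      also have "\<dots> \<le> ennreal (2 powr qq) * (epow (N x) qq + epow (X x * R) qq)" using qq_pos by (intro epow_add_le) auto
      finally show ?thesis by (simp add: epow_mult mult.commute)
    qed
    have "(\<integral>\<^sup>+x\<in>B. epow (J \<alpha> j b f x) qq * ennreal (u x) \<partial>lborel)
      \<le> (\<integral>\<^sup>+x. ennreal (2 powr qq) * (epow (N x) qq * ennreal (u x) + epow R qq * (epow (X x) qq * ennreal (u x) * indicator B x)) \<partial>lborel)"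
    proof (rule nn_integral_mono)
      fix x
      show "epow (J \<alpha> j b f x) qq * ennreal (u x) * indicator B x
        \<le> ennreal (2 powr qq) * (epow (N x) qq * ennreal (u x) + epow R qq * (epow (X x) qq * ennreal (u x) * indicator B x))"
      proof (cases "x \<in> B")
        case True
        have "epow (J \<alpha> j b f x) qq * ennreal (u x) \<le> (ennreal (2 powr qq) * (epow (N x) qq + epow R qq * epow (X x) qq)) * ennreal (u x)"
          using pw[OF True] by (rule mult_right_mono) simp
        then show ?thesis using True by (simp add: distrib_right mult.assoc)
      qed simp
    qed
    also have "\<dots> = ennreal (2 powr qq) * ((\<integral>\<^sup>+x. epow (N x) qq * ennreal (u x) \<partial>lborel) + epow R qq * (\<integral>\<^sup>+x\<in>B. epow (X x) qq * ennreal (u x) \<partial>lborel))"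
    proof -
      have m1: "(\<lambda>x. epow (N x) qq * ennreal (u x)) \<in> borel_measurable lborel" "(\<lambda>x. epow (X x) qq * ennreal (u x) * indicator B x) \<in> borel_measurable lborel"
        by measurable
      show ?thesis using m1 by (subst nn_integral_cmult, simp, subst nn_integral_add, simp, simp, subst nn_integral_cmult, auto)
    qed
    also have "\<dots> \<le> ennreal (2 powr qq) * (ennreal (C1 * (D * (\<beta> * P)) powr qq) * epow (Z f x0 r) qq + ennreal ((C2 / s) powr qq * (C3 * P powr qq)) * epow (Z f x0 r) qq)"
    proof (intro mult_left_mono add_mono)
      have "(\<integral>\<^sup>+x. epow (N x) qq * ennreal (u x) \<partial>lborel) \<le> ennreal C1 * epow (ennreal \<beta> * (\<Prod>i<m. epow (\<Phi> f i (ball x0 (2 * r))) (1 / p i))) qq"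
        unfolding N_def using near[OF b f r] .
      also have "\<dots> \<le> ennreal C1 * epow (ennreal \<beta> * (ennreal (D * P) * Z f x0 r)) qq"
        using nZ[OF r, of f x0] qq_pos by (intro mult_left_mono epow_mono) (auto simp: P_def B_def)
      also have "ennreal \<beta> * (ennreal (D * P) * Z f x0 r) = ennreal (D * (\<beta> * P)) * Z f x0 r"
      proof -
        have "ennreal \<beta> * (ennreal d * t) = ennreal (\<beta> * d) * t" if "0 \<le> d" for d t
          using that b by (simp add: ennreal_mult mult.assoc)
        from this[of "D * P"] show ?thesis using D P by (simp add: mult.left_commute)
      qed
      also have "ennreal C1 * epow (ennreal (D * (\<beta> * P)) * Z f x0 r) qq = ennreal (C1 * (D * (\<beta> * P)) powr qq) * epow (Z f x0 r) qq"
      proof -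
        have "ennreal C1 * epow (ennreal d * t) qq = ennreal (C1 * d powr qq) * epow t qq" if "0 \<le> d" for d t
          using that C1 by (simp add: epow_powr ennreal_mult mult.assoc)
        note * = this
        show ?thesis using b D P by (intro *) auto
      qed
      finally show "(\<integral>\<^sup>+x. epow (N x) qq * ennreal (u x) \<partial>lborel) \<le> ennreal (C1 * (D * (\<beta> * P)) powr qq) * epow (Z f x0 r) qq" .
      have "epow R qq * (\<integral>\<^sup>+x\<in>B. epow (X x) qq * ennreal (u x) \<partial>lborel) \<le> epow R qq * ennreal (C3 * P powr qq)"
        using mass[OF b s(3) r, of x0] by (intro mult_left_mono) (auto simp: X_def B_def P_def)
      also have "\<dots> = ennreal ((C2 / s) powr qq * (C3 * P powr qq)) * epow (Z f x0 r) qq"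
      proof -
        have Rq: "epow R qq = ennreal ((C2 / s) powr qq) * epow (Z f x0 r) qq"
          unfolding R_def using C2 s by (intro epow_powr) auto
        show ?thesis unfolding Rq using C3 by (subst ennreal_mult[of "(C2 / s) powr qq"]) (auto simp: mult_ac)
      qed
      finally show "epow R qq * (\<integral>\<^sup>+x\<in>B. epow (X x) qq * ennreal (u x) \<partial>lborel) \<le> ennreal ((C2 / s) powr qq * (C3 * P powr qq)) * epow (Z f x0 r) qq" .
    qed auto
    also have "\<dots> = ennreal (2 powr qq * (C1 * (D * (\<beta> * P)) powr qq + (C2 / s) powr qq * (C3 * P powr qq))) * epow (Z f x0 r) qq"
    proof -
      have "ennreal a * (ennreal h * t + ennreal g * t) = ennreal (a * (h + g)) * t" if "0 \<le> a" "0 \<le> h" "0 \<le> g" for a h g t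
        using that by (simp add: ennreal_mult distrib_right mult.assoc)
      note * = this
      show ?thesis using C1 C3 by (intro *) auto
    qed
    also have "2 powr qq * (C1 * (D * (\<beta> * P)) powr qq + (C2 / s) powr qq * (C3 * P powr qq)) = (C * \<beta> * P) powr qq"
    proof -
      have "(D * (\<beta> * P)) powr qq = D powr qq * (\<beta> powr qq * P powr qq)" by (simp only: powr_mult)
      moreover have "(C2 / s) powr qq = (C2 / c) powr qq * \<beta> powr qq"
      proof -
        have "C2 / s = C2 / c * \<beta>" by (simp add: s_def)
        then show ?thesis by (simp only: powr_mult)
      qed
      moreover have "(C * \<beta> * P) powr qq = K * (\<beta> powr qq * P powr qq)" by (simp only: powr_mult CK mult.assoc)
      ultimately show ?thesis by (simp add: K_def algebra_simps)
    qed
    also have "ennreal ((C * \<beta> * P) powr qq) * epow (Z f x0 r) qq = epow (ennreal (C * \<beta> * P) * Z f x0 r) qq"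
      using b P by (intro epow_powr[symmetric]) (auto simp: C_def)
    finally show ?thesis by (simp add: B_def P_def)
  qed
  moreover have "0 < C" using K by (simp add: C_def)
  ultimately show ?thesis by blast
qed

end

section \<open>Morrey spaces\<close>

text \<open>\<open>essinf_on\<close> is a supremum of reals, so boundedness above has to be checked:
  otherwise g would exceed every integer almost everywhere on a half-line, impossible for a
  real-valued function.\<close>

lemma essinf_on_ge:
  assumes "\<And>\<eta>. t < \<eta> \<Longrightarrow> c \<le> g \<eta>"
  shows "c \<le> essinf_on {t<..} g"
  unfolding essinf_on_def
proof (rule cSup_upper)
  show "c \<in> {c. AE \<eta> in lborel. \<eta> \<in> {t<..} \<longrightarrow> c \<le> g \<eta>}" using assms by simp
  show "bdd_above {c. AE \<eta> in lborel. \<eta> \<in> {t<..} \<longrightarrow> c \<le> g \<eta>}"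
  proof (rule ccontr)
    assume nb: "\<not> bdd_above {c. AE \<eta> in lborel. \<eta> \<in> {t<..} \<longrightarrow> c \<le> g \<eta>}"
    have "AE \<eta> in lborel. \<eta> \<in> {t<..} \<longrightarrow> real n \<le> g \<eta>" for n
    proof -
      obtain c where "AE \<eta> in lborel. \<eta> \<in> {t<..} \<longrightarrow> c \<le> g \<eta>" "real n < c"
        using nb unfolding bdd_above_def by (auto simp: not_le)
      then show ?thesis by (auto elim: eventually_mono)
    qed
    then have "AE \<eta> in lborel. \<forall>n. \<eta> \<in> {t<..} \<longrightarrow> real n \<le> g \<eta>"
      unfolding AE_all_countable by (intro allI)
    then have "AE \<eta> in lborel. \<eta> \<notin> {t<..}"
      by eventually_elim (metis linorder_not_le reals_Archimedean2)
    then have "emeasure lborel {t<..} = 0" using AE_iff_measurable[of "{t<..}" lborel "\<lambda>\<eta>. \<eta> \<notin> {t<..}"] by auto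
    moreover have "emeasure lborel {t<..<t + 1} \<le> emeasure lborel {t<..}" by (intro emeasure_mono) auto
    ultimately show False by simp
  qed
qed

text \<open>The infimum is attained, since the Morrey bound is a closed condition on the constant;
  where \<phi> vanishes the bound does not involve the constant at all.\<close>

lemma morrey_norm_nonneg:
  assumes "in_morrey s \<phi> w f" "\<And>x r. 0 < r \<Longrightarrow> 0 \<le> \<phi> x r"
  shows "0 \<le> morrey_norm s \<phi> w f" and "morrey_bound s \<phi> w f (morrey_norm s \<phi> w f)"
proof -
  define S where "S = {C. 0 \<le> C \<and> morrey_bound s \<phi> w f C}"
  obtain C where C: "morrey_bound s \<phi> w f C" using assms(1) by (auto simp: in_morrey_def)
  have "morrey_bound s \<phi> w f (max 0 C)"
    unfolding morrey_bound_def
  proof (intro allI impI)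
    fix x r assume r: "(0::real) < r"
    have "wmeas w (ball x r) powr (-1 / s) * wLnorm s w (ball x r) f \<le> C * \<phi> x r" using C r by (simp add: morrey_bound_def)
    also have "\<dots> \<le> max 0 C * \<phi> x r" using assms(2)[OF r] by (intro mult_right_mono) auto
    finally show "wmeas w (ball x r) powr (-1 / s) * wLnorm s w (ball x r) f \<le> max 0 C * \<phi> x r" .
  qed
  then have S: "S \<noteq> {}" by (auto simp: S_def intro!: exI[of _ "max 0 C"])
  have Inf: "morrey_norm s \<phi> w f = Inf S" by (simp add: morrey_norm_def S_def)
  show "0 \<le> morrey_norm s \<phi> w f" unfolding Inf using S by (intro cInf_greatest) (auto simp: S_def)
  show "morrey_bound s \<phi> w f (morrey_norm s \<phi> w f)"
    unfolding morrey_bound_def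
  proof (intro allI impI)
    fix x r assume r: "(0::real) < r"
    define X where "X = wmeas w (ball x r) powr (-1 / s) * wLnorm s w (ball x r) f"
    have X: "X \<le> C * \<phi> x r" if "C \<in> S" for C using that r by (simp add: S_def morrey_bound_def X_def)
    show "X \<le> morrey_norm s \<phi> w f * \<phi> x r"
    proof (cases "\<phi> x r = 0")
      case True
      then show ?thesis using X S by fastforce
    next
      case False
      then have p: "0 < \<phi> x r" using assms(2)[OF r, of x] by simp
      then have "X / \<phi> x r \<le> Inf S" using X S by (intro cInf_greatest) (auto simp: pos_divide_le_eq)
      then show ?thesis using p by (simp add: Inf pos_divide_le_eq)
    qed
  qed
qed

lemma bmo_norm_nonneg:
  assumes "bmo b"
  shows "0 \<le> bmo_norm (b :: 'a::euclidean_space \<Rightarrow> real)" and "bmo_norm b \<le> \<beta> \<Longrightarrow> bmob \<beta> b"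
proof -
  define S where "S = {avg (ball x r) (\<lambda>y. \<bar>b y - avg (ball x r) b\<bar>) | x r. 0 < r}"
  have bdd: "bdd_above S" using assms by (simp add: bmo_def S_def)
  have le: "avg (ball x r) (\<lambda>y. \<bar>b y - avg (ball x r) b\<bar>) \<le> bmo_norm b" if "0 < r" for x r
    unfolding bmo_norm_def S_def[symmetric] using bdd that by (intro cSup_upper) (auto simp: S_def)
  have "0 \<le> avg (ball 0 1) (\<lambda>y. \<bar>b y - avg (ball 0 1) b\<bar>)"
    unfolding avg_def set_lebesgue_integral_def by (intro divide_nonneg_nonneg integral_nonneg_AE) auto
  then show "0 \<le> bmo_norm b" using le[of 1 0] by simp
  show "bmob \<beta> b" if "bmo_norm b \<le> \<beta>" using assms that order_trans[OF le that] by (auto simp: bmo_def bmob_def)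
qed

text \<open>Transfers bounds for all \<beta> above a BMO norm to the norm itself, which may be
  zero.\<close>

lemma le_mult_limit:
  fixes X Y S :: real
  assumes "0 \<le> Y" "\<And>\<beta>. S < \<beta> \<Longrightarrow> X \<le> \<beta> * Y"
  shows "X \<le> S * Y"
proof (cases "Y = 0")
  case True
  then show ?thesis using assms(2)[of "S + 1"] by simp
next
  case False
  then have Y: "0 < Y" using assms(1) by simp
  have "X / Y \<le> S" by (rule dense_ge) (use assms(2) Y in \<open>auto simp: pos_divide_le_eq\<close>)
  then show ?thesis using Y by (simp add: pos_divide_le_eq)
qed

text \<open>Any single \<beta>, such as S + 1, gives finiteness of the local integrals; the limit of
  \<beta> towards S gives the norm.\<close>

lemma morrey_from_local:
  fixes F u :: "'a::euclidean_space \<Rightarrow> real"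
  assumes F: "F \<in> borel_measurable borel" and u: "wt u" and s: "0 < s" and K: "0 \<le> K" and S: "0 \<le> S"
    and \<phi>: "\<And>x r. 0 < r \<Longrightarrow> 0 \<le> \<phi> x r"
    and le: "\<And>x r \<beta>. 0 < r \<Longrightarrow> S < \<beta> \<Longrightarrow> (\<integral>\<^sup>+y\<in>ball x r. ennreal (\<bar>F y\<bar> powr s * u y) \<partial>lborel)
      \<le> ennreal ((K * \<beta> * \<phi> x r * wmeas u (ball x r) powr (1 / s)) powr s)"
  shows "in_morrey s \<phi> u F \<and> morrey_norm s \<phi> u F \<le> K * S"
proof -
  have bound: "morrey_bound s \<phi> u F (K * S)"
    unfolding morrey_bound_def
  proof (intro allI impI)
    fix x :: 'a and r :: real assume r: "0 < r"
    define B where "B = ball x r"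
    define U where "U = wmeas u B"
    have U: "0 < U" unfolding U_def B_def using u r by (rule wmeas_ball_pos)
    define X where "X = U powr (-1 / s) * wLnorm s u B F"
    have lim: "X \<le> \<beta> * (K * \<phi> x r)" if \<beta>: "S < \<beta>" for \<beta>
    proof -
      define R where "R = K * \<beta> * \<phi> x r * U powr (1 / s)"
      have R: "0 \<le> R" using K S \<beta> \<phi>[OF r] by (simp add: R_def)
      have "enn2real (\<integral>\<^sup>+y\<in>B. ennreal (\<bar>F y\<bar> powr s * u y) \<partial>lborel) \<le> R powr s"
        using le[OF r \<beta>, of x] by (intro enn2real_leI) (auto simp: R_def B_def U_def)
      then have "wLnorm s u B F \<le> (R powr s) powr (1 / s)"
        unfolding wLnorm_def using s by (intro powr_mono2) auto
      then have "wLnorm s u B F \<le> R" using R s by (simp add: powr_powr)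
      then have "X \<le> U powr (-1 / s) * R" unfolding X_def by (intro mult_left_mono) auto
      also have "\<dots> = K * \<beta> * \<phi> x r * (U powr (-1 / s) * U powr (1 / s))" by (simp add: R_def)
      also have "U powr (-1 / s) * U powr (1 / s) = 1" using U by (simp add: powr_add[symmetric])
      finally show ?thesis by (simp add: mult_ac)
    qed
    have "X \<le> S * (K * \<phi> x r)" using K \<phi>[OF r] by (rule le_mult_limit[OF mult_nonneg_nonneg lim])
    then show "wmeas u (ball x r) powr (-1 / s) * wLnorm s u (ball x r) F \<le> K * S * \<phi> x r"
      by (simp add: X_def U_def B_def mult_ac)
  qed
  have fin: "(\<integral>\<^sup>+y\<in>ball x r. ennreal (\<bar>F y\<bar> powr s * u y) \<partial>lborel) < \<infinity>" if "0 < r" for x r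
    using le_less_trans[OF le[OF that, of "S + 1" x], of \<infinity>] by simp
  have "morrey_norm s \<phi> u F \<le> K * S"
    unfolding morrey_norm_def using bound K S by (intro cInf_lower) (auto intro!: bdd_belowI[of _ 0])
  then show ?thesis using F fin bound by (auto simp: in_morrey_def)
qed

section \<open>Measurability and domination by the absolute integral\<close>

lemma comm_kernel_measurable:
  fixes b f :: "nat \<Rightarrow> 'a::euclidean_space \<Rightarrow> real"
  assumes j: "j < m" and b: "b j \<in> borel_measurable borel" and f: "\<And>i. i < m \<Longrightarrow> f i \<in> borel_measurable borel"
  shows "(\<lambda>(x, y). comm_kernel m \<alpha> j b f x y) \<in> borel_measurable (borel \<Otimes>\<^sub>M PiM {..<m} (\<lambda>_. lborel))"
proof -
  have comp: "(\<lambda>z. snd z i) \<in> borel \<Otimes>\<^sub>M PiM {..<m} (\<lambda>_. lborel) \<rightarrow>\<^sub>M (borel :: 'a measure)" if "i < m" for i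
    using measurable_compose[OF measurable_snd measurable_component_singleton[of i "{..<m}" "\<lambda>_. lborel :: 'a measure"]] that by simp
  note [measurable] = measurable_compose[OF comp[OF j] b] measurable_compose[OF measurable_fst b]
  have 1: "(\<lambda>z. \<Prod>i<m. f i (snd z i)) \<in> borel_measurable (borel \<Otimes>\<^sub>M PiM {..<m} (\<lambda>_. lborel))"
    using comp f by (intro borel_measurable_prod measurable_compose[OF comp f]) auto
  have 2: "(\<lambda>z. \<Sum>i<m. dist (fst z) (snd z i)) \<in> borel_measurable (borel \<Otimes>\<^sub>M PiM {..<m} (\<lambda>_. lborel))"
    using comp by (intro borel_measurable_sum borel_measurable_dist measurable_fst) auto
  note [measurable] = 1 2
  show ?thesis unfolding comm_kernel_def case_prod_beta by measurable
qed

lemma sigma_finite_PiM_lborel: "sigma_finite_measure (PiM {..<m::nat} (\<lambda>_. lborel :: 'a::euclidean_space measure))"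
proof -
  interpret product_sigma_finite "\<lambda>_::nat. lborel :: 'a measure" ..
  show ?thesis by (rule sigma_finite) simp
qed

context frac_system
begin

text \<open>Joint measurability of the kernel passes to its integrals in y, the product space being
  sigma-finite.\<close>

lemma J_measurable:
  assumes "j < m" "b j \<in> borel_measurable borel" "\<And>i. i < m \<Longrightarrow> f i \<in> borel_measurable borel"
  shows "J \<alpha> j b f \<in> borel_measurable borel" and "frac_comm_j m \<alpha> j b f \<in> borel_measurable borel"
    and "comm_kernel m \<alpha> j b f x \<in> borel_measurable (PiM {..<m} (\<lambda>_. lborel))"
proof -
  interpret sigma_finite_measure "PiM {..<m} (\<lambda>_. lborel :: 'a measure)" by (rule sigma_finite_PiM_lborel)
  note k = comm_kernel_measurable[where b = b and f = f and m = m and j = j and \<alpha> = \<alpha>, OF assms]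
  have k2: "(\<lambda>(x, y). ennreal \<bar>comm_kernel m \<alpha> j b f x y\<bar>) \<in> borel_measurable (borel \<Otimes>\<^sub>M PiM {..<m} (\<lambda>_. lborel))"
    using k unfolding case_prod_beta' by measurable
  show "J \<alpha> j b f \<in> borel_measurable borel"
    unfolding J_def[abs_def] using k2 by (rule borel_measurable_nn_integral)
  show "frac_comm_j m \<alpha> j b f \<in> borel_measurable borel"
    unfolding frac_comm_j_def[abs_def] using k by (rule borel_measurable_lebesgue_integral)
  show "comm_kernel m \<alpha> j b f x \<in> borel_measurable (PiM {..<m} (\<lambda>_. lborel))"
    using measurable_compose[OF measurable_Pair1' k, of x] by (simp add: case_prod_beta')
qed

text \<open>Where the kernel is not integrable the Bochner integral is 0 by convention, so no
  exceptional set appears.\<close>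

lemma frac_comm_j_le_J: "ennreal \<bar>frac_comm_j m \<alpha> j b f x\<bar> \<le> J \<alpha> j b f x"
proof (cases "integrable (PiM {..<m} (\<lambda>_. lborel)) (comm_kernel m \<alpha> j b f x)")
  case True
  then show ?thesis using integral_norm_bound_ennreal[OF True] by (simp add: frac_comm_j_def J_def)
next
  case False
  then show ?thesis by (simp add: frac_comm_j_def not_integrable_integral_eq)
qed

text \<open>As p i \<le> q i, the power \<omega>^p is at most 1 + \<omega>^q, hence locally
  integrable.\<close>

lemma wt_\<omega>_p:
  assumes i: "i < m"
  shows "wt (\<lambda>y. \<omega> i y powr p i)"
  unfolding wt_def
proof (intro conjI allI)
  note [measurable] = \<omega>_meas[OF i]
  show "(\<lambda>y. \<omega> i y powr p i) \<in> borel_measurable borel" by measurable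
  show "AE y in lborel. 0 < \<omega> i y powr p i" using \<omega>_pos by eventually_elim (use i in auto)
  fix x r
  note [measurable] = wtD(2)[OF wt_v[OF i]]
  have pq: "p i \<le> q i" using gap[OF i] p[OF i] q[OF i] by (simp add: field_simps)
  have "ennreal (\<omega> i y powr p i) \<le> 1 + ennreal (v i y)" for y
  proof -
    have "\<omega> i y powr p i \<le> 1 + v i y"
    proof (cases "\<omega> i y \<le> 1")
      case True
      then have "\<omega> i y powr p i \<le> 1" using \<omega>0[OF i] p[OF i] by (intro powr_le1) auto
      then show ?thesis by (simp add: v_def add_increasing2)
    next
      case False
      then have "\<omega> i y powr p i \<le> \<omega> i y powr q i" using pq by (intro powr_mono) auto
      then show ?thesis by (simp add: v_def)
    qed
    then have "ennreal (\<omega> i y powr p i) \<le> ennreal (1 + v i y)" by (rule ennreal_leI)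
    then show ?thesis by (simp add: v_def)
  qed
  then have "(\<integral>\<^sup>+y\<in>ball x r. ennreal (\<omega> i y powr p i) \<partial>lborel) \<le> (\<integral>\<^sup>+y. indicator (ball x r) y + ennreal (v i y) * indicator (ball x r) y \<partial>lborel)"
    by (intro nn_integral_mono) (auto simp: indicator_def)
  also have "\<dots> = emeasure lborel (ball x r) + (\<integral>\<^sup>+y\<in>ball x r. ennreal (v i y) \<partial>lborel)"
    by (subst nn_integral_add) auto
  also have "\<dots> < \<infinity>" using wtD(4)[OF wt_v[OF i], of x r] emeasure_lborel_ball_finite[of x r] by simp
  finally show "(\<integral>\<^sup>+y\<in>ball x r. ennreal (\<omega> i y powr p i) \<partial>lborel) < \<infinity>" .
qed simp

text \<open>Each term of \<open>Z\<close> is compared with the integrand on a dyadic interval from h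
  to 2 h, where h = 2^(k+1) r. For t in it and \<eta> > t, norms on the ball of radius h are at most
  those on radius \<eta>, hence controlled by the essential infimum; doubling replaces the masses at
  h by those at t; and k + 1 \<le> 2 (1 + ln (t / r)).\<close>

lemma Z_le_integral:
  "\<exists>D>0. \<forall>f \<phi>1 N x0 r K. (\<forall>i<m. \<forall>x r. 0 < r \<longrightarrow> 0 \<le> \<phi>1 i x r) \<longrightarrow>
     (\<forall>i<m. \<forall>x r. 0 < r \<longrightarrow> \<Phi> f i (ball x r) < \<infinity>) \<longrightarrow>
     (\<forall>i<m. 0 \<le> N i \<and> morrey_bound (p i) (\<phi>1 i) (\<lambda>y. \<omega> i y powr p i) (f i) (N i)) \<longrightarrow> 0 < r \<longrightarrow> 0 \<le> K \<longrightarrow>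
     (\<integral>\<^sup>+ t. ennreal ((1 + ln (t / r)) *
            essinf_on {t<..} (\<lambda>\<eta>. \<Prod>i<m. \<phi>1 i x0 \<eta> * Lnorm_ball (p i) (\<omega> i) (ball x0 \<eta>))
            / (\<Prod>i<m. Lnorm_ball (q i) (\<omega> i) (ball x0 t)) / t) * indicator {r<..} t \<partial>lborel) \<le> ennreal K \<longrightarrow>
     Z f x0 r \<le> ennreal (D * (\<Prod>i<m. N i) * K)"
proof -
  define Kd where "Kd i = (A i * 2 ^ DIM('a)) powr (1 / ((1 / p i - \<kappa> i) / (1 - \<kappa> i)))" for i
  define D where "D = (\<Prod>i<m. Kd i powr (1 / q i))"
  have Kd: "0 < Kd i" if "i < m" for i
    using ainf_ge_1[OF ainf_v[OF that]] by (simp add: Kd_def)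
  have D: "0 < D" unfolding D_def using Kd by (intro prod_pos) (force simp: less_le)
  have "Z f x0 r \<le> ennreal (4 * D * (\<Prod>i<m. N i) * K)"
    if \<phi>1: "\<forall>i<m. \<forall>x r. 0 < r \<longrightarrow> 0 \<le> \<phi>1 i x r" and fin: "\<forall>i<m. \<forall>x r. 0 < r \<longrightarrow> \<Phi> f i (ball x r) < \<infinity>"
      and mb: "\<forall>i<m. 0 \<le> N i \<and> morrey_bound (p i) (\<phi>1 i) (\<lambda>y. \<omega> i y powr p i) (f i) (N i)"
      and r: "0 < r" and K: "0 \<le> K"
      and int: "(\<integral>\<^sup>+ t. ennreal ((1 + ln (t / r)) *
            essinf_on {t<..} (\<lambda>\<eta>. \<Prod>i<m. \<phi>1 i x0 \<eta> * Lnorm_ball (p i) (\<omega> i) (ball x0 \<eta>))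
            / (\<Prod>i<m. Lnorm_ball (q i) (\<omega> i) (ball x0 t)) / t) * indicator {r<..} t \<partial>lborel) \<le> ennreal K"
    for f \<phi>1 N x0 r K
  proof -
    define NN where "NN = (\<Prod>i<m. N i)"
    have NN: "0 \<le> NN" unfolding NN_def using mb by (intro prod_nonneg) auto
    define g where "g \<eta> = (\<Prod>i<m. \<phi>1 i x0 \<eta> * Lnorm_ball (p i) (\<omega> i) (ball x0 \<eta>))" for \<eta>
    define G where "G t = essinf_on {t<..} g" for t
    define Y where "Y i \<rho> = enn2real (\<Phi> f i (ball x0 \<rho>)) powr (1 / p i)" for i \<rho>
    have Y: "epow (\<Phi> f i (ball x0 \<rho>)) (1 / p i) = ennreal (Y i \<rho>)" if "i < m" "0 < \<rho>" for i \<rho>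
      using fin[rule_format, OF that, of x0] by (cases "\<Phi> f i (ball x0 \<rho>)") (auto simp: Y_def)
    have Y0: "0 \<le> Y i \<rho>" for i \<rho> by (simp add: Y_def)
    have Ymono: "Y i \<rho> \<le> Y i \<eta>" if "i < m" "0 < \<rho>" "\<rho> \<le> \<eta>" for i \<rho> \<eta>
    proof -
      have "\<Phi> f i (ball x0 \<rho>) \<le> \<Phi> f i (ball x0 \<eta>)"
        unfolding \<Phi>_def using that by (intro set_nn_integral_mono_set subset_ball)
      then have "ennreal (Y i \<rho>) \<le> ennreal (Y i \<eta>)"
        using that p[OF that(1)] by (subst (1 2) Y[symmetric]) (auto intro!: epow_mono)
      then show ?thesis using Y0 by (simp add: ennreal_le_iff)
    qed
    have Yle: "Y i \<eta> \<le> N i * (\<phi>1 i x0 \<eta> * Lnorm_ball (p i) (\<omega> i) (ball x0 \<eta>))" if i: "i < m" and \<eta>: "0 < \<eta>" for i \<eta>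
    proof -
      define w where "w = wmeas (\<lambda>y. \<omega> i y powr p i) (ball x0 \<eta>)"
      have w: "0 < w" unfolding w_def by (intro wmeas_ball_pos wt_\<omega>_p i \<eta>)
      have L: "Lnorm_ball (p i) (\<omega> i) (ball x0 \<eta>) = w powr (1 / p i)" by (simp add: Lnorm_ball_def w_def wmeas_def)
      have "w powr (-1 / p i) * Y i \<eta> \<le> N i * \<phi>1 i x0 \<eta>"
        using mb i \<eta> by (simp add: morrey_bound_def w_def Y_def wLnorm_def \<Phi>_def)
      then have "w powr (1 / p i) * (w powr (-1 / p i) * Y i \<eta>) \<le> w powr (1 / p i) * (N i * \<phi>1 i x0 \<eta>)"
        by (rule mult_left_mono) simp
      moreover have "w powr (1 / p i) * w powr (-1 / p i) = 1" using w by (simp add: powr_add[symmetric])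
      ultimately show ?thesis unfolding L by (simp add: mult.assoc[symmetric]) (simp add: mult_ac)
    qed
    have g0: "0 \<le> g \<eta>" if "0 < \<eta>" for \<eta>
      unfolding g_def using \<phi>1 that by (intro prod_nonneg) (auto simp: Lnorm_ball_def)
    have G0: "0 \<le> G t" if "0 < t" for t unfolding G_def using g0 that by (intro essinf_on_ge) auto
    \<comment> \<open>The Morrey bound is available at every \<eta> > t, so it may be taken at the
      essential infimum.\<close>
    have YG: "(\<Prod>i<m. Y i \<rho>) \<le> NN * G t" if \<rho>: "0 < \<rho>" "\<rho> \<le> t" for \<rho> t
    proof -
      have le: "(\<Prod>i<m. Y i \<rho>) \<le> NN * g \<eta>" if "t < \<eta>" for \<eta>
        unfolding NN_def g_def prod.distrib[symmetric]
      proof (intro prod_mono conjI Y0)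
        fix i assume "i \<in> {..<m}"
        then show "Y i \<rho> \<le> N i * (\<phi>1 i x0 \<eta> * Lnorm_ball (p i) (\<omega> i) (ball x0 \<eta>))"
          using order_trans[OF Ymono[of i \<rho> \<eta>] Yle[of i \<eta>]] \<rho> that by auto
      qed
      show ?thesis
      proof (cases "NN = 0")
        case True
        then show ?thesis using le[of "t + 1"] by simp
      next
        case False
        then have "0 < NN" using NN by simp
        then have "(\<Prod>i<m. Y i \<rho>) / NN \<le> G t"
          unfolding G_def using le by (intro essinf_on_ge) (auto simp: pos_divide_le_eq mult.commute)
        then show ?thesis using \<open>0 < NN\<close> by (simp add: pos_divide_le_eq mult.commute)
      qed
    qed
    define PW where "PW t = (\<Prod>i<m. W i (ball x0 t) powr (1 / q i))" for t
    have PW: "0 < PW t" if "0 < t" for t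
      unfolding PW_def using W_pos that by (intro prod_pos) (force simp: less_le)
    define h where "h k = 2 ^ Suc k * r" for k
    have h: "0 < h k" for k using r by (simp add: h_def)
    define c where "c k = (real k + 1) * (\<Prod>i<m. Y i (h k)) / PW (h k)" for k
    have c0: "0 \<le> c k" for k unfolding c_def using Y0 PW[OF h, of k] by (intro divide_nonneg_pos mult_nonneg_nonneg prod_nonneg) auto
    have Zc: "Z f x0 r = (\<Sum>k. ennreal (c k))"
      unfolding Z_eq
    proof (rule suminf_cong)
      fix k
      have "T f x0 r k = (\<Prod>i<m. ennreal (W i (ball x0 (h k)) powr (- (1 / q i)) * Y i (h k)))"
        unfolding T_def h_def[symmetric] using Y[OF _ h] Y0 by (intro prod.cong) (auto simp: ennreal_mult)
      also have "\<dots> = ennreal (\<Prod>i<m. W i (ball x0 (h k)) powr (- (1 / q i)) * Y i (h k))"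
        using Y0 by (intro prod_ennreal) auto
      also have "(\<Prod>i<m. W i (ball x0 (h k)) powr (- (1 / q i)) * Y i (h k)) = (\<Prod>i<m. Y i (h k)) / PW (h k)"
        by (simp add: PW_def powr_minus_divide prod.distrib prod_dividef)
      finally have "T f x0 r k = ennreal ((\<Prod>i<m. Y i (h k)) / PW (h k))" .
      moreover have "0 \<le> (\<Prod>i<m. Y i (h k)) / PW (h k)" using Y0 PW[OF h, of k] by (intro divide_nonneg_pos prod_nonneg) auto
      ultimately show "ennreal (real k + 1) * T f x0 r k = ennreal (c k)"
        unfolding c_def times_divide_eq_right[symmetric] by (subst ennreal_mult) auto
    qed
    \<comment> \<open>A vanishing product of norms makes all terms zero; it is split off because
      \<open>a\<close> below divides by \<open>NN\<close>.\<close>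
    show ?thesis
    proof (cases "NN = 0")
      case True
      have "(\<Prod>i<m. Y i (h k)) = 0" for k
        using YG[OF h order_refl, of k] prod_nonneg[of "{..<m}" "\<lambda>i. Y i (h k)"] Y0 True by auto
      then have "c k = 0" for k unfolding c_def by simp
      then show ?thesis unfolding Zc by simp
    next
      case False
      then have NNp: "0 < NN" using NN by simp
      define I where "I k = {h k..<h (Suc k)}" for k
      have h2: "h (Suc k) = 2 * h k" for k by (simp add: h_def)
      have hmono: "h k \<le> h l" if "k \<le> l" for k l
        using that r by (simp add: h_def power_increasing)
      have disj: "disjoint_family I"
        unfolding disjoint_family_on_def
      proof (intro ballI impI)
        fix k l :: nat assume "k \<noteq> l"
        then consider "Suc k \<le> l" | "Suc l \<le> k" by linarith
        then show "I k \<inter> I l = {}" using hmono[of "Suc k" l] hmono[of "Suc l" k] by cases (auto simp: I_def)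
      qed
      \<comment> \<open>Height of a step on \<open>I k\<close>, an interval of length h k, whose
        integral is c k / (4 D NN). One factor 2 in the 4 comes from the logarithm, the other from t
        < 2 h k.\<close>
      define a where "a k = c k / (4 * D * NN * h k)" for k
      have a0: "0 \<le> a k" for k using c0 D NNp h[of k] by (simp add: a_def)
      define Fi where "Fi t = (1 + ln (t / r)) * G t / (\<Prod>i<m. Lnorm_ball (q i) (\<omega> i) (ball x0 t)) / t" for t
      have pw: "a k \<le> Fi t \<and> r < t" if t: "t \<in> I k" for k t
      proof -
        have t1: "h k \<le> t" "t < 2 * h k" "0 < t" using t h[of k] h2[of k] by (auto simp: I_def)
        have "r * 1 < r * 2 ^ Suc k" using r one_less_power[of "2::real" "Suc k"] by (intro mult_strict_left_mono) auto
        then have rt: "r < t" using t1(1) by (simp add: h_def mult.commute)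
        have Lq: "(\<Prod>i<m. Lnorm_ball (q i) (\<omega> i) (ball x0 t)) = PW t"
          unfolding PW_def by (intro prod.cong) (auto simp: Lnorm_ball_def W_def wmeas_def v_def)
        have "2 ^ Suc k \<le> t / r" using t1(1) r by (simp add: h_def pos_le_divide_eq)
        then have "ln (2 ^ Suc k) \<le> ln (t / r)" using t1 r by (subst ln_le_cancel_iff) auto
        then have "real (Suc k) * ln 2 \<le> ln (t / r)" by (simp only: ln_realpow)
        moreover have "real (Suc k) * (1 / 2) \<le> real (Suc k) * ln 2"
          using ln2_ge_two_thirds by (intro mult_left_mono) auto
        ultimately have "real (Suc k) * (1 / 2) \<le> ln (t / r)" by (rule order_trans[rotated])
        then have lnk: "real k + 1 \<le> 2 * (1 + ln (t / r))" by simp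
        have Wt: "PW t \<le> D * PW (h k)"
        proof -
          have "PW t \<le> (\<Prod>i<m. (Kd i * W i (ball x0 (h k))) powr (1 / q i))"
            unfolding PW_def
          proof (intro prod_mono conjI)
            fix i assume "i \<in> {..<m}"
            then have i: "i < m" by simp
            have "W i (ball x0 t) \<le> W i (ball x0 (2 * h k))"
              unfolding W_def using t1 by (intro wmeas_mono[OF wt_v[OF i] _ subset_refl] subset_ball) auto
            also have "\<dots> \<le> Kd i * W i (ball x0 (h k))"
              unfolding W_def Kd_def using h[of k] by (intro ainf_doubling[OF ainf_v[OF i] theta(1)[OF i]] subset_ball) auto
            finally show "W i (ball x0 t) powr (1 / q i) \<le> (Kd i * W i (ball x0 (h k))) powr (1 / q i)"
              using q[OF i] by (intro powr_mono2) (auto simp: W_def)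
          qed auto
          also have "\<dots> = D * PW (h k)" by (simp add: powr_mult prod.distrib D_def PW_def)
          finally show ?thesis .
        qed
        have "c k \<le> (2 * (1 + ln (t / r))) * (NN * G t) / (PW t / D)"
          unfolding c_def
        proof (intro frac_le mult_mono)
          show "(\<Prod>i<m. Y i (h k)) \<le> NN * G t" using t1 h[of k] by (intro YG) auto
          show "PW t / D \<le> PW (h k)" using Wt D by (simp add: pos_divide_le_eq mult.commute)
          show "0 < PW t / D" using PW[OF t1(3)] D by simp
          show "0 \<le> 2 * (1 + ln (t / r))" using lnk by linarith
          then show "0 \<le> 2 * (1 + ln (t / r)) * (NN * G t)" using NNp G0[OF t1(3)] by simp
        qed (use lnk Y0 in \<open>auto intro!: prod_nonneg\<close>)
        also have "\<dots> = (2 * D * NN * t) * Fi t" using t1 D by (simp add: Fi_def Lq)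
        finally have ct: "c k \<le> (2 * D * NN * t) * Fi t" .
        have "0 \<le> Fi t"
          unfolding Fi_def Lq using lnk G0[OF t1(3)] PW[OF t1(3)] t1(3) by (intro divide_nonneg_pos mult_nonneg_nonneg) auto
        then have "(2 * D * NN * t) * Fi t \<le> (4 * D * NN * h k) * Fi t"
          using t1 D NNp by (intro mult_right_mono) auto
        with ct have "c k \<le> (4 * D * NN * h k) * Fi t" by linarith
        then have "a k \<le> Fi t" unfolding a_def using D NNp h[of k] by (subst pos_divide_le_eq) (auto simp: mult.commute)
        then show ?thesis using rt by simp
      qed
      have "(\<Sum>k. ennreal (c k)) = (\<Sum>k. ennreal (4 * D * NN) * ennreal (a k * h k))"
      proof (rule suminf_cong)
        fix k
        have "c k = 4 * D * NN * (a k * h k)" using D NNp h[of k] by (simp add: a_def)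
        then show "ennreal (c k) = ennreal (4 * D * NN) * ennreal (a k * h k)"
          using D NNp a0[of k] h[of k] by (simp add: ennreal_mult)
      qed
      also have "\<dots> = ennreal (4 * D * NN) * (\<Sum>k. ennreal (a k * h k))" by (rule ennreal_suminf_cmult)
      also have "(\<Sum>k. ennreal (a k * h k)) = (\<integral>\<^sup>+t. (\<Sum>k. ennreal (a k) * indicator (I k) t) \<partial>lborel)"
      proof -
        have "(\<integral>\<^sup>+t. ennreal (a k) * indicator (I k) t \<partial>lborel) = ennreal (a k * h k)" for k
        proof -
          have "emeasure lborel (I k) = ennreal (h k)" unfolding I_def using hmono[of k "Suc k"] by (simp add: h2)
          then show ?thesis using a0[of k] h[of k] by (subst nn_integral_cmult) (auto simp: I_def ennreal_mult)
        qed
        then show ?thesis by (subst nn_integral_suminf) (auto simp: I_def)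
      qed
      also have "\<dots> \<le> (\<integral>\<^sup>+t. ennreal (Fi t) * indicator {r<..} t \<partial>lborel)"
      proof (rule nn_integral_mono)
        fix t
        show "(\<Sum>k. ennreal (a k) * indicator (I k) t) \<le> ennreal (Fi t) * indicator {r<..} t"
        proof (cases "\<exists>k. t \<in> I k")
          case True
          then obtain k where k: "t \<in> I k" by blast
          have "(\<Sum>k. ennreal (a k) * indicator (I k) t) = ennreal (a k)"
            using suminf_cmult_indicator[OF disj k, of "\<lambda>k. ennreal (a k)"] by simp
          then show ?thesis using pw[OF k] by (auto intro: ennreal_leI)
        qed simp
      qed
      also have "\<dots> \<le> ennreal K" using int by (simp add: Fi_def[abs_def] G_def[abs_def] g_def[abs_def])
      finally have "Z f x0 r \<le> ennreal (4 * D * NN) * ennreal K" unfolding Zc by (simp add: mult_left_mono)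
      also have "\<dots> = ennreal (4 * D * NN * K)" using D NNp K by (intro ennreal_mult[symmetric]) auto
      finally show ?thesis by (simp add: NN_def)
    qed
  qed
  then show ?thesis using D by (intro exI[of _ "4 * D"]) auto
qed

lemma morrey_local_estimate:
  fixes \<phi>1 :: "nat \<Rightarrow> 'a \<Rightarrow> real \<Rightarrow> real" and \<phi>2 :: "'a \<Rightarrow> real \<Rightarrow> real"
  assumes \<alpha>: "\<alpha> = (\<Sum>i<m. real DIM('a) * \<kappa> i)" and j: "j < m"
    and Cr: "0 < Cr" "\<And>x r. 0 < r \<Longrightarrow> (\<Prod>i<m. W i (ball x r) powr (1 / q i)) \<le> Cr * wmeas u (ball x r) powr (1 / qq)"
    and \<phi>1: "\<And>i x r. i < m \<Longrightarrow> 0 < r \<Longrightarrow> 0 \<le> \<phi>1 i x r" and \<phi>2: "\<And>x r. 0 < r \<Longrightarrow> 0 \<le> \<phi>2 x r"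
    and int: "\<And>x r. 0 < r \<Longrightarrow> (\<integral>\<^sup>+ t. ennreal ((1 + ln (t / r)) *
            essinf_on {t<..} (\<lambda>\<eta>. \<Prod>i<m. \<phi>1 i x \<eta> * Lnorm_ball (p i) (\<omega> i) (ball x \<eta>))
            / (\<Prod>i<m. Lnorm_ball (q i) (\<omega> i) (ball x t)) / t) * indicator {r<..} t \<partial>lborel) \<le> ennreal (C\<phi> * \<phi>2 x r)"
  shows "\<exists>C>0. \<forall>b f \<beta> x r. (\<forall>i<m. in_morrey (p i) (\<phi>1 i) (\<lambda>y. \<omega> i y powr p i) (f i)) \<longrightarrow> bmob \<beta> (b j) \<longrightarrow> 0 < \<beta> \<longrightarrow> 0 < r \<longrightarrow>
    (\<integral>\<^sup>+y\<in>ball x r. epow (J \<alpha> j b f y) qq * ennreal (u y) \<partial>lborel)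
      \<le> ennreal ((C * (\<Prod>i<m. morrey_norm (p i) (\<phi>1 i) (\<lambda>y. \<omega> i y powr p i) (f i)) * \<beta> * \<phi>2 x r * wmeas u (ball x r) powr (1 / qq)) powr qq)"
proof -
  obtain Cm where Cm: "0 < Cm" and master: "\<And>b \<beta> f x0 r. bmob \<beta> (b j) \<Longrightarrow> 0 < \<beta> \<Longrightarrow> (\<forall>i<m. f i \<in> borel_measurable borel) \<Longrightarrow> 0 < r \<Longrightarrow>
    (\<integral>\<^sup>+x\<in>ball x0 r. epow (J \<alpha> j b f x) qq * ennreal (u x) \<partial>lborel)
      \<le> epow (ennreal (Cm * \<beta> * (\<Prod>i<m. W i (ball x0 r) powr (1 / q i))) * Z f x0 r) qq"
    using master_estimate[OF \<alpha> j] by blast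
  obtain D where D: "0 < D" and Zle: "\<And>f \<phi>1 N x0 r K. (\<forall>i<m. \<forall>x r. 0 < r \<longrightarrow> 0 \<le> \<phi>1 i x r) \<Longrightarrow>
     (\<forall>i<m. \<forall>x r. 0 < r \<longrightarrow> \<Phi> f i (ball x r) < \<infinity>) \<Longrightarrow>
     (\<forall>i<m. 0 \<le> N i \<and> morrey_bound (p i) (\<phi>1 i) (\<lambda>y. \<omega> i y powr p i) (f i) (N i)) \<Longrightarrow> 0 < r \<Longrightarrow> 0 \<le> K \<Longrightarrow>
     (\<integral>\<^sup>+ t. ennreal ((1 + ln (t / r)) *
            essinf_on {t<..} (\<lambda>\<eta>. \<Prod>i<m. \<phi>1 i x0 \<eta> * Lnorm_ball (p i) (\<omega> i) (ball x0 \<eta>))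
            / (\<Prod>i<m. Lnorm_ball (q i) (\<omega> i) (ball x0 t)) / t) * indicator {r<..} t \<partial>lborel) \<le> ennreal K \<Longrightarrow>
     Z f x0 r \<le> ennreal (D * (\<Prod>i<m. N i) * K)"
    using Z_le_integral by blast
  \<comment> \<open>\<open>max 0 C\<phi> + 1\<close> replaces \<open>C\<phi>\<close>, which may be
    negative or zero, by a positive constant.\<close>
  define C where "C = Cm * Cr * D * (max 0 C\<phi> + 1)"
  have "(\<integral>\<^sup>+y\<in>ball x r. epow (J \<alpha> j b f y) qq * ennreal (u y) \<partial>lborel)
      \<le> ennreal ((C * (\<Prod>i<m. morrey_norm (p i) (\<phi>1 i) (\<lambda>y. \<omega> i y powr p i) (f i)) * \<beta> * \<phi>2 x r * wmeas u (ball x r) powr (1 / qq)) powr qq)"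
    if f: "\<forall>i<m. in_morrey (p i) (\<phi>1 i) (\<lambda>y. \<omega> i y powr p i) (f i)" and b: "bmob \<beta> (b j)" "0 < \<beta>" and r: "0 < r" for b f \<beta> x r
  proof -
    define N where "N i = morrey_norm (p i) (\<phi>1 i) (\<lambda>y. \<omega> i y powr p i) (f i)" for i
    define P where "P = (\<Prod>i<m. W i (ball x r) powr (1 / q i))"
    define K where "K = (max 0 C\<phi> + 1) * \<phi>2 x r"
    have K: "0 \<le> K" using \<phi>2[OF r] by (simp add: K_def)
    have N: "0 \<le> N i \<and> morrey_bound (p i) (\<phi>1 i) (\<lambda>y. \<omega> i y powr p i) (f i) (N i)" if "i < m" for i
      unfolding N_def using f that \<phi>1 by (intro conjI morrey_norm_nonneg) auto
    have NN: "0 \<le> (\<Prod>i<m. N i)" using N by (intro prod_nonneg) auto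
    have P: "0 \<le> P" by (auto simp: P_def intro!: prod_nonneg)
    have "C\<phi> * \<phi>2 x r \<le> K" unfolding K_def using \<phi>2[OF r, of x] by (intro mult_right_mono) auto
    then have "Z f x r \<le> ennreal (D * (\<Prod>i<m. N i) * K)"
      using f \<phi>1 N r K order_trans[OF int[OF r, of x] ennreal_leI] by (intro Zle[of \<phi>1 f N r K x]) (auto simp: in_morrey_def \<Phi>_def)
    then have "ennreal (Cm * \<beta> * P) * Z f x r \<le> ennreal (Cm * \<beta> * P) * ennreal (D * (\<Prod>i<m. N i) * K)"
      by (rule mult_left_mono) simp
    also have "\<dots> = ennreal (Cm * \<beta> * P * (D * (\<Prod>i<m. N i) * K))"
      using Cm b P D NN K by (intro ennreal_mult[symmetric]) auto
    also have "\<dots> \<le> ennreal (Cm * \<beta> * (Cr * wmeas u (ball x r) powr (1 / qq)) * (D * (\<Prod>i<m. N i) * K))"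
      unfolding P_def using Cm b D NN K Cr(2)[OF r, of x] by (intro ennreal_leI mult_right_mono mult_left_mono) auto
    also have "Cm * \<beta> * (Cr * wmeas u (ball x r) powr (1 / qq)) * (D * (\<Prod>i<m. N i) * K)
        = C * (\<Prod>i<m. N i) * \<beta> * \<phi>2 x r * wmeas u (ball x r) powr (1 / qq)" by (simp add: C_def K_def mult_ac)
    finally have "epow (ennreal (Cm * \<beta> * P) * Z f x r) qq \<le> epow (ennreal (C * (\<Prod>i<m. N i) * \<beta> * \<phi>2 x r * wmeas u (ball x r) powr (1 / qq))) qq"
      using qq_pos by (intro epow_mono) auto
    moreover have "0 \<le> C * (\<Prod>i<m. N i) * \<beta> * \<phi>2 x r * wmeas u (ball x r) powr (1 / qq)"
      using Cm Cr D NN b \<phi>2[OF r] by (simp add: C_def)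
    ultimately show ?thesis
      using master[of \<beta> b f r x] f b r unfolding N_def P_def in_morrey_def by (auto elim!: order_trans)
  qed
  moreover have "0 < C" using Cm Cr D by (simp add: C_def)
  ultimately show ?thesis by blast
qed

text \<open>A finite integral of J^qq u over every ball about 0, with u > 0 almost everywhere,
  forces J to be finite almost everywhere; this is the absolute convergence of the
  commutator.\<close>

lemma J_finite_AE:
  assumes u: "wt u" and J: "J \<alpha> j b f \<in> borel_measurable borel"
    and fin: "\<And>r. 0 < r \<Longrightarrow> (\<integral>\<^sup>+y\<in>ball 0 r. epow (J \<alpha> j b f y) qq * ennreal (u y) \<partial>lborel) < \<infinity>"
  shows "AE x in lborel. J \<alpha> j b f x < \<infinity>"
proof -
  note [measurable] = J
  have "AE x in lborel. \<forall>n. epow (J \<alpha> j b f x) qq * ennreal (u x) * indicator (ball 0 (real (Suc n))) x \<noteq> \<infinity>"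
    unfolding AE_all_countable using fin by (intro allI nn_integral_PInf_AE) (auto simp: less_top)
  then show ?thesis using wtD(3)[OF u]
  proof eventually_elim
    case (elim x)
    obtain n where "norm x < real n" using reals_Archimedean2 by blast
    then have "x \<in> ball 0 (real (Suc n))" by simp
    then have "epow (J \<alpha> j b f x) qq * ennreal (u x) \<noteq> top" using elim(1)[rule_format, of n] by simp
    then have "J \<alpha> j b f x \<noteq> top" using elim(2) by (auto simp: ennreal_top_mult)
    then show ?case by (simp add: less_top)
  qed
qed

lemma nn_integral_frac_comm_j_le:
  "(\<integral>\<^sup>+y\<in>B. ennreal (\<bar>frac_comm_j m \<alpha> j b f y\<bar> powr qq * u y) \<partial>lborel) \<le> (\<integral>\<^sup>+y\<in>B. epow (J \<alpha> j b f y) qq * ennreal (u y) \<partial>lborel)"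
proof (intro nn_integral_mono mult_right_mono)
  fix y
  have "ennreal (\<bar>frac_comm_j m \<alpha> j b f y\<bar> powr qq * u y) = epow (ennreal \<bar>frac_comm_j m \<alpha> j b f y\<bar>) qq * ennreal (u y)"
    by (simp add: ennreal_mult u_def)
  also have "\<dots> \<le> epow (J \<alpha> j b f y) qq * ennreal (u y)"
    using qq_pos frac_comm_j_le_J by (intro mult_right_mono epow_mono) auto
  finally show "ennreal (\<bar>frac_comm_j m \<alpha> j b f y\<bar> powr qq * u y) \<le> epow (J \<alpha> j b f y) qq * ennreal (u y)" .
qed simp

text \<open>The power of a sum of m terms is estimated by their maximum, as qq may be below or above
  one; this costs m^qq.\<close>

lemma nn_integral_frac_comm_le:
  assumes "\<And>j. j < m \<Longrightarrow> J \<alpha> j b f \<in> borel_measurable borel" and [measurable]: "B \<in> sets borel"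
  shows "(\<integral>\<^sup>+y\<in>B. ennreal (\<bar>frac_comm m \<alpha> b f y\<bar> powr qq * u y) \<partial>lborel)
    \<le> ennreal (real m powr qq) * (\<Sum>j<m. \<integral>\<^sup>+y\<in>B. epow (J \<alpha> j b f y) qq * ennreal (u y) \<partial>lborel)"
proof -
  have pw: "ennreal (\<bar>frac_comm m \<alpha> b f y\<bar> powr qq * u y) \<le> ennreal (real m powr qq) * (\<Sum>j<m. epow (J \<alpha> j b f y) qq * ennreal (u y))" for y
  proof -
    have "ennreal \<bar>frac_comm m \<alpha> b f y\<bar> \<le> (\<Sum>j<m. ennreal \<bar>frac_comm_j m \<alpha> j b f y\<bar>)"
      unfolding frac_comm_def by (subst sum_ennreal) (auto intro!: ennreal_leI sum_abs)
    also have "\<dots> \<le> (\<Sum>j<m. J \<alpha> j b f y)" by (intro sum_mono frac_comm_j_le_J)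
    finally have "epow (ennreal \<bar>frac_comm m \<alpha> b f y\<bar>) qq \<le> epow (\<Sum>j<m. J \<alpha> j b f y) qq"
      using qq_pos by (intro epow_mono) auto
    also have "\<dots> \<le> ennreal (real (card {..<m}) powr qq) * (\<Sum>j<m. epow (J \<alpha> j b f y) qq)"
      using qq_pos m by (intro epow_sum_le) auto
    finally have "epow (ennreal \<bar>frac_comm m \<alpha> b f y\<bar>) qq * ennreal (u y) \<le> ennreal (real m powr qq) * (\<Sum>j<m. epow (J \<alpha> j b f y) qq) * ennreal (u y)"
      by (intro mult_right_mono) auto
    then show ?thesis by (simp add: ennreal_mult u_def sum_distrib_right mult.assoc)
  qed
  note [measurable] = assms(1)
  have "(\<integral>\<^sup>+y\<in>B. ennreal (\<bar>frac_comm m \<alpha> b f y\<bar> powr qq * u y) \<partial>lborel)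
      \<le> (\<integral>\<^sup>+y. ennreal (real m powr qq) * (\<Sum>j<m. epow (J \<alpha> j b f y) qq * ennreal (u y) * indicator B y) \<partial>lborel)"
    using pw by (intro nn_integral_mono) (auto simp: indicator_def)
  also have "\<dots> = ennreal (real m powr qq) * (\<integral>\<^sup>+y. (\<Sum>j<m. epow (J \<alpha> j b f y) qq * ennreal (u y) * indicator B y) \<partial>lborel)"
    by (intro nn_integral_cmult borel_measurable_sum) auto
  also have "(\<integral>\<^sup>+y. (\<Sum>j<m. epow (J \<alpha> j b f y) qq * ennreal (u y) * indicator B y) \<partial>lborel)
      = (\<Sum>j<m. \<integral>\<^sup>+y\<in>B. epow (J \<alpha> j b f y) qq * ennreal (u y) \<partial>lborel)"
    by (intro nn_integral_sum) auto
  finally show ?thesis .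
qed

lemma integrable_comm_kernel_AE:
  assumes "j < m" "b j \<in> borel_measurable borel" "\<And>i. i < m \<Longrightarrow> f i \<in> borel_measurable borel"
    and "AE x in lborel. J \<alpha> j b f x < \<infinity>"
  shows "AE x in lborel. integrable (PiM {..<m} (\<lambda>_. lborel)) (comm_kernel m \<alpha> j b f x)"
  using assms(4)
proof eventually_elim
  case (elim x)
  then show ?case using J_measurable(3)[where j = j and b = b and f = f and \<alpha> = \<alpha> and x = x, OF assms(1,2,3)] by (intro integrableI_bounded) (auto simp: J_def)
qed

end

theorem theorem1p9:
  fixes m :: nat
    and p q :: "nat \<Rightarrow> real"
    and pp qq \<alpha> :: real
    and \<omega> :: "nat \<Rightarrow> 'a::euclidean_space \<Rightarrow> real"
    and \<phi>1 :: "nat \<Rightarrow> 'a \<Rightarrow> real \<Rightarrow> real"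
    and \<phi>2 :: "'a \<Rightarrow> real \<Rightarrow> real"
  assumes m2: "2 \<le> m"
    and p_range: "\<forall>i<m. 1 < p i"
    and pp_def: "1 / pp = (\<Sum>i<m. 1 / p i)"
    and q_pos: "\<forall>i<m. 0 < q i"
    and alpha_range: "\<forall>i<m. 0 < 1 / p i - 1 / q i \<and> 1 / p i - 1 / q i < 1"
    and alpha_def: "\<alpha> = (\<Sum>i<m. real DIM('a) * (1 / p i - 1 / q i))"
    and qq_def: "1 / qq = (\<Sum>i<m. 1 / q i)"
    and omega_nonneg: "\<forall>i<m. \<forall>y. 0 \<le> \<omega> i y"
    and omega_APq: "A_vec_Pq m p qq \<omega>"
    and omega_Ainf: "\<forall>i<m. A_infty (\<lambda>y. \<omega> i y powr q i)"
    and phi1_nonneg: "\<forall>i<m. \<forall>x r. 0 < r \<longrightarrow> 0 \<le> \<phi>1 i x r"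
    and phi1_meas: "\<forall>i<m. case_prod (\<phi>1 i) \<in> borel_measurable (restrict_space borel (UNIV \<times> {0<..}))"
    and phi2_nonneg: "\<forall>x r. 0 < r \<longrightarrow> 0 \<le> \<phi>2 x r"
    and phi2_meas: "case_prod \<phi>2 \<in> borel_measurable (restrict_space borel (UNIV \<times> {0<..}))"
    and phi_cond: "\<exists>C. \<forall>x r. 0 < r \<longrightarrow>
        (\<integral>\<^sup>+ t. ennreal ((1 + ln (t / r)) *
            essinf_on {t<..} (\<lambda>\<eta>. \<Prod>i<m. \<phi>1 i x \<eta> * Lnorm_ball (p i) (\<omega> i) (ball x \<eta>))
            / (\<Prod>i<m. Lnorm_ball (q i) (\<omega> i) (ball x t)) / t) * indicator {r<..} t \<partial>lborel)
        \<le> ennreal (C * \<phi>2 x r)"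
  shows "(\<forall>j<m. \<exists>C>0. \<forall>b f.
            (\<forall>i<m. bmo (b i)) \<longrightarrow>
            (\<forall>i<m. in_morrey (p i) (\<phi>1 i) (\<lambda>y. \<omega> i y powr p i) (f i)) \<longrightarrow>
              (AE x in lborel. integrable (PiM {..<m} (\<lambda>_. lborel)) (comm_kernel m \<alpha> j b f x)) \<and>
              in_morrey qq \<phi>2 (\<lambda>y. (\<Prod>i<m. \<omega> i y) powr qq) (frac_comm_j m \<alpha> j b f) \<and>
              morrey_norm qq \<phi>2 (\<lambda>y. (\<Prod>i<m. \<omega> i y) powr qq) (frac_comm_j m \<alpha> j b f)
                \<le> C * bmo_norm (b j) * (\<Prod>i<m. morrey_norm (p i) (\<phi>1 i) (\<lambda>y. \<omega> i y powr p i) (f i)))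
       \<and> (\<exists>C>0. \<forall>b f.
            (\<forall>i<m. bmo (b i)) \<longrightarrow>
            (\<forall>i<m. in_morrey (p i) (\<phi>1 i) (\<lambda>y. \<omega> i y powr p i) (f i)) \<longrightarrow>
              in_morrey qq \<phi>2 (\<lambda>y. (\<Prod>i<m. \<omega> i y) powr qq) (frac_comm m \<alpha> b f) \<and>
              morrey_norm qq \<phi>2 (\<lambda>y. (\<Prod>i<m. \<omega> i y) powr qq) (frac_comm m \<alpha> b f)
                \<le> C * Max ((\<lambda>i. bmo_norm (b i)) ` {..<m}) *
                   (\<Prod>i<m. morrey_norm (p i) (\<phi>1 i) (\<lambda>y. \<omega> i y powr p i) (f i)))"
proof -
  have m: "0 < m" using m2 by simp
  note red = vector_weight_reduction[OF m p_range[rule_format] q_pos[rule_format] _ qq_def omega_nonneg[rule_format] omega_APq omega_Ainf[rule_format]]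
  obtain A where A: "\<forall>i<m. mpair (1 / q i / (1 - (1 / p i - 1 / q i))) (A i) (\<lambda>y. \<omega> i y powr q i) (\<lambda>y. \<omega> i y powr (- (p i / (p i - 1))))"
    using red(1) alpha_range by blast
  obtain Cr where Cr: "0 < Cr" "\<And>x r. 0 < r \<Longrightarrow> (\<Prod>i<m. wmeas (\<lambda>y. \<omega> i y powr q i) (ball x r) powr (1 / q i))
        \<le> Cr * wmeas (\<lambda>y. (\<Prod>i<m. \<omega> i y) powr qq) (ball x r) powr (1 / qq)"
    using red(2) alpha_range by blast
  interpret frac_system m p q A qq \<omega>
    using m p_range q_pos alpha_range qq_def omega_nonneg A by unfold_locales auto
  have u_eq: "(\<lambda>y. (\<Prod>i<m. \<omega> i y) powr qq) = u" by (simp add: u_def fun_eq_iff)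
  have wtu: "wt u" using red(3) alpha_range by (simp add: u_eq)
  have \<alpha>: "\<alpha> = (\<Sum>i<m. real DIM('a) * \<kappa> i)" by (simp add: alpha_def \<kappa>_def)
  obtain C\<phi> where C\<phi>: "\<And>x r. 0 < r \<Longrightarrow> (\<integral>\<^sup>+ t. ennreal ((1 + ln (t / r)) *
            essinf_on {t<..} (\<lambda>\<eta>. \<Prod>i<m. \<phi>1 i x \<eta> * Lnorm_ball (p i) (\<omega> i) (ball x \<eta>))
            / (\<Prod>i<m. Lnorm_ball (q i) (\<omega> i) (ball x t)) / t) * indicator {r<..} t \<partial>lborel) \<le> ennreal (C\<phi> * \<phi>2 x r)"
    using phi_cond by blast
  define N where "N f = (\<Prod>i<m. morrey_norm (p i) (\<phi>1 i) (\<lambda>y. \<omega> i y powr p i) (f i))" for f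
  define X where "X f \<longleftrightarrow> (\<forall>i<m. in_morrey (p i) (\<phi>1 i) (\<lambda>y. \<omega> i y powr p i) (f i))" for f
  define R where "R C f \<beta> x r = C * N f * \<beta> * \<phi>2 x r * wmeas u (ball x r) powr (1 / qq)" for C f \<beta> x r
  have N: "0 \<le> N f" if "X f" for f
    unfolding N_def using that phi1_nonneg by (intro prod_nonneg morrey_norm_nonneg) (auto simp: X_def)
  have X_meas: "f i \<in> borel_measurable borel" if "X f" "i < m" for f i using that by (simp add: X_def in_morrey_def)
  have R0: "0 \<le> R C f \<beta> x r" if "X f" "0 \<le> C" "0 \<le> \<beta>" "0 < r" for C f \<beta> x r
    using N[OF that(1)] that phi2_nonneg by (simp add: R_def)
  \<comment> \<open>A predicate in the constant, so that the constants for all j come from one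
    choice; \<open>R\<close> is the local bound before the power qq is taken.\<close>
  define Q where "Q j C \<longleftrightarrow> 0 < C \<and> (\<forall>b f \<beta> x r. X f \<longrightarrow> bmob \<beta> (b j) \<longrightarrow> 0 < \<beta> \<longrightarrow> 0 < r \<longrightarrow>
    (\<integral>\<^sup>+y\<in>ball x r. epow (J \<alpha> j b f y) qq * ennreal (u y) \<partial>lborel) \<le> ennreal (R C f \<beta> x r powr qq))" for j C
  have "\<exists>C. Q j C" if j: "j < m" for j
    unfolding Q_def X_def R_def N_def
    by (rule morrey_local_estimate[OF \<alpha> j Cr(1) _ phi1_nonneg[rule_format] phi2_nonneg[rule_format] C\<phi>])
      (use Cr(2) in \<open>auto simp: W_def u_eq v_def[abs_def]\<close>)
  then obtain C where Q: "\<And>j. j < m \<Longrightarrow> Q j (C j)" by metis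
  have C: "0 < C j" if "j < m" for j using Q[OF that] by (simp add: Q_def)
  have loc: "(\<integral>\<^sup>+y\<in>ball x r. epow (J \<alpha> j b f y) qq * ennreal (u y) \<partial>lborel) \<le> ennreal (R (C j) f \<beta> x r powr qq)"
    if "j < m" "X f" "bmob \<beta> (b j)" "0 < \<beta>" "0 < r" for j b f \<beta> x r
    using Q[OF that(1)] that by (simp add: Q_def)
  have single: "(AE x in lborel. integrable (PiM {..<m} (\<lambda>_. lborel)) (comm_kernel m \<alpha> j b f x)) \<and>
      in_morrey qq \<phi>2 u (frac_comm_j m \<alpha> j b f) \<and> morrey_norm qq \<phi>2 u (frac_comm_j m \<alpha> j b f) \<le> C j * bmo_norm (b j) * N f"
    if j: "j < m" and b: "\<forall>i<m. bmo (b i)" and f: "X f" for j b f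
  proof -
    have bj: "bmo (b j)" "b j \<in> borel_measurable borel" using b j by (auto simp: bmo_def)
    note meas = J_measurable[where j = j and b = b and f = f and \<alpha> = \<alpha>, OF j bj(2) X_meas[OF f]]
    \<comment> \<open>Every \<beta> above the norm is a positive bound for the oscillations, also
      when the norm is 0.\<close>
    have le: "(\<integral>\<^sup>+y\<in>ball x r. epow (J \<alpha> j b f y) qq * ennreal (u y) \<partial>lborel) \<le> ennreal (R (C j) f \<beta> x r powr qq)"
      if "bmo_norm (b j) < \<beta>" "0 < r" for \<beta> x r
      using that bmo_norm_nonneg[OF bj(1)] by (intro loc j f) auto
    have "AE x in lborel. J \<alpha> j b f x < \<infinity>"
      using meas(1) le[of "bmo_norm (b j) + 1", THEN le_less_trans] by (intro J_finite_AE[OF wtu]) auto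
    then have "AE x in lborel. integrable (PiM {..<m} (\<lambda>_. lborel)) (comm_kernel m \<alpha> j b f x)"
      by (intro integrable_comm_kernel_AE j bj X_meas[OF f])
    moreover have "in_morrey qq \<phi>2 u (frac_comm_j m \<alpha> j b f) \<and> morrey_norm qq \<phi>2 u (frac_comm_j m \<alpha> j b f) \<le> (C j * N f) * bmo_norm (b j)"
    proof (rule morrey_from_local[OF meas(2) wtu qq_pos])
      show "0 \<le> C j * N f" using C[OF j] N[OF f] by simp
      show "(\<integral>\<^sup>+y\<in>ball x r. ennreal (\<bar>frac_comm_j m \<alpha> j b f y\<bar> powr qq * u y) \<partial>lborel)
          \<le> ennreal ((C j * N f * \<beta> * \<phi>2 x r * wmeas u (ball x r) powr (1 / qq)) powr qq)" if "0 < r" "bmo_norm (b j) < \<beta>" for x r \<beta>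
        using order_trans[OF nn_integral_frac_comm_j_le le[OF that(2,1), of x]] by (simp add: R_def)
    qed (use bmo_norm_nonneg[OF bj(1)] phi2_nonneg in auto)
    ultimately show ?thesis by (simp add: mult_ac)
  qed
  define Cs where "Cs = (\<Sum>j<m. C j)"
  \<comment> \<open>The factor m comes from the power of a sum of m terms, m^(1/qq) from adding m
    equal integral bounds, and \<open>Cs\<close> majorises all the \<open>C j\<close>.\<close>
  define L where "L = real m * real m powr (1 / qq) * Cs"
  have Cs: "0 < Cs" unfolding Cs_def using C m by (intro sum_pos) auto
  have L: "0 < L" using Cs m by (simp add: L_def)
  have sum: "in_morrey qq \<phi>2 u (frac_comm m \<alpha> b f) \<and> morrey_norm qq \<phi>2 u (frac_comm m \<alpha> b f) \<le> L * Max ((\<lambda>i. bmo_norm (b i)) ` {..<m}) * N f"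
    if b: "\<forall>i<m. bmo (b i)" and f: "X f" for b f
  proof -
    define S where "S = Max ((\<lambda>i. bmo_norm (b i)) ` {..<m})"
    have S: "bmo_norm (b i) \<le> S" if "i < m" for i unfolding S_def using that by (intro Max_ge) auto
    have S0: "0 \<le> S" using S[OF m] bmo_norm_nonneg(1)[OF b[rule_format, OF m]] by linarith
    have bm: "b i \<in> borel_measurable borel" if "i < m" for i using b that by (simp add: bmo_def)
    note meas = J_measurable[where b = b and f = f and \<alpha> = \<alpha>, OF _ bm X_meas[OF f]]
    have "in_morrey qq \<phi>2 u (frac_comm m \<alpha> b f) \<and> morrey_norm qq \<phi>2 u (frac_comm m \<alpha> b f) \<le> (L * N f) * S"
    proof (rule morrey_from_local[OF _ wtu qq_pos _ S0])
      show "frac_comm m \<alpha> b f \<in> borel_measurable borel"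
        unfolding frac_comm_def[abs_def] using meas(2) by (intro borel_measurable_sum) auto
      show "0 \<le> L * N f" using L N[OF f] by simp
      fix x r \<beta> assume r: "(0::real) < r" and \<beta>: "S < \<beta>"
      have "(\<integral>\<^sup>+y\<in>ball x r. ennreal (\<bar>frac_comm m \<alpha> b f y\<bar> powr qq * u y) \<partial>lborel)
        \<le> ennreal (real m powr qq) * (\<Sum>j<m. \<integral>\<^sup>+y\<in>ball x r. epow (J \<alpha> j b f y) qq * ennreal (u y) \<partial>lborel)"
        using meas(1) by (intro nn_integral_frac_comm_le) auto
      also have "\<dots> \<le> ennreal (real m powr qq) * (\<Sum>j<m. ennreal (R Cs f \<beta> x r powr qq))"
      proof (intro mult_left_mono sum_mono)
        fix j assume "j \<in> {..<m}"
        then have j: "j < m" by simp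
        have "C j \<le> Cs" unfolding Cs_def using C j by (intro member_le_sum) (auto simp: less_imp_le)
        then have "R (C j) f \<beta> x r \<le> R Cs f \<beta> x r"
          unfolding R_def using N[OF f] S0 \<beta> phi2_nonneg r by (intro mult_right_mono) auto
        then have "R (C j) f \<beta> x r powr qq \<le> R Cs f \<beta> x r powr qq"
          using qq_pos R0[OF f, of "C j" \<beta> r x] C[OF j] S0 \<beta> r by (intro powr_mono2) auto
        moreover have "(\<integral>\<^sup>+y\<in>ball x r. epow (J \<alpha> j b f y) qq * ennreal (u y) \<partial>lborel) \<le> ennreal (R (C j) f \<beta> x r powr qq)"
          using S[OF j] S0 \<beta> bmo_norm_nonneg(2)[OF b[rule_format, OF j], of \<beta>] r by (intro loc j f) auto
        ultimately show "(\<integral>\<^sup>+y\<in>ball x r. epow (J \<alpha> j b f y) qq * ennreal (u y) \<partial>lborel) \<le> ennreal (R Cs f \<beta> x r powr qq)"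
          by (meson ennreal_leI order_trans)
      qed simp
      also have "\<dots> = ennreal (real m powr qq * (real m * R Cs f \<beta> x r powr qq))"
        by (simp add: ennreal_mult ennreal_of_nat_eq_real_of_nat)
      also have "real m powr qq * (real m * R Cs f \<beta> x r powr qq) = (real m * real m powr (1 / qq) * R Cs f \<beta> x r) powr qq"
        using qq_pos by (simp add: powr_mult powr_powr)
      also have "real m * real m powr (1 / qq) * R Cs f \<beta> x r = L * N f * \<beta> * \<phi>2 x r * wmeas u (ball x r) powr (1 / qq)"
        by (simp add: L_def R_def mult_ac)
      finally show "(\<integral>\<^sup>+y\<in>ball x r. ennreal (\<bar>frac_comm m \<alpha> b f y\<bar> powr qq * u y) \<partial>lborel)
        \<le> ennreal ((L * N f * \<beta> * \<phi>2 x r * wmeas u (ball x r) powr (1 / qq)) powr qq)" .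
    qed (use phi2_nonneg in auto)
    then show ?thesis by (simp add: S_def mult_ac)
  qed
  show ?thesis
    unfolding u_eq X_def[symmetric] N_def[symmetric]
  proof (intro conjI allI impI)
    fix j assume "j < m"
    then show "\<exists>C>0. \<forall>b f. (\<forall>i<m. bmo (b i)) \<longrightarrow> X f \<longrightarrow>
        (AE x in lborel. integrable (PiM {..<m} (\<lambda>_. lborel)) (comm_kernel m \<alpha> j b f x)) \<and>
        in_morrey qq \<phi>2 u (frac_comm_j m \<alpha> j b f) \<and> morrey_norm qq \<phi>2 u (frac_comm_j m \<alpha> j b f) \<le> C * bmo_norm (b j) * N f"
      using C single by (intro exI[of _ "C j"]) blast
  next
    show "\<exists>C>0. \<forall>b f. (\<forall>i<m. bmo (b i)) \<longrightarrow> X f \<longrightarrow> in_morrey qq \<phi>2 u (frac_comm m \<alpha> b f) \<and>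
        morrey_norm qq \<phi>2 u (frac_comm m \<alpha> b f) \<le> C * Max ((\<lambda>i. bmo_norm (b i)) ` {..<m}) * N f"
      using L sum by (intro exI[of _ L]) blast
  qed
qed

end
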